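(* Consider the NIRVAR model $\boldsymbol y^{(q)}=(X'\otimes I_N)R(A)\boldsymbol\gamma(A)+\mathbf u^{(q)}$, where $A\in\{0,1\}^{N\times NQ}$ specifies the true restrictions of the data generating process and $\boldsymbol\beta=R(A)\boldsymbol\gamma(A)$, and let $\hat A\in\{0,1\}^{N\times NQ}$ be another set of restrictions. For $B\in\{A,\hat A\}$ let $$\hat{\boldsymbol\gamma}(B)=\{R(B)'(XX'\otimes\Sigma^{-1})R(B)\}^{-1}R(B)'(X\otimes\Sigma^{-1})\boldsymbol y^{(q)},\qquad\hat{\boldsymbol\beta}(B)=R(B)\hat{\boldsymbol\gamma}(B)$$ be the corresponding generalised least-squares estimators. Assume $\mathrm{colsp}\{R(A)\}\subseteq\mathrm{colsp}\{R(\hat A)\}$. Then the asymptotic variance of $\hat{\boldsymbol\beta}(\hat A)$ is greater than or equal to that of $\hat{\boldsymbol\beta}(A)$, in the sense that $$\mathrm{var}\left[\sqrt T\{\hat{\boldsymbol\beta}(\hat A)-\boldsymbol\beta\}\right]-\mathrm{var}\left[\sqrt T\{\hat{\boldsymbol\beta}(A)-\boldsymbol\beta\}\right]\succeq0,$$ where $\mathrm{var}$ denotes the asymptotic variance (the covariance matrix of the limiting distribution as $T\to\infty$) and $\succeq0$ means positive semi-definite.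
   Context: Prime denotes transpose, $\mathrm{colsp}$ column space, $\mathrm{vec}$ column-stacking, $\otimes$ Kronecker product, $\odot$ Hadamard product, $|\cdot|_0$ number of nonzero entries. $N,Q$ are fixed, $q\in\{1,\dots,Q\}$ is a fixed response feature, and $T$ is the sample size. NIRVAR model: $\boldsymbol X^{(q)}_t=\sum_{r=1}^Q (A^{(r)}\odot\tilde\Phi^{(r)})\boldsymbol X^{(r)}_{t-1}+\boldsymbol\epsilon^{(q)}_t\in\mathbb R^N$, a zero-mean second-order stationary process, with $A^{(r)}\in\{0,1\}^{N\times N}$ (a realisation of) the adjacency matrix of a stochastic block model (treated as given) and $\tilde\Phi^{(r)}$ fixed $N\times N$ weight matrices (both may depend on $q$, suppressed in the notation). Put $\Phi^{(r)}=A^{(r)}\odot\tilde\Phi^{(r)}$, $\Phi=(\Phi^{(1)}|\cdots|\Phi^{(Q)})$ and $A=(A^{(1)}|\cdots|A^{(Q)})\in\{0,1\}^{N\times NQ}$ (column-wise concatenation). Every feature follows such an equation, so the stacked vector $\boldsymbol X_t=(\boldsymbol X_t^{(1)\prime},\dots,\boldsymbol X_t^{(Q)\prime})'\in\mathbb R^{NQ}$ is a VAR(1), assumed stable (coefficient matrix with spectral radius less than $1$) and stationary. The noise is white noise: $\boldsymbol\epsilon^{(q)}_t$ are continuous random vectors with $\mathbb E\boldsymbol\epsilon^{(q)}_t=0$, $\Sigma=\mathbb E\{\boldsymbol\epsilon^{(q)}_t\boldsymbol\epsilon^{(q)\prime}_t\}$ nonsingular, $\boldsymbol\epsilon^{(q)}_t$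 and $\boldsymbol\epsilon^{(r)}_s$ independent for $t\ne s$ and $q\neq r$, and fourth-order moments $\mathbb E|\epsilon^{(q)}_{i,t}\epsilon^{(q)}_{j,t}\epsilon^{(q)}_{l,t}\epsilon^{(q)}_{m,t}|\le c<\infty$ for a finite constant $c$, for all $t$, $q$ and $i,j,l,m$. Data matrices: $Y^{(q)}=(\boldsymbol X^{(q)}_1,\dots,\boldsymbol X^{(q)}_T)$, $X=(\boldsymbol X_0,\dots,\boldsymbol X_{T-1})$, $U^{(q)}=(\boldsymbol\epsilon^{(q)}_1,\dots,\boldsymbol\epsilon^{(q)}_T)$, $\boldsymbol y^{(q)}=\mathrm{vec}(Y^{(q)})$, $\mathbf u^{(q)}=\mathrm{vec}(U^{(q)})$, $\boldsymbol\beta=\mathrm{vec}(\Phi)$. Restriction matrices: for a binary matrix $B\in\{0,1\}^{N\times NQ}$ with $M_B=|B|_0$, $R(B)\in\{0,1\}^{N^2Q\times M_B}$ is defined by $[R(B)]_{ij}=\mathrm{vec}(B)_i\,\mathbf 1\{\sum_{k=1}^{i-1}\mathrm{vec}(B)_k=j-1\}$, and $\boldsymbol\gamma(B)\in\mathbb R^{M_B}$ is the vector of those entries $\beta_i$ with $\mathrm{vec}(B)_i\ne0$ (in order). The restrictions $\hat A$ are treated as given (non-random, not varying with $T$). *)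

theory Defs
  imports "HOL-Probability.Probability" "Jordan_Normal_Form.Spectral_Radius"
begin

text \<open>
  All matrices are those of \<^theory>\<open>Jordan_Normal_Form.Matrix\<close>, whose dimensions are terms; this allows
  the number of columns to be the sample size \<open>T\<close> or the number of unrestricted coefficients.
  Every index (features, vector entries, matrix rows and columns) counts from \<open>0\<close>, so that the
  features are \<open>0, \<dots>, Q - 1\<close>. Time ranges over all integers.
\<close>

unbundle no vec_syntax

hide_const (open) Finite_Cartesian_Product.vec Finite_Cartesian_Product.mat


section \<open>Matrices\<close>

definition hadamard_mat :: "real mat \<Rightarrow> real mat \<Rightarrow> real mat" (infixl \<open>\<odot>\<^sub>m\<close> 70) where
  "A \<odot>\<^sub>m B = mat (dim_row A) (dim_col A) (\<lambda>ij. A $$ ij * B $$ ij)"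

definition kron_mat :: "real mat \<Rightarrow> real mat \<Rightarrow> real mat" (infixl \<open>\<otimes>\<^sub>m\<close> 70) where
  "A \<otimes>\<^sub>m B = mat (dim_row A * dim_row B) (dim_col A * dim_col B)
     (\<lambda>(i, j). A $$ (i div dim_row B, j div dim_col B) * B $$ (i mod dim_row B, j mod dim_col B))"

text \<open>Column stacking.\<close>

definition vec_mat :: "real mat \<Rightarrow> real vec" where
  "vec_mat A = vec (dim_row A * dim_col A) (\<lambda>k. A $$ (k mod dim_row A, k div dim_row A))"

text \<open>\<open>(B 0 | \<dots> | B (Q - 1))\<close> for \<open>N \<times> N\<close> blocks \<open>B r\<close>.\<close>

definition hconcat_mat :: "nat \<Rightarrow> nat \<Rightarrow> (nat \<Rightarrow> real mat) \<Rightarrow> real mat" where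
  "hconcat_mat N Q B = mat N (N * Q) (\<lambda>(i, j). B (j div N) $$ (i, j mod N))"

definition binary_mat :: "nat \<Rightarrow> nat \<Rightarrow> real mat \<Rightarrow> bool" where
  "binary_mat n m B \<longleftrightarrow> B \<in> carrier_mat n m \<and> (\<forall>i<n. \<forall>j<m. B $$ (i, j) \<in> {0, 1})"

definition nonzeros :: "real mat \<Rightarrow> nat" where
  "nonzeros B = card {(i, j). i < dim_row B \<and> j < dim_col B \<and> B $$ (i, j) \<noteq> 0}"

text \<open>The value \<open>0\<close> on singular matrices only serves to make the function total.\<close>

definition inv_mat :: "real mat \<Rightarrow> real mat" where
  "inv_mat A = (case mat_inverse A of Some B \<Rightarrow> B | None \<Rightarrow> 0\<^sub>m (dim_row A) (dim_row A))"

definition psd_mat :: "real mat \<Rightarrow> bool" where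
  "psd_mat A \<longleftrightarrow> square_mat A \<and> A\<^sup>T = A \<and> (\<forall>v \<in> carrier_vec (dim_row A). 0 \<le> v \<bullet> (A *\<^sub>v v))"


section \<open>Restrictions and the generalised least-squares estimator\<close>

definition restr_mat :: "real mat \<Rightarrow> real mat" where
  "restr_mat B = mat (dim_row B * dim_col B) (nonzeros B)
     (\<lambda>(i, j). vec_mat B $ i * of_bool ((\<Sum>k<i. vec_mat B $ k) = real j))"

text \<open>The entries of \<open>b\<close> at the unrestricted positions, in order.\<close>

definition restr_vec :: "real mat \<Rightarrow> real vec \<Rightarrow> real vec" where
  "restr_vec B b = vec_of_list (map (($) b) (filter (\<lambda>i. vec_mat B $ i \<noteq> 0) [0..<dim_vec b]))"

definition gls_gamma :: "real mat \<Rightarrow> real mat \<Rightarrow> real mat \<Rightarrow> real vec \<Rightarrow> real vec" where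
  "gls_gamma S B X y =
     inv_mat ((restr_mat B)\<^sup>T * ((X * X\<^sup>T) \<otimes>\<^sub>m inv_mat S) * restr_mat B) *\<^sub>v
       ((restr_mat B)\<^sup>T *\<^sub>v ((X \<otimes>\<^sub>m inv_mat S) *\<^sub>v y))"

definition gls_beta :: "real mat \<Rightarrow> real mat \<Rightarrow> real mat \<Rightarrow> real vec \<Rightarrow> real vec" where
  "gls_beta S B X y = restr_mat B *\<^sub>v gls_gamma S B X y"


section \<open>Random vectors and asymptotic variance\<close>

text \<open>
  The vector type carries no topology or \<open>\<sigma>\<close>-algebra. A vector of dimension \<open>n\<close> is therefore
  identified with its coordinate function in \<open>{..<n} \<rightarrow>\<^sub>E UNIV\<close>, which has the product \<open>\<sigma>\<close>-algebra
  and the product topology \<open>powertop_real {..<n}\<close> of the Euclidean space of dimension \<open>n\<close>.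
\<close>

definition coords :: "nat \<Rightarrow> real vec \<Rightarrow> nat \<Rightarrow> real" where
  "coords n v = (\<lambda>i\<in>{..<n}. v $ i)"

abbreviation borel_vec :: "nat \<Rightarrow> (nat \<Rightarrow> real) measure" where
  "borel_vec n \<equiv> Pi\<^sub>M {..<n} (\<lambda>_. borel)"

definition random_vec :: "'w measure \<Rightarrow> nat \<Rightarrow> ('w \<Rightarrow> real vec) \<Rightarrow> bool" where
  "random_vec M n Z \<longleftrightarrow>
     (\<forall>\<omega> \<in> space M. Z \<omega> \<in> carrier_vec n) \<and> (\<lambda>\<omega>. coords n (Z \<omega>)) \<in> measurable M (borel_vec n)"

definition converges_in_distribution ::
    "'w measure \<Rightarrow> nat \<Rightarrow> (nat \<Rightarrow> 'w \<Rightarrow> real vec) \<Rightarrow> (nat \<Rightarrow> real) measure \<Rightarrow> bool" where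
  "converges_in_distribution M n Z L \<longleftrightarrow>
     (\<forall>T. random_vec M n (Z T)) \<and> prob_space L \<and> sets L = sets (borel_vec n) \<and>
     (\<forall>f. continuous_map (powertop_real {..<n}) euclideanreal f \<and> bounded (f ` ({..<n} \<rightarrow>\<^sub>E UNIV)) \<longrightarrow>
        (\<lambda>T. \<integral>\<omega>. f (coords n (Z T \<omega>)) \<partial>M) \<longlonglongrightarrow> (\<integral>x. f x \<partial>L))"

definition cov_mat :: "nat \<Rightarrow> (nat \<Rightarrow> real) measure \<Rightarrow> real mat" where
  "cov_mat n L = mat n n (\<lambda>(i, j). \<integral>x. (x i - (\<integral>z. z i \<partial>L)) * (x j - (\<integral>z. z j \<partial>L)) \<partial>L)"

text \<open>Weak limits are unique, so there is at most one such \<open>V\<close>.\<close>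

definition has_asymptotic_variance ::
    "'w measure \<Rightarrow> nat \<Rightarrow> (nat \<Rightarrow> 'w \<Rightarrow> real vec) \<Rightarrow> real mat \<Rightarrow> bool" where
  "has_asymptotic_variance M n Z V \<longleftrightarrow>
     (\<exists>L. converges_in_distribution M n Z L \<and> (\<forall>i<n. integrable L (\<lambda>x. (x i)\<^sup>2)) \<and> V = cov_mat n L)"


section \<open>The NIRVAR model\<close>

text \<open>
  \<open>A p r\<close> and \<open>W p r\<close> are the adjacency and weight matrix of predictor feature \<open>r\<close> in the equation
  of response feature \<open>p\<close>.
\<close>

definition coef_mat ::
    "nat \<Rightarrow> nat \<Rightarrow> (nat \<Rightarrow> nat \<Rightarrow> real mat) \<Rightarrow> (nat \<Rightarrow> nat \<Rightarrow> real mat) \<Rightarrow> nat \<Rightarrow> real mat" where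
  "coef_mat N Q A W p = hconcat_mat N Q (\<lambda>r. A p r \<odot>\<^sub>m W p r)"

text \<open>The coefficient matrix of the VAR(1) process of all features; block row \<open>p\<close> is \<open>coef_mat N Q A W p\<close>.\<close>

definition var_mat ::
    "nat \<Rightarrow> nat \<Rightarrow> (nat \<Rightarrow> nat \<Rightarrow> real mat) \<Rightarrow> (nat \<Rightarrow> nat \<Rightarrow> real mat) \<Rightarrow> real mat" where
  "var_mat N Q A W =
     mat (N * Q) (N * Q) (\<lambda>(i, j). coef_mat N Q A W (i div N) $$ (i mod N, j))"

definition stack_vec :: "nat \<Rightarrow> nat \<Rightarrow> (nat \<Rightarrow> real vec) \<Rightarrow> real vec" where
  "stack_vec N Q x = vec (N * Q) (\<lambda>i. x (i div N) $ (i mod N))"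

definition response_mat ::
    "nat \<Rightarrow> (nat \<Rightarrow> int \<Rightarrow> 'w \<Rightarrow> real vec) \<Rightarrow> nat \<Rightarrow> nat \<Rightarrow> 'w \<Rightarrow> real mat" where
  "response_mat N X q T \<omega> = mat N T (\<lambda>(i, t). X q (int t + 1) \<omega> $ i)"

definition design_mat ::
    "nat \<Rightarrow> nat \<Rightarrow> (nat \<Rightarrow> int \<Rightarrow> 'w \<Rightarrow> real vec) \<Rightarrow> nat \<Rightarrow> 'w \<Rightarrow> real mat" where
  "design_mat N Q X T \<omega> = mat (N * Q) T (\<lambda>(i, t). stack_vec N Q (\<lambda>r. X r (int t) \<omega>) $ i)"

locale nirvar = prob_space M for M :: "'w measure" +
  fixes N Q :: nat
    and A W :: "nat \<Rightarrow> nat \<Rightarrow> real mat"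
    and X eps :: "nat \<Rightarrow> int \<Rightarrow> 'w \<Rightarrow> real vec"
    and Sigma :: "nat \<Rightarrow> real mat"
  assumes dims: "0 < N" "0 < Q"
    and adjacency: "\<And>p r. p < Q \<Longrightarrow> r < Q \<Longrightarrow> binary_mat N N (A p r)"
    and weights: "\<And>p r. p < Q \<Longrightarrow> r < Q \<Longrightarrow> W p r \<in> carrier_mat N N"
    and random_X: "\<And>p t. p < Q \<Longrightarrow> random_vec M N (X p t)"
    and random_eps: "\<And>p t. p < Q \<Longrightarrow> random_vec M N (eps p t)"
    and equation: "\<And>p t. p < Q \<Longrightarrow> AE \<omega> in M. \<forall>i<N.
        X p t \<omega> $ i = (\<Sum>r<Q. ((A p r \<odot>\<^sub>m W p r) *\<^sub>v X r (t - 1) \<omega>) $ i) + eps p t \<omega> $ i"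
    and stable: "spectral_radius (map_mat complex_of_real (var_mat N Q A W)) < 1"
    \<comment> \<open>\<open>X\<close> is zero-mean and second-order stationary\<close>
    and X_square_integrable: "\<And>p t i. p < Q \<Longrightarrow> i < N \<Longrightarrow> integrable M (\<lambda>\<omega>. (X p t \<omega> $ i)\<^sup>2)"
    and X_mean: "\<And>p t i. p < Q \<Longrightarrow> i < N \<Longrightarrow> expectation (\<lambda>\<omega>. X p t \<omega> $ i) = 0"
    and X_autocovariance: "\<And>p r i j s t h. p < Q \<Longrightarrow> r < Q \<Longrightarrow> i < N \<Longrightarrow> j < N \<Longrightarrow>
        expectation (\<lambda>\<omega>. X p (s + h) \<omega> $ i * X r s \<omega> $ j) =
        expectation (\<lambda>\<omega>. X p (t + h) \<omega> $ i * X r t \<omega> $ j)"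
    \<comment> \<open>\<open>eps\<close> is white noise; the vectors are continuous in that they have a Lebesgue density\<close>
    and eps_continuous: "\<And>p t. p < Q \<Longrightarrow>
        \<exists>f. distributed M (Pi\<^sub>M {..<N} (\<lambda>_. lborel)) (\<lambda>\<omega>. coords N (eps p t \<omega>)) f"
    and eps_mean: "\<And>p t i. p < Q \<Longrightarrow> i < N \<Longrightarrow> expectation (\<lambda>\<omega>. eps p t \<omega> $ i) = 0"
    and eps_covariance: "\<And>p t i j. p < Q \<Longrightarrow> i < N \<Longrightarrow> j < N \<Longrightarrow>
        expectation (\<lambda>\<omega>. eps p t \<omega> $ i * eps p t \<omega> $ j) = Sigma p $$ (i, j)"
    and Sigma: "\<And>p. p < Q \<Longrightarrow> Sigma p \<in> carrier_mat N N" "\<And>p. p < Q \<Longrightarrow> invertible_mat (Sigma p)"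
    and eps_indep: "indep_vars (\<lambda>_. borel_vec N) (\<lambda>(p, t) \<omega>. coords N (eps p t \<omega>)) ({..<Q} \<times> UNIV)"
    and eps_fourth_moments: "\<exists>c. \<forall>p<Q. \<forall>t. \<forall>i<N. \<forall>j<N. \<forall>l<N. \<forall>m<N.
        integrable M (\<lambda>\<omega>. eps p t \<omega> $ i * eps p t \<omega> $ j * eps p t \<omega> $ l * eps p t \<omega> $ m) \<and>
        expectation (\<lambda>\<omega>. \<bar>eps p t \<omega> $ i * eps p t \<omega> $ j * eps p t \<omega> $ l * eps p t \<omega> $ m\<bar>) \<le> c"

section \<open>The restricted regression form\<close>

lemma filter_upt_nth:
  assumes "i < n" "P i"
  shows "filter P [0..<n] ! length (filter P [0..<i]) = i"
    and "length (filter P [0..<i]) < length (filter P [0..<n])"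
proof -
  have "[0..<n] = [0..<i] @ i # [Suc i..<n]"
    using assms(1) by (metis le_add_same_cancel1 less_imp_le_nat upt_add_eq_append upt_conv_Cons zero_le le_add_diff_inverse)
  then have *: "filter P [0..<n] = filter P [0..<i] @ i # filter P [Suc i..<n]"
    using assms(2) by simp
  show "filter P [0..<n] ! length (filter P [0..<i]) = i" by (simp add: * nth_append)
  show "length (filter P [0..<i]) < length (filter P [0..<n])" by (simp add: *)
qed

lemma divmod_less:
  fixes i :: nat
  assumes "i < a * b"
  shows "i mod a < a" "i div a < b"
  using assms by (cases "a = 0"; simp add: less_mult_imp_div_less mult.commute)+

lemma vec_mat_binary:
  assumes "binary_mat n m B" "i < n * m"
  shows "vec_mat B $ i \<in> {0, 1}"
proof -
  have "B $$ (i mod n, i div n) \<in> {0, 1}" "B \<in> carrier_mat n m"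
    using assms divmod_less[OF assms(2)] unfolding binary_mat_def by blast+
  then show ?thesis using assms(2) by (simp add: vec_mat_def)
qed

lemma nonzeros_eq_length:
  assumes "B \<in> carrier_mat n m"
  shows "nonzeros B = length (filter (\<lambda>i. vec_mat B $ i \<noteq> 0) [0..<n * m])"
proof -
  let ?S = "{(i, j). i < n \<and> j < m \<and> B $$ (i, j) \<noteq> 0}"
  let ?f = "\<lambda>(i, j). i + n * j"
  have less: "i + n * j < n * m" if "i < n" "j < m" for i j
  proof -
    have "i + n * j < n * Suc j" using that by simp
    also have "\<dots> \<le> n * m" using that by (intro mult_le_mono) auto
    finally show ?thesis .
  qed
  have "bij_betw ?f ?S {i. i < n * m \<and> vec_mat B $ i \<noteq> 0}"
    by (rule bij_betw_byWitness[where f' = "\<lambda>k. (k mod n, k div n)"])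
       (use assms less divmod_less in \<open>auto simp: vec_mat_def\<close>)
  then have "card ?S = card {i. i < n * m \<and> vec_mat B $ i \<noteq> 0}" by (rule bij_betw_same_card)
  also have "{i. i < n * m \<and> vec_mat B $ i \<noteq> 0} = set (filter (\<lambda>i. vec_mat B $ i \<noteq> 0) [0..<n * m])"
    by auto
  also have "card \<dots> = length (filter (\<lambda>i. vec_mat B $ i \<noteq> 0) [0..<n * m])"
    by (rule distinct_card) simp
  finally show ?thesis using assms by (simp add: nonzeros_def)
qed

lemma restr_mat_restr_vec:
  assumes B: "binary_mat n m B" and b: "b \<in> carrier_vec (n * m)"
    and zero: "\<And>i. i < n * m \<Longrightarrow> vec_mat B $ i = 0 \<Longrightarrow> b $ i = 0"
  shows "restr_mat B *\<^sub>v restr_vec B b = b"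
proof (rule eq_vecI)
  let ?P = "\<lambda>i. vec_mat B $ i \<noteq> 0"
  let ?n = "n * m"
  have carr: "B \<in> carrier_mat n m" using B by (simp add: binary_mat_def)
  have M: "nonzeros B = length (filter ?P [0..<?n])" by (rule nonzeros_eq_length[OF carr])
  have dv: "dim_vec b = ?n" using b by simp
  show "dim_vec (restr_mat B *\<^sub>v restr_vec B b) = dim_vec b" using carr dv by (simp add: restr_mat_def)
  fix i assume "i < dim_vec b"
  then have i: "i < ?n" using dv by simp
  have S: "(\<Sum>k<i. vec_mat B $ k) = real (length (filter ?P [0..<i]))"
  proof -
    have "(\<Sum>k<i. vec_mat B $ k) = (\<Sum>k<i. of_bool (?P k))"
    proof (rule sum.cong[OF refl])
      fix k assume "k \<in> {..<i}"
      then show "vec_mat B $ k = of_bool (?P k)" using vec_mat_binary[OF B, of k] i by auto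
    qed
    also have "\<dots> = real (card {k. k < i \<and> ?P k})"
      by (auto simp: of_bool_def sum.If_cases Int_def intro!: arg_cong[where f = card])
    also have "{k. k < i \<and> ?P k} = set (filter ?P [0..<i])" by auto
    also have "card (set (filter ?P [0..<i])) = length (filter ?P [0..<i])"
      by (rule distinct_card) simp
    finally show ?thesis .
  qed
  let ?c = "length (filter ?P [0..<i])"
  have "(restr_mat B *\<^sub>v restr_vec B b) $ i =
      (\<Sum>j<nonzeros B. vec_mat B $ i * of_bool (?c = j) * restr_vec B b $ j)"
    using i carr M dv by (simp add: restr_mat_def restr_vec_def scalar_prod_def S atLeast0LessThan)
  also have "\<dots> = b $ i"
  proof (cases "?P i")
    case False
    then show ?thesis using zero[OF i] by simp
  next
    case True
    have 1: "vec_mat B $ i = 1" using vec_mat_binary[OF B i] True by auto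
    have c: "?c < nonzeros B" using filter_upt_nth(2)[of i ?n ?P] i True M by simp
    have "(\<Sum>j<nonzeros B. vec_mat B $ i * of_bool (?c = j) * restr_vec B b $ j) =
        (\<Sum>j<nonzeros B. if ?c = j then restr_vec B b $ j else 0)"
      by (intro sum.cong) (auto simp: 1)
    also have "\<dots> = restr_vec B b $ ?c" using c by simp
    also have "\<dots> = b $ (filter ?P [0..<?n] ! ?c)"
      using c M dv by (simp add: restr_vec_def vec_of_list_index)
    finally show ?thesis using filter_upt_nth(1)[of i ?n ?P] i True by simp
  qed
  finally show "(restr_mat B *\<^sub>v restr_vec B b) $ i = b $ i" .
qed

lemma sum_divmod:
  fixes f :: "nat \<Rightarrow> nat \<Rightarrow> real"
  shows "(\<Sum>k<a * b. f (k mod a) (k div a)) = (\<Sum>j<b. \<Sum>i<a. f i j)"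
proof -
  have less: "i + a * j < a * b" if "i < a" "j < b" for i j
  proof -
    have "i + a * j < a * Suc j" using that by simp
    also have "\<dots> \<le> a * b" using that by (intro mult_le_mono) auto
    finally show ?thesis .
  qed
  have "(\<Sum>(j, i)\<in>{..<b} \<times> {..<a}. f i j) = (\<Sum>k<a * b. f (k mod a) (k div a))"
    by (rule sum.reindex_bij_witness[where i = "\<lambda>k. (k div a, k mod a)" and j = "\<lambda>(j, i). i + a * j"])
       (use less divmod_less in auto)
  then show ?thesis by (simp add: sum.cartesian_product)
qed

context nirvar
begin

lemma binary_hconcat: "p < Q \<Longrightarrow> binary_mat N (N * Q) (hconcat_mat N Q (A p))"
  using adjacency divmod_less[of _ N Q] by (fastforce simp: binary_mat_def hconcat_mat_def)

lemma coef_restricted: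
  assumes "p < Q"
  shows "restr_mat (hconcat_mat N Q (A p)) *\<^sub>v
           restr_vec (hconcat_mat N Q (A p)) (vec_mat (coef_mat N Q A W p)) = vec_mat (coef_mat N Q A W p)"
proof (rule restr_mat_restr_vec[OF binary_hconcat[OF assms]])
  show "vec_mat (coef_mat N Q A W p) \<in> carrier_vec (N * (N * Q))"
    by (simp add: vec_mat_def coef_mat_def hconcat_mat_def)
  fix i assume i: "i < N * (N * Q)" and "vec_mat (hconcat_mat N Q (A p)) $ i = 0"
  moreover have "i mod N < N" "i div N < N * Q" using divmod_less[OF i] by auto
  moreover have "i div N mod N < N" "i div N div N < Q" using divmod_less[of "i div N" N Q] calculation by auto
  moreover have "A p (i div N div N) \<in> carrier_mat N N"
    using adjacency[OF assms] calculation by (simp add: binary_mat_def)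
  ultimately show "vec_mat (coef_mat N Q A W p) $ i = 0"
    by (simp add: vec_mat_def coef_mat_def hconcat_mat_def hadamard_mat_def)
qed

text \<open>The model in the vectorised form of the regression that the estimators refer to.\<close>

lemma regression_form:
  assumes p: "p < Q"
  defines "B \<equiv> hconcat_mat N Q (A p)"
  shows "AE \<omega> in M. vec_mat (response_mat N X p T \<omega>) =
      ((design_mat N Q X T \<omega>)\<^sup>T \<otimes>\<^sub>m 1\<^sub>m N) *\<^sub>v
        (restr_mat B *\<^sub>v restr_vec B (vec_mat (coef_mat N Q A W p))) +
      vec_mat (response_mat N eps p T \<omega>)"
proof -
  have "AE \<omega> in M. \<forall>t\<in>{..<T}. \<forall>i<N. X p (int t + 1) \<omega> $ i =
      (\<Sum>r<Q. ((A p r \<odot>\<^sub>m W p r) *\<^sub>v X r (int t) \<omega>) $ i) + eps p (int t + 1) \<omega> $ i"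
    by (subst AE_ball_countable) (use equation[OF p, of "int _ + 1"] in auto)
  then show ?thesis
    unfolding B_def coef_restricted[OF p]
  proof (rule AE_mp, intro AE_I2 impI)
    fix \<omega> assume \<omega>: "\<omega> \<in> space M" and eq: "\<forall>t\<in>{..<T}. \<forall>i<N. X p (int t + 1) \<omega> $ i =
      (\<Sum>r<Q. ((A p r \<odot>\<^sub>m W p r) *\<^sub>v X r (int t) \<omega>) $ i) + eps p (int t + 1) \<omega> $ i"
    show "vec_mat (response_mat N X p T \<omega>) = ((design_mat N Q X T \<omega>)\<^sup>T \<otimes>\<^sub>m 1\<^sub>m N) *\<^sub>v
        vec_mat (coef_mat N Q A W p) + vec_mat (response_mat N eps p T \<omega>)" (is "?l = ?K *\<^sub>v ?b + ?u")
    proof (rule eq_vecI)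
      have K: "dim_row ?K = N * T" "dim_col ?K = N * (N * Q)" "dim_vec ?b = N * (N * Q)"
        by (auto simp: kron_mat_def design_mat_def vec_mat_def coef_mat_def hconcat_mat_def)
      show "dim_vec ?l = dim_vec (?K *\<^sub>v ?b + ?u)"
        by (simp add: vec_mat_def response_mat_def)
      fix k assume "k < dim_vec (?K *\<^sub>v ?b + ?u)"
      then have k: "k < N * T" by (simp add: vec_mat_def response_mat_def)
      define i t where "i = k mod N" and "t = k div N"
      have it: "i < N" "t < T" using divmod_less[OF k] by (auto simp: i_def t_def)
      let ?Phi = "coef_mat N Q A W p"
      have "(?K *\<^sub>v ?b) $ k = (\<Sum>l<N * (N * Q). ?K $$ (k, l) * ?b $ l)"
        using k K by (simp add: scalar_prod_def atLeast0LessThan)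
      also have "\<dots> = (\<Sum>l<N * (N * Q). (\<lambda>i' j. X (j div N) (int t) \<omega> $ (j mod N) * of_bool (i = i') * ?Phi $$ (i', j)) (l mod N) (l div N))"
      proof (rule sum.cong[OF refl])
        fix l assume "l \<in> {..<N * (N * Q)}"
        then have l: "l < N * (N * Q)" by simp
        have "l mod N < N" "l div N < N * Q" using divmod_less[OF l] by auto
        then show "?K $$ (k, l) * ?b $ l = (\<lambda>i' j. X (j div N) (int t) \<omega> $ (j mod N) * of_bool (i = i') * ?Phi $$ (i', j)) (l mod N) (l div N)"
          using k l it
          by (simp add: kron_mat_def vec_mat_def design_mat_def stack_vec_def coef_mat_def hconcat_mat_def
              mult.commute[of T] mult.commute[of "N * Q" N] i_def[symmetric] t_def[symmetric])
      qed
      also have "\<dots> = (\<Sum>j<N * Q. \<Sum>i'<N. X (j div N) (int t) \<omega> $ (j mod N) * of_bool (i = i') * ?Phi $$ (i', j))"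
        by (rule sum_divmod)
      also have "\<dots> = (\<Sum>j<N * Q. X (j div N) (int t) \<omega> $ (j mod N) * ?Phi $$ (i, j))"
      proof (rule sum.cong[OF refl])
        fix j
        have "(\<Sum>i'<N. X (j div N) (int t) \<omega> $ (j mod N) * of_bool (i = i') * ?Phi $$ (i', j)) =
          (\<Sum>i'<N. if i = i' then X (j div N) (int t) \<omega> $ (j mod N) * ?Phi $$ (i', j) else 0)"
          by (intro sum.cong) auto
        then show "(\<Sum>i'<N. X (j div N) (int t) \<omega> $ (j mod N) * of_bool (i = i') * ?Phi $$ (i', j)) =
          X (j div N) (int t) \<omega> $ (j mod N) * ?Phi $$ (i, j)" using it by simp
      qed
      also have "\<dots> = (\<Sum>j<N * Q. (\<lambda>j' r. X r (int t) \<omega> $ j' * (A p r \<odot>\<^sub>m W p r) $$ (i, j')) (j mod N) (j div N))"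
        using it by (intro sum.cong) (auto simp: coef_mat_def hconcat_mat_def)
      also have "\<dots> = (\<Sum>r<Q. \<Sum>j'<N. X r (int t) \<omega> $ j' * (A p r \<odot>\<^sub>m W p r) $$ (i, j'))"
        by (rule sum_divmod)
      also have "\<dots> = (\<Sum>r<Q. ((A p r \<odot>\<^sub>m W p r) *\<^sub>v X r (int t) \<omega>) $ i)"
      proof (rule sum.cong[OF refl])
        fix r assume "r \<in> {..<Q}"
        then have "A p r \<in> carrier_mat N N" "X r (int t) \<omega> \<in> carrier_vec N"
          using adjacency[OF p] random_X \<omega> by (auto simp: binary_mat_def random_vec_def)
        then show "(\<Sum>j'<N. X r (int t) \<omega> $ j' * (A p r \<odot>\<^sub>m W p r) $$ (i, j')) =
            ((A p r \<odot>\<^sub>m W p r) *\<^sub>v X r (int t) \<omega>) $ i"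
          using it by (simp add: scalar_prod_def hadamard_mat_def atLeast0LessThan mult.commute)
      qed
      finally have "(?K *\<^sub>v ?b) $ k + eps p (int t + 1) \<omega> $ i = X p (int t + 1) \<omega> $ i"
        using eq it by simp
      then show "?l $ k = (?K *\<^sub>v ?b + ?u) $ k"
        using k K it by (simp add: vec_mat_def response_mat_def i_def t_def)
    qed
  qed
qed

end

end

theory Submission
  imports Defs
begin

text \<open>
  Put \<open>C(B) = R (R' (\<Gamma> \<otimes> \<Sigma>\<inverse>) R)\<inverse> R'\<close> with \<open>R = R(B)\<close> and \<open>\<Gamma>\<close> the stationary covariance matrix. If
  \<open>\<beta>\<close> lies in the column space of \<open>R\<close>, the normalised error is the same expression with the sample
  covariance in place of \<open>\<Gamma>\<close>, applied to the score \<open>(1 / sqrt T) (X \<otimes> \<Sigma>\<inverse>) u\<close>. The sample covariance tends to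
  \<open>\<Gamma>\<close> and the score to \<open>N(0, \<Gamma> \<otimes> \<Sigma>\<inverse>)\<close> by a martingale central limit theorem, and
  \<open>C (\<Gamma> \<otimes> \<Sigma>\<inverse>) C = C\<close>, so \<open>C(B)\<close> is the asymptotic variance. If the column space of \<open>R(A)\<close> is
  contained in that of \<open>R(A')\<close>, then \<open>C(A') (\<Gamma> \<otimes> \<Sigma>\<inverse>) C(A) = C(A)\<close>; hence
  \<open>D = C(A') - C(A)\<close> satisfies \<open>D = D (\<Gamma> \<otimes> \<Sigma>\<inverse>) D\<close> and is positive semi-definite.

  Both limit theorems are proved for the path \<open>W\<close> started at \<open>0\<close>, which is a function of the noise alone
  and is adapted to a filtration; the stationary process differs from it by a geometrically decaying term.
\<close>

text \<open>The model does not state that \<open>X\<close> at time t is a function of past noise or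
  independent of later noise, and only second moments of \<open>X\<close> are assumed; the noise has
  a constant covariance, but its law may change with time. This rules out the ergodic theorem, and
  no filtration comes with \<open>X\<close>. The path started at \<open>0\<close> supplies both
  adaptedness and fourth moments; its covariance averages converge because their error solves a
  Lyapunov equation whose right-hand side vanishes in the limit. The estimator inverts a random
  matrix that may be singular and whose inverse has no known moments. Its convergence is therefore
  measured by the expectation of \<open>min 1 \<bar>z\<bar>\<close>, under which a rare bad event
  costs only its probability, while the limit theorems for the sample covariance and the score run
  in L1. The rank of \<open>C(B)\<close> is the number of unrestricted coefficients, so the Gaussian
  limit may be singular and is built as a linear image of independent normals, not from a
  density.\<close>

subsection \<open>Weak convergence from characteristic functions\<close>

text \<open>These functions form an algebra that separates points differing in a coordinate below
  \<open>n\<close>, as Stone-Weierstrass requires, and their integrals are finite combinations of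
  values of the characteristic function. The complex factor \<open>c\<close> carries amplitude and
  phase, so that sines and constants are included.\<close>

inductive_set trig_poly :: "nat \<Rightarrow> ((nat \<Rightarrow> real) \<Rightarrow> real) set" for n :: nat where
  base: "(\<lambda>x. Re (c * cis (\<Sum>j<n. u j * x j))) \<in> trig_poly n"
| add: "f \<in> trig_poly n \<Longrightarrow> g \<in> trig_poly n \<Longrightarrow> (\<lambda>x. f x + g x) \<in> trig_poly n"

lemma trig_poly_const: "(\<lambda>_. c) \<in> trig_poly n"
  using trig_poly.base[of "of_real c" "\<lambda>_. 0" n] by simp

lemma trig_poly_mult:
  assumes "f \<in> trig_poly n" "g \<in> trig_poly n"
  shows "(\<lambda>x. f x * g x) \<in> trig_poly n"
  using assms(1)
proof induction
  case (base c u)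
  from assms(2) show ?case
  proof induction
    case (base d v)
    have "(\<lambda>x. Re (c * cis (\<Sum>j<n. u j * x j)) * Re (d * cis (\<Sum>j<n. v j * x j))) =
      (\<lambda>x. Re (c * d / 2 * cis (\<Sum>j<n. (u j + v j) * x j)) +
           Re (c * cnj d / 2 * cis (\<Sum>j<n. (u j - v j) * x j)))"
    proof
      fix x :: "nat \<Rightarrow> real"
      define a where "a = (\<Sum>j<n. u j * x j)"
      define b where "b = (\<Sum>j<n. v j * x j)"
      \<comment> \<open>Product-to-sum formula: it turns the frequencies \<open>u\<close> and
        \<open>v\<close> into \<open>u + v\<close> and \<open>u - v\<close>, which keeps the product
        of two generators in the span.\<close>
      have *: "Re z * Re w = Re (z * w / 2) + Re (z * cnj w / 2)" for z w
        by (simp add: field_simps)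
      have "cis (a + b) = cis a * cis b" "cis (a - b) = cis a * cnj (cis b)"
        by (simp_all add: cis_mult cis_cnj)
      moreover have "(\<Sum>j<n. (u j + v j) * x j) = a + b" "(\<Sum>j<n. (u j - v j) * x j) = a - b"
        by (simp_all add: a_def b_def algebra_simps sum.distrib sum_subtractf)
      ultimately show "Re (c * cis (\<Sum>j<n. u j * x j)) * Re (d * cis (\<Sum>j<n. v j * x j)) =
          Re (c * d / 2 * cis (\<Sum>j<n. (u j + v j) * x j)) +
          Re (c * cnj d / 2 * cis (\<Sum>j<n. (u j - v j) * x j))"
        unfolding a_def[symmetric] b_def[symmetric] * by (simp add: mult_ac)
    qed
    then show ?case by (simp only:) (intro trig_poly.intros)
  next
    case (add f g)
    then show ?case by (simp add: distrib_left trig_poly.add)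
  qed
next
  case (add f g)
  then show ?case by (simp add: distrib_right trig_poly.add)
qed

lemma trig_poly_bounded: "f \<in> trig_poly n \<Longrightarrow> \<exists>C. \<forall>x. \<bar>f x\<bar> \<le> C"
proof (induction rule: trig_poly.induct)
  case (base c u)
  have "\<bar>Re (c * cis (\<Sum>j<n. u j * x j))\<bar> \<le> cmod c" for x
    by (metis abs_Re_le_cmod norm_mult norm_cis mult.right_neutral)
  then show ?case by blast
next
  case (add f g)
  then obtain C D where "\<forall>x. \<bar>f x\<bar> \<le> C" "\<forall>x. \<bar>g x\<bar> \<le> D" by blast
  then have "\<forall>x. \<bar>f x + g x\<bar> \<le> C + D" by (meson abs_triangle_ineq add_mono order_trans)
  then show ?case by blast
qed

lemma cis_measurable[measurable]: "cis \<in> borel_measurable borel"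
  by (intro borel_measurable_continuous_onI continuous_intros)

lemma trig_poly_measurable: "f \<in> trig_poly n \<Longrightarrow> f \<in> borel_measurable (borel_vec n)"
proof (induction rule: trig_poly.induct)
  case (base c u)
  have [measurable]: "(\<lambda>x. x j) \<in> borel_measurable (borel_vec n)" if "j \<in> {..<n}" for j
    using that by measurable
  have "(\<lambda>x. \<Sum>j<n. u j * x j) \<in> borel_measurable (borel_vec n)"
    by (intro borel_measurable_sum borel_measurable_times) auto
  from measurable_compose[OF this cis_measurable]
  show ?case by simp
qed auto

lemma trig_poly_continuous: "f \<in> trig_poly n \<Longrightarrow> continuous_on S f"
proof (induction rule: trig_poly.induct)
  case (base c u)
  have "continuous_on S (\<lambda>x::nat \<Rightarrow> real. \<Sum>j<n. u j * x j)"
    by (intro continuous_on_sum continuous_on_mult continuous_on_const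
        continuous_on_subset[OF continuous_on_product_coordinates subset_UNIV])
  then show ?case by (intro continuous_on_Re continuous_on_mult continuous_on_const continuous_on_cis)
qed (auto intro: continuous_intros)

lemma trig_poly_integral_tendsto:
  assumes "f \<in> trig_poly n"
    and \<mu>: "\<And>T. prob_space (\<mu> T)" "\<And>T. sets (\<mu> T) = sets (borel_vec n)"
    and L: "prob_space L" "sets L = sets (borel_vec n)"
    and ch: "\<And>u. (\<lambda>T. \<integral>x. cis (\<Sum>j<n. u j * x j) \<partial>\<mu> T) \<longlonglongrightarrow> (\<integral>x. cis (\<Sum>j<n. u j * x j) \<partial>L)"
  shows "(\<lambda>T. \<integral>x. f x \<partial>\<mu> T) \<longlonglongrightarrow> (\<integral>x. f x \<partial>L)"
proof -
  have int: "integrable K g" if g: "g \<in> trig_poly n" and "prob_space K" and K: "sets K = sets (borel_vec n)" for g K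
  proof -
    interpret prob_space K by fact
    obtain C where "\<forall>x. \<bar>g x\<bar> \<le> C" using trig_poly_bounded[OF g] by blast
    moreover have "g \<in> borel_measurable K"
      using trig_poly_measurable[OF g] K measurable_cong_sets by blast
    ultimately show ?thesis by (intro integrable_const_bound[of _ C]) auto
  qed
  from assms(1) show ?thesis
  proof induction
    case (base c u)
    have *: "(\<integral>x. Re (c * cis (\<Sum>j<n. u j * x j)) \<partial>K) = Re (c * (\<integral>x. cis (\<Sum>j<n. u j * x j) \<partial>K))"
      if "prob_space K" "sets K = sets (borel_vec n)" for K
    proof -
      interpret prob_space K by fact
      have "(\<lambda>x. \<Sum>j<n. u j * x j) \<in> borel_measurable (borel_vec n)"
        by (intro borel_measurable_sum borel_measurable_times) auto
      from measurable_compose[OF this cis_measurable]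
      have m: "(\<lambda>x. cis (\<Sum>j<n. u j * x j)) \<in> borel_measurable K"
        using that(2) measurable_cong_sets by blast
      have "integrable K (\<lambda>x. cis (\<Sum>j<n. u j * x j))"
        by (intro integrable_const_bound[of _ 1] m) auto
      then have "integrable K (\<lambda>x. c * cis (\<Sum>j<n. u j * x j))" by (rule integrable_mult_right)
      from integral_Re[OF this] show ?thesis by (simp del: times_complex.sel)
    qed
    show ?case unfolding *[OF \<mu>] *[OF L] by (intro tendsto_intros ch)
  next
    case (add f g)
    then show ?case by (simp add: int[OF _ \<mu>] int[OF _ L] tendsto_add)
  qed
qed

lemma trig_poly_polynomial:
  assumes "real_polynomial_function (p :: real \<Rightarrow> real)" "g \<in> trig_poly n"
  shows "(\<lambda>x. p (g x)) \<in> trig_poly n"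
  using assms(1)
proof induction
  case (linear f)
  then obtain c where "f = (\<lambda>x. x * c)" using real_bounded_linear by blast
  then show ?case using trig_poly_mult[OF assms(2) trig_poly_const[of c]] by simp
qed (auto intro: trig_poly_const trig_poly.add trig_poly_mult)

lemma trig_poly_separates:
  assumes "i < n" "x i \<noteq> (y i :: real)"
  shows "\<exists>f\<in>trig_poly n. f x \<noteq> f y"
proof -
  \<comment> \<open>The frequency \<open>w\<close> makes the phases at \<open>x\<close> and
    \<open>y\<close> differ by exactly pi, and \<open>c\<close> rotates the phase at
    \<open>y\<close> to \<open>0\<close>; the two values are then \<open>-1\<close> and
    \<open>1\<close>.\<close>
  define w where "w = pi / (x i - y i)"
  define c where "c = cis (- (w * y i))"
  let ?f = "\<lambda>x. Re (c * cis (\<Sum>j<n. (if j = i then w else 0) * x j))"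
  have s: "(\<Sum>j<n. (if j = i then w else 0) * z j) = w * z i" for z
    using assms(1) by (simp add: if_distrib[of "\<lambda>w. w * _"] cong: if_cong)
  have "w * (x i - y i) = pi" using assms(2) by (simp add: w_def)
  then have "- (w * y i) + w * x i = pi" by (simp add: right_diff_distrib)
  then have "?f x = - 1" "?f y = 1" unfolding s c_def cis_mult by simp_all
  then show ?thesis by (intro bexI[of _ ?f] trig_poly.base) simp
qed

text \<open>
  A trigonometric polynomial that is close to \<open>f\<close> on the cube may be large outside it; composing it
  with a one-dimensional polynomial close to the truncation at \<open>\<plusminus>C\<close> repairs this.
\<close>

lemma trig_poly_approx:
  fixes f :: "(nat \<Rightarrow> real) \<Rightarrow> real"
  assumes f: "continuous_map (powertop_real {..<n}) euclideanreal f"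
    and C: "\<And>x. x \<in> {..<n} \<rightarrow>\<^sub>E UNIV \<Longrightarrow> \<bar>f x\<bar> \<le> C" and e: "e > 0"
  shows "\<exists>g\<in>trig_poly n. (\<forall>x\<in>{..<n} \<rightarrow>\<^sub>E UNIV. (\<forall>i<n. \<bar>x i\<bar> \<le> K) \<longrightarrow> \<bar>f x - g x\<bar> \<le> e) \<and> (\<forall>x. \<bar>g x\<bar> \<le> C + e)"
proof -
  \<comment> \<open>Points of the product over \<open>{..<n}\<close> are \<open>undefined\<close>
    beyond \<open>n\<close>, whereas Stone-Weierstrass is applied in the full type of functions.
    \<open>?E\<close> moves a point into the compact cube \<open>S\<close> by filling in
    \<open>0\<close>, and restriction to \<open>{..<n}\<close> moves it back.\<close>
  let ?E = "\<lambda>x::nat\<Rightarrow>real. \<lambda>i. if i < n then x i else 0"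
  define S where "S = PiE UNIV (\<lambda>i. if i < n then {-K..K} else {0::real})"
  have "compactin (product_topology (\<lambda>i. euclidean) UNIV) S"
    unfolding S_def compactin_PiE by auto
  then have S: "compact S" by (simp add: euclidean_product_topology)
  have r: "continuous_map euclidean (powertop_real {..<n}) (\<lambda>x::nat\<Rightarrow>real. restrict x {..<n})"
    unfolding continuous_map_componentwise
    by (auto simp: continuous_map_iff_continuous2 intro: continuous_on_product_coordinates)
  have "continuous_on UNIV (\<lambda>x. f (restrict x {..<n}))"
    using continuous_map_compose[OF r f] by (simp add: o_def)
  then have fr: "continuous_on S (\<lambda>x. f (restrict x {..<n}))" by (rule continuous_on_subset) simp
  obtain g where g: "g \<in> trig_poly n" "\<And>x. x \<in> S \<Longrightarrow> \<bar>f (restrict x {..<n}) - g x\<bar> < e/2"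
  proof -
    have "\<exists>g. g \<in> trig_poly n \<and> (\<forall>x\<in>S. \<bar>f (restrict x {..<n}) - g x\<bar> < e/2)"
    proof (rule Stone_Weierstrass_HOL[OF S])
      fix x y assume "x \<in> S \<and> y \<in> S \<and> x \<noteq> y"
      then obtain i where i: "x i \<noteq> y i" "x \<in> S" "y \<in> S" by auto
      have "i < n"
      proof (rule ccontr)
        assume "\<not> i < n"
        then have "x i = 0" "y i = 0" using PiE_mem[OF i(2)[unfolded S_def], of i] PiE_mem[OF i(3)[unfolded S_def], of i] by simp_all
        with i show False by simp
      qed
      with i show "\<exists>f. f \<in> trig_poly n \<and> f x \<noteq> f y" using trig_poly_separates by blast
    qed (use e fr in \<open>auto intro: trig_poly_const trig_poly_continuous trig_poly.add trig_poly_mult\<close>)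
    then show ?thesis using that by blast
  qed
  obtain D where D: "\<And>x. \<bar>g x\<bar> \<le> D" using trig_poly_bounded[OF g(1)] by blast
  have "C \<ge> 0" using C[of "\<lambda>i\<in>{..<n}. 0"] by force
  let ?cl = "\<lambda>y::real. max (- C) (min C y)"
  have "continuous_on {-D..D} ?cl" by (intro continuous_intros)
  then obtain p where p: "real_polynomial_function p" "\<And>y. y \<in> {-D..D} \<Longrightarrow> \<bar>?cl y - p y\<bar> < e/2"
    using Stone_Weierstrass_real_polynomial_function[of "{-D..D}" ?cl "e/2"] e by auto
  have p': "\<bar>?cl (g x) - p (g x)\<bar> < e/2" for x using p(2)[of "g x"] D[of x] by (auto simp: abs_le_iff)
  show ?thesis
  proof (intro bexI[of _ "\<lambda>x. p (g x)"] conjI ballI allI impI)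
    show "(\<lambda>x. p (g x)) \<in> trig_poly n" by (rule trig_poly_polynomial[OF p(1) g(1)])
    show "\<bar>p (g x)\<bar> \<le> C + e" for x using p'[of x] \<open>C \<ge> 0\<close> e by linarith
    fix x assume x: "x \<in> {..<n} \<rightarrow>\<^sub>E (UNIV :: real set)" "\<forall>i<n. \<bar>x i\<bar> \<le> K"
    have gE: "h (?E x) = h x" if "h \<in> trig_poly n" for h using that by induction auto
    have "?E x \<in> S" using x(2) by (auto simp: S_def abs_le_iff minus_le_iff)
    moreover have "restrict (?E x) {..<n} = x" using x(1) by (auto simp: fun_eq_iff restrict_def PiE_def extensional_def)
    ultimately have "\<bar>f x - g x\<bar> < e/2" using g(2)[of "?E x"] gE[OF g(1)] by simp
    then show "\<bar>f x - p (g x)\<bar> \<le> e" using p'[of x] C[OF x(1)] by linarith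
  qed
qed

text \<open>On its domain \<open>f\<close> equals itself after extension by \<open>0\<close> and
  restriction. Continuity on the full function type gives Borel measurability there, and the
  extension is measurable because each of its coordinates is.\<close>

lemma continuous_map_measurable_borel_vec:
  assumes "continuous_map (powertop_real {..<n}) euclideanreal f"
  shows "f \<in> borel_measurable (borel_vec n)"
proof -
  let ?E = "\<lambda>x::nat\<Rightarrow>real. \<lambda>i. if i < n then x i else 0"
  have r: "continuous_map euclidean (powertop_real {..<n}) (\<lambda>x::nat\<Rightarrow>real. restrict x {..<n})"
    unfolding continuous_map_componentwise
    by (auto simp: continuous_map_iff_continuous2 intro: continuous_on_product_coordinates)
  have "continuous_on UNIV (\<lambda>x. f (restrict x {..<n}))"
    using continuous_map_compose[OF r assms] by (simp add: o_def)
  then have m: "(\<lambda>x. f (restrict x {..<n})) \<in> borel_measurable borel"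
    by (rule borel_measurable_continuous_onI)
  have "?E \<in> measurable (borel_vec n) borel"
  proof (rule measurable_coordinatewise_then_product)
    show "(\<lambda>x. if i < n then x i else 0) \<in> borel_measurable (borel_vec n)" for i
      by (cases "i < n") simp_all
  qed
  from measurable_compose[OF this m] have "(\<lambda>x. f (restrict (?E x) {..<n})) \<in> borel_measurable (borel_vec n)" .
  moreover have "restrict (?E x) {..<n} = x" if "x \<in> space (borel_vec n)" for x
    using that by (auto simp: fun_eq_iff restrict_def PiE_def extensional_def space_PiM)
  ultimately show ?thesis by (simp cong: measurable_cong)
qed

text \<open>The substantial half of Levy's continuity theorem, with tightness as a hypothesis. A
  bounded continuous \<open>f\<close> is replaced by a trigonometric polynomial close to it on a
  large cube; tightness makes the mass outside negligible, and the integrals of the polynomial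
  converge by \<open>ch\<close>.\<close>

lemma weak_convergence_of_char:
  assumes \<mu>: "\<And>T. prob_space (\<mu> T)" "\<And>T. sets (\<mu> T) = sets (borel_vec n)"
    and L: "prob_space L" "sets L = sets (borel_vec n)"
    and ch: "\<And>u. (\<lambda>T. \<integral>x. cis (\<Sum>j<n. u j * x j) \<partial>\<mu> T) \<longlonglongrightarrow> (\<integral>x. cis (\<Sum>j<n. u j * x j) \<partial>L)"
    and tight: "\<And>e. e > 0 \<Longrightarrow> \<exists>K. \<forall>\<^sub>F T in sequentially. measure (\<mu> T) {x\<in>space (\<mu> T). \<exists>i<n. \<bar>x i\<bar> > K} \<le> e"
    and tightL: "\<And>e. e > 0 \<Longrightarrow> \<exists>K. measure L {x\<in>space L. \<exists>i<n. \<bar>x i\<bar> > K} \<le> e"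
    and f: "continuous_map (powertop_real {..<n}) euclideanreal f"
    and bdd: "bounded (f ` ({..<n} \<rightarrow>\<^sub>E UNIV))"
  shows "(\<lambda>T. \<integral>x. f x \<partial>\<mu> T) \<longlonglongrightarrow> (\<integral>x. f x \<partial>L)"
proof -
  obtain C where C: "\<And>x. x \<in> {..<n} \<rightarrow>\<^sub>E UNIV \<Longrightarrow> \<bar>f x\<bar> \<le> C" "C > 0"
    using bdd unfolding bounded_pos by (metis imageI real_norm_def)
  \<comment> \<open>On the cube the integrands differ by at most \<open>e\<close>; outside they are
    bounded by \<open>C\<close> and \<open>C + e\<close>, which gives the factor
    \<open>2 * C + e\<close>.\<close>
  have approx: "\<bar>(\<integral>x. f x \<partial>\<nu>) - (\<integral>x. g x \<partial>\<nu>)\<bar> \<le> e + (2 * C + e) * measure \<nu> {x\<in>space \<nu>. \<exists>i<n. \<bar>x i\<bar> > K}"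
    if \<nu>: "prob_space \<nu>" "sets \<nu> = sets (borel_vec n)" and g: "g \<in> trig_poly n" and e: "e > 0"
      and gf: "\<And>x. x \<in> {..<n} \<rightarrow>\<^sub>E UNIV \<Longrightarrow> (\<forall>i<n. \<bar>x i\<bar> \<le> K) \<Longrightarrow> \<bar>f x - g x\<bar> \<le> e" "\<And>x. \<bar>g x\<bar> \<le> C + e"
    for \<nu> g e K
  proof -
    interpret prob_space \<nu> by fact
    have sp: "space \<nu> = {..<n} \<rightarrow>\<^sub>E UNIV" using sets_eq_imp_space_eq[OF \<nu>(2)] by (simp add: space_PiM)
    have mf[measurable]: "f \<in> borel_measurable \<nu>" "g \<in> borel_measurable \<nu>"
      using continuous_map_measurable_borel_vec[OF f] trig_poly_measurable[OF g] \<nu>(2) measurable_cong_sets by blast+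
    have "(\<lambda>x. x i) \<in> borel_measurable (borel_vec n)" if "i < n" for i using that by simp
    then have mx[measurable]: "(\<lambda>x. x i) \<in> borel_measurable \<nu>" if "i < n" for i
      using that \<nu>(2) measurable_cong_sets by blast
    let ?A = "{x\<in>space \<nu>. \<exists>i<n. \<bar>x i\<bar> > K}"
    have "?A = (\<Union>i\<in>{..<n}. {x\<in>space \<nu>. \<bar>x i\<bar> > K})" by auto
    moreover have "\<dots> \<in> sets \<nu>" by (intro sets.finite_UN) auto
    ultimately have A: "?A \<in> sets \<nu>" by simp
    have int: "integrable \<nu> f" "integrable \<nu> g"
      using C(1) gf(2) sp by (auto intro!: integrable_const_bound[of _ C] integrable_const_bound[of g "C + e"])
    have int2: "integrable \<nu> (\<lambda>x. e + (2 * C + e) * indicator ?A x)"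
      using A by (intro Bochner_Integration.integrable_add integrable_mult_right integrable_real_indicator) (auto simp: less_top[symmetric])
    have "\<bar>(\<integral>x. f x \<partial>\<nu>) - (\<integral>x. g x \<partial>\<nu>)\<bar> = \<bar>\<integral>x. f x - g x \<partial>\<nu>\<bar>" using int by simp
    also have "\<dots> \<le> (\<integral>x. \<bar>f x - g x\<bar> \<partial>\<nu>)" by (rule integral_abs_bound)
    also have "\<dots> \<le> (\<integral>x. e + (2 * C + e) * indicator ?A x \<partial>\<nu>)"
    proof (rule integral_mono)
      fix x assume x: "x \<in> space \<nu>"
      show "\<bar>f x - g x\<bar> \<le> e + (2 * C + e) * indicator ?A x"
      proof (cases "\<exists>i<n. \<bar>x i\<bar> > K")
        case True
        then have "indicator ?A x = (1::real)" using x by simp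
        moreover have "\<bar>f x\<bar> \<le> C" "\<bar>g x\<bar> \<le> C + e" using x C(1)[of x] gf(2)[of x] sp by auto
        ultimately show ?thesis using e by simp
      next
        case False
        then have "\<forall>i<n. \<bar>x i\<bar> \<le> K" by (metis not_less)
        then have "\<bar>f x - g x\<bar> \<le> e" "x \<notin> ?A" using gf(1)[of x] x sp by fastforce+
        then show ?thesis by simp
      qed
    qed (use int int2 in auto)
    also have "\<dots> = e + (2 * C + e) * measure \<nu> ?A"
      using A by (subst Bochner_Integration.integral_add) (auto simp: prob_space less_top[symmetric])
    finally show ?thesis .
  qed
  show ?thesis
  proof (rule LIMSEQ_I)
    fix r :: real assume r: "r > 0"
    \<comment> \<open>With \<open>e \<le> 1\<close> each of the two replacements costs at most
      \<open>e + (2 * C + 1) * e\<close>, and the limit costs one more \<open>e\<close>; the sum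
      \<open>(4 * C + 5) * e\<close> does not exceed \<open>r\<close>.\<close>
    define e where "e = min 1 (r / (4 * (2 * C + 3)))"
    have "e \<le> r / (4 * (2 * C + 3))" by (simp add: e_def)
    then have e: "e > 0" "e \<le> 1" "e * (4 * (2 * C + 3)) \<le> r"
      using r C(2) by (simp_all add: pos_le_divide_eq) (simp_all add: e_def)
    obtain K1 where K1: "\<forall>\<^sub>F T in sequentially. measure (\<mu> T) {x\<in>space (\<mu> T). \<exists>i<n. \<bar>x i\<bar> > K1} \<le> e"
      using tight[OF e(1)] by blast
    obtain K2 where K2: "measure L {x\<in>space L. \<exists>i<n. \<bar>x i\<bar> > K2} \<le> e" using tightL[OF e(1)] by blast
    define K where "K = max K1 K2"
    have mono: "measure \<nu> {x\<in>space \<nu>. \<exists>i<n. \<bar>x i\<bar> > K} \<le> measure \<nu> {x\<in>space \<nu>. \<exists>i<n. \<bar>x i\<bar> > K'}"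
      if "prob_space \<nu>" "sets \<nu> = sets (borel_vec n)" "K' \<le> K" for \<nu> K'
    proof -
      interpret prob_space \<nu> by fact
      have "(\<lambda>x. x i) \<in> borel_measurable (borel_vec n)" if "i < n" for i using that by simp
      then have mx[measurable]: "(\<lambda>x. x i) \<in> borel_measurable \<nu>" if "i < n" for i
        using that \<open>sets \<nu> = _\<close> measurable_cong_sets by blast
      have "{x\<in>space \<nu>. \<exists>i<n. \<bar>x i\<bar> > K'} = (\<Union>i\<in>{..<n}. {x\<in>space \<nu>. \<bar>x i\<bar> > K'})" by auto
      moreover have "\<dots> \<in> sets \<nu>" by (intro sets.finite_UN) auto
      ultimately show ?thesis using that(3) by (intro finite_measure_mono) (auto intro: order.strict_trans1)
    qed
    obtain g where g: "g \<in> trig_poly n"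
        "\<And>x. x \<in> {..<n} \<rightarrow>\<^sub>E UNIV \<Longrightarrow> (\<forall>i<n. \<bar>x i\<bar> \<le> K) \<Longrightarrow> \<bar>f x - g x\<bar> \<le> e" "\<And>x. \<bar>g x\<bar> \<le> C + e"
      using trig_poly_approx[OF f C(1) e(1), of K] by blast
    have gl: "\<forall>\<^sub>F T in sequentially. \<bar>(\<integral>x. g x \<partial>\<mu> T) - (\<integral>x. g x \<partial>L)\<bar> < e"
      using tendstoD[OF trig_poly_integral_tendsto[OF g(1) \<mu> L ch] e(1)] by (simp add: dist_real_def)
    have b: "(2 * C + e) * m \<le> (2 * C + 1) * e" if "m \<le> e" "m \<ge> 0" for m
      using that e C(2) by (intro mult_mono) auto
    have "\<forall>\<^sub>F T in sequentially. norm ((\<integral>x. f x \<partial>\<mu> T) - (\<integral>x. f x \<partial>L)) < r"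
      using gl K1
    proof eventually_elim
      case (elim T)
      have 1: "\<bar>(\<integral>x. f x \<partial>\<mu> T) - (\<integral>x. g x \<partial>\<mu> T)\<bar> \<le> e + (2 * C + 1) * e"
        using approx[where \<nu> = "\<mu> T" and K = K, OF \<mu> g(1) e(1) g(2,3)] b[of "measure (\<mu> T) {x\<in>space (\<mu> T). \<exists>i<n. \<bar>x i\<bar> > K}"]
          mono[OF \<mu>, of K1 T] elim(2) by (simp add: K_def)
      have 2: "\<bar>(\<integral>x. f x \<partial>L) - (\<integral>x. g x \<partial>L)\<bar> \<le> e + (2 * C + 1) * e"
        using approx[where K = K, OF L g(1) e(1) g(2,3)] b[of "measure L {x\<in>space L. \<exists>i<n. \<bar>x i\<bar> > K}"]
          mono[OF L, of K2] K2 by (simp add: K_def)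
      have "\<bar>(\<integral>x. f x \<partial>\<mu> T) - (\<integral>x. f x \<partial>L)\<bar> < 2 * (e + (2 * C + 1) * e) + e"
        using 1 2 elim(1) unfolding mult_2 by linarith
      also have "\<dots> \<le> e * (4 * (2 * C + 3))" using e C(2) by (simp add: algebra_simps)
      finally show ?case using e(3) by simp
    qed
    then show "\<exists>no. \<forall>T\<ge>no. norm ((\<integral>x. f x \<partial>\<mu> T) - (\<integral>x. f x \<partial>L)) < r"
      by (simp add: eventually_sequentially)
  qed
qed

subsection \<open>Gaussian laws\<close>

text \<open>Entries are given by a function of the indices instead of a matrix, so that the
  induction in \<open>cholesky\<close> can pass to a smaller \<open>n\<close> without forming
  submatrices.\<close>

definition psd_form :: "nat \<Rightarrow> (nat \<Rightarrow> nat \<Rightarrow> real) \<Rightarrow> bool" where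
  "psd_form n a \<longleftrightarrow> (\<forall>i<n. \<forall>j<n. a i j = a j i) \<and> (\<forall>u. 0 \<le> (\<Sum>i<n. \<Sum>j<n. u i * u j * a i j))"

lemma quadratic_form_Suc:
  fixes a :: "nat \<Rightarrow> nat \<Rightarrow> real"
  assumes "\<And>i. i < n \<Longrightarrow> a n i = a i n"
  shows "(\<Sum>i<Suc n. \<Sum>j<Suc n. u i * u j * a i j) =
    (\<Sum>i<n. \<Sum>j<n. u i * u j * a i j) + 2 * u n * (\<Sum>i<n. u i * a i n) + u n * u n * a n n"
proof -
  have "(\<Sum>j<n. u n * u j * a n j) = u n * (\<Sum>i<n. u i * a i n)"
    unfolding sum_distrib_left by (intro sum.cong) (auto simp: assms)
  moreover have "(\<Sum>i<n. u i * u n * a i n) = u n * (\<Sum>i<n. u i * a i n)"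
    unfolding sum_distrib_left by (intro sum.cong) auto
  ultimately show ?thesis by (simp add: sum.distrib algebra_simps)
qed

lemma affine_nonneg_imp_slope_zero:
  fixes b s :: real
  assumes "\<And>t. 0 \<le> b + t * s"
  shows "s = 0"
proof (rule ccontr)
  assume "s \<noteq> 0"
  then show False using assms[of "- (b + 1) / s"] by simp
qed

text \<open>Symmetric elimination of the last index: its row, divided by the root of the pivot
  \<open>d\<close>, becomes a column of the factor, and the Schur complement \<open>a'\<close> is
  again positive semi-definite. A zero pivot is allowed, since positivity then forces the whole last
  row to vanish.\<close>

lemma cholesky:
  assumes "psd_form n a"
  shows "\<exists>b. \<forall>i<n. \<forall>j<n. a i j = (\<Sum>k<n. b i k * b j k)"
  using assms
proof (induction n arbitrary: a)
  case 0
  then show ?case by simp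
next
  case (Suc n)
  define d where "d = a n n"
  have sym: "a i j = a j i" if "i \<le> n" "j \<le> n" for i j
    using Suc.prems that by (simp add: psd_form_def less_Suc_eq_le)
  have pos: "0 \<le> (\<Sum>i<n. \<Sum>j<n. u i * u j * a i j) + 2 * t * (\<Sum>i<n. u i * a i n) + t * t * d" for u t
  proof -
    let ?u = "\<lambda>i. if i = n then t else u i"
    have "0 \<le> (\<Sum>i<Suc n. \<Sum>j<Suc n. ?u i * ?u j * a i j)" using Suc.prems by (simp only: psd_form_def)
    also have "\<dots> = (\<Sum>i<n. \<Sum>j<n. ?u i * ?u j * a i j) + 2 * ?u n * (\<Sum>i<n. ?u i * a i n) + ?u n * ?u n * a n n"
      by (rule quadratic_form_Suc) (simp add: sym)
    finally show ?thesis by (simp add: d_def)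
  qed
  have d: "d \<ge> 0" using pos[of "\<lambda>_. 0" 1] by simp
  \<comment> \<open>For \<open>d = 0\<close> the form at the \<open>i\<close>-th unit vector with
    last coordinate \<open>t\<close> is affine in \<open>t\<close>; being nonnegative for all
    \<open>t\<close>, it has slope zero.\<close>
  have zero: "a i n = 0" if "d = 0" "i < n" for i
  proof -
    let ?u = "\<lambda>k. if k = i then 1 else 0 :: real"
    have "0 \<le> (\<Sum>i<n. \<Sum>j<n. ?u i * ?u j * a i j) + t * (2 * (\<Sum>i<n. ?u i * a i n))" for t
      using pos[of ?u t] that by (simp add: mult_ac)
    from affine_nonneg_imp_slope_zero[OF this]
    have "(\<Sum>k<n. ?u k * a k n) = 0" by simp
    then show ?thesis using that by (simp add: if_distrib[of "\<lambda>w. w * _"] cong: if_cong)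
  qed
  define a' where "a' i j = a i j - a i n * a j n / d" for i j
  have "psd_form n a'"
    unfolding psd_form_def
  proof (intro conjI allI impI)
    show "a' i j = a' j i" if "i < n" "j < n" for i j using that sym[of i j] by (simp add: a'_def)
    fix u
    define s where "s = (\<Sum>i<n. u i * a i n)"
    have "(\<Sum>i<n. \<Sum>j<n. u i * u j * a' i j) =
        (\<Sum>i<n. \<Sum>j<n. u i * u j * a i j) - (\<Sum>i<n. \<Sum>j<n. (u i * a i n) * (u j * a j n)) / d"
      unfolding a'_def by (simp add: right_diff_distrib sum_subtractf sum_divide_distrib mult_ac)
    also have "(\<Sum>i<n. \<Sum>j<n. (u i * a i n) * (u j * a j n)) = s * s"
      unfolding s_def by (rule sum_product[symmetric])
    \<comment> \<open>Completing the square: \<open>- s / d\<close> is the last coordinate that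
      minimises the full form. For \<open>d = 0\<close> the identity still holds because division by
      zero gives \<open>0\<close>.\<close>
    also have "(\<Sum>i<n. \<Sum>j<n. u i * u j * a i j) - s * s / d =
        (\<Sum>i<n. \<Sum>j<n. u i * u j * a i j) + 2 * (- s / d) * s + (- s / d) * (- s / d) * d"
      by (cases "d = 0") (simp_all add: field_simps)
    also have "\<dots> \<ge> 0" unfolding s_def by (rule pos)
    finally show "0 \<le> (\<Sum>i<n. \<Sum>j<n. u i * u j * a' i j)" .
  qed
  then obtain b where b: "\<And>i j. i < n \<Longrightarrow> j < n \<Longrightarrow> a' i j = (\<Sum>k<n. b i k * b j k)"
    using Suc.IH by blast
  define b' where "b' i k = (if k = n then a i n / sqrt d else if i = n then 0 else b i k)" for i k
  have bn: "b' i n * b' j n = a i n * a j n / d" for i j using d by (simp add: b'_def)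
  show ?case
  proof (intro exI[of _ b'] allI impI)
    fix i j assume "i < Suc n" "j < Suc n"
    then consider "i < n" "j < n" | "i = n" "j \<le> n" | "i \<le> n" "j = n" by linarith
    then show "a i j = (\<Sum>k<Suc n. b' i k * b' j k)"
    proof cases
      case 1
      then have "(\<Sum>k<n. b' i k * b' j k) = a' i j" unfolding b[OF 1] by (intro sum.cong) (auto simp: b'_def)
      then show ?thesis using bn[of i j] by (simp add: a'_def)
    next
      case 2
      then have "(\<Sum>k<n. b' i k * b' j k) = 0" by (intro sum.neutral) (auto simp: b'_def)
      then show ?thesis using bn[of i j] 2 zero[of j] sym[of n j] by (cases "j = n"; cases "d = 0") (auto simp: d_def)
    next
      case 3
      then have "(\<Sum>k<n. b' i k * b' j k) = 0" by (intro sum.neutral) (auto simp: b'_def)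
      then show ?thesis using bn[of i j] 3 zero[of i] by (cases "i = n"; cases "d = 0") (auto simp: d_def)
    qed
  qed
qed

text \<open>The law is the image of independent standard normals under a factor \<open>b\<close> of
  \<open>V\<close>. Moments and characteristic function then reduce to integrals of products over
  independent coordinates.\<close>

lemma gaussian_exists:
  assumes "psd_form n V"
  shows "\<exists>L. prob_space L \<and> sets L = sets (borel_vec n) \<and>
    (\<forall>u. (\<integral>x. cis (\<Sum>j<n. u j * x j) \<partial>L) = of_real (exp (- (\<Sum>i<n. \<Sum>j<n. u i * u j * V i j) / 2))) \<and>
    (\<forall>i<n. integrable L (\<lambda>x. (x i)\<^sup>2) \<and> (\<integral>x. x i \<partial>L) = 0) \<and>
    (\<forall>i<n. \<forall>j<n. (\<integral>x. x i * x j \<partial>L) = V i j)"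
proof -
  obtain b where b: "\<And>i j. i < n \<Longrightarrow> j < n \<Longrightarrow> V i j = (\<Sum>k<n. b i k * b j k)"
    using cholesky[OF assms] by blast
  interpret S: prob_space std_normal_distribution
    using real_dist_normal_dist by (simp add: real_distribution_def)
  interpret P: product_prob_space "\<lambda>_::nat. std_normal_distribution" "{..<n}"
    by unfold_locales
  define G where "G = Pi\<^sub>M {..<n} (\<lambda>_::nat. std_normal_distribution)"
  interpret G: prob_space G unfolding G_def by (intro prob_space_PiM S.prob_space_axioms)
  have setsG: "sets G = sets (borel_vec n)" unfolding G_def by (intro sets_PiM_cong) auto
  define f where "f x = (\<lambda>i\<in>{..<n}. \<Sum>k<n. b i k * x k)" for x :: "nat \<Rightarrow> real"
  have co[measurable]: "(\<lambda>x. x k) \<in> borel_measurable G" if "k < n" for k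
  proof -
    have "(\<lambda>x. x k) \<in> borel_measurable (borel_vec n)" using that by simp
    then show ?thesis using setsG measurable_cong_sets by blast
  qed
  have f: "f \<in> measurable G (borel_vec n)"
    unfolding f_def by (intro measurable_restrict borel_measurable_sum borel_measurable_times borel_measurable_const co) auto
  define L where "L = distr G (borel_vec n) f"
  interpret L: prob_space L unfolding L_def by (rule G.prob_space_distr[OF f])
  have prodint: "integrable G (\<lambda>x. \<Prod>k<n. h k (x k))" "(\<integral>x. (\<Prod>k<n. h k (x k)) \<partial>G) = (\<Prod>k<n. integral\<^sup>L std_normal_distribution (h k))"
    if "\<And>k. k < n \<Longrightarrow> integrable std_normal_distribution (h k)" for h :: "nat \<Rightarrow> real \<Rightarrow> real"
    using P.product_integrable_prod[of "{..<n}" h] P.product_integral_prod[of "{..<n}" h] that by (auto simp: G_def)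
  have mom: "integrable std_normal_distribution (\<lambda>x::real. x)" "integrable std_normal_distribution (\<lambda>x::real. x\<^sup>2)"
    "(\<integral>x. x \<partial>std_normal_distribution) = (0::real)" "(\<integral>x. x\<^sup>2 \<partial>std_normal_distribution) = (1::real)"
    using integrable_std_normal_distribution_moment[of 1] integrable_std_normal_distribution_moment[of 2]
      integral_std_normal_distribution_moment_odd[of 1] std_normal_distribution_even_moments(1)[of 1] by auto
  have one: "integrable G (\<lambda>x. x k) \<and> (\<integral>x. x k \<partial>G) = 0" if "k < n" for k
  proof -
    \<comment> \<open>A single coordinate is written as a product with factors \<open>1\<close>
      elsewhere, so that \<open>prodint\<close> evaluates it; the next claim does the same for two
      coordinates.\<close>
    let ?h = "\<lambda>j x. if j = k then x else 1::real"
    have i: "integrable std_normal_distribution (?h j)" for j using mom(1) by (cases "j = k") simp_all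
    have e: "(\<lambda>x. \<Prod>j<n. ?h j (x j)) = (\<lambda>x. x k)" by (rule ext) (simp add: that)
    have "integral\<^sup>L std_normal_distribution (?h k) = 0" using mom(3) by simp
    then have "(\<Prod>j<n. integral\<^sup>L std_normal_distribution (?h j)) = 0"
      using that by (intro prod_zero bexI[of _ k]) simp_all
    then show ?thesis using prodint[of ?h] i unfolding e by simp
  qed
  have two: "integrable G (\<lambda>x. x k * x l) \<and> (\<integral>x. x k * x l \<partial>G) = of_bool (k = l)" if "k < n" "l < n" for k l
  proof -
    let ?h = "\<lambda>j x. (if j = k then x else 1::real) * (if j = l then x else 1::real)"
    have i: "integrable std_normal_distribution (?h j)" for j
      using mom(1,2) by (cases "j = k"; cases "j = l") (simp_all add: power2_eq_square)
    have e: "(\<lambda>x. \<Prod>j<n. ?h j (x j)) = (\<lambda>x. x k * x l)" by (rule ext) (simp add: that prod.distrib)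
    have "(\<Prod>j<n. integral\<^sup>L std_normal_distribution (?h j)) = of_bool (k = l)"
    proof (cases "k = l")
      case True
      have "integral\<^sup>L std_normal_distribution (?h j) = 1" for j
        using mom(4) True S.prob_space by (cases "j = k") (simp_all add: power2_eq_square)
      then show ?thesis using True by simp
    next
      case False
      then have "integral\<^sup>L std_normal_distribution (?h k) = 0" using mom(3) by simp
      then have "(\<Prod>j<n. integral\<^sup>L std_normal_distribution (?h j)) = 0"
        using that by (intro prod_zero bexI[of _ k]) simp_all
      then show ?thesis using False by simp
    qed
    then show ?thesis using prodint[of ?h] i unfolding e by simp
  qed
  have ch: "(\<integral>x. cis (\<Sum>j<n. u j * x j) \<partial>L) = of_real (exp (- (\<Sum>i<n. \<Sum>j<n. u i * u j * V i j) / 2))" for u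
  proof -
    define w where "w k = (\<Sum>i<n. u i * b i k)" for k
    have m: "(\<lambda>x. cis (\<Sum>j<n. u j * x j)) \<in> borel_measurable (borel_vec n)"
    proof -
      have "(\<lambda>x. \<Sum>j<n. u j * x j) \<in> borel_measurable (borel_vec n)"
        by (intro borel_measurable_sum borel_measurable_times) auto
      moreover have "cis \<in> borel_measurable borel" by (intro borel_measurable_continuous_onI continuous_intros)
      ultimately show ?thesis by (rule measurable_compose)
    qed
    have "(\<Sum>i<n. u i * f x i) = (\<Sum>k<n. w k * x k)" for x
      unfolding w_def by (simp add: f_def sum_distrib_left sum_distrib_right mult_ac) (rule sum.swap)
    then have "(\<integral>x. cis (\<Sum>j<n. u j * x j) \<partial>L) = (\<integral>x. cis (\<Sum>k<n. w k * x k) \<partial>G)"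
      unfolding L_def integral_distr[OF f m] by simp
    also have "(\<lambda>x. cis (\<Sum>k<n. w k * x k)) = (\<lambda>x. \<Prod>k<n. cis (w k * x k))"
    proof
      show "cis (\<Sum>k<n. w k * x k) = (\<Prod>k<n. cis (w k * x k))" for x
        by (induction n) (simp_all add: cis_mult[symmetric])
    qed
    also have "(\<integral>x. (\<Prod>k<n. cis (w k * x k)) \<partial>G) = (\<Prod>k<n. \<integral>x. cis (w k * x) \<partial>std_normal_distribution)"
      unfolding G_def
    proof (rule P.product_integral_prod)
      have "(\<lambda>x. cis (w k * x)) \<in> borel_measurable borel" for k
        by (intro borel_measurable_continuous_onI continuous_intros)
      then show "complex_integrable std_normal_distribution (\<lambda>x. cis (w k * x))" for k
        by (intro S.integrable_const_bound[of _ 1]) auto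
    qed simp
    also have "\<dots> = (\<Prod>k<n. complex_of_real (exp (- (w k)\<^sup>2 / 2)))"
    proof (rule prod.cong[OF refl])
      show "(\<integral>x. cis (w k * x) \<partial>std_normal_distribution) = of_real (exp (- (w k)\<^sup>2 / 2))" for k
        using fun_cong[OF char_std_normal_distribution, of "w k"] by (simp add: char_def cis_conv_exp)
    qed
    also have "\<dots> = of_real (exp (\<Sum>k<n. - (w k)\<^sup>2 / 2))"
      by (simp add: exp_sum)
    also have "(\<Sum>k<n. - (w k)\<^sup>2 / 2) = - (\<Sum>i<n. \<Sum>j<n. u i * u j * V i j) / 2"
    proof -
      have "(\<Sum>i<n. \<Sum>j<n. u i * u j * V i j) = (\<Sum>i<n. \<Sum>j<n. \<Sum>k<n. (u i * b i k) * (u j * b j k))"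
        by (intro sum.cong refl) (auto simp: b sum_distrib_left mult_ac)
      also have "\<dots> = (\<Sum>i<n. \<Sum>k<n. \<Sum>j<n. (u i * b i k) * (u j * b j k))"
        by (intro sum.cong refl sum.swap)
      also have "\<dots> = (\<Sum>k<n. \<Sum>i<n. \<Sum>j<n. (u i * b i k) * (u j * b j k))"
        by (rule sum.swap)
      also have "\<dots> = (\<Sum>k<n. (w k)\<^sup>2)" by (simp add: w_def power2_eq_square sum_product)
      finally show ?thesis by (simp add: sum_negf sum_divide_distrib)
    qed
    finally show ?thesis .
  qed
  have mean: "(\<integral>x. x i \<partial>L) = 0" if "i < n" for i
  proof -
    have "(\<integral>x. x i \<partial>L) = (\<integral>x. f x i \<partial>G)" unfolding L_def by (rule integral_distr[OF f]) (use that in simp)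
    also have "\<dots> = (\<integral>x. (\<Sum>k<n. b i k * x k) \<partial>G)" using that by (simp add: f_def)
    also have "\<dots> = 0" using one by (simp add: Bochner_Integration.integral_sum)
    finally show ?thesis .
  qed
  have ff: "f x i * f x j = (\<Sum>k<n. \<Sum>l<n. b i k * b j l * (x k * x l))" if "i < n" "j < n" for i j x
    using that by (simp add: f_def sum_product mult_ac)
  have cov: "(\<integral>x. x i * x j \<partial>L) = V i j" if "i < n" "j < n" for i j
  proof -
    have "(\<integral>x. x i * x j \<partial>L) = (\<integral>x. f x i * f x j \<partial>G)"
      unfolding L_def by (rule integral_distr[OF f]) (use that in simp)
    also have "\<dots> = (\<Sum>k<n. \<Sum>l<n. b i k * b j l * of_bool (k = l))"
    proof -
      have i: "integrable G (\<lambda>x. b i k * b j l * (x k * x l))" if "k < n" "l < n" for k l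
        using two[OF that] by (intro integrable_mult_right) simp
      have "(\<integral>x. f x i * f x j \<partial>G) = (\<Sum>k<n. \<integral>x. (\<Sum>l<n. b i k * b j l * (x k * x l)) \<partial>G)"
        unfolding ff[OF that]
        by (rule Bochner_Integration.integral_sum) (auto intro!: Bochner_Integration.integrable_sum i)
      also have "\<dots> = (\<Sum>k<n. \<Sum>l<n. \<integral>x. b i k * b j l * (x k * x l) \<partial>G)"
        by (intro sum.cong refl Bochner_Integration.integral_sum i) auto
      also have "\<dots> = (\<Sum>k<n. \<Sum>l<n. b i k * b j l * of_bool (k = l))"
        by (intro sum.cong refl) (simp add: two)
      finally show ?thesis .
    qed
    also have "\<dots> = V i j" using b[OF that] by simp
    finally show ?thesis .
  qed
  have sq: "integrable L (\<lambda>x. (x i)\<^sup>2)" if "i < n" for i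
  proof -
    have "integrable G (\<lambda>x. f x i * f x i)" unfolding ff[OF that that]
      using two by (intro Bochner_Integration.integrable_sum integrable_mult_right) auto
    then show ?thesis unfolding L_def by (subst integrable_distr_eq[OF f]) (use that in \<open>auto simp: power2_eq_square\<close>)
  qed
  show ?thesis
    by (intro exI[of _ L]) (auto simp: L.prob_space_axioms ch mean cov sq, auto simp: L_def)
qed

subsection \<open>Stable linear recursions\<close>

text \<open>Matrix powers over an arbitrary index set: the same bounds are later used on pairs of
  indices, where second moments recur.\<close>

fun mpow :: "'i set \<Rightarrow> ('i \<Rightarrow> 'i \<Rightarrow> real) \<Rightarrow> nat \<Rightarrow> 'i \<Rightarrow> 'i \<Rightarrow> real" where
  "mpow I P 0 i j = of_bool (i = j)"
| "mpow I P (Suc k) i j = (\<Sum>l\<in>I. P i l * mpow I P k l j)"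

text \<open>Discrete variation of constants: the input that entered \<open>s\<close> steps ago has
  since been multiplied by the \<open>s\<close>-th power.\<close>

lemma linear_recursion_solution:
  fixes u z :: "nat \<Rightarrow> 'i \<Rightarrow> real"
  assumes I: "finite I" and rec: "\<And>t i. t < m \<Longrightarrow> i \<in> I \<Longrightarrow> u (Suc t) i = (\<Sum>j\<in>I. P i j * u t j) + z (Suc t) i"
  shows "t \<le> m \<Longrightarrow> i \<in> I \<Longrightarrow>
    u t i = (\<Sum>j\<in>I. mpow I P t i j * u 0 j) + (\<Sum>s<t. \<Sum>j\<in>I. mpow I P s i j * z (t - s) j)"
proof (induction t arbitrary: i)
  case 0
  have "(\<Sum>j\<in>I. of_bool (i = j) * u 0 j) = (\<Sum>j\<in>I. if i = j then u 0 j else 0)"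
    by (intro sum.cong) auto
  then show ?case using I 0 by simp
next
  case (Suc t)
  have *: "(\<Sum>l\<in>I. P i l * (\<Sum>j\<in>I. mpow I P k l j * w j)) = (\<Sum>j\<in>I. mpow I P (Suc k) i j * w j)" for k w
    by (simp add: sum_distrib_left sum_distrib_right mult_ac) (rule sum.swap)
  have **: "(\<Sum>j\<in>I. mpow I P 0 i j * w j) = w i" for w
  proof -
    have "(\<Sum>j\<in>I. mpow I P 0 i j * w j) = (\<Sum>j\<in>I. if i = j then w j else 0)"
      by (intro sum.cong) auto
    then show ?thesis using I Suc.prems by simp
  qed
  have "u (Suc t) i = (\<Sum>l\<in>I. P i l * u t l) + z (Suc t) i" using rec Suc.prems by simp
  also have "(\<Sum>l\<in>I. P i l * u t l) = (\<Sum>j\<in>I. mpow I P (Suc t) i j * u 0 j) +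
      (\<Sum>s<t. \<Sum>j\<in>I. mpow I P (Suc s) i j * z (Suc t - Suc s) j)"
  proof -
    have "(\<Sum>l\<in>I. P i l * u t l) = (\<Sum>l\<in>I. P i l * (\<Sum>j\<in>I. mpow I P t l j * u 0 j)) +
        (\<Sum>l\<in>I. P i l * (\<Sum>s<t. \<Sum>j\<in>I. mpow I P s l j * z (t - s) j))"
      using Suc by (simp add: sum.distrib distrib_left)
    also have "(\<Sum>l\<in>I. P i l * (\<Sum>s<t. \<Sum>j\<in>I. mpow I P s l j * z (t - s) j)) =
        (\<Sum>l\<in>I. \<Sum>s<t. P i l * (\<Sum>j\<in>I. mpow I P s l j * z (t - s) j))"
      by (simp add: sum_distrib_left)
    also have "\<dots> = (\<Sum>s<t. \<Sum>l\<in>I. P i l * (\<Sum>j\<in>I. mpow I P s l j * z (t - s) j))"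
      by (rule sum.swap)
    finally show ?thesis unfolding * by (simp del: mpow.simps)
  qed
  also have "(\<Sum>j\<in>I. mpow I P (Suc t) i j * u 0 j) +
      (\<Sum>s<t. \<Sum>j\<in>I. mpow I P (Suc s) i j * z (Suc t - Suc s) j) + z (Suc t) i =
      (\<Sum>j\<in>I. mpow I P (Suc t) i j * u 0 j) + ((\<Sum>s<t. \<Sum>j\<in>I. mpow I P (Suc s) i j * z (Suc t - Suc s) j) + z (Suc t) i)"
    by (rule add.assoc)
  also have "(\<Sum>s<t. \<Sum>j\<in>I. mpow I P (Suc s) i j * z (Suc t - Suc s) j) + z (Suc t) i = (\<Sum>s<Suc t. \<Sum>j\<in>I. mpow I P s i j * z (Suc t - s) j)"
    unfolding sum.lessThan_Suc_shift using **[of "z (Suc t)"] by (simp del: mpow.simps)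
  finally show ?case .
qed

definition geometric_decay :: "'i set \<Rightarrow> ('i \<Rightarrow> 'i \<Rightarrow> real) \<Rightarrow> real \<Rightarrow> real \<Rightarrow> bool" where
  "geometric_decay I P c r \<longleftrightarrow> c \<ge> 0 \<and> 0 < r \<and> r < 1 \<and> (\<forall>k. \<forall>i\<in>I. \<forall>j\<in>I. \<bar>mpow I P k i j\<bar> \<le> c * r ^ k)"

lemma linear_recursion_bound:
  fixes u z :: "nat \<Rightarrow> 'i \<Rightarrow> real"
  assumes I: "finite I" and P: "geometric_decay I P c r"
    and rec: "\<And>t i. t < m \<Longrightarrow> i \<in> I \<Longrightarrow> u (Suc t) i = (\<Sum>j\<in>I. P i j * u t j) + z (Suc t) i"
    and m: "t \<le> m" and i: "i \<in> I"
  shows "\<bar>u t i\<bar> \<le> c * r ^ t * (\<Sum>j\<in>I. \<bar>u 0 j\<bar>) + (\<Sum>s<t. c * r ^ s * (\<Sum>j\<in>I. \<bar>z (t - s) j\<bar>))"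
proof -
  have *: "\<bar>\<Sum>j\<in>I. mpow I P k i j * w j\<bar> \<le> c * r ^ k * (\<Sum>j\<in>I. \<bar>w j\<bar>)" for k w
  proof -
    have "\<bar>\<Sum>j\<in>I. mpow I P k i j * w j\<bar> \<le> (\<Sum>j\<in>I. \<bar>mpow I P k i j\<bar> * \<bar>w j\<bar>)"
      by (rule order_trans[OF sum_abs]) (simp add: abs_mult)
    also have "\<dots> \<le> (\<Sum>j\<in>I. c * r ^ k * \<bar>w j\<bar>)"
      using P i by (intro sum_mono mult_right_mono) (auto simp: geometric_decay_def)
    finally show ?thesis by (simp add: sum_distrib_left)
  qed
  have "u t i = (\<Sum>j\<in>I. mpow I P t i j * u 0 j) + (\<Sum>s<t. \<Sum>j\<in>I. mpow I P s i j * z (t - s) j)"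
    by (rule linear_recursion_solution[where m = m]) (use I rec m i in auto)
  then have "\<bar>u t i\<bar> \<le> \<bar>\<Sum>j\<in>I. mpow I P t i j * u 0 j\<bar> + \<bar>\<Sum>s<t. \<Sum>j\<in>I. mpow I P s i j * z (t - s) j\<bar>"
    by (simp only: abs_triangle_ineq)
  also have "\<dots> \<le> c * r ^ t * (\<Sum>j\<in>I. \<bar>u 0 j\<bar>) + (\<Sum>s<t. \<bar>\<Sum>j\<in>I. mpow I P s i j * z (t - s) j\<bar>)"
    by (intro add_mono * sum_abs)
  also have "\<dots> \<le> c * r ^ t * (\<Sum>j\<in>I. \<bar>u 0 j\<bar>) + (\<Sum>s<t. c * r ^ s * (\<Sum>j\<in>I. \<bar>z (t - s) j\<bar>))"
    by (intro add_left_mono sum_mono *)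
  finally show ?thesis .
qed

text \<open>A fixed point is a constant solution of the recursion, so the bound for recursions holds
  at every time; letting the time grow removes the term of the initial value and sums the geometric
  series.\<close>

lemma linear_fixpoint_bound:
  fixes u z :: "'i \<Rightarrow> real"
  assumes I: "finite I" and P: "geometric_decay I P c r"
    and fp: "\<And>i. i \<in> I \<Longrightarrow> u i = (\<Sum>j\<in>I. P i j * u j) + z i" and i: "i \<in> I"
  shows "\<bar>u i\<bar> \<le> c / (1 - r) * (\<Sum>j\<in>I. \<bar>z j\<bar>)"
proof (rule tendsto_lowerbound)
  have r: "0 < r" "r < 1" "c \<ge> 0" using P by (auto simp: geometric_decay_def)
  let ?Z = "\<Sum>j\<in>I. \<bar>z j\<bar>"
  have Z: "?Z \<ge> 0" by (intro sum_nonneg) auto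
  have "\<bar>u i\<bar> \<le> c * r ^ t * (\<Sum>j\<in>I. \<bar>u j\<bar>) + c / (1 - r) * ?Z" for t
  proof -
    have "\<bar>u i\<bar> \<le> c * r ^ t * (\<Sum>j\<in>I. \<bar>u j\<bar>) + (\<Sum>s<t. c * r ^ s * ?Z)"
      by (rule linear_recursion_bound[where u = "\<lambda>_. u" and z = "\<lambda>_. z" and m = t, OF I P]) (erule fp, rule order_refl, rule i)
    also have "(\<Sum>s<t. c * r ^ s * ?Z) = c * (\<Sum>s<t. r ^ s) * ?Z"
    proof -
      have "(\<Sum>s<t. c * r ^ s * y) = c * (\<Sum>s<t. r ^ s) * y" for y
        by (simp add: sum_distrib_left sum_distrib_right)
      then show ?thesis .
    qed
    also have "\<dots> \<le> c * (1 / (1 - r)) * ?Z"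
    proof -
      have "(\<Sum>s<t. r ^ s) = (1 - r ^ t) / (1 - r)" using r by (simp add: sum_gp_strict)
      also have "\<dots> \<le> 1 / (1 - r)" using r by (intro divide_right_mono) auto
      finally show ?thesis using r Z by (intro mult_right_mono mult_left_mono) auto
    qed
    finally show ?thesis by simp
  qed
  then show "\<forall>\<^sub>F t in sequentially. \<bar>u i\<bar> \<le> c * r ^ t * (\<Sum>j\<in>I. \<bar>u j\<bar>) + c / (1 - r) * ?Z" by simp
  have "(\<lambda>t. c * r ^ t * (\<Sum>j\<in>I. \<bar>u j\<bar>) + c / (1 - r) * ?Z) \<longlonglongrightarrow> c * 0 * (\<Sum>j\<in>I. \<bar>u j\<bar>) + c / (1 - r) * ?Z"
    using r by (intro tendsto_intros LIMSEQ_realpow_zero) auto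
  then show "(\<lambda>t. c * r ^ t * (\<Sum>j\<in>I. \<bar>u j\<bar>) + c / (1 - r) * ?Z) \<longlonglongrightarrow> c / (1 - r) * ?Z" by simp
qed simp

lemma mpow_tensor:
  assumes "finite I"
  shows "mpow (I \<times> I) (\<lambda>(i, i') (j, j'). P i j * P i' j') k (i, i') (j, j') = mpow I P k i j * mpow I P k i' j'"
proof (induction k arbitrary: i i')
  case (Suc k)
  have "mpow (I \<times> I) (\<lambda>(i, i') (j, j'). P i j * P i' j') (Suc k) (i, i') (j, j') =
      (\<Sum>l\<in>I. \<Sum>l'\<in>I. (P i l * mpow I P k l j) * (P i' l' * mpow I P k l' j'))"
    unfolding mpow.simps(2) sum.cartesian_product
  proof (rule sum.cong[OF refl])
    fix p assume "p \<in> I \<times> I"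
    obtain l l' where "p = (l, l')" by (cases p)
    then show "(case (i, i') of (i, i') \<Rightarrow> \<lambda>(j, j'). P i j * P i' j') p *
        mpow (I \<times> I) (\<lambda>(i, i') (j, j'). P i j * P i' j') k p (j, j') =
        (case p of (l, l') \<Rightarrow> P i l * mpow I P k l j * (P i' l' * mpow I P k l' j'))"
      by (simp add: Suc)
  qed
  also have "\<dots> = mpow I P (Suc k) i j * mpow I P (Suc k) i' j'"
    by (simp add: sum_product)
  finally show ?case .
qed simp

text \<open>The map sending \<open>D\<close> to \<open>P D P'\<close> acts on the entries of
  \<open>D\<close>, indexed by pairs, as this tensor square. Its decay lets
  \<open>linear_fixpoint_bound\<close> be applied to errors of covariance matrices.\<close>

lemma geometric_decay_tensor:
  assumes "finite I" "geometric_decay I P c r"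
  shows "geometric_decay (I \<times> I) (\<lambda>(i, i') (j, j'). P i j * P i' j') (c * c) (r * r)"
proof -
  have c: "c \<ge> 0" "0 < r" "r < 1" and b: "\<And>k i j. i \<in> I \<Longrightarrow> j \<in> I \<Longrightarrow> \<bar>mpow I P k i j\<bar> \<le> c * r ^ k"
    using assms(2) by (auto simp: geometric_decay_def)
  have "\<bar>mpow I P k i j\<bar> * \<bar>mpow I P k i' j'\<bar> \<le> (c * r ^ k) * (c * r ^ k)"
    if "i \<in> I" "j \<in> I" "i' \<in> I" "j' \<in> I" for k i j i' j'
    using c by (intro mult_mono b that) auto
  moreover have "r * r < 1" using c mult_strict_mono[of r 1 r 1] by simp
  ultimately show ?thesis using c
    by (auto simp: geometric_decay_def mpow_tensor[OF assms(1)] abs_mult power_mult_distrib mult_ac)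
qed

lemma pow_mat_commute:
  assumes "P \<in> carrier_mat n n"
  shows "P ^\<^sub>m Suc k = P * P ^\<^sub>m k"
proof (induction k)
  case (Suc k)
  have "P ^\<^sub>m Suc (Suc k) = (P * P ^\<^sub>m k) * P" using Suc by simp
  also have "\<dots> = P * (P ^\<^sub>m k * P)" using assms by (intro assoc_mult_mat[of _ n n _ n _ n]) auto
  finally show ?case by simp
qed (use assms in simp)

text \<open>Division by an \<open>r\<close> strictly between the spectral radius and
  \<open>1\<close> leaves a matrix with spectral radius still below \<open>1\<close>, whose powers
  are bounded by way of the Jordan normal form; undoing the scaling gives the rate
  \<open>r ^ k\<close>.\<close>

lemma spectral_radius_less_1_imp_geometric_decay:
  assumes P: "P \<in> carrier_mat n n" and n: "n > 0"
    and sr: "spectral_radius (map_mat complex_of_real P) < 1"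
  shows "\<exists>c r. geometric_decay {..<n} (\<lambda>i j. P $$ (i, j)) c r"
proof -
  let ?C = "map_mat complex_of_real P"
  have C: "?C \<in> carrier_mat n n" using P by simp
  define \<rho> where "\<rho> = spectral_radius ?C"
  have \<rho>: "0 \<le> \<rho>" "\<rho> < 1" using spectral_radius_mem_max(1)[OF C n] sr by (auto simp: \<rho>_def)
  define r where "r = (1 + \<rho>) / 2"
  have r: "\<rho> < r" "0 < r" "r < 1" using \<rho> by (auto simp: r_def)
  define D where "D = complex_of_real (1 / r) \<cdot>\<^sub>m ?C"
  have D: "D \<in> carrier_mat n n" using C by (simp add: D_def)
  have "spectral_radius D < 1"
  proof -
    obtain k where k: "k \<in> spectrum D" "spectral_radius D = norm k" using spectral_radius_mem_max(1)[OF D n] by auto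
    then obtain v where v: "v \<in> carrier_vec n" "v \<noteq> 0\<^sub>v n" "D *\<^sub>v v = k \<cdot>\<^sub>v v"
      using D by (auto simp: spectrum_def eigenvalue_def eigenvector_def)
    have "?C *\<^sub>v v = complex_of_real r \<cdot>\<^sub>v (D *\<^sub>v v)"
    proof (rule eq_vecI)
      fix i assume "i < dim_vec (complex_of_real r \<cdot>\<^sub>v (D *\<^sub>v v))"
      then have i: "i < n" using D by simp
      then show "(?C *\<^sub>v v) $ i = (complex_of_real r \<cdot>\<^sub>v (D *\<^sub>v v)) $ i"
        using P r(2) v(1) by (simp add: D_def scalar_prod_def sum_distrib_left)
    qed (use D P in simp)
    also have "\<dots> = (complex_of_real r * k) \<cdot>\<^sub>v v" unfolding v(3) by (simp add: smult_smult_assoc)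
    finally have "complex_of_real r * k \<in> spectrum ?C"
      using v P unfolding spectrum_def eigenvalue_def eigenvector_def by auto
    then have "norm (complex_of_real r * k) \<le> \<rho>"
      unfolding \<rho>_def using spectral_radius_mem_max(2)[OF C n] by blast
    then have "r * norm k \<le> \<rho>" using r(2) by (simp add: norm_mult)
    then have "r * norm k < r * 1" using r(1) by linarith
    then have "norm k < 1" using r(2) by (rule mult_left_less_imp_less[OF _ less_imp_le])
    then show ?thesis using k(2) by simp
  qed
  from spectral_radius_jnf_norm_bound_less_1_upper_triangular[OF D this]
  obtain c where c: "\<And>k. norm_bound (D ^\<^sub>m k) c" by blast
  have pow: "(D ^\<^sub>m k) $$ (i, j) = of_real ((1 / r) ^ k * mpow {..<n} (\<lambda>i j. P $$ (i, j)) k i j)"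
    if "i < n" "j < n" for k i j
    using that
  proof (induction k arbitrary: i)
    case 0
    then show ?case using D by simp
  next
    case (Suc k)
    have "(D ^\<^sub>m Suc k) $$ (i, j) = (\<Sum>l<n. D $$ (i, l) * (D ^\<^sub>m k) $$ (l, j))"
      unfolding pow_mat_commute[OF D] using Suc.prems D by (simp add: scalar_prod_def atLeast0LessThan)
    also have "\<dots> = (\<Sum>l<n. of_real ((1 / r) ^ Suc k * (P $$ (i, l) * mpow {..<n} (\<lambda>i j. P $$ (i, j)) k l j)))"
      using Suc P by (intro sum.cong) (auto simp: D_def)
    finally show ?case by (simp add: sum_distrib_left)
  qed
  have "\<bar>mpow {..<n} (\<lambda>i j. P $$ (i, j)) k i j\<bar> \<le> c * r ^ k" if "i < n" "j < n" for k i j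
  proof -
    have "norm ((D ^\<^sub>m k) $$ (i, j)) \<le> c" using c[of k] D that by (simp add: norm_bound_def)
    then have "(1 / r) ^ k * \<bar>mpow {..<n} (\<lambda>i j. P $$ (i, j)) k i j\<bar> \<le> c"
      unfolding pow[OF that] norm_of_real using r by (simp add: abs_mult)
    then show ?thesis using r by (simp add: power_one_over field_simps)
  qed
  moreover have "c \<ge> 0"
  proof -
    have "norm ((D ^\<^sub>m 0) $$ (0, 0)) \<le> c"
      using c[of 0, unfolded norm_bound_def, rule_format, of 0 0] D n by simp
    then show ?thesis by (rule order_trans[OF norm_ge_zero])
  qed
  ultimately have "geometric_decay {..<n} (\<lambda>i j. P $$ (i, j)) c r" using r by (simp add: geometric_decay_def)
  then show ?thesis by blast
qed

subsection \<open>Fourth moments of the autoregressive path\<close>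

lemma fourth_power_sum_le:
  fixes a :: "'i \<Rightarrow> real"
  shows "(\<Sum>i\<in>I. a i) ^ 4 \<le> of_nat (card I) ^ 3 * (\<Sum>i\<in>I. a i ^ 4)"
proof -
  let ?m = "real (card I)"
  have "(\<Sum>i\<in>I. a i) ^ 4 = ((\<Sum>i\<in>I. a i)\<^sup>2)\<^sup>2" by simp
  also have "\<dots> \<le> ((\<Sum>i\<in>I. (a i)\<^sup>2) * ?m)\<^sup>2"
    by (intro power_mono sum_squared_le_sum_of_squares) simp
  also have "\<dots> = (\<Sum>i\<in>I. (a i)\<^sup>2)\<^sup>2 * ?m\<^sup>2" by (simp add: power_mult_distrib)
  also have "\<dots> \<le> ((\<Sum>i\<in>I. ((a i)\<^sup>2)\<^sup>2) * ?m) * ?m\<^sup>2"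
    by (intro mult_right_mono sum_squared_le_sum_of_squares) simp
  finally show ?thesis by (simp add: power2_eq_square power3_eq_cube power4_eq_xxxx mult_ac)
qed

text \<open>Convexity of the square, used twice. It lets the recursion of \<open>var_bound\<close>
  contract fourth moments by the same factor \<open>r\<close> as the values.\<close>

lemma fourth_power_convex:
  fixes x y r :: real
  assumes "0 \<le> r" "r \<le> 1"
  shows "(r * x + (1 - r) * y) ^ 4 \<le> r * x ^ 4 + (1 - r) * y ^ 4"
proof -
  have sq: "(r * x + (1 - r) * y)\<^sup>2 \<le> r * x\<^sup>2 + (1 - r) * y\<^sup>2" for x y
  proof -
    have "r * x\<^sup>2 + (1 - r) * y\<^sup>2 - (r * x + (1 - r) * y)\<^sup>2 = r * (1 - r) * (x - y)\<^sup>2"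
      by (simp add: power2_eq_square algebra_simps)
    then show ?thesis using assms by (metis diff_ge_0_iff_ge mult_nonneg_nonneg zero_le_power2)
  qed
  have "(r * x + (1 - r) * y) ^ 4 = ((r * x + (1 - r) * y)\<^sup>2)\<^sup>2" by simp
  also have "\<dots> \<le> (r * x\<^sup>2 + (1 - r) * y\<^sup>2)\<^sup>2" by (intro power_mono sq) simp
  also have "\<dots> \<le> r * (x\<^sup>2)\<^sup>2 + (1 - r) * (y\<^sup>2)\<^sup>2" by (rule sq)
  finally show ?thesis by simp
qed

lemma abs_le_1_plus_power4: "\<bar>x\<bar> \<le> 1 + x ^ 4" "x\<^sup>2 \<le> 1 + x ^ 4" "\<bar>x\<bar> ^ 3 \<le> 1 + x ^ 4" for x :: real
proof -
  have *: "\<bar>x\<bar> ^ k \<le> 1 + \<bar>x\<bar> ^ 4" if "k \<le> 4" for k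
  proof (cases "\<bar>x\<bar> \<le> 1")
    case True
    then have "\<bar>x\<bar> ^ k \<le> 1" by (simp add: power_le_one)
    then show ?thesis using zero_le_power[of "\<bar>x\<bar>" 4] by linarith
  next
    case False
    then show ?thesis using power_increasing[OF that, of "\<bar>x\<bar>"] by simp
  qed
  show "\<bar>x\<bar> \<le> 1 + x ^ 4" "x\<^sup>2 \<le> 1 + x ^ 4" "\<bar>x\<bar> ^ 3 \<le> 1 + x ^ 4" using *[of 1] *[of 2] *[of 3] by simp_all
qed

lemma integrable_fourth_power_imp:
  fixes f :: "'a \<Rightarrow> real"
  assumes "finite_measure M" and f[measurable]: "f \<in> borel_measurable M" and i: "integrable M (\<lambda>x. f x ^ 4)"
  shows "integrable M f" "integrable M (\<lambda>x. (f x)\<^sup>2)" "integrable M (\<lambda>x. \<bar>f x\<bar> ^ 3)"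
proof -
  interpret finite_measure M by fact
  have d: "integrable M (\<lambda>x. 1 + f x ^ 4)" using i by simp
  show "integrable M f" "integrable M (\<lambda>x. (f x)\<^sup>2)" "integrable M (\<lambda>x. \<bar>f x\<bar> ^ 3)"
    by (rule Bochner_Integration.integrable_bound[OF d]; use abs_le_1_plus_power4 in \<open>auto simp: abs_of_nonneg\<close>)+
qed

lemma tendsto_zero_sandwich:
  fixes a :: "nat \<Rightarrow> real"
  assumes "b \<longlonglongrightarrow> 0" "\<And>T. T > 0 \<Longrightarrow> a T \<le> b T" "\<And>T. a T \<ge> 0"
  shows "a \<longlonglongrightarrow> 0"
  by (rule tendsto_sandwich[OF _ _ tendsto_const assms(1)])
     (use assms(2,3) in \<open>auto intro: eventually_mono[OF eventually_gt_at_top[of 0]]\<close>)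

lemma abs_mult_le_sum_squares: "\<bar>x * y\<bar> \<le> x\<^sup>2 + y\<^sup>2" for x y :: real
proof -
  have "0 \<le> \<bar>x\<bar> * \<bar>y\<bar>" "2 * (\<bar>x\<bar> * \<bar>y\<bar>) \<le> x\<^sup>2 + y\<^sup>2"
    using sum_squares_bound[of "\<bar>x\<bar>" "\<bar>y\<bar>"] by simp_all
  then show ?thesis unfolding abs_mult by linarith
qed

lemma integrable_square_mult:
  fixes f g :: "'a \<Rightarrow> real"
  assumes [measurable]: "f \<in> borel_measurable M" "g \<in> borel_measurable M"
    and "integrable M (\<lambda>x. (f x)\<^sup>2)" "integrable M (\<lambda>x. (g x)\<^sup>2)"
  shows "integrable M (\<lambda>x. f x * g x)"
proof (rule Bochner_Integration.integrable_bound)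
  show "integrable M (\<lambda>x. (f x)\<^sup>2 + (g x)\<^sup>2)" using assms by simp
  show "AE x in M. norm (f x * g x) \<le> norm ((f x)\<^sup>2 + (g x)\<^sup>2)" by (simp add: abs_mult_le_sum_squares)
qed simp

lemma (in prob_space) covariance_psd_form:
  fixes f :: "nat \<Rightarrow> 'a \<Rightarrow> real"
  assumes f: "\<And>i. i < n \<Longrightarrow> f i \<in> borel_measurable M" "\<And>i. i < n \<Longrightarrow> integrable M (\<lambda>\<omega>. (f i \<omega>)\<^sup>2)"
    and V: "\<And>i j. i < n \<Longrightarrow> j < n \<Longrightarrow> expectation (\<lambda>\<omega>. f i \<omega> * f j \<omega>) = V i j"
  shows "psd_form n V"
  unfolding psd_form_def
proof (intro conjI allI impI)
  show "V i j = V j i" if "i < n" "j < n" for i j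
    using V[OF that] V[OF that(2,1)] by (simp add: mult.commute)
  fix u
  have int: "integrable M (\<lambda>\<omega>. u i * u j * (f i \<omega> * f j \<omega>))" if "i < n" "j < n" for i j
    using f that by (intro integrable_mult_right integrable_square_mult)
  have "0 \<le> expectation (\<lambda>\<omega>. (\<Sum>i<n. u i * f i \<omega>)\<^sup>2)" by simp
  also have "\<dots> = expectation (\<lambda>\<omega>. \<Sum>i<n. \<Sum>j<n. u i * u j * (f i \<omega> * f j \<omega>))"
    by (simp add: power2_eq_square sum_product mult_ac)
  also have "\<dots> = (\<Sum>i<n. expectation (\<lambda>\<omega>. \<Sum>j<n. u i * u j * (f i \<omega> * f j \<omega>)))"
    by (rule Bochner_Integration.integral_sum) (auto intro!: Bochner_Integration.integrable_sum int)
  also have "\<dots> = (\<Sum>i<n. \<Sum>j<n. expectation (\<lambda>\<omega>. u i * u j * (f i \<omega> * f j \<omega>)))"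
    by (intro sum.cong refl Bochner_Integration.integral_sum int) auto
  also have "\<dots> = (\<Sum>i<n. \<Sum>j<n. u i * u j * V i j)" by (intro sum.cong refl) (simp add: V)
  finally show "0 \<le> (\<Sum>i<n. \<Sum>j<n. u i * u j * V i j)" .
qed

lemma (in prob_space) indep_var_subalgebra:
  fixes g h :: "'a \<Rightarrow> 'b::topological_space"
  assumes F: "subalgebra M F" and H: "subalgebra M H" and ind: "indep_set (sets F) (sets H)"
    and g: "g \<in> borel_measurable F" and h: "h \<in> borel_measurable H"
  shows "indep_var borel g borel h"
proof -
  have sub: "sigma_sets (space M) {f -` A \<inter> space M | A. A \<in> sets borel} \<subseteq> sets G"
    if "f \<in> borel_measurable G" "space G = space M" for f :: "'a \<Rightarrow> 'b" and G
    using measurable_sets[OF that(1)] sets.top[of G] unfolding that(2)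
    by (intro sets.sigma_sets_subset') auto
  have sp: "space F = space M" "space H = space M" using F H by (simp_all add: subalgebra_def)
  have i: "sets F \<subseteq> events" "sets H \<subseteq> events"
      "\<And>a b. a \<in> sets F \<Longrightarrow> b \<in> sets H \<Longrightarrow> prob (a \<inter> b) = prob a * prob b"
    using ind by (simp_all add: indep_sets2_eq)
  note s = sub[OF g sp(1)] sub[OF h sp(2)]
  show ?thesis
    unfolding indep_var_eq indep_sets2_eq
  proof (intro conjI ballI)
    fix a b
    assume "a \<in> sigma_sets (space M) {g -` A \<inter> space M | A. A \<in> sets borel}"
      and "b \<in> sigma_sets (space M) {h -` A \<inter> space M | A. A \<in> sets borel}"
    then show "prob (a \<inter> b) = prob a * prob b" using s i(3) by (meson subsetD)
  qed (use measurable_from_subalg[OF F g] measurable_from_subalg[OF H h] order_trans[OF s(1) i(1)] order_trans[OF s(2) i(2)] in auto)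
qed

section \<open>The noise-driven path and its scalar majorant\<close>

fun var_path :: "nat \<Rightarrow> (nat \<Rightarrow> nat \<Rightarrow> real) \<Rightarrow> (nat \<Rightarrow> nat \<Rightarrow> 'w \<Rightarrow> real) \<Rightarrow> nat \<Rightarrow> nat \<Rightarrow> 'w \<Rightarrow> real" where
  "var_path n P e 0 i \<omega> = 0"
| "var_path n P e (Suc t) i \<omega> = (\<Sum>j<n. P i j * var_path n P e t j \<omega>) + e (Suc t) i \<omega>"

text \<open>For a zero start, the right-hand side of \<open>linear_recursion_bound\<close> obeys
  this scalar recursion with contraction factor \<open>r\<close>; moments of the path can thus be
  bounded by induction on time.\<close>

fun var_bound :: "nat \<Rightarrow> real \<Rightarrow> real \<Rightarrow> (nat \<Rightarrow> nat \<Rightarrow> 'w \<Rightarrow> real) \<Rightarrow> nat \<Rightarrow> 'w \<Rightarrow> real" where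
  "var_bound n c r e 0 \<omega> = 0"
| "var_bound n c r e (Suc t) \<omega> = r * var_bound n c r e t \<omega> + c * (\<Sum>i<n. \<bar>e (Suc t) i \<omega>\<bar>)"

lemma var_bound_eq: "var_bound n c r e t \<omega> = (\<Sum>s<t. c * r ^ s * (\<Sum>j<n. \<bar>e (t - s) j \<omega>\<bar>))"
proof (induction t)
  case (Suc t)
  then show ?case by (simp only: sum.lessThan_Suc_shift var_bound.simps) (simp add: sum_distrib_left mult_ac)
qed simp

text \<open>\<open>F t\<close> stands for the past up to time \<open>t\<close> and
  \<open>H t\<close> for the noise at time \<open>t\<close> alone. Independence of
  \<open>F t\<close> and \<open>H (Suc t)\<close> takes the place of conditional expectations
  throughout.\<close>

locale var_noise = prob_space M for M :: "'w measure" +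
  fixes n :: nat and P Om :: "nat \<Rightarrow> nat \<Rightarrow> real" and e :: "nat \<Rightarrow> nat \<Rightarrow> 'w \<Rightarrow> real"
    and F H :: "nat \<Rightarrow> 'w measure" and c r C4 :: real
  assumes decay: "geometric_decay {..<n} P c r"
    and F_sub: "\<And>t. subalgebra M (F t)" and F_mono: "\<And>s t. s \<le> t \<Longrightarrow> sets (F s) \<subseteq> sets (F t)"
    and H_sub: "\<And>t. subalgebra M (H t)"
    and e_F: "\<And>t i. i < n \<Longrightarrow> e (Suc t) i \<in> borel_measurable (F (Suc t))"
    and e_H: "\<And>t i. i < n \<Longrightarrow> e (Suc t) i \<in> borel_measurable (H (Suc t))"
    and indep: "\<And>t. indep_set (sets (F t)) (sets (H (Suc t)))"
    and e_mean: "\<And>t i. i < n \<Longrightarrow> expectation (e (Suc t) i) = 0"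
    and e_cov: "\<And>t i j. i < n \<Longrightarrow> j < n \<Longrightarrow> expectation (\<lambda>\<omega>. e (Suc t) i \<omega> * e (Suc t) j \<omega>) = Om i j"
    and e_int4: "\<And>t i. i < n \<Longrightarrow> integrable M (\<lambda>\<omega>. e (Suc t) i \<omega> ^ 4)"
    and e_bd4: "\<And>t i. i < n \<Longrightarrow> expectation (\<lambda>\<omega>. e (Suc t) i \<omega> ^ 4) \<le> C4"
begin

abbreviation "W \<equiv> var_path n P e"
abbreviation "B \<equiv> var_bound n c r e"

lemma space_F: "space (F t) = space M" using F_sub by (simp add: subalgebra_def)

lemma F_trans: "f \<in> borel_measurable (F s) \<Longrightarrow> s \<le> t \<Longrightarrow> f \<in> borel_measurable (F t)"
  using F_mono[of s t] by (auto simp: measurable_def space_F)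

lemma F_M: "f \<in> borel_measurable (F t) \<Longrightarrow> f \<in> borel_measurable M"
  using measurable_from_subalg[OF F_sub] by blast

lemma H_M: "f \<in> borel_measurable (H t) \<Longrightarrow> f \<in> borel_measurable M"
  using measurable_from_subalg[OF H_sub] by blast

lemma e_M[measurable]: "i < n \<Longrightarrow> e (Suc t) i \<in> borel_measurable M" using e_F F_M by blast

text \<open>The substitute for conditioning on the past: a factor known at time \<open>t\<close>
  splits off from one built from the next noise. The value type is general because the factors are
  real in the moment bounds and complex in the characteristic function.\<close>

lemma indep_mult:
  fixes g h :: "'w \<Rightarrow> 'b::{real_normed_field, banach, second_countable_topology}"
  assumes "g \<in> borel_measurable (F t)" "h \<in> borel_measurable (H (Suc t))" "integrable M g" "integrable M h"
  shows "integrable M (\<lambda>\<omega>. g \<omega> * h \<omega>)" "expectation (\<lambda>\<omega>. g \<omega> * h \<omega>) = expectation g * expectation h"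
  using indep_var_integrable[OF indep_var_subalgebra[OF F_sub H_sub indep assms(1,2)] assms(3,4)]
    indep_var_lebesgue_integral[OF indep_var_subalgebra[OF F_sub H_sub indep assms(1,2)] assms(3,4)] by auto

lemma W_F: "i < n \<Longrightarrow> W t i \<in> borel_measurable (F t)"
proof (induction t arbitrary: i)
  case (Suc t)
  have "(\<lambda>\<omega>. (\<Sum>j<n. P i j * W t j \<omega>) + e (Suc t) i \<omega>) \<in> borel_measurable (F (Suc t))"
    using Suc.IH Suc.prems F_trans[of _ t "Suc t"]
    by (intro borel_measurable_add borel_measurable_sum borel_measurable_times e_F) auto
  then show ?case by simp
next
  case 0
  have "W 0 i = (\<lambda>_. 0)" by (simp add: fun_eq_iff)
  then show ?case by simp
qed

lemma W_M[measurable]: "i < n \<Longrightarrow> W t i \<in> borel_measurable M" using W_F F_M by blast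

lemma B_F: "B t \<in> borel_measurable (F t)"
proof (induction t)
  case (Suc t)
  have "(\<lambda>\<omega>. r * B t \<omega> + c * (\<Sum>i<n. \<bar>e (Suc t) i \<omega>\<bar>)) \<in> borel_measurable (F (Suc t))"
    using F_trans[OF Suc, of "Suc t"] e_F
    by (intro borel_measurable_add borel_measurable_sum borel_measurable_times borel_measurable_abs) auto
  then show ?case by simp
next
  case 0
  have "B 0 = (\<lambda>_. 0)" by (simp add: fun_eq_iff)
  then show ?case by simp
qed

lemma B_M[measurable]: "B t \<in> borel_measurable M" using B_F F_M by blast

lemma cr: "c \<ge> 0" "0 < r" "r < 1" using decay by (auto simp: geometric_decay_def)

lemma B_nonneg: "B t \<omega> \<ge> 0"
  by (induction t) (use cr in \<open>auto intro!: add_nonneg_nonneg mult_nonneg_nonneg sum_nonneg\<close>)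

lemma W_le_B: "i < n \<Longrightarrow> \<bar>W t i \<omega>\<bar> \<le> B t \<omega>"
  using linear_recursion_bound[OF _ decay, of t "\<lambda>t i. W t i \<omega>" "\<lambda>t i. e t i \<omega>" t i]
  by (simp add: var_bound_eq)

lemma e_sum_int4: "integrable M (\<lambda>\<omega>. (\<Sum>i<n. \<bar>e (Suc t) i \<omega>\<bar>) ^ 4)"
  and e_sum_bd4: "expectation (\<lambda>\<omega>. (\<Sum>i<n. \<bar>e (Suc t) i \<omega>\<bar>) ^ 4) \<le> real n ^ 4 * C4"
proof -
  have le: "(\<Sum>i<n. \<bar>e (Suc t) i \<omega>\<bar>) ^ 4 \<le> real n ^ 3 * (\<Sum>i<n. e (Suc t) i \<omega> ^ 4)" for \<omega>
    using fourth_power_sum_le[of "\<lambda>i. \<bar>e (Suc t) i \<omega>\<bar>" "{..<n}"] by simp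
  have i: "integrable M (\<lambda>\<omega>. real n ^ 3 * (\<Sum>i<n. e (Suc t) i \<omega> ^ 4))"
    using e_int4 by (intro integrable_mult_right Bochner_Integration.integrable_sum) auto
  show I: "integrable M (\<lambda>\<omega>. (\<Sum>i<n. \<bar>e (Suc t) i \<omega>\<bar>) ^ 4)"
  proof (rule Bochner_Integration.integrable_bound[OF i])
    show "AE \<omega> in M. norm ((\<Sum>i<n. \<bar>e (Suc t) i \<omega>\<bar>) ^ 4) \<le> norm (real n ^ 3 * (\<Sum>i<n. e (Suc t) i \<omega> ^ 4))"
      using le by (intro AE_I2) (simp add: abs_of_nonneg sum_nonneg order_trans[OF le])
  qed (intro borel_measurable_power borel_measurable_sum borel_measurable_abs e_M, simp)
  have "expectation (\<lambda>\<omega>. (\<Sum>i<n. \<bar>e (Suc t) i \<omega>\<bar>) ^ 4) \<le> expectation (\<lambda>\<omega>. real n ^ 3 * (\<Sum>i<n. e (Suc t) i \<omega> ^ 4))"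
    by (rule integral_mono[OF I i le])
  also have "\<dots> = real n ^ 3 * (\<Sum>i<n. expectation (\<lambda>\<omega>. e (Suc t) i \<omega> ^ 4))"
    using e_int4 by (simp add: Bochner_Integration.integral_sum)
  also have "\<dots> \<le> real n ^ 3 * (\<Sum>i<n. C4)" using e_bd4 by (intro mult_left_mono sum_mono) auto
  finally show "expectation (\<lambda>\<omega>. (\<Sum>i<n. \<bar>e (Suc t) i \<omega>\<bar>) ^ 4) \<le> real n ^ 4 * C4"
    by (simp add: numeral_eq_Suc mult_ac)
qed

text \<open>The second entry is the level that the fourth-moment recursion
  \<open>r * K + (1 - r) * b\<close> preserves, where \<open>b\<close> bounds the fourth moment of
  \<open>c / (1 - r)\<close> times the summed absolute noise. The maximum with \<open>1\<close>
  keeps the bound positive.\<close>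

definition K4 :: real where "K4 = max 1 ((c / (1 - r)) ^ 4 * (real n ^ 4 * C4))"

lemma B_int4: "integrable M (\<lambda>\<omega>. B t \<omega> ^ 4)" and B_bd4: "expectation (\<lambda>\<omega>. B t \<omega> ^ 4) \<le> K4"
proof -
  have "integrable M (\<lambda>\<omega>. B t \<omega> ^ 4) \<and> expectation (\<lambda>\<omega>. B t \<omega> ^ 4) \<le> K4"
  proof (induction t)
    case 0
    then show ?case by (simp add: K4_def)
  next
    case (Suc t)
    let ?s = "\<lambda>\<omega>. \<Sum>i<n. \<bar>e (Suc t) i \<omega>\<bar>"
    let ?b = "\<lambda>\<omega>. r * B t \<omega> ^ 4 + (1 - r) * ((c / (1 - r)) ^ 4 * ?s \<omega> ^ 4)"
    have le: "B (Suc t) \<omega> ^ 4 \<le> ?b \<omega>" for \<omega>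
    proof -
      \<comment> \<open>Writing the new term as \<open>1 - r\<close> times its multiple by
        \<open>1 / (1 - r)\<close> makes the step a convex combination, to which
        \<open>fourth_power_convex\<close> applies.\<close>
      have "B (Suc t) \<omega> = r * B t \<omega> + (1 - r) * (c / (1 - r) * ?s \<omega>)" using cr by simp
      then show ?thesis using fourth_power_convex[of r "B t \<omega>" "c / (1 - r) * ?s \<omega>"] cr
        by (simp only: power_mult_distrib) 
    qed
    have i: "integrable M ?b" using Suc e_sum_int4 by simp
    have I: "integrable M (\<lambda>\<omega>. B (Suc t) \<omega> ^ 4)"
    proof (rule Bochner_Integration.integrable_bound[OF i])
      show "AE \<omega> in M. norm (B (Suc t) \<omega> ^ 4) \<le> norm (?b \<omega>)"
      proof (intro AE_I2)
        fix \<omega>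
        have "norm (B (Suc t) \<omega> ^ 4) = B (Suc t) \<omega> ^ 4" by (simp del: var_bound.simps)
        also have "\<dots> \<le> norm (?b \<omega>)" by (rule order_trans[OF le]) (simp only: real_norm_def abs_ge_self)
        finally show "norm (B (Suc t) \<omega> ^ 4) \<le> norm (?b \<omega>)" .
      qed
    qed (intro borel_measurable_power B_M)
    have "expectation (\<lambda>\<omega>. B (Suc t) \<omega> ^ 4) \<le> expectation ?b" by (rule integral_mono[OF I i le])
    also have "\<dots> = r * expectation (\<lambda>\<omega>. B t \<omega> ^ 4) + (1 - r) * ((c / (1 - r)) ^ 4 * expectation (\<lambda>\<omega>. ?s \<omega> ^ 4))"
      using Suc e_sum_int4 by simp
    also have "\<dots> \<le> r * K4 + (1 - r) * K4"
    proof (intro add_mono mult_left_mono)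
      have "(c / (1 - r)) ^ 4 * expectation (\<lambda>\<omega>. ?s \<omega> ^ 4) \<le> (c / (1 - r)) ^ 4 * (real n ^ 4 * C4)"
        by (intro mult_left_mono e_sum_bd4) simp
      then show "(c / (1 - r)) ^ 4 * expectation (\<lambda>\<omega>. ?s \<omega> ^ 4) \<le> K4" by (simp add: K4_def)
    qed (use Suc cr in auto)
    finally show ?case using I by (simp add: algebra_simps del: var_bound.simps)
  qed
  then show "integrable M (\<lambda>\<omega>. B t \<omega> ^ 4)" "expectation (\<lambda>\<omega>. B t \<omega> ^ 4) \<le> K4" by auto
qed

lemma W_int4: "i < n \<Longrightarrow> integrable M (\<lambda>\<omega>. W t i \<omega> ^ 4)"
proof (rule Bochner_Integration.integrable_bound[OF B_int4])
  assume i: "i < n"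
  then show "(\<lambda>\<omega>. W t i \<omega> ^ 4) \<in> borel_measurable M" by simp
  have "\<bar>W t i \<omega>\<bar> ^ 4 \<le> \<bar>B t \<omega>\<bar> ^ 4" for \<omega>
    using W_le_B[OF i] B_nonneg by (intro power_mono) auto
  then show "AE \<omega> in M. norm (W t i \<omega> ^ 4) \<le> norm (B t \<omega> ^ 4)" by simp
qed

lemma square_bounds:
  "integrable M (\<lambda>\<omega>. (B t \<omega>)\<^sup>2)" "expectation (\<lambda>\<omega>. (B t \<omega>)\<^sup>2) \<le> 1 + K4"
  "i < n \<Longrightarrow> integrable M (\<lambda>\<omega>. (W t i \<omega>)\<^sup>2)" "i < n \<Longrightarrow> expectation (\<lambda>\<omega>. (W t i \<omega>)\<^sup>2) \<le> 1 + K4"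
  "i < n \<Longrightarrow> integrable M (e (Suc t) i)"
  "i < n \<Longrightarrow> integrable M (\<lambda>\<omega>. (e (Suc t) i \<omega>)\<^sup>2)" "i < n \<Longrightarrow> expectation (\<lambda>\<omega>. (e (Suc t) i \<omega>)\<^sup>2) \<le> 1 + C4"
proof -
  note fin = finite_measure_axioms
  have le: "expectation (\<lambda>\<omega>. (f \<omega>)\<^sup>2) \<le> 1 + K"
    if f: "f \<in> borel_measurable M" "integrable M (\<lambda>\<omega>. f \<omega> ^ 4)" "expectation (\<lambda>\<omega>. f \<omega> ^ 4) \<le> K"
    for f :: "'w \<Rightarrow> real" and K
  proof -
    have "expectation (\<lambda>\<omega>. (f \<omega>)\<^sup>2) \<le> expectation (\<lambda>\<omega>. 1 + f \<omega> ^ 4)"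
      using integrable_fourth_power_imp(2)[OF fin f(1,2)] f abs_le_1_plus_power4 by (intro integral_mono) auto
    then show ?thesis using f by (simp add: prob_space)
  qed
  show "integrable M (\<lambda>\<omega>. (B t \<omega>)\<^sup>2)" by (rule integrable_fourth_power_imp[OF fin B_M B_int4])
  show B2: "expectation (\<lambda>\<omega>. (B t \<omega>)\<^sup>2) \<le> 1 + K4" by (rule le[OF B_M B_int4 B_bd4])
  show "i < n \<Longrightarrow> integrable M (\<lambda>\<omega>. (W t i \<omega>)\<^sup>2)" by (rule integrable_fourth_power_imp[OF fin W_M W_int4])
  show "i < n \<Longrightarrow> integrable M (e (Suc t) i)"
    "i < n \<Longrightarrow> integrable M (\<lambda>\<omega>. (e (Suc t) i \<omega>)\<^sup>2)" by (rule integrable_fourth_power_imp[OF fin e_M e_int4]; simp)+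
  show "i < n \<Longrightarrow> expectation (\<lambda>\<omega>. (e (Suc t) i \<omega>)\<^sup>2) \<le> 1 + C4" by (rule le[OF e_M e_int4 e_bd4])
  assume i: "i < n"
  have "expectation (\<lambda>\<omega>. W t i \<omega> ^ 4) \<le> expectation (\<lambda>\<omega>. B t \<omega> ^ 4)"
  proof (rule integral_mono[OF W_int4[OF i] B_int4])
    fix \<omega>
    have "\<bar>W t i \<omega>\<bar> ^ 4 \<le> \<bar>B t \<omega>\<bar> ^ 4" using W_le_B[OF i] B_nonneg by (intro power_mono) auto
    then show "W t i \<omega> ^ 4 \<le> B t \<omega> ^ 4" by simp
  qed
  then show "expectation (\<lambda>\<omega>. (W t i \<omega>)\<^sup>2) \<le> 1 + K4"
    using B_bd4[of t] by (intro le[OF W_M[OF i] W_int4[OF i]]) linarith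
qed

lemma e_int2: "i < n \<Longrightarrow> j < n \<Longrightarrow> integrable M (\<lambda>\<omega>. e (Suc t) i \<omega> * e (Suc t) j \<omega>)"
  by (intro integrable_square_mult) (auto simp: square_bounds)

lemma W_int2: "i < n \<Longrightarrow> j < n \<Longrightarrow> integrable M (\<lambda>\<omega>. W t i \<omega> * W t j \<omega>)"
  by (intro integrable_square_mult) (auto simp: square_bounds)

lemma W_int: "i < n \<Longrightarrow> integrable M (W t i)"
  by (rule integrable_fourth_power_imp[OF finite_measure_axioms W_M W_int4])

lemma Om_nonneg: "0 \<le> (\<Sum>i<n. \<Sum>j<n. a i * a j * Om i j)"
  using covariance_psd_form[of n "e (Suc 0)" Om] e_cov square_bounds(6) by (simp add: psd_form_def)

subsection \<open>Averages along the autoregressive path\<close>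

text \<open>The summands are martingale differences, hence orthogonal.\<close>

lemma martingale_transform:
  fixes a h :: "nat \<Rightarrow> 'w \<Rightarrow> real"
  assumes a: "\<And>t. a t \<in> borel_measurable (F t)" "\<And>t. integrable M (\<lambda>\<omega>. (a t \<omega>)\<^sup>2)"
      "\<And>t. expectation (\<lambda>\<omega>. (a t \<omega>)\<^sup>2) \<le> K1"
    and h: "\<And>t. h (Suc t) \<in> borel_measurable (H (Suc t))" "\<And>t. h (Suc t) \<in> borel_measurable (F (Suc t))"
      "\<And>t. integrable M (\<lambda>\<omega>. (h (Suc t) \<omega>)\<^sup>2)" "\<And>t. expectation (\<lambda>\<omega>. (h (Suc t) \<omega>)\<^sup>2) \<le> K2"
      "\<And>t. integrable M (h (Suc t))" "\<And>t. expectation (h (Suc t)) = 0"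
  shows martingale_average_tendsto_zero:
      "(\<lambda>T. expectation (\<lambda>\<omega>. \<bar>(\<Sum>t<T. a t \<omega> * h (Suc t) \<omega>) / real T\<bar>)) \<longlonglongrightarrow> 0"
    and martingale_sum_integrable: "integrable M (\<lambda>\<omega>. (\<Sum>t<T. a t \<omega> * h (Suc t) \<omega>))"
    and martingale_sum_square_integrable: "integrable M (\<lambda>\<omega>. (\<Sum>t<T. a t \<omega> * h (Suc t) \<omega>)\<^sup>2)"
    and martingale_sum_variance: "expectation (\<lambda>\<omega>. (\<Sum>t<T. a t \<omega> * h (Suc t) \<omega>)\<^sup>2) \<le> real T * (K1 * K2)"
proof -
  define S where "S T \<omega> = (\<Sum>t<T. a t \<omega> * h (Suc t) \<omega>)" for T \<omega>
  have K: "K1 \<ge> 0" "K2 \<ge> 0"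
    using order_trans[OF _ a(3)] order_trans[OF _ h(4)] by (auto simp: integral_nonneg)
  have SF: "S T \<in> borel_measurable (F T)" for T
    unfolding S_def
    by (intro borel_measurable_sum borel_measurable_times F_trans[OF a(1)] F_trans[OF h(2)]) auto
  note SM = F_M[OF SF] and aM = F_M[OF a(1)] and hM = F_M[OF h(2)]
  have sq: "integrable M (\<lambda>\<omega>. (a t \<omega>)\<^sup>2 * (h (Suc t) \<omega>)\<^sup>2)"
    "expectation (\<lambda>\<omega>. (a t \<omega>)\<^sup>2 * (h (Suc t) \<omega>)\<^sup>2) = expectation (\<lambda>\<omega>. (a t \<omega>)\<^sup>2) * expectation (\<lambda>\<omega>. (h (Suc t) \<omega>)\<^sup>2)" for t
    using indep_mult[of "\<lambda>\<omega>. (a t \<omega>)\<^sup>2" t "\<lambda>\<omega>. (h (Suc t) \<omega>)\<^sup>2"] a h by auto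
  have S2: "integrable M (\<lambda>\<omega>. (S T \<omega>)\<^sup>2) \<and> expectation (\<lambda>\<omega>. (S T \<omega>)\<^sup>2) \<le> real T * (K1 * K2)" for T
  proof (induction T)
    case 0
    then show ?case by (simp add: S_def)
  next
    case (Suc T)
    have Sa: "integrable M (\<lambda>\<omega>. S T \<omega> * a T \<omega>)" using Suc a SM aM by (intro integrable_square_mult) auto
    have SaF: "(\<lambda>\<omega>. S T \<omega> * a T \<omega>) \<in> borel_measurable (F T)" using SF a(1) by (rule borel_measurable_times)
    note x = indep_mult[OF SaF h(1) Sa h(5)]
    have eq: "(S (Suc T) \<omega>)\<^sup>2 = (S T \<omega>)\<^sup>2 + 2 * (S T \<omega> * a T \<omega> * h (Suc T) \<omega>) + (a T \<omega>)\<^sup>2 * (h (Suc T) \<omega>)\<^sup>2" for \<omega>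
      by (simp add: S_def power2_eq_square algebra_simps)
    have "expectation (\<lambda>\<omega>. (S (Suc T) \<omega>)\<^sup>2) =
        expectation (\<lambda>\<omega>. (S T \<omega>)\<^sup>2) + 2 * expectation (\<lambda>\<omega>. S T \<omega> * a T \<omega> * h (Suc T) \<omega>) + expectation (\<lambda>\<omega>. (a T \<omega>)\<^sup>2 * (h (Suc T) \<omega>)\<^sup>2)"
      unfolding eq using Suc x(1) sq(1) by simp
    also have "\<dots> = expectation (\<lambda>\<omega>. (S T \<omega>)\<^sup>2) + expectation (\<lambda>\<omega>. (a T \<omega>)\<^sup>2) * expectation (\<lambda>\<omega>. (h (Suc T) \<omega>)\<^sup>2)"
      unfolding x(2) sq(2) h(6) by simp
    also have "\<dots> \<le> real T * (K1 * K2) + K1 * K2"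
      using Suc a h K by (intro add_mono mult_mono) auto
    finally have "expectation (\<lambda>\<omega>. (S (Suc T) \<omega>)\<^sup>2) \<le> real (Suc T) * (K1 * K2)" by (simp add: algebra_simps)
    moreover have "integrable M (\<lambda>\<omega>. (S (Suc T) \<omega>)\<^sup>2)" unfolding eq using Suc x(1) sq(1) by simp
    ultimately show ?case by blast
  qed
  have S1: "integrable M (S T)" for T
  proof (rule Bochner_Integration.integrable_bound)
    show "integrable M (\<lambda>\<omega>. 1 + (S T \<omega>)\<^sup>2)" using S2 by simp
    have "\<bar>x\<bar> \<le> 1 + x\<^sup>2" for x :: real using sum_squares_bound[of 1 "\<bar>x\<bar>"] by simp
    then show "AE \<omega> in M. norm (S T \<omega>) \<le> norm (1 + (S T \<omega>)\<^sup>2)" by simp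
  qed (rule SM)
  then show "integrable M (\<lambda>\<omega>. (\<Sum>t<T. a t \<omega> * h (Suc t) \<omega>))" by (simp add: S_def[abs_def])
  show "integrable M (\<lambda>\<omega>. (\<Sum>t<T. a t \<omega> * h (Suc t) \<omega>)\<^sup>2)"
    "expectation (\<lambda>\<omega>. (\<Sum>t<T. a t \<omega> * h (Suc t) \<omega>)\<^sup>2) \<le> real T * (K1 * K2)"
    using S2[of T] by (simp_all add: S_def)
  have "(\<lambda>T. expectation (\<lambda>\<omega>. \<bar>S T \<omega> / real T\<bar>)) \<longlonglongrightarrow> 0"
  proof (rule tendsto_zero_sandwich)
    show "(\<lambda>T. (1 + K1 * K2) / 2 / sqrt (real T)) \<longlonglongrightarrow> 0" by real_asymp
    fix T :: nat assume T: "T > 0"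
    \<comment> \<open>The inequality of arithmetic and geometric means for \<open>1\<close> and
      \<open>\<bar>S T \<omega>\<bar> / sqrt T\<close> trades the absolute value for a square. The
      variance grows at most linearly, so the resulting bound is of order
      \<open>1 / sqrt T\<close>.\<close>
    have "\<bar>S T \<omega> / real T\<bar> \<le> (1 / sqrt T + (S T \<omega>)\<^sup>2 / (real T * sqrt T)) / 2" for \<omega>
    proof -
      have "2 * 1 * (\<bar>S T \<omega>\<bar> / sqrt T) \<le> 1\<^sup>2 + (\<bar>S T \<omega>\<bar> / sqrt T)\<^sup>2" by (rule sum_squares_bound)
      then have "2 * (\<bar>S T \<omega>\<bar> / sqrt T) / sqrt T \<le> (1 + (S T \<omega>)\<^sup>2 / T) / sqrt T"
        using T by (intro divide_right_mono) (simp_all add: power_divide)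
      then have "2 * (\<bar>S T \<omega>\<bar> / real T) \<le> 1 / sqrt T + (S T \<omega>)\<^sup>2 / (real T * sqrt T)"
        using T by (simp add: add_divide_distrib)
      moreover have "y \<le> z / 2" if "2 * y \<le> z" for y z :: real using that by simp
      ultimately show ?thesis by (simp only: abs_divide abs_of_nat)
    qed
    then have "expectation (\<lambda>\<omega>. \<bar>S T \<omega> / real T\<bar>) \<le> expectation (\<lambda>\<omega>. (1 / sqrt T + (S T \<omega>)\<^sup>2 / (real T * sqrt T)) / 2)"
      using S1 S2 by (intro integral_mono) auto
    also have "\<dots> = (1 / sqrt T + expectation (\<lambda>\<omega>. (S T \<omega>)\<^sup>2) / (real T * sqrt T)) / 2"
      using S2[of T] by (simp add: prob_space)
    also have "\<dots> \<le> (1 / sqrt T + (real T * (K1 * K2)) / (real T * sqrt T)) / 2"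
      using S2[of T] by (intro divide_right_mono add_left_mono) auto
    also have "\<dots> = (1 + K1 * K2) / 2 / sqrt (real T)" using T by (simp add: add_divide_distrib)
    finally show "expectation (\<lambda>\<omega>. \<bar>S T \<omega> / real T\<bar>) \<le> (1 + K1 * K2) / 2 / sqrt (real T)" .
  qed simp
  then show "(\<lambda>T. expectation (\<lambda>\<omega>. \<bar>(\<Sum>t<T. a t \<omega> * h (Suc t) \<omega>) / real T\<bar>)) \<longlonglongrightarrow> 0"
    by (simp add: S_def)
qed

lemma cross_average:
  assumes "i < n" "j < n"
  shows "(\<lambda>T. expectation (\<lambda>\<omega>. \<bar>(\<Sum>t<T. W t i \<omega> * e (Suc t) j \<omega>) / real T\<bar>)) \<longlonglongrightarrow> 0"
    "integrable M (\<lambda>\<omega>. \<Sum>t<T. W t i \<omega> * e (Suc t) j \<omega>)"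
    "integrable M (\<lambda>\<omega>. (\<Sum>t<T. W t i \<omega> * e (Suc t) j \<omega>)\<^sup>2)"
    "expectation (\<lambda>\<omega>. (\<Sum>t<T. W t i \<omega> * e (Suc t) j \<omega>)\<^sup>2) \<le> real T * ((1 + K4) * (1 + C4))"
  using assms
  by (intro martingale_transform[of "\<lambda>t. W t i" "1 + K4" "\<lambda>t. e t j" "1 + C4"];
      auto intro: W_F e_F e_H square_bounds e_mean)+

text \<open>The centred products are martingale differences with multiplier \<open>1\<close>; their
  variances are bounded through the fourth moments of the noise.\<close>

lemma noise_average:
  assumes "i < n" "j < n"
  shows "(\<lambda>T. expectation (\<lambda>\<omega>. \<bar>(\<Sum>t<T. e (Suc t) i \<omega> * e (Suc t) j \<omega> - Om i j) / real T\<bar>)) \<longlonglongrightarrow> 0"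
proof -
  let ?h = "\<lambda>t \<omega>. e t i \<omega> * e t j \<omega> - Om i j"
  have i4: "integrable M (\<lambda>\<omega>. e (Suc t) i \<omega> ^ 4 + e (Suc t) j \<omega> ^ 4 + (Om i j)\<^sup>2)" for t
    using e_int4 assms by simp
  have le: "(?h (Suc t) \<omega>)\<^sup>2 \<le> 2 * (e (Suc t) i \<omega> ^ 4 + e (Suc t) j \<omega> ^ 4 + (Om i j)\<^sup>2)" for t \<omega>
  proof -
    define x y z where "x = e (Suc t) i \<omega>" and "y = e (Suc t) j \<omega>" and "z = Om i j"
    have "0 \<le> (x * y + z)\<^sup>2" by simp
    then have "(x * y - z)\<^sup>2 \<le> 2 * (x\<^sup>2 * y\<^sup>2 + z\<^sup>2)" by (simp add: power2_eq_square algebra_simps)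
    also have "\<dots> \<le> 2 * (x ^ 4 + y ^ 4 + z\<^sup>2)"
    proof -
      have "2 * (x\<^sup>2 * y\<^sup>2) \<le> x ^ 4 + y ^ 4" "0 \<le> x ^ 4" "0 \<le> y ^ 4"
        using sum_squares_bound[of "x\<^sup>2" "y\<^sup>2"] by simp_all
      then show ?thesis unfolding distrib_left by linarith
    qed
    finally show ?thesis by (simp add: x_def y_def z_def)
  qed
  have hm: "?h (Suc t) \<in> borel_measurable M" for t using assms by simp
  have h2: "integrable M (\<lambda>\<omega>. (?h (Suc t) \<omega>)\<^sup>2)" for t
  proof (rule Bochner_Integration.integrable_bound[OF integrable_mult_right[OF i4[of t], of 2]])
    show "AE \<omega> in M. norm ((?h (Suc t) \<omega>)\<^sup>2) \<le> norm (2 * (e (Suc t) i \<omega> ^ 4 + e (Suc t) j \<omega> ^ 4 + (Om i j)\<^sup>2))"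
      using order_trans[OF le abs_ge_self] by simp
  qed (use hm in measurable)
  have "expectation (\<lambda>\<omega>. (?h (Suc t) \<omega>)\<^sup>2) \<le> 2 * (C4 + C4 + (Om i j)\<^sup>2)" for t
  proof -
    have "expectation (\<lambda>\<omega>. (?h (Suc t) \<omega>)\<^sup>2) \<le> expectation (\<lambda>\<omega>. 2 * (e (Suc t) i \<omega> ^ 4 + e (Suc t) j \<omega> ^ 4 + (Om i j)\<^sup>2))"
      by (rule integral_mono[OF h2 integrable_mult_right[OF i4] le])
    also have "\<dots> = 2 * (expectation (\<lambda>\<omega>. e (Suc t) i \<omega> ^ 4) + expectation (\<lambda>\<omega>. e (Suc t) j \<omega> ^ 4) + (Om i j)\<^sup>2)"
      using e_int4 assms by (simp add: prob_space)
    also have "\<dots> \<le> 2 * (C4 + C4 + (Om i j)\<^sup>2)" using e_bd4 assms by (intro mult_left_mono add_mono) auto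
    finally show ?thesis .
  qed
  moreover have "expectation (?h (Suc t)) = 0" for t using e_cov e_int2 assms by (simp add: prob_space)
  ultimately have "(\<lambda>T. expectation (\<lambda>\<omega>. \<bar>(\<Sum>t<T. 1 * ?h (Suc t) \<omega>) / real T\<bar>)) \<longlonglongrightarrow> 0"
    using assms h2 e_int2
    by (intro martingale_average_tendsto_zero[of "\<lambda>_ _. 1" 1 ?h]) (auto simp: prob_space intro!: borel_measurable_diff borel_measurable_times e_F e_H)
  then show ?thesis by simp
qed

end

text \<open>\<open>Gam\<close> is introduced as the limit of the path's own second moments, so that
  the limit theorems speak of the noise alone; \<open>var_process\<close> later supplies the
  stationary covariance for it.\<close>

locale var_noise_limit = var_noise +
  fixes Gam :: "nat \<Rightarrow> nat \<Rightarrow> real"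
  assumes Gam: "\<And>i j. i < n \<Longrightarrow> j < n \<Longrightarrow> (\<lambda>t. expectation (\<lambda>\<omega>. var_path n P e t i \<omega> * var_path n P e t j \<omega>)) \<longlonglongrightarrow> Gam i j"
begin

lemma W_step_prod:
  "W (Suc t) i \<omega> * W (Suc t) j \<omega> = (\<Sum>k<n. \<Sum>l<n. P i k * P j l * (W t k \<omega> * W t l \<omega>)) +
     (\<Sum>k<n. P i k * (W t k \<omega> * e (Suc t) j \<omega>)) + (\<Sum>l<n. P j l * (W t l \<omega> * e (Suc t) i \<omega>)) +
     e (Suc t) i \<omega> * e (Suc t) j \<omega>"
proof -
  have "(\<Sum>k<n. P i k * W t k \<omega>) * (\<Sum>l<n. P j l * W t l \<omega>) = (\<Sum>k<n. \<Sum>l<n. P i k * P j l * (W t k \<omega> * W t l \<omega>))"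
    by (simp add: sum_product mult_ac)
  moreover have "(\<Sum>k<n. P i k * W t k \<omega>) * e (Suc t) j \<omega> = (\<Sum>k<n. P i k * (W t k \<omega> * e (Suc t) j \<omega>))"
    by (simp only: sum_distrib_right mult.assoc)
  moreover have "e (Suc t) i \<omega> * (\<Sum>l<n. P j l * W t l \<omega>) = (\<Sum>l<n. P j l * (W t l \<omega> * e (Suc t) i \<omega>))"
    by (simp add: sum_distrib_left mult_ac)
  ultimately show ?thesis by (simp add: distrib_left distrib_right)
qed

text \<open>The discrete Lyapunov equation, as the limit of the one-step identity for second
  moments. The mixed terms have mean zero because the path up to \<open>t\<close> is independent of
  the noise at \<open>Suc t\<close>.\<close>

lemma Gam_eq:
  assumes i: "i < n" "j < n"
  shows "Gam i j = (\<Sum>k<n. \<Sum>l<n. P i k * P j l * Gam k l) + Om i j"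
proof (rule LIMSEQ_unique)
  let ?g = "\<lambda>t i j. expectation (\<lambda>\<omega>. W t i \<omega> * W t j \<omega>)"
  show "(\<lambda>t. ?g (Suc t) i j) \<longlonglongrightarrow> Gam i j" using LIMSEQ_Suc[OF Gam[OF i]] .
  have We: "integrable M (\<lambda>\<omega>. W t k \<omega> * e (Suc t) l \<omega>)" "expectation (\<lambda>\<omega>. W t k \<omega> * e (Suc t) l \<omega>) = 0"
    if "k < n" "l < n" for k l t
    using indep_mult[OF W_F[of k t] e_H[of l t]] W_int square_bounds(5) e_mean that by auto
  have "?g (Suc t) i j = (\<Sum>k<n. \<Sum>l<n. P i k * P j l * ?g t k l) + Om i j" for t
  proof -
    have 1: "integrable M (\<lambda>\<omega>. \<Sum>k<n. \<Sum>l<n. P i k * P j l * (W t k \<omega> * W t l \<omega>))"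
      by (intro Bochner_Integration.integrable_sum integrable_mult_right W_int2) auto
    have 2: "integrable M (\<lambda>\<omega>. \<Sum>k<n. P i k * (W t k \<omega> * e (Suc t) j \<omega>))" if "j < n" for i j
      by (intro Bochner_Integration.integrable_sum integrable_mult_right We that) auto
    have "expectation (\<lambda>\<omega>. \<Sum>k<n. P i k * (W t k \<omega> * e (Suc t) j \<omega>)) =
      (\<Sum>k<n. expectation (\<lambda>\<omega>. P i k * (W t k \<omega> * e (Suc t) j \<omega>)))" if "j < n" for i j
      by (rule Bochner_Integration.integral_sum) (intro integrable_mult_right We that, auto)
    then have 3: "expectation (\<lambda>\<omega>. \<Sum>k<n. P i k * (W t k \<omega> * e (Suc t) j \<omega>)) = 0" if "j < n" for i j
      using We that by simp
    have "expectation (\<lambda>\<omega>. \<Sum>k<n. \<Sum>l<n. P i k * P j l * (W t k \<omega> * W t l \<omega>)) =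
      (\<Sum>k<n. expectation (\<lambda>\<omega>. \<Sum>l<n. P i k * P j l * (W t k \<omega> * W t l \<omega>)))"
      by (rule Bochner_Integration.integral_sum) (intro Bochner_Integration.integrable_sum integrable_mult_right W_int2, auto)
    also have "\<dots> = (\<Sum>k<n. \<Sum>l<n. expectation (\<lambda>\<omega>. P i k * P j l * (W t k \<omega> * W t l \<omega>)))"
      by (intro sum.cong refl Bochner_Integration.integral_sum integrable_mult_right W_int2) auto
    finally have 4: "expectation (\<lambda>\<omega>. \<Sum>k<n. \<Sum>l<n. P i k * P j l * (W t k \<omega> * W t l \<omega>)) =
      (\<Sum>k<n. \<Sum>l<n. P i k * P j l * ?g t k l)" by simp
    show ?thesis unfolding W_step_prod
      using 1 2[OF i(2), of i] 2[OF i(1), of j] e_int2[OF i, of t]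
      by (simp add: 3[OF i(2)] 3[OF i(1)] 4 e_cov[OF i])
  qed
  then show "(\<lambda>t. ?g (Suc t) i j) \<longlonglongrightarrow> (\<Sum>k<n. \<Sum>l<n. P i k * P j l * Gam k l) + Om i j"
    by (simp only:) (intro tendsto_intros Gam, auto)
qed

text \<open>The error \<open>D\<close> of the average satisfies \<open>D = P D P' + R\<close> up to a remainder \<open>R\<close> that tends to \<open>0\<close>, and
  this equation bounds \<open>D\<close> in terms of \<open>R\<close>.\<close>

lemma second_moment_average:
  assumes ij: "i < n" "j < n"
  shows "(\<lambda>T. expectation (\<lambda>\<omega>. \<bar>(\<Sum>t<T. W t i \<omega> * W t j \<omega>) / real T - Gam i j\<bar>)) \<longlonglongrightarrow> 0"
proof -
  \<comment> \<open>The remainder collects the averages of path times noise, the centred noise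
    products, and the endpoint term that is left when the sum is shifted by one time step.\<close>
  define R where "R T = (\<lambda>(i, j) \<omega>.
     (\<Sum>k<n. P i k * ((\<Sum>t<T. W t k \<omega> * e (Suc t) j \<omega>) / real T)) +
     (\<Sum>l<n. P j l * ((\<Sum>t<T. W t l \<omega> * e (Suc t) i \<omega>) / real T)) +
     (\<Sum>t<T. e (Suc t) i \<omega> * e (Suc t) j \<omega> - Om i j) / real T - W T i \<omega> * W T j \<omega> / real T)" for T
  define D where "D T = (\<lambda>(i, j) \<omega>. (\<Sum>t<T. W t i \<omega> * W t j \<omega>) / real T - Gam i j)" for T
  let ?I = "{..<n} \<times> {..<n}"
  have fp: "D T p \<omega> = (\<Sum>q\<in>?I. (\<lambda>(i, i') (j, j'). P i j * P i' j') p q * D T q \<omega>) + R T p \<omega>"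
    if T: "T > 0" and p: "p \<in> ?I" for T p \<omega>
  proof -
    obtain i j where p': "p = (i, j)" "i < n" "j < n" using p by auto
    let ?A = "\<lambda>i j. \<Sum>t<T. W t i \<omega> * W t j \<omega>"
    \<comment> \<open>Shifting the time index changes nothing at the lower end because
      \<open>W 0\<close> is \<open>0\<close>.\<close>
    have "(\<Sum>t<T. W (Suc t) i \<omega> * W (Suc t) j \<omega>) = ?A i j + W T i \<omega> * W T j \<omega>"
      by (subst sum.lessThan_Suc[symmetric], subst sum.lessThan_Suc_shift) simp
    also have "(\<Sum>t<T. W (Suc t) i \<omega> * W (Suc t) j \<omega>) = (\<Sum>k<n. \<Sum>l<n. P i k * P j l * ?A k l) +
       (\<Sum>k<n. P i k * (\<Sum>t<T. W t k \<omega> * e (Suc t) j \<omega>)) + (\<Sum>l<n. P j l * (\<Sum>t<T. W t l \<omega> * e (Suc t) i \<omega>)) +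
       (\<Sum>t<T. e (Suc t) i \<omega> * e (Suc t) j \<omega>)"
    proof -
      have sw: "(\<Sum>t<T. \<Sum>k<n. P i k * (W t k \<omega> * e (Suc t) j \<omega>)) = (\<Sum>k<n. P i k * (\<Sum>t<T. W t k \<omega> * e (Suc t) j \<omega>))" for i j
        unfolding sum_distrib_left by (rule sum.swap)
      have "(\<Sum>t<T. \<Sum>k<n. \<Sum>l<n. P i k * P j l * (W t k \<omega> * W t l \<omega>)) = (\<Sum>k<n. \<Sum>l<n. P i k * P j l * ?A k l)"
        unfolding sum_distrib_left by (subst sum.swap) (intro sum.cong refl sum.swap)
      then show ?thesis unfolding W_step_prod sum.distrib sw by (simp only:)
    qed

    finally have "?A i j = (\<Sum>k<n. \<Sum>l<n. P i k * P j l * ?A k l) +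
       (\<Sum>k<n. P i k * (\<Sum>t<T. W t k \<omega> * e (Suc t) j \<omega>)) + (\<Sum>l<n. P j l * (\<Sum>t<T. W t l \<omega> * e (Suc t) i \<omega>)) +
       (\<Sum>t<T. e (Suc t) i \<omega> * e (Suc t) j \<omega>) - W T i \<omega> * W T j \<omega>" by linarith
    then have "?A i j / T = (\<Sum>k<n. \<Sum>l<n. P i k * P j l * (?A k l / T)) +
       (\<Sum>k<n. P i k * ((\<Sum>t<T. W t k \<omega> * e (Suc t) j \<omega>) / T)) + (\<Sum>l<n. P j l * ((\<Sum>t<T. W t l \<omega> * e (Suc t) i \<omega>) / T)) +
       (\<Sum>t<T. e (Suc t) i \<omega> * e (Suc t) j \<omega>) / T - W T i \<omega> * W T j \<omega> / T"
    proof -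
      have d1: "(\<Sum>k<n. f k * g k) / T = (\<Sum>k<n. f k * (g k / T))" for f g :: "nat \<Rightarrow> real"
        by (simp add: sum_divide_distrib)
      have d2: "(\<Sum>k<n. \<Sum>l<n. f k * f' l * g k l) / T = (\<Sum>k<n. \<Sum>l<n. f k * f' l * (g k l / T))" for f f' g
        by (simp add: sum_divide_distrib)
      show ?thesis
        using \<open>?A i j = _\<close> by (simp only: add_divide_distrib diff_divide_distrib d1 d2)
    qed
    moreover have "(\<Sum>t<T. e (Suc t) i \<omega> * e (Suc t) j \<omega> - Om i j) / T = (\<Sum>t<T. e (Suc t) i \<omega> * e (Suc t) j \<omega>) / T - Om i j"
      using T by (simp add: sum_subtractf diff_divide_distrib)
    moreover have "(\<Sum>q\<in>?I. (\<lambda>(i, i') (j, j'). P i j * P i' j') p q * D T q \<omega>) =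
       (\<Sum>k<n. \<Sum>l<n. P i k * P j l * (?A k l / T)) - (\<Sum>k<n. \<Sum>l<n. P i k * P j l * Gam k l)"
      by (simp add: p' D_def sum.cartesian_product[symmetric] right_diff_distrib sum_subtractf split_def)
         (simp add: sum.cartesian_product split_def)
    ultimately show ?thesis unfolding p' using Gam_eq[OF p'(2,3)] by (simp add: D_def R_def)
  qed
  \<comment> \<open>The constant of \<open>linear_fixpoint_bound\<close> for the tensor square,
    whose decay parameters are \<open>c * c\<close> and \<open>r * r\<close>.\<close>
  define C where "C = c * c / (1 - r * r)"
  have C: "C \<ge> 0" using cr mult_strict_mono[of r 1 r 1] by (simp add: C_def)
  have Dle: "\<bar>D T (i, j) \<omega>\<bar> \<le> C * (\<Sum>q\<in>?I. \<bar>R T q \<omega>\<bar>)" if "T > 0" for T \<omega>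
    unfolding C_def using ij
    by (intro linear_fixpoint_bound[where u = "\<lambda>q. D T q \<omega>" and z = "\<lambda>q. R T q \<omega>", OF _ geometric_decay_tensor[OF _ decay]] fp[OF that]) auto
  have Rint: "integrable M (R T p) \<and> (\<lambda>T. expectation (\<lambda>\<omega>. \<bar>R T p \<omega>\<bar>)) \<longlonglongrightarrow> 0" if p: "p \<in> ?I" for p T
  proof -
    obtain i j where p': "p = (i, j)" and ij: "i < n" "j < n" using p by auto
    let ?X = "\<lambda>i j T \<omega>. (\<Sum>t<T. W t i \<omega> * e (Suc t) j \<omega>) / real T"
    let ?N = "\<lambda>T \<omega>. (\<Sum>t<T. e (Suc t) i \<omega> * e (Suc t) j \<omega> - Om i j) / real T"
    let ?W = "\<lambda>T \<omega>. W T i \<omega> * W T j \<omega> / real T"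
    have X: "integrable M (?X i j T)" if "i < n" "j < n" for i j T using cross_average(2)[OF that] by simp
    have N: "integrable M (?N T)" for T
      using e_int2[OF ij] by (intro integrable_divide_zero Bochner_Integration.integrable_sum Bochner_Integration.integrable_diff) auto
    have W: "integrable M (?W T)" for T using W_int2[OF ij] by simp
    have Req: "R T p \<omega> = (\<Sum>k<n. P i k * ?X k j T \<omega>) + (\<Sum>l<n. P j l * ?X l i T \<omega>) + ?N T \<omega> - ?W T \<omega>" for T \<omega>
      by (simp add: R_def p')
    have I: "integrable M (R T p)" for T
      unfolding Req[abs_def] by (intro Bochner_Integration.integrable_diff Bochner_Integration.integrable_add Bochner_Integration.integrable_sum integrable_mult_right X N W ij) (auto)
    let ?b = "\<lambda>T \<omega>. (\<Sum>k<n. \<bar>P i k\<bar> * \<bar>?X k j T \<omega>\<bar>) + (\<Sum>l<n. \<bar>P j l\<bar> * \<bar>?X l i T \<omega>\<bar>) + \<bar>?N T \<omega>\<bar> + \<bar>?W T \<omega>\<bar>"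
    have le: "\<bar>R T p \<omega>\<bar> \<le> ?b T \<omega>" for T \<omega>
    proof -
      have "\<bar>\<Sum>k<n. P i k * ?X k j T \<omega>\<bar> \<le> (\<Sum>k<n. \<bar>P i k\<bar> * \<bar>?X k j T \<omega>\<bar>)" for i j
        unfolding abs_mult[symmetric] by (rule sum_abs)
      from this[of i j] this[of j i] show ?thesis unfolding Req by linarith
    qed
    have "expectation (\<lambda>\<omega>. \<bar>R T p \<omega>\<bar>) \<le> (\<Sum>k<n. \<bar>P i k\<bar> * expectation (\<lambda>\<omega>. \<bar>?X k j T \<omega>\<bar>)) +
        (\<Sum>l<n. \<bar>P j l\<bar> * expectation (\<lambda>\<omega>. \<bar>?X l i T \<omega>\<bar>)) + expectation (\<lambda>\<omega>. \<bar>?N T \<omega>\<bar>) + expectation (\<lambda>\<omega>. \<bar>?W T \<omega>\<bar>)" for T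
    proof -
      have s: "integrable M (\<lambda>\<omega>. \<Sum>k<n. \<bar>P i k\<bar> * \<bar>?X k j T \<omega>\<bar>)"
        "expectation (\<lambda>\<omega>. \<Sum>k<n. \<bar>P i k\<bar> * \<bar>?X k j T \<omega>\<bar>) = (\<Sum>k<n. \<bar>P i k\<bar> * expectation (\<lambda>\<omega>. \<bar>?X k j T \<omega>\<bar>))"
        if "j < n" for i j
      proof -
        have x: "integrable M (\<lambda>\<omega>. \<bar>P i k\<bar> * \<bar>?X k j T \<omega>\<bar>)" if "k \<in> {..<n}" for k
          using X[of k j T] that \<open>j < n\<close> by (intro integrable_mult_right integrable_abs) auto
        show "integrable M (\<lambda>\<omega>. \<Sum>k<n. \<bar>P i k\<bar> * \<bar>?X k j T \<omega>\<bar>)"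
          by (rule Bochner_Integration.integrable_sum[OF x])
        have "expectation (\<lambda>\<omega>. \<Sum>k<n. \<bar>P i k\<bar> * \<bar>?X k j T \<omega>\<bar>) = (\<Sum>k<n. expectation (\<lambda>\<omega>. \<bar>P i k\<bar> * \<bar>?X k j T \<omega>\<bar>))"
          by (rule Bochner_Integration.integral_sum[OF x])
        then show "expectation (\<lambda>\<omega>. \<Sum>k<n. \<bar>P i k\<bar> * \<bar>?X k j T \<omega>\<bar>) = (\<Sum>k<n. \<bar>P i k\<bar> * expectation (\<lambda>\<omega>. \<bar>?X k j T \<omega>\<bar>))"
          by (simp only: integral_mult_right_zero)
      qed
      note s1 = s[OF ij(2), of i] and s2 = s[OF ij(1), of j]
      have a: "integrable M (\<lambda>\<omega>. \<bar>?N T \<omega>\<bar>)" "integrable M (\<lambda>\<omega>. \<bar>?W T \<omega>\<bar>)"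
        by (rule integrable_abs[OF N], rule integrable_abs[OF W])
      have "expectation (\<lambda>\<omega>. \<bar>R T p \<omega>\<bar>) \<le> expectation (?b T)"
        by (rule integral_mono[OF integrable_abs[OF I] _ le])
           (intro Bochner_Integration.integrable_add s1(1) s2(1) a)
      also have "\<dots> = expectation (\<lambda>\<omega>. (\<Sum>k<n. \<bar>P i k\<bar> * \<bar>?X k j T \<omega>\<bar>) + (\<Sum>l<n. \<bar>P j l\<bar> * \<bar>?X l i T \<omega>\<bar>) + \<bar>?N T \<omega>\<bar>) + expectation (\<lambda>\<omega>. \<bar>?W T \<omega>\<bar>)"
        by (intro Bochner_Integration.integral_add Bochner_Integration.integrable_add s1(1) s2(1) a)
      also have "expectation (\<lambda>\<omega>. (\<Sum>k<n. \<bar>P i k\<bar> * \<bar>?X k j T \<omega>\<bar>) + (\<Sum>l<n. \<bar>P j l\<bar> * \<bar>?X l i T \<omega>\<bar>) + \<bar>?N T \<omega>\<bar>) =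
          expectation (\<lambda>\<omega>. (\<Sum>k<n. \<bar>P i k\<bar> * \<bar>?X k j T \<omega>\<bar>) + (\<Sum>l<n. \<bar>P j l\<bar> * \<bar>?X l i T \<omega>\<bar>)) + expectation (\<lambda>\<omega>. \<bar>?N T \<omega>\<bar>)"
        by (intro Bochner_Integration.integral_add Bochner_Integration.integrable_add s1(1) s2(1) a)
      also have "expectation (\<lambda>\<omega>. (\<Sum>k<n. \<bar>P i k\<bar> * \<bar>?X k j T \<omega>\<bar>) + (\<Sum>l<n. \<bar>P j l\<bar> * \<bar>?X l i T \<omega>\<bar>)) =
          expectation (\<lambda>\<omega>. \<Sum>k<n. \<bar>P i k\<bar> * \<bar>?X k j T \<omega>\<bar>) + expectation (\<lambda>\<omega>. \<Sum>l<n. \<bar>P j l\<bar> * \<bar>?X l i T \<omega>\<bar>)"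
        by (intro Bochner_Integration.integral_add s1(1) s2(1))
      finally show ?thesis unfolding s1(2) s2(2) .
    qed
    moreover have "(\<lambda>T. (\<Sum>k<n. \<bar>P i k\<bar> * expectation (\<lambda>\<omega>. \<bar>?X k j T \<omega>\<bar>)) +
        (\<Sum>l<n. \<bar>P j l\<bar> * expectation (\<lambda>\<omega>. \<bar>?X l i T \<omega>\<bar>)) + expectation (\<lambda>\<omega>. \<bar>?N T \<omega>\<bar>) + expectation (\<lambda>\<omega>. \<bar>?W T \<omega>\<bar>)) \<longlonglongrightarrow>
        (\<Sum>k<n. \<bar>P i k\<bar> * 0) + (\<Sum>l<n. \<bar>P j l\<bar> * 0) + 0 + 0"
    proof (intro tendsto_add tendsto_sum tendsto_mult tendsto_const cross_average(1) noise_average ij)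
      show "(\<lambda>T. expectation (\<lambda>\<omega>. \<bar>?W T \<omega>\<bar>)) \<longlonglongrightarrow> 0"
      proof (rule tendsto_zero_sandwich)
        show "(\<lambda>T. (1 + K4) / real T) \<longlonglongrightarrow> 0" by real_asymp
        fix T :: nat assume "T > 0"
        have b: "\<bar>W T i \<omega> * W T j \<omega>\<bar> \<le> (B T \<omega>)\<^sup>2" for \<omega>
          unfolding abs_mult power2_eq_square using W_le_B ij B_nonneg by (intro mult_mono) auto
        have "expectation (\<lambda>\<omega>. \<bar>?W T \<omega>\<bar>) = expectation (\<lambda>\<omega>. \<bar>W T i \<omega> * W T j \<omega>\<bar>) / T" by simp
        also have "\<dots> \<le> expectation (\<lambda>\<omega>. (B T \<omega>)\<^sup>2) / T"
          by (intro divide_right_mono integral_mono integrable_abs W_int2 ij square_bounds b) simp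
        also have "\<dots> \<le> (1 + K4) / T" by (intro divide_right_mono square_bounds) simp
        finally show "expectation (\<lambda>\<omega>. \<bar>?W T \<omega>\<bar>) \<le> (1 + K4) / T" .
      qed simp
    qed auto
    ultimately have "(\<lambda>T. expectation (\<lambda>\<omega>. \<bar>R T p \<omega>\<bar>)) \<longlonglongrightarrow> 0"
      by (intro tendsto_zero_sandwich[where a = "\<lambda>T. expectation (\<lambda>\<omega>. \<bar>R T p \<omega>\<bar>)"]) auto
    with I show ?thesis by blast
  qed
  have DI: "integrable M (D T (i, j))" for T
    unfolding D_def split using ij
    by (intro Bochner_Integration.integrable_diff integrable_divide_zero Bochner_Integration.integrable_sum W_int2) auto
  have "(\<lambda>T. expectation (\<lambda>\<omega>. \<bar>D T (i, j) \<omega>\<bar>)) \<longlonglongrightarrow> 0"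
  proof (rule tendsto_zero_sandwich)
    have "(\<lambda>T. C * (\<Sum>q\<in>?I. expectation (\<lambda>\<omega>. \<bar>R T q \<omega>\<bar>))) \<longlonglongrightarrow> C * (\<Sum>q\<in>?I. 0)"
      using Rint by (intro tendsto_mult tendsto_const tendsto_sum) blast
    then show "(\<lambda>T. C * (\<Sum>q\<in>?I. expectation (\<lambda>\<omega>. \<bar>R T q \<omega>\<bar>))) \<longlonglongrightarrow> 0" by simp
    fix T :: nat assume T: "T > 0"
    have "expectation (\<lambda>\<omega>. \<bar>D T (i, j) \<omega>\<bar>) \<le> expectation (\<lambda>\<omega>. C * (\<Sum>q\<in>?I. \<bar>R T q \<omega>\<bar>))"
      using Rint DI by (intro integral_mono Dle T integrable_abs integrable_mult_right Bochner_Integration.integrable_sum) auto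
    also have "\<dots> = C * (\<Sum>q\<in>?I. expectation (\<lambda>\<omega>. \<bar>R T q \<omega>\<bar>))"
      using Rint by (simp add: Bochner_Integration.integral_sum)
    finally show "expectation (\<lambda>\<omega>. \<bar>D T (i, j) \<omega>\<bar>) \<le> C * (\<Sum>q\<in>?I. expectation (\<lambda>\<omega>. \<bar>R T q \<omega>\<bar>))" .
  qed simp
  then show ?thesis by (simp add: D_def)
qed

end

subsection \<open>The martingale central limit theorem\<close>

text \<open>The upper estimate comes from \<open>1 - y + y\<^sup>2 / 2\<close> times
  \<open>1 + y + y\<^sup>2 / 2\<close> being \<open>1 + y ^ 4 / 4\<close>, hence at least
  \<open>1\<close>, together with the quadratic lower bound of \<open>exp y\<close>.\<close>

lemma exp_minus_Taylor_quadratic: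
  fixes y :: real
  assumes "0 \<le> y"
  shows "\<bar>exp (- y) - (1 - y)\<bar> \<le> y\<^sup>2 / 2"
proof -
  have "1 * 1 \<le> (1 - y + y\<^sup>2 / 2) * (1 + y + y\<^sup>2 / 2)"
    using zero_le_power2[of "y\<^sup>2"] by (simp add: power2_eq_square algebra_simps)
  also have "\<dots> \<le> (1 - y + y\<^sup>2 / 2) * exp y"
  proof (intro mult_left_mono exp_lower_Taylor_quadratic assms)
    have "0 \<le> (1 - y)\<^sup>2" by simp
    then show "0 \<le> 1 - y + y\<^sup>2 / 2" by (simp add: power2_eq_square algebra_simps)
  qed
  finally have "exp (- y) \<le> 1 - y + y\<^sup>2 / 2" by (simp add: exp_minus field_simps)
  moreover have "1 - y \<le> exp (- y)" using exp_ge_add_one_self[of "- y"] by simp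
  ultimately show ?thesis by simp
qed

lemma abs_exp_minus_1_le: "\<bar>exp y - 1\<bar> \<le> \<bar>y\<bar> * exp \<bar>y\<bar>" for y :: real
proof (cases "0 \<le> y")
  case True
  have "(1 - y) * exp y \<le> exp (- y) * exp y"
    using exp_ge_add_one_self[of "- y"] by (intro mult_right_mono) auto
  then have "exp y - 1 \<le> y * exp y" by (simp add: exp_minus algebra_simps)
  then show ?thesis using True by simp
next
  case False
  have "1 - exp y \<le> - y" using exp_ge_add_one_self[of y] by linarith
  also have "- y * 1 \<le> - y * exp (- y)" using False by (intro mult_left_mono) auto
  finally show ?thesis using False by simp
qed

lemma cis_Taylor_quadratic: "cmod (cis x - (1 + \<i> * of_real x - of_real (x\<^sup>2 / 2))) \<le> \<bar>x\<bar> ^ 3 / 6"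
proof -
  have "(\<Sum>k\<le>2. (\<i> * of_real x) ^ k / fact k) = 1 + \<i> * of_real x - of_real (x\<^sup>2 / 2)"
    by (simp add: numeral_2_eq_2 power2_eq_square algebra_simps)
  then show ?thesis using iexp_approx1[of x 2] by (simp add: cis_conv_exp fact_numeral eval_nat_numeral)
qed

lemma norm_integral_le_integral:
  fixes f :: "'a \<Rightarrow> 'b::{banach, second_countable_topology}"
  assumes "integrable M f" "integrable M g" "\<And>x. norm (f x) \<le> g x"
  shows "norm (\<integral>x. f x \<partial>M) \<le> (\<integral>x. g x \<partial>M)"
proof -
  have "norm (\<integral>x. f x \<partial>M) \<le> (\<integral>x. norm (f x) \<partial>M)" by (rule integral_norm_bound)
  also have "\<dots> \<le> (\<integral>x. g x \<partial>M)" using assms by (intro integral_mono) auto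
  finally show ?thesis .
qed

text \<open>Integrability is part of the notion because the integral of a non-integrable function is
  \<open>0\<close> by convention and would satisfy the limit vacuously.\<close>

definition (in prob_space) L1_null :: "(nat \<Rightarrow> 'a \<Rightarrow> real) \<Rightarrow> bool" where
  "L1_null f \<longleftrightarrow> (\<forall>T. integrable M (f T)) \<and> (\<lambda>T. expectation (\<lambda>\<omega>. \<bar>f T \<omega>\<bar>)) \<longlonglongrightarrow> 0"

context prob_space
begin

lemma L1_null_add:
  assumes "L1_null f" "L1_null g"
  shows "L1_null (\<lambda>T \<omega>. f T \<omega> + g T \<omega>)"
proof -
  have i: "integrable M (f T)" "integrable M (g T)" for T using assms by (auto simp: L1_null_def)
  have "expectation (\<lambda>\<omega>. \<bar>f T \<omega> + g T \<omega>\<bar>) \<le> expectation (\<lambda>\<omega>. \<bar>f T \<omega>\<bar>) + expectation (\<lambda>\<omega>. \<bar>g T \<omega>\<bar>)" for T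
  proof -
    have "expectation (\<lambda>\<omega>. \<bar>f T \<omega> + g T \<omega>\<bar>) \<le> expectation (\<lambda>\<omega>. \<bar>f T \<omega>\<bar> + \<bar>g T \<omega>\<bar>)"
      using i by (intro integral_mono abs_triangle_ineq) auto
    then show ?thesis using i by simp
  qed
  moreover have "(\<lambda>T. expectation (\<lambda>\<omega>. \<bar>f T \<omega>\<bar>) + expectation (\<lambda>\<omega>. \<bar>g T \<omega>\<bar>)) \<longlonglongrightarrow> 0 + 0"
    using assms by (intro tendsto_add) (auto simp: L1_null_def)
  ultimately show ?thesis unfolding L1_null_def using i
    by (auto intro!: tendsto_zero_sandwich[where a = "\<lambda>T. expectation (\<lambda>\<omega>. \<bar>f T \<omega> + g T \<omega>\<bar>)"])
qed

lemma L1_null_mult: "L1_null f \<Longrightarrow> L1_null (\<lambda>T \<omega>. a * f T \<omega>)"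
  using tendsto_mult[OF tendsto_const, of "\<lambda>T. expectation (\<lambda>\<omega>. \<bar>f T \<omega>\<bar>)" 0 sequentially "\<bar>a\<bar>"]
  by (auto simp: L1_null_def abs_mult)

lemma L1_null_abs: "L1_null f \<Longrightarrow> L1_null (\<lambda>T \<omega>. \<bar>f T \<omega>\<bar>)"
  by (simp add: L1_null_def)

lemma L1_null_zero: "L1_null (\<lambda>_ _. 0)" by (simp add: L1_null_def)

lemma L1_null_sum: "finite I \<Longrightarrow> (\<And>i. i \<in> I \<Longrightarrow> L1_null (f i)) \<Longrightarrow> L1_null (\<lambda>T \<omega>. \<Sum>i\<in>I. f i T \<omega>)"
  by (induction rule: finite_induct) (auto simp: L1_null_zero intro: L1_null_add)

end

context var_noise_limit
begin

text \<open>The Cramer-Wold form of the limit theorem. The exponential of the partial sum, times the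
  exponential of half the accumulated conditional variance, has almost constant mean
  \<open>1\<close>, at least when stopped before that variance becomes large. As the average
  conditional variance tends to \<open>\<sigma>\<close> in L1, dividing by the limiting factor
  leaves the Gaussian characteristic function.\<close>

lemma central_limit_char:
  fixes a :: "nat \<Rightarrow> nat \<Rightarrow> real"
  defines "d \<equiv> \<lambda>t \<omega>. \<Sum>i<n. (\<Sum>j<n. a j i * W t j \<omega>) * e (Suc t) i \<omega>"
    and "\<sigma> \<equiv> \<Sum>i<n. \<Sum>k<n. \<Sum>j<n. \<Sum>l<n. a j i * a l k * Om i k * Gam j l"
  shows "(\<lambda>T. expectation (\<lambda>\<omega>. cis ((\<Sum>t<T. d t \<omega>) / sqrt (real T)))) \<longlonglongrightarrow> of_real (exp (- \<sigma> / 2))"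
proof -
  define w where "w t i \<omega> = (\<Sum>j<n. a j i * W t j \<omega>)" for t i \<omega>
  \<comment> \<open>\<open>v t\<close> is the conditional variance of \<open>d t\<close> given the
    past, written out explicitly as a quadratic form in the path.\<close>
  define v where "v t \<omega> = (\<Sum>i<n. \<Sum>k<n. w t i \<omega> * w t k \<omega> * Om i k)" for t \<omega>
  define s where "s t \<omega> = (\<Sum>i<n. \<bar>e (Suc t) i \<omega>\<bar>)" for t \<omega>
  define A where "A = (\<Sum>i<n. \<Sum>j<n. \<bar>a j i\<bar>)"
  define O' where "O' = (\<Sum>i<n. \<Sum>k<n. \<bar>Om i k\<bar>)"
  have A0: "A \<ge> 0" "O' \<ge> 0" by (auto simp: A_def O'_def intro!: sum_nonneg)
  have d_eq: "d t \<omega> = (\<Sum>i<n. w t i \<omega> * e (Suc t) i \<omega>)" for t \<omega> by (simp add: d_def w_def)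
  have wF: "w t i \<in> borel_measurable (F t)" if "i < n" for t i
    unfolding w_def by (intro borel_measurable_sum borel_measurable_times W_F) auto
  have vF: "v t \<in> borel_measurable (F t)" for t
    unfolding v_def by (intro borel_measurable_sum borel_measurable_times wF) auto
  have dF: "d t \<in> borel_measurable (F (Suc t))" for t
    unfolding d_eq by (intro borel_measurable_sum borel_measurable_times F_trans[OF wF] e_F) auto
  have sH: "s t \<in> borel_measurable (H (Suc t))" for t
    unfolding s_def by (intro borel_measurable_sum borel_measurable_abs e_H) auto
  have wle: "\<bar>w t i \<omega>\<bar> \<le> A * B t \<omega>" if "i < n" for t i \<omega>
  proof -
    have "\<bar>w t i \<omega>\<bar> \<le> (\<Sum>j<n. \<bar>a j i\<bar> * B t \<omega>)"
      unfolding w_def using W_le_B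
      by (intro order_trans[OF sum_abs] sum_mono) (auto simp: abs_mult intro!: mult_left_mono)
    also have "\<dots> = (\<Sum>j<n. \<bar>a j i\<bar>) * B t \<omega>" by (simp add: sum_distrib_right)
    also have "\<dots> \<le> A * B t \<omega>"
      unfolding A_def using that B_nonneg
      by (intro mult_right_mono member_le_sum[of i "{..<n}" "\<lambda>i. \<Sum>j<n. \<bar>a j i\<bar>"]) (auto intro: sum_nonneg)
    finally show ?thesis .
  qed
  have dle: "\<bar>d t \<omega>\<bar> \<le> A * B t \<omega> * s t \<omega>" for t \<omega>
  proof -
    have "\<bar>d t \<omega>\<bar> \<le> (\<Sum>i<n. A * B t \<omega> * \<bar>e (Suc t) i \<omega>\<bar>)"
      unfolding d_eq using wle
      by (intro order_trans[OF sum_abs] sum_mono) (auto simp: abs_mult intro!: mult_right_mono)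
    then show ?thesis by (simp add: s_def sum_distrib_left)
  qed
  have vle: "\<bar>v t \<omega>\<bar> \<le> A\<^sup>2 * (B t \<omega>)\<^sup>2 * O'" for t \<omega>
  proof -
    have "\<bar>v t \<omega>\<bar> \<le> (\<Sum>i<n. \<Sum>k<n. (A * B t \<omega>) * (A * B t \<omega>) * \<bar>Om i k\<bar>)"
      unfolding v_def
    proof (intro order_trans[OF sum_abs] sum_mono)
      fix i k assume ik: "i \<in> {..<n}" "k \<in> {..<n}"
      then show "\<bar>w t i \<omega> * w t k \<omega> * Om i k\<bar> \<le> (A * B t \<omega>) * (A * B t \<omega>) * \<bar>Om i k\<bar>"
        unfolding abs_mult using wle A0 B_nonneg by (intro mult_right_mono mult_mono) auto
    qed
    then show ?thesis by (simp add: O'_def sum_distrib_left power2_eq_square mult_ac)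
  qed
  have v0: "v t \<omega> \<ge> 0" for t \<omega> unfolding v_def by (rule Om_nonneg)
  have dM[measurable]: "d t \<in> borel_measurable M" and vM[measurable]: "v t \<in> borel_measurable M" for t
    using dF vF F_M by blast+
  \<comment> \<open>\<open>B t\<close> and the next summed noise \<open>s t\<close> are independent,
    so the fourth moment of their product is the product of the fourth moments; \<open>A\<close>
    bounds the coefficients.\<close>
  define Kd where "Kd = A ^ 4 * (K4 * (real n ^ 4 * C4))"
  define Kv where "Kv = A ^ 4 * O'\<^sup>2 * K4"
  have Bs: "integrable M (\<lambda>\<omega>. B t \<omega> ^ 4 * s t \<omega> ^ 4)"
    "expectation (\<lambda>\<omega>. B t \<omega> ^ 4 * s t \<omega> ^ 4) = expectation (\<lambda>\<omega>. B t \<omega> ^ 4) * expectation (\<lambda>\<omega>. s t \<omega> ^ 4)" for t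
    using B_int4 e_sum_int4
    by (auto intro!: indep_mult[of _ t] borel_measurable_power B_F sH simp: s_def[symmetric])
  have d4: "integrable M (\<lambda>\<omega>. d t \<omega> ^ 4)" "expectation (\<lambda>\<omega>. d t \<omega> ^ 4) \<le> Kd" for t
  proof -
    have le: "d t \<omega> ^ 4 \<le> A ^ 4 * (B t \<omega> ^ 4 * s t \<omega> ^ 4)" for \<omega>
      using power_mono[OF dle abs_ge_zero, of t \<omega> 4] by (simp add: power_mult_distrib mult_ac)
    show I: "integrable M (\<lambda>\<omega>. d t \<omega> ^ 4)"
      by (rule Bochner_Integration.integrable_bound[OF integrable_mult_right[OF Bs(1)[of t], of "A ^ 4"]])
         (simp_all add: le)
    have "expectation (\<lambda>\<omega>. d t \<omega> ^ 4) \<le> expectation (\<lambda>\<omega>. A ^ 4 * (B t \<omega> ^ 4 * s t \<omega> ^ 4))"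
      by (rule integral_mono[OF I integrable_mult_right[OF Bs(1)] le])
    also have "\<dots> = A ^ 4 * (expectation (\<lambda>\<omega>. B t \<omega> ^ 4) * expectation (\<lambda>\<omega>. s t \<omega> ^ 4))"
      by (simp add: Bs(2))
    also have "\<dots> \<le> Kd"
      unfolding Kd_def using e_sum_bd4[of t] B_bd4[of t]
      by (intro mult_left_mono mult_mono) (auto simp: s_def K4_def)
    finally show "expectation (\<lambda>\<omega>. d t \<omega> ^ 4) \<le> Kd" .
  qed
  have v2: "integrable M (\<lambda>\<omega>. (v t \<omega>)\<^sup>2)" "expectation (\<lambda>\<omega>. (v t \<omega>)\<^sup>2) \<le> Kv" for t
  proof -
    have le: "(v t \<omega>)\<^sup>2 \<le> A ^ 4 * O'\<^sup>2 * B t \<omega> ^ 4" for \<omega>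
      using power_mono[OF vle abs_ge_zero, of t \<omega> 2] by (simp add: power_mult_distrib mult_ac)
    show I: "integrable M (\<lambda>\<omega>. (v t \<omega>)\<^sup>2)"
      by (rule Bochner_Integration.integrable_bound[OF integrable_mult_right[OF B_int4[of t], of "A ^ 4 * O'\<^sup>2"]])
         (simp_all add: le)
    have "expectation (\<lambda>\<omega>. (v t \<omega>)\<^sup>2) \<le> expectation (\<lambda>\<omega>. A ^ 4 * O'\<^sup>2 * B t \<omega> ^ 4)"
      by (rule integral_mono[OF I integrable_mult_right[OF B_int4] le])
    also have "\<dots> = A ^ 4 * O'\<^sup>2 * expectation (\<lambda>\<omega>. B t \<omega> ^ 4)" by simp
    also have "\<dots> \<le> Kv" unfolding Kv_def by (intro mult_left_mono B_bd4) simp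
    finally show "expectation (\<lambda>\<omega>. (v t \<omega>)\<^sup>2) \<le> Kv" .
  qed
  have w2: "integrable M (\<lambda>\<omega>. (w t i \<omega>)\<^sup>2)" if "i < n" for t i
  proof (rule Bochner_Integration.integrable_bound[OF integrable_mult_right[OF square_bounds(1)[of t], of "A\<^sup>2"]])
    have "(w t i \<omega>)\<^sup>2 \<le> A\<^sup>2 * (B t \<omega>)\<^sup>2" for \<omega>
      using power_mono[OF wle[OF that] abs_ge_zero, of t \<omega> 2] by (simp add: power_mult_distrib)
    then show "AE \<omega> in M. norm ((w t i \<omega>)\<^sup>2) \<le> norm (A\<^sup>2 * (B t \<omega>)\<^sup>2)" by simp
  qed (use F_M[OF wF[OF that]] in measurable)
  have orth: "integrable M (\<lambda>\<omega>. g \<omega> * of_real (h \<omega>))" "expectation (\<lambda>\<omega>. g \<omega> * of_real (h \<omega>)) = 0"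
    if "g \<in> borel_measurable (F t)" "integrable M g" "h \<in> borel_measurable (H (Suc t))" "integrable M h" "expectation h = 0"
    for g :: "'a \<Rightarrow> complex" and h t
    using indep_mult[of g t "\<lambda>\<omega>. complex_of_real (h \<omega>)"] that by auto
  \<comment> \<open>Conditionally on the past, \<open>cis x\<close> and \<open>exp (- y)\<close> agree up to third-order terms.\<close>
  have step: "cmod (expectation (\<lambda>\<omega>. Y \<omega> * (cis (\<chi> \<omega> * d t \<omega> / sqrt T) - of_real (exp (- (\<chi> \<omega> * v t \<omega> / (2 * T)))))))
      \<le> \<kappa> * ((1 + Kd) / (6 * (T * sqrt T)) + Kv / (8 * T\<^sup>2))"
    if Y: "Y \<in> borel_measurable (F t)" "\<And>\<omega>. cmod (Y \<omega>) \<le> \<kappa>"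
      and \<chi>: "\<chi> \<in> borel_measurable (F t)" "\<And>\<omega>. \<chi> \<omega> \<in> {0, 1}" and T: "T > 0"
    for Y :: "'a \<Rightarrow> complex" and \<chi> :: "'a \<Rightarrow> real" and t and T \<kappa> :: real
  proof -
    have \<kappa>0: "\<kappa> \<ge> 0" using order_trans[OF norm_ge_zero Y(2)] .
    have [measurable]: "Y \<in> borel_measurable M" "\<chi> \<in> borel_measurable M" using Y \<chi> F_M by blast+
    have bdd: "integrable M (\<lambda>\<omega>. Y \<omega> * of_real (\<chi> \<omega> * f \<omega>))" if "integrable M f" for f
    proof (rule Bochner_Integration.integrable_bound[OF integrable_mult_right[OF that, of \<kappa>]])
      have [measurable]: "f \<in> borel_measurable M" using that by auto
      show "(\<lambda>\<omega>. Y \<omega> * of_real (\<chi> \<omega> * f \<omega>)) \<in> borel_measurable M" by measurable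
      have "cmod (Y \<omega> * of_real (\<chi> \<omega> * f \<omega>)) \<le> \<kappa> * \<bar>f \<omega>\<bar>" for \<omega>
        unfolding norm_mult using Y(2) \<chi>(2)[of \<omega>] \<kappa>0 by (intro mult_mono) auto
      then show "AE \<omega> in M. cmod (Y \<omega> * of_real (\<chi> \<omega> * f \<omega>)) \<le> norm (\<kappa> * f \<omega>)"
        using \<kappa>0 by (auto simp: abs_mult)
    qed
    have lin: "integrable M (\<lambda>\<omega>. Y \<omega> * of_real (\<chi> \<omega> * d t \<omega>)) \<and> expectation (\<lambda>\<omega>. Y \<omega> * of_real (\<chi> \<omega> * d t \<omega>)) = 0"
    proof -
      have eq: "Y \<omega> * of_real (\<chi> \<omega> * d t \<omega>) = (\<Sum>i<n. (Y \<omega> * of_real (\<chi> \<omega> * w t i \<omega>)) * of_real (e (Suc t) i \<omega>))" for \<omega>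
        by (simp add: d_eq sum_distrib_left mult_ac)
      have o: "integrable M (\<lambda>\<omega>. (Y \<omega> * of_real (\<chi> \<omega> * w t i \<omega>)) * of_real (e (Suc t) i \<omega>))"
        "expectation (\<lambda>\<omega>. (Y \<omega> * of_real (\<chi> \<omega> * w t i \<omega>)) * of_real (e (Suc t) i \<omega>)) = 0" if "i < n" for i
      proof -
        have m: "(\<lambda>\<omega>. Y \<omega> * of_real (\<chi> \<omega> * w t i \<omega>)) \<in> borel_measurable (F t)"
          using Y(1) \<chi>(1) wF[OF that] by measurable
        have wi: "integrable M (w t i)"
          using square_integrable_imp_integrable[OF F_M[OF wF[OF that]] w2[OF that]] .
        note orth[OF m bdd[OF wi] e_H[OF that] square_bounds(5)[OF that] e_mean[OF that]]
        then show "integrable M (\<lambda>\<omega>. (Y \<omega> * of_real (\<chi> \<omega> * w t i \<omega>)) * of_real (e (Suc t) i \<omega>))"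
          "expectation (\<lambda>\<omega>. (Y \<omega> * of_real (\<chi> \<omega> * w t i \<omega>)) * of_real (e (Suc t) i \<omega>)) = 0" by blast+
      qed
      show ?thesis unfolding eq
        using o by (subst Bochner_Integration.integral_sum) (auto intro!: Bochner_Integration.integrable_sum)
    qed
    \<comment> \<open>Subtracting \<open>v t\<close> replaces every product of two noise entries by
      its centred version, which is independent of the past.\<close>
    have quad: "integrable M (\<lambda>\<omega>. Y \<omega> * of_real (\<chi> \<omega> * ((d t \<omega>)\<^sup>2 - v t \<omega>))) \<and>
      expectation (\<lambda>\<omega>. Y \<omega> * of_real (\<chi> \<omega> * ((d t \<omega>)\<^sup>2 - v t \<omega>))) = 0"
    proof -
      have eq: "Y \<omega> * of_real (\<chi> \<omega> * ((d t \<omega>)\<^sup>2 - v t \<omega>)) =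
        (\<Sum>i<n. \<Sum>k<n. (Y \<omega> * of_real (\<chi> \<omega> * (w t i \<omega> * w t k \<omega>))) * of_real (e (Suc t) i \<omega> * e (Suc t) k \<omega> - Om i k))" for \<omega>
      proof -
        have "(d t \<omega>)\<^sup>2 - v t \<omega> = (\<Sum>i<n. \<Sum>k<n. (w t i \<omega> * w t k \<omega>) * (e (Suc t) i \<omega> * e (Suc t) k \<omega> - Om i k))"
          by (simp add: d_eq v_def power2_eq_square sum_product right_diff_distrib sum_subtractf mult_ac)
        then show ?thesis by (simp add: sum_distrib_left mult_ac)
      qed
      have o: "integrable M (\<lambda>\<omega>. (Y \<omega> * of_real (\<chi> \<omega> * (w t i \<omega> * w t k \<omega>))) * of_real (e (Suc t) i \<omega> * e (Suc t) k \<omega> - Om i k))"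
        "expectation (\<lambda>\<omega>. (Y \<omega> * of_real (\<chi> \<omega> * (w t i \<omega> * w t k \<omega>))) * of_real (e (Suc t) i \<omega> * e (Suc t) k \<omega> - Om i k)) = 0"
        if ik: "i < n" "k < n" for i k
      proof -
        have m: "(\<lambda>\<omega>. Y \<omega> * of_real (\<chi> \<omega> * (w t i \<omega> * w t k \<omega>))) \<in> borel_measurable (F t)"
          using Y(1) \<chi>(1) wF[OF ik(1)] wF[OF ik(2)] by measurable
        have wi: "integrable M (\<lambda>\<omega>. w t i \<omega> * w t k \<omega>)"
          using ik by (intro integrable_square_mult F_M[OF wF] w2)
        have h: "(\<lambda>\<omega>. e (Suc t) i \<omega> * e (Suc t) k \<omega> - Om i k) \<in> borel_measurable (H (Suc t))"
          using e_H[OF ik(1)] e_H[OF ik(2)] by measurable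
        have "expectation (\<lambda>\<omega>. e (Suc t) i \<omega> * e (Suc t) k \<omega> - Om i k) = 0"
          using e_int2[OF ik] e_cov[OF ik] by (simp add: prob_space)
        note orth[OF m bdd[OF wi] h Bochner_Integration.integrable_diff[OF e_int2[OF ik] integrable_const] this]
        then show "integrable M (\<lambda>\<omega>. (Y \<omega> * of_real (\<chi> \<omega> * (w t i \<omega> * w t k \<omega>))) * of_real (e (Suc t) i \<omega> * e (Suc t) k \<omega> - Om i k))"
          "expectation (\<lambda>\<omega>. (Y \<omega> * of_real (\<chi> \<omega> * (w t i \<omega> * w t k \<omega>))) * of_real (e (Suc t) i \<omega> * e (Suc t) k \<omega> - Om i k)) = 0"
          by blast+
      qed
      define g where "g i \<omega> = (\<Sum>k<n. (Y \<omega> * of_real (\<chi> \<omega> * (w t i \<omega> * w t k \<omega>))) * of_real (e (Suc t) i \<omega> * e (Suc t) k \<omega> - Om i k))" for i \<omega>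
      have "integrable M (g i) \<and> expectation (g i) = 0" if "i < n" for i
        unfolding g_def using o that by (subst Bochner_Integration.integral_sum) (auto intro!: Bochner_Integration.integrable_sum simp del: of_real_diff of_real_mult)
      then show ?thesis unfolding eq g_def[symmetric]
        by (subst Bochner_Integration.integral_sum) (auto intro!: Bochner_Integration.integrable_sum)
    qed
    define x where "x \<omega> = \<chi> \<omega> * d t \<omega> / sqrt T" for \<omega>
    define y where "y \<omega> = \<chi> \<omega> * v t \<omega> / (2 * T)" for \<omega>
    have [measurable]: "x \<in> borel_measurable M" "y \<in> borel_measurable M" unfolding x_def[abs_def] y_def[abs_def] by measurable
    \<comment> \<open>Second-order expansion of \<open>cis x - exp (- y)\<close>, grouped so that
      each part is a centred noise term times something known at time \<open>t\<close>. Its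
      expectation against \<open>Y\<close> is zero, and only the remainder \<open>R\<close> has to
      be estimated.\<close>
    define p where "p \<omega> = \<i> * complex_of_real (x \<omega>) - of_real ((x \<omega>)\<^sup>2 / 2 - y \<omega>)" for \<omega>
    have Yp: "Y \<omega> * p \<omega> = (\<i> / of_real (sqrt T)) * (Y \<omega> * of_real (\<chi> \<omega> * d t \<omega>)) -
        of_real (1 / (2 * T)) * (Y \<omega> * of_real (\<chi> \<omega> * ((d t \<omega>)\<^sup>2 - v t \<omega>)))" for \<omega>
    proof -
      \<comment> \<open>Here \<open>\<chi>\<close> equals its own square, because its values are
        \<open>0\<close> and \<open>1\<close>.\<close>
      have "(x \<omega>)\<^sup>2 / 2 - y \<omega> = 1 / (2 * T) * (\<chi> \<omega> * ((d t \<omega>)\<^sup>2 - v t \<omega>))"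
        using T \<chi>(2)[of \<omega>] by (auto simp: x_def y_def power_divide power_mult_distrib field_simps)
      then show ?thesis unfolding p_def by (simp only:) (simp add: x_def algebra_simps)
    qed
    have Ip: "integrable M (\<lambda>\<omega>. Y \<omega> * p \<omega>)" "expectation (\<lambda>\<omega>. Y \<omega> * p \<omega>) = 0"
      unfolding Yp using lin quad by simp_all
    define R where "R \<omega> = cis (x \<omega>) - of_real (exp (- y \<omega>)) - p \<omega>" for \<omega>
    define b where "b \<omega> = \<kappa> * ((1 + d t \<omega> ^ 4) / (6 * (T * sqrt T)) + (v t \<omega>)\<^sup>2 / (8 * T\<^sup>2))" for \<omega>
    have Rle: "cmod (Y \<omega> * R \<omega>) \<le> b \<omega>" for \<omega>
    proof -
      have y0: "y \<omega> \<ge> 0" using v0 \<chi>(2)[of \<omega>] T by (auto simp: y_def)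
      have "R \<omega> = (cis (x \<omega>) - (1 + \<i> * of_real (x \<omega>) - of_real ((x \<omega>)\<^sup>2 / 2))) - of_real (exp (- y \<omega>) - (1 - y \<omega>))"
        by (simp add: R_def p_def)
      then have "cmod (R \<omega>) \<le> cmod (cis (x \<omega>) - (1 + \<i> * of_real (x \<omega>) - of_real ((x \<omega>)\<^sup>2 / 2))) + cmod (of_real (exp (- y \<omega>) - (1 - y \<omega>)))"
        by (simp only: norm_triangle_ineq4)
      also have "\<dots> \<le> \<bar>x \<omega>\<bar> ^ 3 / 6 + (y \<omega>)\<^sup>2 / 2"
        unfolding norm_of_real by (intro add_mono cis_Taylor_quadratic exp_minus_Taylor_quadratic y0)
      also have "\<dots> \<le> (1 + d t \<omega> ^ 4) / (6 * (T * sqrt T)) + (v t \<omega>)\<^sup>2 / (8 * T\<^sup>2)"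
      proof (rule add_mono)
        have "\<bar>x \<omega>\<bar> ^ 3 \<le> \<bar>d t \<omega>\<bar> ^ 3 / (T * sqrt T)"
          using T \<chi>(2)[of \<omega>] by (auto simp: x_def power_divide abs_mult power3_eq_cube)
        also have "\<dots> \<le> (1 + d t \<omega> ^ 4) / (T * sqrt T)"
          using T by (intro divide_right_mono abs_le_1_plus_power4) simp
        finally have "\<bar>x \<omega>\<bar> ^ 3 / 6 \<le> (1 + d t \<omega> ^ 4) / (T * sqrt T) / 6" by (rule divide_right_mono) simp
        then show "\<bar>x \<omega>\<bar> ^ 3 / 6 \<le> (1 + d t \<omega> ^ 4) / (6 * (T * sqrt T))"
          by (simp only: divide_divide_eq_left mult.commute[of _ "6::real"])
        have "(y \<omega>)\<^sup>2 \<le> (v t \<omega>)\<^sup>2 / (4 * T\<^sup>2)"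
          using T \<chi>(2)[of \<omega>] by (auto simp: y_def power_divide power_mult_distrib)
        then show "(y \<omega>)\<^sup>2 / 2 \<le> (v t \<omega>)\<^sup>2 / (8 * T\<^sup>2)" by simp
      qed
      finally show ?thesis unfolding norm_mult b_def using Y(2) \<kappa>0 by (intro mult_mono) auto
    qed
    have bI: "integrable M b" unfolding b_def using d4 v2 by simp
    have [measurable]: "p \<in> borel_measurable M" "R \<in> borel_measurable M" unfolding p_def[abs_def] R_def[abs_def] by measurable
    have RI: "integrable M (\<lambda>\<omega>. Y \<omega> * R \<omega>)"
      by (rule Bochner_Integration.integrable_bound[OF bI]) (auto intro!: AE_I2 order_trans[OF Rle abs_ge_self])
    have "expectation (\<lambda>\<omega>. Y \<omega> * (cis (x \<omega>) - of_real (exp (- y \<omega>)))) = expectation (\<lambda>\<omega>. Y \<omega> * p \<omega> + Y \<omega> * R \<omega>)"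
      by (simp add: R_def algebra_simps)
    also have "\<dots> = expectation (\<lambda>\<omega>. Y \<omega> * R \<omega>)" using Ip RI by simp
    finally have "cmod (expectation (\<lambda>\<omega>. Y \<omega> * (cis (x \<omega>) - of_real (exp (- y \<omega>))))) \<le> expectation b"
      using norm_integral_le_integral[OF RI bI Rle] by simp
    also have "expectation b = \<kappa> * ((1 + expectation (\<lambda>\<omega>. d t \<omega> ^ 4)) / (6 * (T * sqrt T)) + expectation (\<lambda>\<omega>. (v t \<omega>)\<^sup>2) / (8 * T\<^sup>2))"
      unfolding b_def using d4 v2 by (simp add: prob_space)
    also have "\<dots> \<le> \<kappa> * ((1 + Kd) / (6 * (T * sqrt T)) + Kv / (8 * T\<^sup>2))"
      using d4 v2 \<kappa>0 T by (intro mult_left_mono add_mono divide_right_mono) auto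
    finally show ?thesis by (simp add: x_def y_def)
  qed
  \<comment> \<open>The cutoff lies \<open>1\<close> above \<open>\<bar>\<sigma>\<bar>\<close>, so
    exceeding it means that the average variance is off by at least \<open>1\<close>.
    \<open>\<kappa>\<close> bounds the exponential of half the truncated variance, and
    \<open>C0\<close> covers the two cases of \<open>path\<close> at once.\<close>
  define \<Lambda> where "\<Lambda> = \<bar>\<sigma>\<bar> + 1"
  define \<kappa> where "\<kappa> = exp (\<Lambda> / 2)"
  define V where "V T \<omega> = (\<Sum>t<T. v t \<omega>) / real T" for T \<omega>
  define C0 where "C0 = 1 + exp \<Lambda> + \<kappa> * exp \<bar>\<sigma>\<bar>"
  have bound: "cmod (expectation (\<lambda>\<omega>. cis ((\<Sum>t<T. d t \<omega>) / sqrt T)) - of_real (exp (- \<sigma> / 2))) \<le>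
      C0 * expectation (\<lambda>\<omega>. \<bar>V T \<omega> - \<sigma>\<bar>) + exp (- \<sigma> / 2) * (T * (\<kappa> * ((1 + Kd) / (6 * (T * sqrt T)) + Kv / (8 * (real T)\<^sup>2))))"
    if T: "T > 0" for T :: nat
  proof -
    \<comment> \<open>The sum includes the index \<open>t\<close>, whose variance is already known
      at time \<open>t\<close>. Truncation is therefore decided before the step is taken, and the
      accumulated variance never overshoots \<open>\<Lambda>\<close>.\<close>
    define U where "U t \<omega> = (\<Sum>s\<le>t. v s \<omega>) / real T" for t \<omega>
    define \<chi> where "\<chi> t \<omega> = (if U t \<omega> \<le> \<Lambda> then 1 else 0 :: real)" for t \<omega>
    define x where "x t \<omega> = \<chi> t \<omega> * d t \<omega> / sqrt T" for t \<omega>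
    define y where "y t \<omega> = \<chi> t \<omega> * v t \<omega> / (2 * real T)" for t \<omega>
    define Z where "Z t \<omega> = cis (\<Sum>s<t. x s \<omega>) * of_real (exp (\<Sum>s<t. y s \<omega>))" for t \<omega>
    \<comment> \<open>The phase stops before step \<open>t\<close>, but the exponential already
      includes it. This makes \<open>Y t\<close> measurable at time \<open>t\<close> and turns the
      increment of \<open>Z\<close> into \<open>Y t\<close> times the difference estimated in
      \<open>step\<close>.\<close>
    define Y where "Y t \<omega> = cis (\<Sum>s<t. x s \<omega>) * of_real (exp (\<Sum>s<Suc t. y s \<omega>))" for t \<omega>
    have UF: "U t \<in> borel_measurable (F t)" for t
      unfolding U_def by (intro borel_measurable_divide borel_measurable_sum borel_measurable_const F_trans[OF vF]) auto
    have \<chi>F: "\<chi> t \<in> borel_measurable (F t)" for t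
      unfolding \<chi>_def using UF[of t] by measurable
    have xF: "x t \<in> borel_measurable (F (Suc t))" and yF: "y t \<in> borel_measurable (F t)" for t
      unfolding x_def y_def
      by (intro borel_measurable_divide borel_measurable_times borel_measurable_const F_trans[OF \<chi>F] dF; simp)
         (intro borel_measurable_divide borel_measurable_times borel_measurable_const \<chi>F vF)
    have sx: "(\<lambda>\<omega>. \<Sum>s<t. x s \<omega>) \<in> borel_measurable (F t)" for t
      by (intro borel_measurable_sum F_trans[OF xF]) auto
    have sy: "(\<lambda>\<omega>. \<Sum>s<Suc t. y s \<omega>) \<in> borel_measurable (F t)" for t
      by (intro borel_measurable_sum F_trans[OF yF]) auto
    have YF: "Y t \<in> borel_measurable (F t)" for t
      unfolding Y_def using sx[of t] sy[of t] by measurable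
    have ZM: "Z t \<in> borel_measurable M" for t
    proof -
      have "(\<lambda>\<omega>. \<Sum>s<t. y s \<omega>) \<in> borel_measurable M" by (intro borel_measurable_sum F_M[OF yF])
      then show ?thesis unfolding Z_def using F_M[OF sx[of t]] by measurable
    qed
    \<comment> \<open>If \<open>U t \<le> \<Lambda>\<close>, dropping the indicators from
      nonnegative terms bounds the sum by \<open>U t / 2\<close>; otherwise the new term is
      zero.\<close>
    have yle: "(\<Sum>s<t. y s \<omega>) \<le> \<Lambda> / 2" for t \<omega>
    proof (induction t)
      case 0
      then show ?case by (simp add: \<Lambda>_def)
    next
      case (Suc t)
      show ?case
      proof (cases "U t \<omega> \<le> \<Lambda>")
        case True
        have "(\<Sum>s<Suc t. y s \<omega>) \<le> (\<Sum>s<Suc t. v s \<omega> / (2 * real T))"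
          using v0 T by (intro sum_mono) (auto simp: y_def \<chi>_def)
        also have "\<dots> = U t \<omega> / 2" by (simp add: U_def sum_divide_distrib lessThan_Suc_atMost mult.commute)
        finally show ?thesis using True by simp
      next
        case False
        then show ?thesis using Suc by (simp add: y_def \<chi>_def)
      qed
    qed
    have Zle: "cmod (Z t \<omega>) \<le> \<kappa>" and Yle: "cmod (Y t \<omega>) \<le> \<kappa>" for t \<omega>
      unfolding Z_def Y_def norm_mult norm_cis norm_of_real \<kappa>_def abs_exp_cancel mult_1 exp_le_cancel_iff by (rule yle)+
    have ZI: "integrable M (Z t)" for t
      by (rule integrable_const_bound[of _ \<kappa>]) (auto simp: Zle ZM)
    have Zstep: "Z (Suc t) \<omega> - Z t \<omega> = Y t \<omega> * (cis (x t \<omega>) - of_real (exp (- y t \<omega>)))" for t \<omega>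
    proof -
      have "exp (\<Sum>s<t. y s \<omega>) = exp (\<Sum>s<Suc t. y s \<omega>) * exp (- y t \<omega>)" by (simp add: mult_exp_exp)
      moreover have "cis (\<Sum>s<Suc t. x s \<omega>) = cis (\<Sum>s<t. x s \<omega>) * cis (x t \<omega>)" by (simp add: cis_mult)
      ultimately show ?thesis unfolding Z_def Y_def by (simp only: of_real_mult) (simp only: algebra_simps)
    qed
    let ?b = "\<kappa> * ((1 + Kd) / (6 * (T * sqrt T)) + Kv / (8 * (real T)\<^sup>2))"
    have EZ: "cmod (expectation (Z t) - 1) \<le> t * ?b" for t :: nat
    proof (induction t)
      case 0
      then show ?case by (simp add: Z_def prob_space)
    next
      case (Suc t)
      have "expectation (Z (Suc t)) - expectation (Z t) = expectation (\<lambda>\<omega>. Z (Suc t) \<omega> - Z t \<omega>)"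
        using ZI by simp
      also have "cmod \<dots> \<le> ?b"
        unfolding Zstep x_def y_def by (rule step[OF YF Yle \<chi>F]) (use T in \<open>auto simp: \<chi>_def\<close>)
      finally have "cmod ((expectation (Z (Suc t)) - expectation (Z t)) + (expectation (Z t) - 1)) \<le> ?b + t * ?b"
        using Suc norm_triangle_mono by blast
      moreover have "real (Suc t) * z = z + t * z" for z :: real by (simp add: algebra_simps)
      moreover have "(z1 - z2) + (z2 - 1) = z1 - 1" for z1 z2 :: complex by simp
      ultimately show ?case by (simp only:)
    qed
    \<comment> \<open>If \<open>V T \<le> \<Lambda>\<close>, no step was truncated and the
      comparison is exact up to the exponential of half of \<open>V T - \<sigma>\<close>. Otherwise
      \<open>\<bar>V T - \<sigma>\<bar>\<close> is at least \<open>1\<close> and absorbs the crude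
      bound.\<close>
    have path: "cmod (cis ((\<Sum>t<T. d t \<omega>) / sqrt T) - of_real (exp (- \<sigma> / 2)) * Z T \<omega>) \<le> C0 * \<bar>V T \<omega> - \<sigma>\<bar>" for \<omega>
    proof (cases "V T \<omega> \<le> \<Lambda>")
      case True
      have "U t \<omega> \<le> \<Lambda>" if "t < T" for t
      proof -
        have "(\<Sum>s\<le>t. v s \<omega>) \<le> (\<Sum>s<T. v s \<omega>)" using v0 that by (intro sum_mono2) auto
        then have "U t \<omega> \<le> V T \<omega>" unfolding U_def V_def by (intro divide_right_mono) auto
        then show ?thesis using True by simp
      qed
      then have "(\<Sum>s<T. x s \<omega>) = (\<Sum>t<T. d t \<omega>) / sqrt T" "(\<Sum>s<T. y s \<omega>) = V T \<omega> / 2"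
        by (simp_all add: x_def y_def \<chi>_def V_def sum_divide_distrib mult.commute)
      then have "of_real (exp (- \<sigma> / 2)) * Z T \<omega> = cis ((\<Sum>t<T. d t \<omega>) / sqrt T) * of_real (exp ((V T \<omega> - \<sigma>) / 2))"
        by (simp add: Z_def mult.left_commute mult_exp_exp diff_divide_distrib flip: of_real_mult)
      then have "cis ((\<Sum>t<T. d t \<omega>) / sqrt T) - of_real (exp (- \<sigma> / 2)) * Z T \<omega> =
          cis ((\<Sum>t<T. d t \<omega>) / sqrt T) * of_real (- (exp ((V T \<omega> - \<sigma>) / 2) - 1))"
        by (simp add: algebra_simps)
      then have "cmod (cis ((\<Sum>t<T. d t \<omega>) / sqrt T) - of_real (exp (- \<sigma> / 2)) * Z T \<omega>) = \<bar>exp ((V T \<omega> - \<sigma>) / 2) - 1\<bar>"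
        by (simp only: norm_mult norm_cis norm_of_real abs_minus_cancel mult_1)
      also have "\<dots> \<le> \<bar>(V T \<omega> - \<sigma>) / 2\<bar> * exp \<bar>(V T \<omega> - \<sigma>) / 2\<bar>" by (rule abs_exp_minus_1_le)
      also have "\<dots> \<le> \<bar>V T \<omega> - \<sigma>\<bar> * C0"
      proof (rule mult_mono)
        have "V T \<omega> \<ge> 0" using v0 by (simp add: V_def sum_nonneg)
        then have "\<bar>(V T \<omega> - \<sigma>) / 2\<bar> \<le> \<Lambda>" using True by (simp add: \<Lambda>_def)
        then have "exp \<bar>(V T \<omega> - \<sigma>) / 2\<bar> \<le> exp \<Lambda>" by simp
        also have "\<dots> \<le> C0" by (simp add: C0_def \<kappa>_def)
        finally show "exp \<bar>(V T \<omega> - \<sigma>) / 2\<bar> \<le> C0" .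
      qed (auto simp: C0_def)
      finally show ?thesis by (simp add: mult.commute)
    next
      case False
      have "cmod (cis ((\<Sum>t<T. d t \<omega>) / sqrt T) - of_real (exp (- \<sigma> / 2)) * Z T \<omega>) \<le> 1 + exp (- \<sigma> / 2) * cmod (Z T \<omega>)"
        using norm_triangle_ineq4[of "cis ((\<Sum>t<T. d t \<omega>) / sqrt T)" "of_real (exp (- \<sigma> / 2)) * Z T \<omega>"] by (simp add: norm_mult)
      also have "\<dots> \<le> 1 + exp \<bar>\<sigma>\<bar> * \<kappa>" by (intro add_left_mono mult_mono Zle) auto
      also have "\<dots> \<le> C0 * 1" by (simp add: C0_def mult.commute)
      also have "\<dots> \<le> C0 * \<bar>V T \<omega> - \<sigma>\<bar>"
        using False by (intro mult_left_mono) (auto simp: \<Lambda>_def C0_def \<kappa>_def)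
      finally show ?thesis .
    qed
    have cI: "integrable M (\<lambda>\<omega>. cis ((\<Sum>t<T. d t \<omega>) / sqrt T))"
      by (rule integrable_const_bound[of _ 1]) auto
    have vI: "integrable M (v t)" for t
      using square_integrable_imp_integrable[OF vM v2(1)] .
    have VI: "integrable M (\<lambda>\<omega>. C0 * \<bar>V T \<omega> - \<sigma>\<bar>)" unfolding V_def using vI by simp
    have "expectation (\<lambda>\<omega>. cis ((\<Sum>t<T. d t \<omega>) / sqrt T)) - of_real (exp (- \<sigma> / 2)) =
        expectation (\<lambda>\<omega>. cis ((\<Sum>t<T. d t \<omega>) / sqrt T) - of_real (exp (- \<sigma> / 2)) * Z T \<omega>) + of_real (exp (- \<sigma> / 2)) * (expectation (Z T) - 1)"
      using cI ZI by (simp add: algebra_simps)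
    also have "cmod \<dots> \<le> expectation (\<lambda>\<omega>. C0 * \<bar>V T \<omega> - \<sigma>\<bar>) + exp (- \<sigma> / 2) * (T * ?b)"
    proof (rule norm_triangle_mono)
      show "cmod (expectation (\<lambda>\<omega>. cis ((\<Sum>t<T. d t \<omega>) / sqrt T) - of_real (exp (- \<sigma> / 2)) * Z T \<omega>)) \<le> expectation (\<lambda>\<omega>. C0 * \<bar>V T \<omega> - \<sigma>\<bar>)"
        using cI ZI by (intro norm_integral_le_integral VI path) auto
      show "cmod (of_real (exp (- \<sigma> / 2)) * (expectation (Z T) - 1)) \<le> exp (- \<sigma> / 2) * (T * ?b)"
        unfolding norm_mult using EZ by (intro mult_mono) auto
    qed
    finally show ?thesis by simp
  qed
  \<comment> \<open>\<open>V T - \<sigma>\<close> is a fixed linear combination of the errors of the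
    second-moment averages.\<close>
  have "L1_null (\<lambda>T \<omega>. \<Sum>i<n. \<Sum>k<n. \<Sum>j<n. \<Sum>l<n. a j i * a l k * Om i k * ((\<Sum>t<T. W t j \<omega> * W t l \<omega>) / real T - Gam j l))"
  proof (intro L1_null_sum L1_null_mult)
    fix j l assume "j \<in> {..<n}" "l \<in> {..<n}"
    then show "L1_null (\<lambda>T \<omega>. (\<Sum>t<T. W t j \<omega> * W t l \<omega>) / real T - Gam j l)"
      unfolding L1_null_def using second_moment_average[of j l] by (auto intro!: Bochner_Integration.integrable_sum W_int2)
  qed auto
  moreover have "(\<Sum>i<n. \<Sum>k<n. \<Sum>j<n. \<Sum>l<n. a j i * a l k * Om i k * ((\<Sum>t<T. W t j \<omega> * W t l \<omega>) / real T - Gam j l)) = V T \<omega> - \<sigma>" for T \<omega>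
  proof -
    have "v t \<omega> = (\<Sum>i<n. \<Sum>k<n. \<Sum>j<n. \<Sum>l<n. a j i * a l k * Om i k * (W t j \<omega> * W t l \<omega>))" for t
    proof -
      have "w t i \<omega> * w t k \<omega> * Om i k = (\<Sum>j<n. \<Sum>l<n. a j i * a l k * Om i k * (W t j \<omega> * W t l \<omega>))" for i k
        unfolding w_def sum_product unfolding sum_distrib_right by (intro sum.cong refl) (simp only: mult_ac)
      then show ?thesis by (simp only: v_def)
    qed
    then have "V T \<omega> = (\<Sum>t<T. \<Sum>i<n. \<Sum>k<n. \<Sum>j<n. \<Sum>l<n. a j i * a l k * Om i k * (W t j \<omega> * W t l \<omega>)) / T"
      by (simp add: V_def)
    also have "(\<Sum>t<T. \<Sum>i<n. \<Sum>k<n. \<Sum>j<n. \<Sum>l<n. a j i * a l k * Om i k * (W t j \<omega> * W t l \<omega>)) =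
        (\<Sum>i<n. \<Sum>k<n. \<Sum>j<n. \<Sum>l<n. a j i * a l k * Om i k * (\<Sum>t<T. W t j \<omega> * W t l \<omega>))"
    proof -
      have "(\<Sum>t<T. \<Sum>i<n. f t i) = (\<Sum>i<n. \<Sum>t<T. f t i)" for f :: "nat \<Rightarrow> nat \<Rightarrow> real" by (rule sum.swap)
      then show ?thesis by (simp only: sum_distrib_left)
    qed
    also have "\<dots> / T = (\<Sum>i<n. \<Sum>k<n. \<Sum>j<n. \<Sum>l<n. a j i * a l k * Om i k * ((\<Sum>t<T. W t j \<omega> * W t l \<omega>) / T))"
    proof -
      have "(\<Sum>i<n. \<Sum>k<n. \<Sum>j<n. \<Sum>l<n. f i k j l * g j l) / T = (\<Sum>i<n. \<Sum>k<n. \<Sum>j<n. \<Sum>l<n. f i k j l * (g j l / T))"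
        for f :: "nat \<Rightarrow> nat \<Rightarrow> nat \<Rightarrow> nat \<Rightarrow> real" and g
        by (simp add: sum_divide_distrib)
      from this[of "\<lambda>i k j l. a j i * a l k * Om i k" "\<lambda>j l. \<Sum>t<T. W t j \<omega> * W t l \<omega>"]
      show ?thesis .
    qed
    finally show ?thesis unfolding \<sigma>_def by (simp only: right_diff_distrib sum_subtractf)
  qed
  ultimately have Vnull: "(\<lambda>T. expectation (\<lambda>\<omega>. \<bar>V T \<omega> - \<sigma>\<bar>)) \<longlonglongrightarrow> 0"
    by (simp add: L1_null_def)
  have "(\<lambda>T. expectation (\<lambda>\<omega>. cis ((\<Sum>t<T. d t \<omega>) / sqrt (real T))) - of_real (exp (- \<sigma> / 2))) \<longlonglongrightarrow> 0"
  proof (rule tendsto_norm_zero_cancel, rule tendsto_zero_sandwich[OF _ bound])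
    \<comment> \<open>Each of the \<open>T\<close> steps errs by order
      \<open>1 / (T * sqrt T)\<close>, so the total error is of order
      \<open>1 / sqrt T\<close>.\<close>
    have "(\<lambda>T. T * (\<kappa> * ((1 + Kd) / (6 * (T * sqrt T)) + Kv / (8 * (real T)\<^sup>2)))) \<longlonglongrightarrow> 0"
      by real_asymp
    then have "(\<lambda>T. C0 * expectation (\<lambda>\<omega>. \<bar>V T \<omega> - \<sigma>\<bar>) + exp (- \<sigma> / 2) * (T * (\<kappa> * ((1 + Kd) / (6 * (T * sqrt T)) + Kv / (8 * (real T)\<^sup>2))))) \<longlonglongrightarrow> C0 * 0 + exp (- \<sigma> / 2) * 0"
      by (intro tendsto_add tendsto_mult tendsto_const Vnull)
    then show "(\<lambda>T. C0 * expectation (\<lambda>\<omega>. \<bar>V T \<omega> - \<sigma>\<bar>) + exp (- \<sigma> / 2) * (T * (\<kappa> * ((1 + Kd) / (6 * (T * sqrt T)) + Kv / (8 * (real T)\<^sup>2))))) \<longlonglongrightarrow> 0"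
      by simp
  qed auto
  then show ?thesis by (rule LIM_zero_cancel)
qed

end

subsection \<open>Stationary autoregressive processes\<close>

locale var_process = var_noise +
  fixes x :: "nat \<Rightarrow> nat \<Rightarrow> 'a \<Rightarrow> real" and Gam :: "nat \<Rightarrow> nat \<Rightarrow> real"
  assumes x_M: "\<And>t i. i < n \<Longrightarrow> x t i \<in> borel_measurable M"
    and x_square: "\<And>t i. i < n \<Longrightarrow> integrable M (\<lambda>\<omega>. (x t i \<omega>)\<^sup>2)"
    and x_eq: "\<And>t i. i < n \<Longrightarrow> AE \<omega> in M. x (Suc t) i \<omega> = (\<Sum>j<n. P i j * x t j \<omega>) + e (Suc t) i \<omega>"
    and x_cov: "\<And>t i j. i < n \<Longrightarrow> j < n \<Longrightarrow> expectation (\<lambda>\<omega>. x t i \<omega> * x t j \<omega>) = Gam i j"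
begin

definition initial :: "'a \<Rightarrow> real" where "initial \<omega> = (\<Sum>j<n. \<bar>x 0 j \<omega>\<bar>)"

lemma initial_M[measurable]: "initial \<in> borel_measurable M"
  unfolding initial_def using x_M by (intro borel_measurable_sum borel_measurable_abs) auto

lemma initial_nonneg: "initial \<omega> \<ge> 0" by (simp add: initial_def sum_nonneg)

lemma initial_square: "integrable M (\<lambda>\<omega>. (initial \<omega>)\<^sup>2)"
proof (rule Bochner_Integration.integrable_bound)
  show "integrable M (\<lambda>\<omega>. (\<Sum>j<n. (x 0 j \<omega>)\<^sup>2) * real n)"
    using x_square by (intro integrable_mult_left Bochner_Integration.integrable_sum) auto
  have "(initial \<omega>)\<^sup>2 \<le> (\<Sum>j<n. (x 0 j \<omega>)\<^sup>2) * real n" for \<omega>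
    using sum_squared_le_sum_of_squares[of "\<lambda>j. \<bar>x 0 j \<omega>\<bar>" "{..<n}"] by (simp add: initial_def)
  then show "AE \<omega> in M. norm ((initial \<omega>)\<^sup>2) \<le> norm ((\<Sum>j<n. (x 0 j \<omega>)\<^sup>2) * real n)"
    by (auto intro: order_trans[OF _ abs_ge_self])
qed measurable

text \<open>Both processes receive the same noise, so their difference solves the noise-free
  recursion and is the value of \<open>x\<close> at time \<open>0\<close> carried along by the
  powers of \<open>P\<close>.\<close>

lemma x_minus_W: "AE \<omega> in M. \<forall>t. \<forall>i<n. \<bar>x t i \<omega> - W t i \<omega>\<bar> \<le> c * r ^ t * initial \<omega>"
proof -
  have "AE \<omega> in M. \<forall>t. \<forall>i\<in>{..<n}. x (Suc t) i \<omega> = (\<Sum>j<n. P i j * x t j \<omega>) + e (Suc t) i \<omega>"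
    unfolding AE_all_countable by (intro allI AE_ball_countable') (auto intro: x_eq)
  then show ?thesis
  proof (rule AE_mp, intro AE_I2 impI allI)
    fix \<omega> t i assume eq: "\<forall>t. \<forall>i\<in>{..<n}. x (Suc t) i \<omega> = (\<Sum>j<n. P i j * x t j \<omega>) + e (Suc t) i \<omega>" and i: "i < n"
    have "\<bar>x t i \<omega> - W t i \<omega>\<bar> \<le> c * r ^ t * (\<Sum>j\<in>{..<n}. \<bar>x 0 j \<omega> - W 0 j \<omega>\<bar>) + (\<Sum>s<t. c * r ^ s * (\<Sum>j\<in>{..<n}. \<bar>0\<bar>))"
      by (rule linear_recursion_bound[where u = "\<lambda>t i. x t i \<omega> - W t i \<omega>" and z = "\<lambda>_ _. 0" and m = t, OF _ decay])
         (use i eq in \<open>auto simp: right_diff_distrib sum_subtractf\<close>)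
    then show "\<bar>x t i \<omega> - W t i \<omega>\<bar> \<le> c * r ^ t * initial \<omega>" by (simp add: initial_def)
  qed
qed

lemma r_le_1: "0 \<le> r ^ t" "c * r ^ t \<ge> 0" using cr by auto

text \<open>Since \<open>x\<close> has only second moments, its deviation from the path is bounded
  in L1 against a square-integrable partner; that partner will be \<open>x\<close> itself, the path
  or the noise.\<close>

lemma x_minus_W_mult:
  assumes i: "i < n" and f[measurable]: "f \<in> borel_measurable M" and f2: "integrable M (\<lambda>\<omega>. (f \<omega>)\<^sup>2)"
  shows "integrable M (\<lambda>\<omega>. (x t i \<omega> - W t i \<omega>) * f \<omega>)"
    "expectation (\<lambda>\<omega>. \<bar>(x t i \<omega> - W t i \<omega>) * f \<omega>\<bar>) \<le>
      c * r ^ t * (expectation (\<lambda>\<omega>. (initial \<omega>)\<^sup>2) + expectation (\<lambda>\<omega>. (f \<omega>)\<^sup>2))"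
proof -
  have [measurable]: "x t i \<in> borel_measurable M" "W t i \<in> borel_measurable M" using x_M i by auto
  have le: "AE \<omega> in M. \<bar>(x t i \<omega> - W t i \<omega>) * f \<omega>\<bar> \<le> c * r ^ t * ((initial \<omega>)\<^sup>2 + (f \<omega>)\<^sup>2)"
    using x_minus_W
  proof (rule AE_mp, intro AE_I2 impI)
    fix \<omega> assume "\<forall>t. \<forall>i<n. \<bar>x t i \<omega> - W t i \<omega>\<bar> \<le> c * r ^ t * initial \<omega>"
    then have "\<bar>x t i \<omega> - W t i \<omega>\<bar> * \<bar>f \<omega>\<bar> \<le> c * r ^ t * initial \<omega> * \<bar>f \<omega>\<bar>"
      using i by (intro mult_right_mono) auto
    also have "\<dots> = c * r ^ t * \<bar>initial \<omega> * f \<omega>\<bar>" using initial_nonneg by (simp add: abs_mult)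
    also have "\<dots> \<le> c * r ^ t * ((initial \<omega>)\<^sup>2 + (f \<omega>)\<^sup>2)" by (intro mult_left_mono abs_mult_le_sum_squares r_le_1)
    finally show "\<bar>(x t i \<omega> - W t i \<omega>) * f \<omega>\<bar> \<le> c * r ^ t * ((initial \<omega>)\<^sup>2 + (f \<omega>)\<^sup>2)" by (simp add: abs_mult)
  qed
  have b: "integrable M (\<lambda>\<omega>. c * r ^ t * ((initial \<omega>)\<^sup>2 + (f \<omega>)\<^sup>2))" using initial_square f2 by simp
  show I: "integrable M (\<lambda>\<omega>. (x t i \<omega> - W t i \<omega>) * f \<omega>)"
    by (rule Bochner_Integration.integrable_bound[OF b]) (measurable, use le in \<open>auto elim!: eventually_mono\<close>)
  have "expectation (\<lambda>\<omega>. \<bar>(x t i \<omega> - W t i \<omega>) * f \<omega>\<bar>) \<le> expectation (\<lambda>\<omega>. c * r ^ t * ((initial \<omega>)\<^sup>2 + (f \<omega>)\<^sup>2))"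
    by (rule integral_mono_AE[OF integrable_abs[OF I] b le])
  then show "expectation (\<lambda>\<omega>. \<bar>(x t i \<omega> - W t i \<omega>) * f \<omega>\<bar>) \<le>
      c * r ^ t * (expectation (\<lambda>\<omega>. (initial \<omega>)\<^sup>2) + expectation (\<lambda>\<omega>. (f \<omega>)\<^sup>2))"
    using initial_square f2 by simp
qed

lemma x_prod_minus_W_prod:
  assumes ij: "i < n" "j < n"
  shows "integrable M (\<lambda>\<omega>. x t i \<omega> * x t j \<omega> - W t i \<omega> * W t j \<omega>)"
    "expectation (\<lambda>\<omega>. \<bar>x t i \<omega> * x t j \<omega> - W t i \<omega> * W t j \<omega>\<bar>) \<le>
       (c * (2 * expectation (\<lambda>\<omega>. (initial \<omega>)\<^sup>2) + Gam j j + (1 + K4))) * r ^ t"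
proof -
  have eq: "x t i \<omega> * x t j \<omega> - W t i \<omega> * W t j \<omega> = (x t i \<omega> - W t i \<omega>) * x t j \<omega> + (x t j \<omega> - W t j \<omega>) * W t i \<omega>" for \<omega>
    by (simp add: algebra_simps)
  note 1 = x_minus_W_mult[OF ij(1) x_M[OF ij(2)] x_square[OF ij(2)], of t t]
    and 2 = x_minus_W_mult[OF ij(2) W_M[OF ij(1)] square_bounds(3)[OF ij(1)], of t t]
  show "integrable M (\<lambda>\<omega>. x t i \<omega> * x t j \<omega> - W t i \<omega> * W t j \<omega>)" unfolding eq using 1 2 by simp
  have "expectation (\<lambda>\<omega>. \<bar>x t i \<omega> * x t j \<omega> - W t i \<omega> * W t j \<omega>\<bar>) \<le>
      expectation (\<lambda>\<omega>. \<bar>(x t i \<omega> - W t i \<omega>) * x t j \<omega>\<bar> + \<bar>(x t j \<omega> - W t j \<omega>) * W t i \<omega>\<bar>)"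
    unfolding eq using 1 2 by (intro integral_mono abs_triangle_ineq) auto
  also have "\<dots> \<le> c * r ^ t * (expectation (\<lambda>\<omega>. (initial \<omega>)\<^sup>2) + expectation (\<lambda>\<omega>. (x t j \<omega>)\<^sup>2)) +
      c * r ^ t * (expectation (\<lambda>\<omega>. (initial \<omega>)\<^sup>2) + expectation (\<lambda>\<omega>. (W t i \<omega>)\<^sup>2))"
    using 1 2 by (simp add: add_mono)
  also have "\<dots> \<le> c * r ^ t * (expectation (\<lambda>\<omega>. (initial \<omega>)\<^sup>2) + Gam j j) +
      c * r ^ t * (expectation (\<lambda>\<omega>. (initial \<omega>)\<^sup>2) + (1 + K4))"
    using x_cov[OF ij(2) ij(2), of t] square_bounds(4)[OF ij(1)]
    by (intro add_mono mult_left_mono r_le_1) (auto simp: power2_eq_square)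
  finally show "expectation (\<lambda>\<omega>. \<bar>x t i \<omega> * x t j \<omega> - W t i \<omega> * W t j \<omega>\<bar>) \<le>
       (c * (2 * expectation (\<lambda>\<omega>. (initial \<omega>)\<^sup>2) + Gam j j + (1 + K4))) * r ^ t"
    by (simp add: algebra_simps)
qed

text \<open>The second moments of the path approach the stationary covariance at rate
  \<open>r ^ t\<close>, which identifies the limit required by the law of large numbers.\<close>

sublocale var_noise_limit
proof
  fix i j assume ij: "i < n" "j < n"
  let ?C = "c * (2 * expectation (\<lambda>\<omega>. (initial \<omega>)\<^sup>2) + Gam j j + (1 + K4))"
  have "(\<lambda>t. Gam i j - expectation (\<lambda>\<omega>. W t i \<omega> * W t j \<omega>)) \<longlonglongrightarrow> 0"
  proof (rule tendsto_norm_zero_cancel, rule tendsto_zero_sandwich)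
    have "(\<lambda>t. ?C * r ^ t) \<longlonglongrightarrow> ?C * 0" using cr by (intro tendsto_mult tendsto_const LIMSEQ_realpow_zero) auto
    then show "(\<lambda>t. ?C * r ^ t) \<longlonglongrightarrow> 0" by simp
    fix t :: nat
    have "Gam i j - expectation (\<lambda>\<omega>. W t i \<omega> * W t j \<omega>) = expectation (\<lambda>\<omega>. x t i \<omega> * x t j \<omega> - W t i \<omega> * W t j \<omega>)"
      using x_cov[OF ij] integrable_square_mult[OF x_M[OF ij(1)] x_M[OF ij(2)] x_square[OF ij(1)] x_square[OF ij(2)]] W_int2[OF ij] by simp
    moreover have "\<bar>expectation (\<lambda>\<omega>. x t i \<omega> * x t j \<omega> - W t i \<omega> * W t j \<omega>)\<bar> \<le> ?C * r ^ t"
      by (rule order_trans[OF integral_abs_bound x_prod_minus_W_prod(2)[OF ij]])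
    ultimately show "norm (Gam i j - expectation (\<lambda>\<omega>. W t i \<omega> * W t j \<omega>)) \<le> ?C * r ^ t"
      by (simp only: real_norm_def)
  qed simp
  from tendsto_diff[OF tendsto_const this, of "Gam i j"]
  show "(\<lambda>t. expectation (\<lambda>\<omega>. var_path n P e t i \<omega> * var_path n P e t j \<omega>)) \<longlonglongrightarrow> Gam i j" by simp
qed

lemma geometric_sum_le: "(\<Sum>t<T. r ^ t) \<le> 1 / (1 - r)"
proof -
  have "(\<Sum>t<T. r ^ t) = (1 - r ^ T) / (1 - r)" using cr by (simp add: sum_gp_strict)
  also have "\<dots> \<le> 1 / (1 - r)" using cr by (intro divide_right_mono) auto
  finally show ?thesis .
qed

text \<open>The summed errors stay bounded in L1, so any null factor suffices: \<open>1 / T\<close>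
  for the sample covariance and \<open>1 / sqrt T\<close> for the score.\<close>

lemma L1_null_geometric:
  assumes f: "\<And>t. integrable M (f t)" "\<And>t. expectation (\<lambda>\<omega>. \<bar>f t \<omega>\<bar>) \<le> C * r ^ t"
    and a: "a \<longlonglongrightarrow> 0"
  shows "L1_null (\<lambda>T \<omega>. a T * (\<Sum>t<T. f t \<omega>))"
proof -
  have C: "C \<ge> 0" using order_trans[OF _ f(2)[of 0]] by (simp add: integral_nonneg)
  have I: "integrable M (\<lambda>\<omega>. \<Sum>t<T. f t \<omega>)" for T using f(1) by (intro Bochner_Integration.integrable_sum)
  have le: "expectation (\<lambda>\<omega>. \<bar>a T * (\<Sum>t<T. f t \<omega>)\<bar>) \<le> \<bar>a T\<bar> * (C / (1 - r))" for T
  proof -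
    have "expectation (\<lambda>\<omega>. \<bar>\<Sum>t<T. f t \<omega>\<bar>) \<le> expectation (\<lambda>\<omega>. \<Sum>t<T. \<bar>f t \<omega>\<bar>)"
      using f(1) I by (intro integral_mono integrable_abs Bochner_Integration.integrable_sum sum_abs) auto
    also have "\<dots> = (\<Sum>t<T. expectation (\<lambda>\<omega>. \<bar>f t \<omega>\<bar>))" using f(1) by (intro Bochner_Integration.integral_sum integrable_abs)
    also have "\<dots> \<le> (\<Sum>t<T. C * r ^ t)" by (intro sum_mono f(2))
    also have "\<dots> = C * (\<Sum>t<T. r ^ t)" by (simp add: sum_distrib_left)
    also have "\<dots> \<le> C * (1 / (1 - r))" by (intro mult_left_mono geometric_sum_le C)
    finally have "\<bar>a T\<bar> * expectation (\<lambda>\<omega>. \<bar>\<Sum>t<T. f t \<omega>\<bar>) \<le> \<bar>a T\<bar> * (C / (1 - r))" by (intro mult_left_mono) auto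
    then show ?thesis by (simp add: abs_mult)
  qed
  have "(\<lambda>T. \<bar>a T\<bar> * (C / (1 - r))) \<longlonglongrightarrow> 0 * (C / (1 - r))"
    by (intro tendsto_mult tendsto_const tendsto_rabs_zero a)
  then have "(\<lambda>T. expectation (\<lambda>\<omega>. \<bar>a T * (\<Sum>t<T. f t \<omega>)\<bar>)) \<longlonglongrightarrow> 0"
    by (intro tendsto_zero_sandwich[OF _ le]) auto
  then show ?thesis using I by (simp add: L1_null_def)
qed

lemma sample_covariance:
  assumes ij: "i < n" "j < n"
  shows "L1_null (\<lambda>T \<omega>. (\<Sum>t<T. x t i \<omega> * x t j \<omega>) / real T - Gam i j)"
proof -
  have "L1_null (\<lambda>T \<omega>. (\<Sum>t<T. W t i \<omega> * W t j \<omega>) / real T - Gam i j)"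
    unfolding L1_null_def using second_moment_average[OF ij] ij
    by (auto intro!: Bochner_Integration.integrable_sum W_int2)
  moreover have "L1_null (\<lambda>T \<omega>. 1 / real T * (\<Sum>t<T. x t i \<omega> * x t j \<omega> - W t i \<omega> * W t j \<omega>))"
    by (rule L1_null_geometric[OF x_prod_minus_W_prod[OF ij]]) real_asymp
  ultimately have "L1_null (\<lambda>T \<omega>. ((\<Sum>t<T. W t i \<omega> * W t j \<omega>) / real T - Gam i j) + 1 / real T * (\<Sum>t<T. x t i \<omega> * x t j \<omega> - W t i \<omega> * W t j \<omega>))"
    by (rule L1_null_add)
  then show ?thesis by (simp add: sum_subtractf diff_divide_distrib)
qed

lemma score_difference:
  assumes ij: "i < n" "j < n"
  shows "L1_null (\<lambda>T \<omega>. (\<Sum>t<T. x t i \<omega> * e (Suc t) j \<omega>) / sqrt (real T) - (\<Sum>t<T. W t i \<omega> * e (Suc t) j \<omega>) / sqrt (real T))"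
proof -
  have "L1_null (\<lambda>T \<omega>. 1 / sqrt (real T) * (\<Sum>t<T. (x t i \<omega> - W t i \<omega>) * e (Suc t) j \<omega>))"
  proof (rule L1_null_geometric)
    fix t
    note 1 = x_minus_W_mult[OF ij(1) e_M[OF ij(2)] square_bounds(6)[OF ij(2)], of t t]
    show "integrable M (\<lambda>\<omega>. (x t i \<omega> - W t i \<omega>) * e (Suc t) j \<omega>)" by (rule 1)
    have "expectation (\<lambda>\<omega>. \<bar>(x t i \<omega> - W t i \<omega>) * e (Suc t) j \<omega>\<bar>) \<le> c * r ^ t * (expectation (\<lambda>\<omega>. (initial \<omega>)\<^sup>2) + (1 + C4))"
      using square_bounds(7)[OF ij(2)] by (intro order_trans[OF 1(2)] mult_left_mono r_le_1) auto
    then show "expectation (\<lambda>\<omega>. \<bar>(x t i \<omega> - W t i \<omega>) * e (Suc t) j \<omega>\<bar>) \<le> (c * (expectation (\<lambda>\<omega>. (initial \<omega>)\<^sup>2) + (1 + C4))) * r ^ t"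
      by (simp add: mult_ac)
  qed real_asymp
  then show ?thesis by (simp add: left_diff_distrib sum_subtractf diff_divide_distrib)
qed

lemma score_square:
  assumes "i < n" "j < n"
  shows "integrable M (\<lambda>\<omega>. ((\<Sum>t<T. W t i \<omega> * e (Suc t) j \<omega>) / sqrt (real T))\<^sup>2)"
    "expectation (\<lambda>\<omega>. ((\<Sum>t<T. W t i \<omega> * e (Suc t) j \<omega>) / sqrt (real T))\<^sup>2) \<le> (1 + K4) * (1 + C4)"
proof -
  show "integrable M (\<lambda>\<omega>. ((\<Sum>t<T. W t i \<omega> * e (Suc t) j \<omega>) / sqrt (real T))\<^sup>2)"
    using cross_average(3)[OF assms] by (simp add: power_divide)
  have "0 \<le> expectation (\<lambda>\<omega>. (e (Suc 0) i \<omega>)\<^sup>2)" by simp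
  then have "0 \<le> 1 + C4" using square_bounds(7)[OF assms(1), of 0] by linarith
  then have "0 \<le> (1 + K4) * (1 + C4)" by (simp add: K4_def)
  then show "expectation (\<lambda>\<omega>. ((\<Sum>t<T. W t i \<omega> * e (Suc t) j \<omega>) / sqrt (real T))\<^sup>2) \<le> (1 + K4) * (1 + C4)"
    using cross_average(4)[OF assms, of T] by (cases "T = 0") (simp_all add: power_divide divide_le_eq mult.commute)
qed

end

subsection \<open>Inverses as functions of the entries\<close>

lemma inv_mat_eqI:
  assumes A: "A \<in> carrier_mat n n" and B: "B \<in> carrier_mat n n" and AB: "A * B = 1\<^sub>m n"
  shows "inv_mat A = B"
proof (cases "mat_inverse A")
  case None
  have "det A * det B = 1" using det_mult[OF A B] AB by simp
  then have "det A \<noteq> 0" by auto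
  then have "A \<in> Units (ring_mat TYPE(real) n ())" by (rule det_non_zero_imp_unit[OF A])
  moreover have "A \<notin> Units (ring_mat TYPE(real) n ())" by (rule mat_inverse(1)[OF A None])
  ultimately show ?thesis by simp
next
  case (Some C)
  note C = mat_inverse(2)[OF A Some]
  then have C': "C \<in> carrier_mat n n" by simp
  have "C = C * (A * B)" unfolding AB using C' by simp
  also have "\<dots> = (C * A) * B" by (rule assoc_mult_mat[OF C' A B, symmetric])
  finally show ?thesis using Some C B by (simp add: inv_mat_def)
qed

text \<open>Cramer's rule holds for singular matrices too, since the default value \<open>0\<close>
  of \<open>inv_mat\<close> agrees with \<open>1 / 0 = 0\<close>. The entries of the inverse are
  thus quotients of polynomials everywhere, which settles their measurability.\<close>

lemma inv_mat_adj:
  assumes A: "A \<in> carrier_mat n n"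
  shows "inv_mat A = (1 / det A) \<cdot>\<^sub>m adj_mat A"
proof (cases "det A = 0")
  case True
  have "mat_inverse A = None"
  proof (rule ccontr)
    assume "mat_inverse A \<noteq> None"
    then obtain B where "mat_inverse A = Some B" by auto
    note B = mat_inverse(2)[OF A this]
    then have "det A * det B = 1" using det_mult[OF A, of B] by simp
    then show False using True by simp
  qed
  then show ?thesis using True A adj_mat(1)[OF A] by (auto simp: inv_mat_def intro!: eq_matI)
next
  case False
  note adj = adj_mat[OF A]
  have "A * ((1 / det A) \<cdot>\<^sub>m adj_mat A) = (1 / det A) \<cdot>\<^sub>m (det A \<cdot>\<^sub>m 1\<^sub>m n)"
    using mult_smult_distrib[OF A adj(1)] adj(2) by simp
  also have "\<dots> = 1\<^sub>m n" using False by (intro eq_matI) auto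
  finally show ?thesis using adj(1) by (intro inv_mat_eqI[OF A]) auto
qed

lemma inv_mat_carrier[simp]: "A \<in> carrier_mat n n \<Longrightarrow> inv_mat A \<in> carrier_mat n n"
  using inv_mat_adj[of A n] adj_mat(1)[of A n] by simp

lemma inv_mat_mult:
  assumes A: "A \<in> carrier_mat n n" and d: "det A \<noteq> 0"
  shows "A * inv_mat A = 1\<^sub>m n" "inv_mat A * A = 1\<^sub>m n"
proof -
  note adj = adj_mat[OF A]
  have "A * inv_mat A = (1 / det A) \<cdot>\<^sub>m (det A \<cdot>\<^sub>m 1\<^sub>m n)"
    using mult_smult_distrib[OF A adj(1)] adj(2) inv_mat_adj[OF A] by simp
  also have "\<dots> = 1\<^sub>m n" using d by (intro eq_matI) auto
  finally show 1: "A * inv_mat A = 1\<^sub>m n" .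
  show "inv_mat A * A = 1\<^sub>m n" by (rule mat_mult_left_right_inverse[OF A inv_mat_carrier[OF A] 1])
qed

lemma transpose_inv_mat:
  assumes A: "A \<in> carrier_mat n n" and d: "det A \<noteq> 0" and sym: "A\<^sup>T = A"
  shows "(inv_mat A)\<^sup>T = inv_mat A"
proof (rule inv_mat_eqI[symmetric, OF A])
  show "A * (inv_mat A)\<^sup>T = 1\<^sub>m n"
    using transpose_mult[OF inv_mat_carrier[OF A] A] inv_mat_mult(2)[OF A d] sym by simp
qed (use A in simp)

text \<open>Determinants, adjugates and the matrix products below are polynomials in the entries; closure under
  sums and products therefore covers measurability and continuity at once.\<close>

locale function_algebra =
  fixes \<F> :: "('b \<Rightarrow> real) set"
  assumes const: "(\<lambda>_. k) \<in> \<F>"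
    and add: "f \<in> \<F> \<Longrightarrow> g \<in> \<F> \<Longrightarrow> (\<lambda>\<omega>. f \<omega> + g \<omega>) \<in> \<F>"
    and mult: "f \<in> \<F> \<Longrightarrow> g \<in> \<F> \<Longrightarrow> (\<lambda>\<omega>. f \<omega> * g \<omega>) \<in> \<F>"
begin

definition mat_in :: "nat \<Rightarrow> nat \<Rightarrow> ('b \<Rightarrow> real mat) \<Rightarrow> bool" where
  "mat_in n m A \<longleftrightarrow> (\<forall>\<omega>. A \<omega> \<in> carrier_mat n m) \<and> (\<forall>i<n. \<forall>j<m. (\<lambda>\<omega>. A \<omega> $$ (i, j)) \<in> \<F>)"

lemma sum: "(\<And>i. i \<in> I \<Longrightarrow> f i \<in> \<F>) \<Longrightarrow> (\<lambda>\<omega>. \<Sum>i\<in>I. f i \<omega>) \<in> \<F>"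
  by (induction I rule: infinite_finite_induct) (auto intro: const add)

lemma prod: "(\<And>i. i \<in> I \<Longrightarrow> f i \<in> \<F>) \<Longrightarrow> (\<lambda>\<omega>. \<Prod>i\<in>I. f i \<omega>) \<in> \<F>"
  by (induction I rule: infinite_finite_induct) (auto intro: const mult)

lemma mat_inI:
  assumes "\<And>\<omega>. A \<omega> \<in> carrier_mat n m" "\<And>\<omega> i j. i < n \<Longrightarrow> j < m \<Longrightarrow> A \<omega> $$ (i, j) = f i j \<omega>"
    and "\<And>i j. i < n \<Longrightarrow> j < m \<Longrightarrow> f i j \<in> \<F>"
  shows "mat_in n m A"
  using assms by (simp add: mat_in_def)

lemma mat_in_const: "A \<in> carrier_mat n m \<Longrightarrow> mat_in n m (\<lambda>_. A)"
  by (simp add: mat_in_def const)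

lemma mat_in_mult:
  assumes A: "mat_in n m A" and B: "mat_in m k B"
  shows "mat_in n k (\<lambda>\<omega>. A \<omega> * B \<omega>)"
proof -
  have c: "A \<omega> \<in> carrier_mat n m" "B \<omega> \<in> carrier_mat m k" for \<omega> using A B by (auto simp: mat_in_def)
  show ?thesis
  proof (rule mat_inI)
    show "A \<omega> * B \<omega> \<in> carrier_mat n k" for \<omega> using c by (rule mult_carrier_mat)
    show "(A \<omega> * B \<omega>) $$ (i, j) = (\<Sum>l<m. A \<omega> $$ (i, l) * B \<omega> $$ (l, j))" if "i < n" "j < k" for i j \<omega>
      using c[of \<omega>] that by (simp add: scalar_prod_def atLeast0LessThan)
    show "(\<lambda>\<omega>. \<Sum>l<m. A \<omega> $$ (i, l) * B \<omega> $$ (l, j)) \<in> \<F>" if "i < n" "j < k" for i j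
      using A B that by (intro sum mult) (auto simp: mat_in_def)
  qed
qed



lemma mat_in_kron:
  assumes A: "mat_in n m A" and B: "mat_in k l B"
  shows "mat_in (n * k) (m * l) (\<lambda>\<omega>. A \<omega> \<otimes>\<^sub>m B \<omega>)"
proof -
  have c: "A \<omega> \<in> carrier_mat n m" "B \<omega> \<in> carrier_mat k l" for \<omega> using A B by (auto simp: mat_in_def)
  show ?thesis
  proof (rule mat_inI)
    show "A \<omega> \<otimes>\<^sub>m B \<omega> \<in> carrier_mat (n * k) (m * l)" for \<omega>
      using c[of \<omega>] by (auto simp: kron_mat_def)
    fix i j assume ij: "i < n * k" "j < m * l"
    then have "i div k < n" "i mod k < k" "j div l < m" "j mod l < l"
      using divmod_less[of i k n] divmod_less[of j l m] by (simp_all add: mult.commute)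
    then show "(\<lambda>\<omega>. A \<omega> $$ (i div k, j div l) * B \<omega> $$ (i mod k, j mod l)) \<in> \<F>"
      using A B by (intro mult) (simp_all add: mat_in_def)
    show "(A \<omega> \<otimes>\<^sub>m B \<omega>) $$ (i, j) = A \<omega> $$ (i div k, j div l) * B \<omega> $$ (i mod k, j mod l)" for \<omega>
      using c[of \<omega>] ij by (simp add: kron_mat_def)
  qed
qed

lemma det_in:
  assumes "mat_in n n A"
  shows "(\<lambda>\<omega>. det (A \<omega>)) \<in> \<F>"
proof -
  have c: "A \<omega> \<in> carrier_mat n n" for \<omega> using assms by (auto simp: mat_in_def)
  have "(\<lambda>\<omega>. \<Prod>i = 0..<n. A \<omega> $$ (i, p i)) \<in> \<F>" if "p permutes {0..<n}" for p
    using assms permutes_in_image[OF that] by (intro prod) (auto simp: mat_in_def)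
  then show ?thesis unfolding det_def'[OF c] by (intro sum mult const) auto
qed

lemma mat_in_adj:
  assumes A: "mat_in n n A"
  shows "mat_in n n (\<lambda>\<omega>. adj_mat (A \<omega>))"
proof -
  have c: "A \<omega> \<in> carrier_mat n n" for \<omega> using assms by (auto simp: mat_in_def)
  have "mat_in (n - 1) (n - 1) (\<lambda>\<omega>. mat_delete (A \<omega>) j i)" if "i < n" "j < n" for i j
  proof (rule mat_inI)
    show "mat_delete (A \<omega>) j i \<in> carrier_mat (n - 1) (n - 1)" for \<omega> by (rule mat_delete_carrier[OF c])
    fix i' j' assume ij': "i' < n - 1" "j' < n - 1"
    show "mat_delete (A \<omega>) j i $$ (i', j') = A \<omega> $$ (if i' < j then i' else Suc i', if j' < i then j' else Suc j')" for \<omega>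
      using c[of \<omega>] ij' by (simp add: mat_delete_def)
    show "(\<lambda>\<omega>. A \<omega> $$ (if i' < j then i' else Suc i', if j' < i then j' else Suc j')) \<in> \<F>"
      using A ij' by (auto simp: mat_in_def)
  qed
  then have "(\<lambda>\<omega>. cofactor (A \<omega>) j i) \<in> \<F>" if "i < n" "j < n" for i j
    unfolding cofactor_def using that by (intro mult const det_in)
  then show ?thesis
    by (intro mat_inI[where f = "\<lambda>i j \<omega>. cofactor (A \<omega>) j i"])
       (use c adj_mat(1)[OF c] in \<open>auto simp: adj_mat_def carrier_matD[OF c]\<close>)
qed

end

interpretation measurable_algebra: function_algebra "borel_measurable M" for M :: "'b measure"
  by unfold_locales auto

text \<open>Continuity at \<open>l\<close> along one fixed sequence is a property stable under sums
  and products, so the results for function algebras apply to it.\<close>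

definition convergent_functions :: "(nat \<Rightarrow> 'b) \<Rightarrow> 'b \<Rightarrow> ('b \<Rightarrow> real) set" where
  "convergent_functions g l = {f. (\<lambda>k. f (g k)) \<longlonglongrightarrow> f l}"



text \<open>This is \<open>C(B)\<close> with the weight matrix as an argument: the stationary weight
  gives the limit, the sample weight gives the estimator.\<close>

definition gls_core :: "real mat \<Rightarrow> real mat \<Rightarrow> real mat" where
  "gls_core R G = R * (inv_mat (R\<^sup>T * G * R) * R\<^sup>T)"

lemma gls_core_carrier:
  assumes "R \<in> carrier_mat n m" "G \<in> carrier_mat n n"
  shows "gls_core R G \<in> carrier_mat n n" "R\<^sup>T * G * R \<in> carrier_mat m m"
proof -
  show c: "R\<^sup>T * G * R \<in> carrier_mat m m" using assms by auto
  show "gls_core R G \<in> carrier_mat n n" using assms inv_mat_carrier[OF c] by (auto simp: gls_core_def)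
qed

text \<open>A function algebra need not be closed under division. Numerator and determinant are
  therefore shown to belong to it separately, and each application forms the quotient by its own
  means.\<close>

lemma (in function_algebra) gls_core_in:
  assumes R: "R \<in> carrier_mat n m" and G: "mat_in n n G"
  shows "mat_in n n (\<lambda>\<omega>. R * (adj_mat (R\<^sup>T * G \<omega> * R) * R\<^sup>T))" "(\<lambda>\<omega>. det (R\<^sup>T * G \<omega> * R)) \<in> \<F>"
    and "i < n \<Longrightarrow> j < n \<Longrightarrow> gls_core R (G \<omega>) $$ (i, j) =
      (1 / det (R\<^sup>T * G \<omega> * R)) * (R * (adj_mat (R\<^sup>T * G \<omega> * R) * R\<^sup>T)) $$ (i, j)"
proof -
  have J: "mat_in m m (\<lambda>\<omega>. R\<^sup>T * G \<omega> * R)"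
    using R by (intro mat_in_mult[OF mat_in_mult[OF _ G]] mat_in_const) auto
  show "mat_in n n (\<lambda>\<omega>. R * (adj_mat (R\<^sup>T * G \<omega> * R) * R\<^sup>T))"
    using R by (intro mat_in_mult[OF mat_in_const mat_in_mult[OF mat_in_adj[OF J] mat_in_const]]) auto
  show "(\<lambda>\<omega>. det (R\<^sup>T * G \<omega> * R)) \<in> \<F>" by (rule det_in[OF J])
  assume ij: "i < n" "j < n"
  have c: "R\<^sup>T * G \<omega> * R \<in> carrier_mat m m" using J by (simp add: mat_in_def)
  note a = adj_mat(1)[OF c]
  have "gls_core R (G \<omega>) = (1 / det (R\<^sup>T * G \<omega> * R)) \<cdot>\<^sub>m (R * (adj_mat (R\<^sup>T * G \<omega> * R) * R\<^sup>T))"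
    unfolding gls_core_def inv_mat_adj[OF c] using R a
    by (subst mult_smult_assoc_mat[of _ m m _ n], simp, simp, subst mult_smult_distrib[of _ n m _ n]) auto
  then show "gls_core R (G \<omega>) $$ (i, j) =
      (1 / det (R\<^sup>T * G \<omega> * R)) * (R * (adj_mat (R\<^sup>T * G \<omega> * R) * R\<^sup>T)) $$ (i, j)"
    using R a ij by (simp add: carrier_matD)
qed

lemma gls_core_measurable:
  assumes R: "R \<in> carrier_mat n m" and G: "measurable_algebra.mat_in M n n G" and ij: "i < n" "j < n"
  shows "(\<lambda>\<omega>. gls_core R (G \<omega>) $$ (i, j)) \<in> borel_measurable M"
  unfolding measurable_algebra.gls_core_in(3)[OF R G ij]
  using measurable_algebra.gls_core_in(1,2)[OF R G] ij
  by (intro borel_measurable_times borel_measurable_divide borel_measurable_const)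
     (auto simp: measurable_algebra.mat_in_def)

text \<open>If no \<open>\<delta>\<close> worked, matrices violating the claim could be chosen
  within \<open>1 / Suc k\<close> of \<open>\<Gamma>\<close>. Determinants and adjugates converge
  along this sequence, and the nonzero limit of the determinants makes the quotients converge as
  well.\<close>

lemma gls_core_continuous:
  assumes R: "R \<in> carrier_mat (m * N) k" and S: "S \<in> carrier_mat N N" and \<Gamma>: "\<Gamma> \<in> carrier_mat m m"
    and d: "det (R\<^sup>T * (\<Gamma> \<otimes>\<^sub>m S) * R) \<noteq> 0" and \<epsilon>: "\<epsilon> > 0"
  shows "\<exists>\<delta>>0. \<forall>\<Gamma>'\<in>carrier_mat m m. (\<forall>i<m. \<forall>j<m. \<bar>\<Gamma>' $$ (i, j) - \<Gamma> $$ (i, j)\<bar> < \<delta>) \<longrightarrow>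
    det (R\<^sup>T * (\<Gamma>' \<otimes>\<^sub>m S) * R) \<noteq> 0 \<and>
    (\<forall>i<m * N. \<forall>j<m * N. \<bar>gls_core R (\<Gamma>' \<otimes>\<^sub>m S) $$ (i, j) - gls_core R (\<Gamma> \<otimes>\<^sub>m S) $$ (i, j)\<bar> \<le> \<epsilon>)"
proof (rule ccontr)
  let ?good = "\<lambda>\<Gamma>'. det (R\<^sup>T * (\<Gamma>' \<otimes>\<^sub>m S) * R) \<noteq> 0 \<and>
    (\<forall>i<m * N. \<forall>j<m * N. \<bar>gls_core R (\<Gamma>' \<otimes>\<^sub>m S) $$ (i, j) - gls_core R (\<Gamma> \<otimes>\<^sub>m S) $$ (i, j)\<bar> \<le> \<epsilon>)"
  assume "\<not> ?thesis"
  then have "\<exists>\<Gamma>'. \<Gamma>' \<in> carrier_mat m m \<and> (\<forall>i<m. \<forall>j<m. \<bar>\<Gamma>' $$ (i, j) - \<Gamma> $$ (i, j)\<bar> < 1 / real (Suc k)) \<and> \<not> ?good \<Gamma>'" for k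
    by (metis of_nat_0_less_iff zero_less_Suc zero_less_divide_1_iff)
  then obtain g where g: "\<And>k. g k \<in> carrier_mat m m"
      "\<And>k i j. i < m \<Longrightarrow> j < m \<Longrightarrow> \<bar>g k $$ (i, j) - \<Gamma> $$ (i, j)\<bar> < 1 / real (Suc k)" "\<And>k. \<not> ?good (g k)"
    by metis
  \<comment> \<open>Totalised so that all arguments are square matrices of the right size.\<close>
  define G where "G A = (mat m m (\<lambda>ij. A $$ ij)) \<otimes>\<^sub>m S" for A
  interpret C: function_algebra "convergent_functions g \<Gamma>" by unfold_locales (auto simp: convergent_functions_def intro: tendsto_intros)
  have lim: "(\<lambda>k. g k $$ (i, j)) \<longlonglongrightarrow> \<Gamma> $$ (i, j)" if "i < m" "j < m" for i j
  proof (rule LIM_zero_cancel, rule tendsto_norm_zero_cancel, rule tendsto_sandwich[OF _ _ tendsto_const])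
    show "(\<lambda>k. 1 / real (Suc k)) \<longlonglongrightarrow> 0" by real_asymp
    show "\<forall>\<^sub>F k in sequentially. norm (g k $$ (i, j) - \<Gamma> $$ (i, j)) \<le> 1 / real (Suc k)"
      using g(2)[OF that] by (auto intro!: always_eventually less_imp_le)
  qed auto
  have "C.mat_in m m (\<lambda>A. mat m m (\<lambda>ij. A $$ ij))"
    using lim by (intro C.mat_inI[where f = "\<lambda>i j A. A $$ (i, j)"]) (auto simp: convergent_functions_def)
  then have G: "C.mat_in (m * N) (m * N) G"
    unfolding G_def using S by (intro C.mat_in_kron C.mat_in_const)
  have "mat m m (\<lambda>ij. A $$ ij) = A" if "A \<in> carrier_mat m m" for A :: "real mat"
    using that by (intro eq_matI) auto
  then have G_eq: "G (g k) = g k \<otimes>\<^sub>m S" "G \<Gamma> = \<Gamma> \<otimes>\<^sub>m S" for k using g(1) \<Gamma> by (simp_all add: G_def)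
  have detlim: "(\<lambda>k. det (R\<^sup>T * (g k \<otimes>\<^sub>m S) * R)) \<longlonglongrightarrow> det (R\<^sup>T * (\<Gamma> \<otimes>\<^sub>m S) * R)"
    using C.gls_core_in(2)[OF R G] by (simp add: convergent_functions_def G_eq)
  have corelim: "(\<lambda>k. gls_core R (g k \<otimes>\<^sub>m S) $$ (i, j)) \<longlonglongrightarrow> gls_core R (\<Gamma> \<otimes>\<^sub>m S) $$ (i, j)"
    if "i < m * N" "j < m * N" for i j
  proof -
    let ?a = "\<lambda>\<Gamma>'. (R * (adj_mat (R\<^sup>T * (\<Gamma>' \<otimes>\<^sub>m S) * R) * R\<^sup>T)) $$ (i, j)"
    have "(\<lambda>A. (R * (adj_mat (R\<^sup>T * G A * R) * R\<^sup>T)) $$ (i, j)) \<in> convergent_functions g \<Gamma>"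
      using C.gls_core_in(1)[OF R G] that unfolding C.mat_in_def by blast
    then have "(\<lambda>k. ?a (g k)) \<longlonglongrightarrow> ?a \<Gamma>" by (simp add: convergent_functions_def G_eq)
    then have "(\<lambda>k. 1 / det (R\<^sup>T * (g k \<otimes>\<^sub>m S) * R) * ?a (g k)) \<longlonglongrightarrow> 1 / det (R\<^sup>T * (\<Gamma> \<otimes>\<^sub>m S) * R) * ?a \<Gamma>"
      by (intro tendsto_mult tendsto_divide tendsto_const detlim d)
    then show ?thesis using C.gls_core_in(3)[OF R G that] by (simp add: G_eq[symmetric])
  qed
  have "\<forall>\<^sub>F k in sequentially. \<forall>i\<in>{..<m * N}. \<forall>j\<in>{..<m * N}. \<bar>gls_core R (g k \<otimes>\<^sub>m S) $$ (i, j) - gls_core R (\<Gamma> \<otimes>\<^sub>m S) $$ (i, j)\<bar> < \<epsilon>"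
    using tendstoD[OF corelim \<epsilon>] by (intro eventually_ball_finite ballI) (auto simp: dist_real_def)
  moreover have "\<forall>\<^sub>F k in sequentially. det (R\<^sup>T * (g k \<otimes>\<^sub>m S) * R) \<noteq> 0"
    by (rule tendsto_imp_eventually_ne[OF detlim d])
  ultimately have "\<forall>\<^sub>F k in sequentially. ?good (g k)"
    by eventually_elim (auto intro: less_imp_le)
  then show False using g(3) by (auto simp: eventually_sequentially)
qed

subsection \<open>Positive definite matrices and Kronecker products\<close>

definition pd_mat :: "nat \<Rightarrow> real mat \<Rightarrow> bool" where
  "pd_mat n A \<longleftrightarrow> A \<in> carrier_mat n n \<and> A\<^sup>T = A \<and> (\<forall>v\<in>carrier_vec n. v \<noteq> 0\<^sub>v n \<longrightarrow> 0 < v \<bullet> (A *\<^sub>v v))"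

lemma pd_mat_nonneg: "pd_mat n A \<Longrightarrow> v \<in> carrier_vec n \<Longrightarrow> 0 \<le> v \<bullet> (A *\<^sub>v v)"
  by (cases "v = 0\<^sub>v n") (auto simp: pd_mat_def less_imp_le)

lemma quadratic_form_mat:
  fixes A :: "real mat"
  assumes "A \<in> carrier_mat n n" "v \<in> carrier_vec n"
  shows "v \<bullet> (A *\<^sub>v v) = (\<Sum>i<n. \<Sum>j<n. v $ i * v $ j * A $$ (i, j))"
proof -
  have "v \<bullet> (A *\<^sub>v v) = (\<Sum>i<n. v $ i * (\<Sum>j<n. A $$ (i, j) * v $ j))"
    using assms by (simp add: scalar_prod_def atLeast0LessThan)
  also have "\<dots> = (\<Sum>i<n. \<Sum>j<n. v $ i * v $ j * A $$ (i, j))"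
    unfolding sum_distrib_left by (intro sum.cong refl) (simp only: mult_ac)
  finally show ?thesis .
qed

lemma pd_matI:
  assumes A: "A \<in> carrier_mat n n" and psd: "psd_form n (\<lambda>i j. A $$ (i, j))"
    and pd: "\<And>u. (\<Sum>i<n. \<Sum>j<n. u i * u j * A $$ (i, j)) = 0 \<Longrightarrow> \<forall>i<n. u i = 0"
  shows "pd_mat n A"
  unfolding pd_mat_def
proof (intro conjI ballI impI A)
  show "A\<^sup>T = A" using psd A by (intro eq_matI) (auto simp: psd_form_def)
  fix v :: "real vec" assume v: "v \<in> carrier_vec n" "v \<noteq> 0\<^sub>v n"
  have "0 \<le> (\<Sum>i<n. \<Sum>j<n. v $ i * v $ j * A $$ (i, j))" using psd by (simp add: psd_form_def)
  moreover have "(\<Sum>i<n. \<Sum>j<n. v $ i * v $ j * A $$ (i, j)) \<noteq> 0"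
    using pd[of "\<lambda>i. v $ i"] v by (metis eq_vecI carrier_vecD index_zero_vec)
  ultimately show "0 < v \<bullet> (A *\<^sub>v v)" unfolding quadratic_form_mat[OF A v(1)] by simp
qed

lemma pd_mat_psd_form:
  assumes "pd_mat n A"
  shows "psd_form n (\<lambda>i j. A $$ (i, j))"
  unfolding psd_form_def
proof (intro conjI allI impI)
  have A: "A \<in> carrier_mat n n" "A\<^sup>T = A" using assms by (auto simp: pd_mat_def)
  show "A $$ (i, j) = A $$ (j, i)" if "i < n" "j < n" for i j
    using A that by (metis carrier_matD index_transpose_mat(1))
  show "0 \<le> (\<Sum>i<n. \<Sum>j<n. u i * u j * A $$ (i, j))" for u
    using pd_mat_nonneg[OF assms, of "vec n u"] quadratic_form_mat[OF A(1), of "vec n u"] by simp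
qed

lemma pd_mat_zero:
  assumes "pd_mat n A" "(\<Sum>i<n. \<Sum>j<n. u i * u j * A $$ (i, j)) = 0" "i < n"
  shows "u i = 0"
proof -
  have A: "A \<in> carrier_mat n n" using assms by (simp add: pd_mat_def)
  have "vec n u \<bullet> (A *\<^sub>v vec n u) = 0" using quadratic_form_mat[OF A, of "vec n u"] assms(2) by simp
  then have "vec n u = 0\<^sub>v n" using assms(1) by (force simp: pd_mat_def)
  then show ?thesis using assms(3) by (metis index_vec index_zero_vec(1))
qed

lemma pd_mat_det: "pd_mat n A \<Longrightarrow> det A \<noteq> 0"
  using det_0_iff_vec_prod_zero[of A n] by (fastforce simp: pd_mat_def)

text \<open>For \<open>A = b b'\<close> a vanishing quadratic form is a vanishing sum of squares, so
  \<open>b' u = 0\<close>, hence \<open>A u = 0\<close> and \<open>u = 0\<close>. This upgrades the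
  nonsingularity assumed of the noise covariance to definiteness.\<close>

lemma psd_invertible_imp_pd:
  assumes A: "A \<in> carrier_mat n n" and psd: "psd_form n (\<lambda>i j. A $$ (i, j))" and inv: "invertible_mat A"
  shows "pd_mat n A"
proof (rule pd_matI[OF A psd])
  fix u :: "nat \<Rightarrow> real" assume q: "(\<Sum>i<n. \<Sum>j<n. u i * u j * A $$ (i, j)) = 0"
  obtain b where b: "\<And>i j. i < n \<Longrightarrow> j < n \<Longrightarrow> A $$ (i, j) = (\<Sum>k<n. b i k * b j k)"
    using cholesky[OF psd] by blast
  have "(\<Sum>i<n. \<Sum>j<n. u i * u j * A $$ (i, j)) = (\<Sum>i<n. \<Sum>j<n. \<Sum>k<n. (u i * b i k) * (u j * b j k))"
    by (intro sum.cong refl) (auto simp: b sum_distrib_left mult_ac)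
  also have "\<dots> = (\<Sum>i<n. \<Sum>k<n. \<Sum>j<n. (u i * b i k) * (u j * b j k))"
    by (intro sum.cong refl sum.swap)
  also have "\<dots> = (\<Sum>k<n. \<Sum>i<n. \<Sum>j<n. (u i * b i k) * (u j * b j k))" by (rule sum.swap)
  also have "\<dots> = (\<Sum>k<n. (\<Sum>i<n. u i * b i k)\<^sup>2)" by (simp add: power2_eq_square sum_product)
  finally have z: "(\<Sum>i<n. u i * b i k) = 0" if "k < n" for k
    using q that by (simp add: sum_nonneg_eq_0_iff)
  have "A *\<^sub>v vec n u = 0\<^sub>v n"
  proof (rule eq_vecI)
    fix i assume "i < dim_vec (0\<^sub>v n :: real vec)"
    then have i: "i < n" by simp
    have "(A *\<^sub>v vec n u) $ i = (\<Sum>j<n. \<Sum>k<n. b i k * (u j * b j k))"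
    proof -
      have "(A *\<^sub>v vec n u) $ i = (\<Sum>j<n. A $$ (i, j) * u j)"
        using A i by (simp add: scalar_prod_def atLeast0LessThan)
      also have "\<dots> = (\<Sum>j<n. \<Sum>k<n. b i k * (u j * b j k))"
        using b[OF i] by (intro sum.cong refl) (simp add: sum_distrib_left mult_ac)
      finally show ?thesis .
    qed
    also have "\<dots> = (\<Sum>k<n. b i k * (\<Sum>j<n. u j * b j k))"
      unfolding sum_distrib_left by (rule sum.swap)
    finally show "(A *\<^sub>v vec n u) $ i = 0\<^sub>v n $ i" using z i by simp
  qed (use A in simp)
  moreover obtain B where B: "B * A = 1\<^sub>m n" "B \<in> carrier_mat n n"
  proof -
    obtain B where B: "A * B = 1\<^sub>m (dim_row A)" "B * A = 1\<^sub>m (dim_row B)"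
      using inv by (auto simp: invertible_mat_def inverts_mat_def)
    have "dim_col B = dim_col (A * B)" "dim_col A = dim_col (B * A)" by simp_all
    then have "B \<in> carrier_mat n n" using B A by (metis carrier_matD carrier_matI index_one_mat(3))
    with B that show ?thesis by simp
  qed
  ultimately have "vec n u = B *\<^sub>v 0\<^sub>v n"
    using assoc_mult_mat_vec[OF B(2) A vec_carrier, of u] by simp
  also have "\<dots> = 0\<^sub>v n" using B(2) by (intro eq_vecI) auto
  finally have "vec n u = 0\<^sub>v n" .
  then show "\<forall>i<n. u i = 0" by (metis index_vec index_zero_vec(1))
qed

lemma pd_mat_inverse:
  assumes A: "pd_mat n A"
  shows "pd_mat n (inv_mat A)"
  unfolding pd_mat_def
proof (intro conjI ballI impI)
  have A': "A \<in> carrier_mat n n" "A\<^sup>T = A" using A by (auto simp: pd_mat_def)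
  note d = pd_mat_det[OF A]
  note inv = inv_mat_mult[OF A'(1) d]
  show I: "inv_mat A \<in> carrier_mat n n" using A' by simp
  show "(inv_mat A)\<^sup>T = inv_mat A" by (rule transpose_inv_mat[OF A'(1) d A'(2)])
  fix v :: "real vec" assume v: "v \<in> carrier_vec n" "v \<noteq> 0\<^sub>v n"
  define w where "w = inv_mat A *\<^sub>v v"
  have w: "w \<in> carrier_vec n" using I v by (simp add: w_def)
  have Aw: "A *\<^sub>v w = v" using assoc_mult_mat_vec[OF A'(1) I v(1)] inv v by (simp add: w_def)
  have "w \<noteq> 0\<^sub>v n"
  proof
    assume "w = 0\<^sub>v n"
    then have "v = A *\<^sub>v 0\<^sub>v n" using Aw by simp
    also have "\<dots> = 0\<^sub>v n" using A' by (intro eq_vecI) auto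
    finally show False using v by simp
  qed
  then have "0 < w \<bullet> (A *\<^sub>v w)" using A w by (simp add: pd_mat_def)
  also have "\<dots> = v \<bullet> w" unfolding Aw using comm_scalar_prod[OF w v(1)] .
  finally show "0 < v \<bullet> (inv_mat A *\<^sub>v v)" by (simp add: w_def)
qed

lemma sum_divmod':
  fixes f :: "nat \<Rightarrow> nat \<Rightarrow> real"
  shows "(\<Sum>k<a * b. f (k div b) (k mod b)) = (\<Sum>i<a. \<Sum>j<b. f i j)"
  using sum_divmod[of "\<lambda>i j. f j i" b a] by (simp add: mult.commute)

lemma kron_carrier: "A \<in> carrier_mat n m \<Longrightarrow> B \<in> carrier_mat k l \<Longrightarrow> A \<otimes>\<^sub>m B \<in> carrier_mat (n * k) (m * l)"
  by (auto simp: kron_mat_def)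

lemma kron_index:
  assumes "A \<in> carrier_mat n m" "B \<in> carrier_mat k l" "i < n * k" "j < m * l"
  shows "(A \<otimes>\<^sub>m B) $$ (i, j) = A $$ (i div k, j div l) * B $$ (i mod k, j mod l)"
  using assms by (simp add: kron_mat_def)

lemma divmod_less':
  assumes "i < a * (b :: nat)"
  shows "i div b < a" "i mod b < b"
  using divmod_less[of i b a] assms by (simp_all add: mult.commute)

lemma kron_mult:
  assumes A: "A \<in> carrier_mat n m" and B: "B \<in> carrier_mat k l" and C: "C \<in> carrier_mat m p" and D: "D \<in> carrier_mat l q"
  shows "(A \<otimes>\<^sub>m B) * (C \<otimes>\<^sub>m D) = (A * C) \<otimes>\<^sub>m (B * D)"
proof (rule eq_matI)
  note AB = kron_carrier[OF A B] and CD = kron_carrier[OF C D]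
  have AC: "A * C \<in> carrier_mat n p" and BD: "B * D \<in> carrier_mat k q" using A B C D by auto
  note R = kron_carrier[OF AC BD]
  show "dim_row ((A \<otimes>\<^sub>m B) * (C \<otimes>\<^sub>m D)) = dim_row ((A * C) \<otimes>\<^sub>m (B * D))"
    "dim_col ((A \<otimes>\<^sub>m B) * (C \<otimes>\<^sub>m D)) = dim_col ((A * C) \<otimes>\<^sub>m (B * D))"
    using AB CD R by simp_all
  fix i j assume "i < dim_row ((A * C) \<otimes>\<^sub>m (B * D))" "j < dim_col ((A * C) \<otimes>\<^sub>m (B * D))"
  then have ij: "i < n * k" "j < p * q" using R by auto
  note i = divmod_less'[OF ij(1)] and j = divmod_less'[OF ij(2)]
  have "((A \<otimes>\<^sub>m B) * (C \<otimes>\<^sub>m D)) $$ (i, j) = (\<Sum>s<m * l. (A \<otimes>\<^sub>m B) $$ (i, s) * (C \<otimes>\<^sub>m D) $$ (s, j))"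
    using AB CD ij by (simp add: scalar_prod_def atLeast0LessThan)
  also have "\<dots> = (\<Sum>s<m * l. (A $$ (i div k, s div l) * B $$ (i mod k, s mod l)) * (C $$ (s div l, j div q) * D $$ (s mod l, j mod q)))"
    by (intro sum.cong refl) (simp add: kron_index[OF A B ij(1)] kron_index[OF C D _ ij(2)])
  also have "\<dots> = (\<Sum>s<m. \<Sum>t<l. (A $$ (i div k, s) * B $$ (i mod k, t)) * (C $$ (s, j div q) * D $$ (t, j mod q)))"
    by (rule sum_divmod'[of "\<lambda>s t. (A $$ (i div k, s) * B $$ (i mod k, t)) * (C $$ (s, j div q) * D $$ (t, j mod q))"])
  also have "\<dots> = (\<Sum>s<m. A $$ (i div k, s) * C $$ (s, j div q)) * (\<Sum>t<l. B $$ (i mod k, t) * D $$ (t, j mod q))"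
    by (simp add: sum_product mult_ac)
  also have "\<dots> = (A * C) $$ (i div k, j div q) * (B * D) $$ (i mod k, j mod q)"
    using A B C D i j by (simp add: scalar_prod_def atLeast0LessThan)
  also have "\<dots> = ((A * C) \<otimes>\<^sub>m (B * D)) $$ (i, j)" by (rule kron_index[OF AC BD ij, symmetric])
  finally show "((A \<otimes>\<^sub>m B) * (C \<otimes>\<^sub>m D)) $$ (i, j) = ((A * C) \<otimes>\<^sub>m (B * D)) $$ (i, j)" .
qed

text \<open>The factor of a definite matrix has trivial left kernel, because a vector in it
  annihilates the quadratic form.\<close>

lemma pd_mat_factor:
  assumes "pd_mat n A"
  shows "\<exists>c. (\<forall>i<n. \<forall>j<n. A $$ (i, j) = (\<Sum>k<n. c i k * c j k)) \<and>
    (\<forall>u. (\<forall>k<n. (\<Sum>i<n. u i * c i k) = 0) \<longrightarrow> (\<forall>i<n. u i = 0))"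
proof -
  obtain c where c: "\<And>i j. i < n \<Longrightarrow> j < n \<Longrightarrow> A $$ (i, j) = (\<Sum>k<n. c i k * c j k)"
    using cholesky[OF pd_mat_psd_form[OF assms]] by blast
  have "\<forall>i<n. u i = 0" if u: "\<forall>k<n. (\<Sum>i<n. u i * c i k) = 0" for u
  proof -
    have "(\<Sum>i<n. \<Sum>j<n. u i * u j * A $$ (i, j)) = (\<Sum>i<n. u i * (\<Sum>j<n. \<Sum>k<n. c i k * (u j * c j k)))"
      unfolding sum_distrib_left by (intro sum.cong refl) (auto simp: c sum_distrib_left mult_ac)
    also have "\<dots> = (\<Sum>i<n. u i * (\<Sum>k<n. \<Sum>j<n. c i k * (u j * c j k)))"
      by (subst sum.swap) (rule refl)
    also have "\<dots> = 0" using u by (simp add: sum_distrib_left[symmetric])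
    finally show ?thesis using pd_mat_zero[OF assms] by blast
  qed
  with c show ?thesis by blast
qed

text \<open>Factors \<open>c\<close> of \<open>A\<close> and \<open>d\<close> of \<open>B\<close>
  yield the factor \<open>c \<otimes> d\<close>, so the form is a sum of squares. If all squares
  vanish, the trivial kernel of \<open>d\<close> is applied first and then that of
  \<open>c\<close>.\<close>

lemma pd_mat_kron:
  assumes A: "pd_mat n A" and B: "pd_mat m B"
  shows "pd_mat (n * m) (A \<otimes>\<^sub>m B)"
proof -
  have Ac: "A \<in> carrier_mat n n" and Bc: "B \<in> carrier_mat m m" using A B by (auto simp: pd_mat_def)
  obtain c where c: "\<And>i j. i < n \<Longrightarrow> j < n \<Longrightarrow> A $$ (i, j) = (\<Sum>k<n. c i k * c j k)"
      "\<And>u. \<forall>k<n. (\<Sum>i<n. u i * c i k) = 0 \<Longrightarrow> \<forall>i<n. u i = 0" using pd_mat_factor[OF A] by blast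
  obtain d where d: "\<And>i j. i < m \<Longrightarrow> j < m \<Longrightarrow> B $$ (i, j) = (\<Sum>k<m. d i k * d j k)"
      "\<And>u. \<forall>k<m. (\<Sum>i<m. u i * d i k) = 0 \<Longrightarrow> \<forall>i<m. u i = 0" using pd_mat_factor[OF B] by blast
  let ?K = "A \<otimes>\<^sub>m B"
  have K: "?K $$ (p, q) = (\<Sum>k<n. \<Sum>l<m. (c (p div m) k * d (p mod m) l) * (c (q div m) k * d (q mod m) l))"
    if "p < n * m" "q < n * m" for p q
    using that divmod_less'[of p n m] divmod_less'[of q n m]
    by (simp add: kron_index[OF Ac Bc] c(1) d(1) sum_product mult_ac)
  have quad: "(\<Sum>p<n * m. \<Sum>q<n * m. u p * u q * ?K $$ (p, q)) =
      (\<Sum>k<n. \<Sum>l<m. (\<Sum>p<n * m. u p * (c (p div m) k * d (p mod m) l))\<^sup>2)" for u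
  proof -
    let ?g = "\<lambda>k l p. u p * (c (p div m) k * d (p mod m) l)"
    have "(\<Sum>p<n * m. \<Sum>q<n * m. u p * u q * ?K $$ (p, q)) = (\<Sum>p<n * m. \<Sum>q<n * m. \<Sum>k<n. \<Sum>l<m. ?g k l p * ?g k l q)"
      by (intro sum.cong refl) (simp add: K sum_distrib_left mult_ac)
    also have "\<dots> = (\<Sum>p<n * m. \<Sum>k<n. \<Sum>q<n * m. \<Sum>l<m. ?g k l p * ?g k l q)"
      by (intro sum.cong refl sum.swap)
    also have "\<dots> = (\<Sum>k<n. \<Sum>p<n * m. \<Sum>q<n * m. \<Sum>l<m. ?g k l p * ?g k l q)"
      by (rule sum.swap)
    also have "\<dots> = (\<Sum>k<n. \<Sum>p<n * m. \<Sum>l<m. \<Sum>q<n * m. ?g k l p * ?g k l q)"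
      by (intro sum.cong refl sum.swap)
    also have "\<dots> = (\<Sum>k<n. \<Sum>l<m. \<Sum>p<n * m. \<Sum>q<n * m. ?g k l p * ?g k l q)"
      by (intro sum.cong refl sum.swap)
    finally show ?thesis by (simp only: power2_eq_square sum_product)
  qed
  show ?thesis
  proof (rule pd_matI)
    show "?K \<in> carrier_mat (n * m) (n * m)" by (rule kron_carrier[OF Ac Bc])
    show "psd_form (n * m) (\<lambda>i j. ?K $$ (i, j))"
      unfolding psd_form_def quad
    proof (intro conjI allI impI)
      show "?K $$ (i, j) = ?K $$ (j, i)" if "i < n * m" "j < n * m" for i j
        unfolding K[OF that] K[OF that(2,1)] by (simp add: mult_ac)
    qed (auto intro!: sum_nonneg)
    fix u :: "nat \<Rightarrow> real"
    assume "(\<Sum>p<n * m. \<Sum>q<n * m. u p * u q * ?K $$ (p, q)) = 0"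
    then have z: "(\<Sum>p<n * m. u p * (c (p div m) k * d (p mod m) l)) = 0" if "k < n" "l < m" for k l
      unfolding quad using that by (simp add: sum_nonneg_eq_0_iff sum_nonneg)
    \<comment> \<open>The vector is reshaped into an \<open>n\<close> by \<open>m\<close> array, the
      second index running fastest, so that the two factors act on separate indices.\<close>
    define U where "U i j = u (j + m * i)" for i j
    have uU: "u p = U (p div m) (p mod m)" for p by (simp add: U_def)
    have z': "(\<Sum>j<m. (\<Sum>i<n. U i j * c i k) * d j l) = 0" if "k < n" "l < m" for k l
    proof -
      have "(\<Sum>p<n * m. u p * (c (p div m) k * d (p mod m) l)) = (\<Sum>i<n. \<Sum>j<m. U i j * (c i k * d j l))"
        unfolding uU by (rule sum_divmod'[of "\<lambda>i j. U i j * (c i k * d j l)"])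
      also have "\<dots> = (\<Sum>j<m. (\<Sum>i<n. U i j * c i k) * d j l)"
        unfolding sum_distrib_right by (subst sum.swap) (simp only: mult.assoc)
      finally show ?thesis using z[OF that] by simp
    qed
    have z'': "(\<Sum>i<n. U i j * c i k) = 0" if "k < n" "j < m" for k j
    proof -
      have "\<forall>l<m. (\<Sum>j<m. (\<Sum>i<n. U i j * c i k) * d j l) = 0" using z' that(1) by simp
      from d(2)[OF this] show ?thesis using that(2) by simp
    qed
    have U0: "U i j = 0" if "i < n" "j < m" for i j
    proof -
      have "\<forall>k<n. (\<Sum>i<n. U i j * c i k) = 0" using z'' that(2) by simp
      from c(2)[OF this] show ?thesis using that(1) by simp
    qed
    show "\<forall>p<n * m. u p = 0"
    proof (intro allI impI)
      fix p assume "p < n * m"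
      then show "u p = 0" unfolding uU by (intro U0 divmod_less')
    qed
  qed
qed

subsection \<open>Generalised least squares\<close>

lemma restr_mat_carrier: "B \<in> carrier_mat n m \<Longrightarrow> restr_mat B \<in> carrier_mat (n * m) (nonzeros B)"
  by (simp add: restr_mat_def)

text \<open>The columns of \<open>restr_mat B\<close> are distinct unit vectors. In the proof
  \<open>v\<close> is scattered over the unrestricted positions to a vector \<open>b\<close>, which
  \<open>restr_vec\<close> gathers back to \<open>v\<close> and which the matrix returns as the
  image of \<open>v\<close>.\<close>

lemma restr_mat_inj:
  assumes B: "binary_mat n m B" and v: "v \<in> carrier_vec (nonzeros B)" and z: "restr_mat B *\<^sub>v v = 0\<^sub>v (n * m)"
  shows "v = 0\<^sub>v (nonzeros B)"
proof (rule eq_vecI)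
  let ?P = "\<lambda>i. vec_mat B $ i \<noteq> 0"
  have carr: "B \<in> carrier_mat n m" using B by (simp add: binary_mat_def)
  have M: "nonzeros B = length (filter ?P [0..<n * m])" by (rule nonzeros_eq_length[OF carr])
  fix j assume "j < dim_vec (0\<^sub>v (nonzeros B) :: real vec)"
  then have j: "j < nonzeros B" by simp
  define b where "b = vec (n * m) (\<lambda>i. if ?P i then v $ length (filter ?P [0..<i]) else 0)"
  have rv: "restr_vec B b = v"
  proof (rule eq_vecI)
    show "dim_vec (restr_vec B b) = dim_vec v" using M v by (simp add: restr_vec_def b_def)
    fix k assume "k < dim_vec v"
    then have k: "k < length (filter ?P [0..<n * m])" using v M by simp
    define i where "i = filter ?P [0..<n * m] ! k"
    have i: "i < n * m" "?P i" using nth_mem[OF k] by (auto simp: i_def)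
    have "filter ?P [0..<n * m] ! length (filter ?P [0..<i]) = filter ?P [0..<n * m] ! k"
      using filter_upt_nth(1)[of i "n * m" ?P] i by (simp add: i_def)
    then have "length (filter ?P [0..<i]) = k"
      using filter_upt_nth(2)[of i "n * m" ?P] i k by (simp add: nth_eq_iff_index_eq)
    then show "restr_vec B b $ k = v $ k" using i k
      by (simp add: restr_vec_def b_def vec_of_list_index i_def[symmetric])
  qed
  have "restr_mat B *\<^sub>v restr_vec B b = b"
    by (rule restr_mat_restr_vec[OF B]) (auto simp: b_def)
  then have b0: "b = 0\<^sub>v (n * m)" using z rv by simp
  have jl: "j < length (filter ?P [0..<n * m])" using j M by simp
  have "restr_vec B b $ j = b $ (filter ?P [0..<n * m] ! j)"
    using jl by (simp add: restr_vec_def vec_of_list_index b_def)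
  also have "\<dots> = 0" using nth_mem[OF jl] b0 by auto
  finally show "v $ j = 0\<^sub>v (nonzeros B) $ j" using rv j by simp
qed (use v in simp)

locale gls_design =
  fixes n m :: nat and R G :: "real mat"
  assumes R: "R \<in> carrier_mat n m" and R_inj: "\<And>v. v \<in> carrier_vec m \<Longrightarrow> R *\<^sub>v v = 0\<^sub>v n \<Longrightarrow> v = 0\<^sub>v m"
    and G: "pd_mat n G"
begin

lemma G_carrier: "G \<in> carrier_mat n n" and G_sym: "G\<^sup>T = G" using G by (auto simp: pd_mat_def)

abbreviation "J \<equiv> R\<^sup>T * G * R"
abbreviation "C \<equiv> gls_core R G"

lemma carriers: "J \<in> carrier_mat m m" "C \<in> carrier_mat n n" "inv_mat J \<in> carrier_mat m m" "R\<^sup>T \<in> carrier_mat m n"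
  using gls_core_carrier[OF R G_carrier] R inv_mat_carrier[OF gls_core_carrier(2)[OF R G_carrier]] by simp_all

lemmas RT = carriers(4)

lemma product_carriers: "G * R \<in> carrier_mat n m" "R\<^sup>T * G \<in> carrier_mat m n" "inv_mat J * R\<^sup>T \<in> carrier_mat m n"
  by (rule mult_carrier_mat[OF G_carrier R], rule mult_carrier_mat[OF RT G_carrier], rule mult_carrier_mat[OF carriers(3) RT])

lemma J_sym: "J\<^sup>T = J"
proof -
  have "J\<^sup>T = R\<^sup>T * (R\<^sup>T * G)\<^sup>T" by (rule transpose_mult[OF product_carriers(2) R])
  also have "(R\<^sup>T * G)\<^sup>T = G * R" using transpose_mult[OF RT G_carrier] G_sym by simp
  also have "R\<^sup>T * (G * R) = J" by (rule assoc_mult_mat[OF RT G_carrier R, symmetric])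
  finally show ?thesis .
qed

text \<open>A kernel vector \<open>v\<close> of \<open>J\<close> gives \<open>w = R v\<close> with
  vanishing form under \<open>G\<close>; definiteness yields \<open>w = 0\<close> and injectivity
  yields \<open>v = 0\<close>.\<close>

lemma det_J: "det J \<noteq> 0"
proof
  assume "det J = 0"
  then obtain v where v: "v \<in> carrier_vec m" "v \<noteq> 0\<^sub>v m" "J *\<^sub>v v = 0\<^sub>v m"
    using det_0_iff_vec_prod_zero[OF carriers(1)] by blast
  define w where "w = R *\<^sub>v v"
  have w: "w \<in> carrier_vec n" using R v by (simp add: w_def)
  have "J *\<^sub>v v = R\<^sup>T *\<^sub>v (G *\<^sub>v w)"
    unfolding w_def assoc_mult_mat_vec[OF product_carriers(2) R v(1)]
    by (rule assoc_mult_mat_vec[OF RT G_carrier mult_mat_vec_carrier[OF R v(1)]])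
  then have "R\<^sup>T *\<^sub>v (G *\<^sub>v w) = 0\<^sub>v m" using v(3) by simp
  then have "(G *\<^sub>v w) \<bullet> w = 0"
    using transpose_vec_mult_scalar[OF R v(1) mult_mat_vec_carrier[OF G_carrier w]] v(1)
    unfolding w_def[symmetric] by simp
  then have "w \<bullet> (G *\<^sub>v w) = 0"
    using comm_scalar_prod[OF w mult_mat_vec_carrier[OF G_carrier w]] by simp
  then have "w = 0\<^sub>v n" using G w by (force simp: pd_mat_def)
  then show False using R_inj[OF v(1)] v(2) by (simp add: w_def)
qed

text \<open>\<open>C * G\<close> is the projection onto the column space of \<open>R\<close> that is
  orthogonal for the inner product given by \<open>G\<close>; it fixes \<open>R\<close>.\<close>

lemma core_GR: "C * (G * R) = R"
proof -
  have "C * (G * R) = R * ((inv_mat J * R\<^sup>T) * (G * R))"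
    unfolding gls_core_def by (rule assoc_mult_mat[OF R product_carriers(3,1)])
  also have "(inv_mat J * R\<^sup>T) * (G * R) = inv_mat J * (R\<^sup>T * (G * R))"
    by (rule assoc_mult_mat[OF carriers(3) RT product_carriers(1)])
  also have "R\<^sup>T * (G * R) = J" by (rule assoc_mult_mat[OF RT G_carrier R, symmetric])
  also have "inv_mat J * J = 1\<^sub>m m" by (rule inv_mat_mult(2)[OF carriers(1) det_J])
  finally show ?thesis using R by simp
qed

lemma core_sym: "C\<^sup>T = C"
proof -
  have "C\<^sup>T = (inv_mat J * R\<^sup>T)\<^sup>T * R\<^sup>T" unfolding gls_core_def by (rule transpose_mult[OF R product_carriers(3)])
  also have "(inv_mat J * R\<^sup>T)\<^sup>T = R * inv_mat J"
    using transpose_mult[OF carriers(3) RT] transpose_inv_mat[OF carriers(1) det_J J_sym] by simp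
  also have "R * inv_mat J * R\<^sup>T = C" unfolding gls_core_def by (rule assoc_mult_mat[OF R carriers(3) RT])
  finally show ?thesis .
qed

lemma core_absorb:
  assumes X: "X \<in> carrier_mat m k" shows "C * (G * (R * X)) = R * X"
proof -
  have "G * (R * X) = G * R * X" by (rule assoc_mult_mat[OF G_carrier R X, symmetric])
  then have "C * (G * (R * X)) = C * (G * R) * X"
    using assoc_mult_mat[OF carriers(2) product_carriers(1) X] by simp
  then show ?thesis by (simp only: core_GR)
qed

lemma core_idem: "C * (G * C) = C"
  using core_absorb[OF product_carriers(3)] by (simp only: gls_core_def)

end

text \<open>The factor \<open>X\<close> expresses the columns of \<open>R1\<close> through those of
  \<open>R2\<close>, so \<open>D2.C * G\<close> fixes \<open>D1.C\<close>; transposition gives the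
  product in the other order. All four terms of \<open>D G D\<close> are then known.\<close>

lemma psd_gls_core_difference:
  assumes R1: "gls_design n m1 R1 G" and R2: "gls_design n m2 R2 G"
    and X: "X \<in> carrier_mat m2 m1" and RX: "R1 = R2 * X"
  shows "psd_mat (gls_core R2 G - gls_core R1 G)"
proof -
  interpret D1: gls_design n m1 R1 G by fact
  interpret D2: gls_design n m2 R2 G by fact
  note G = D1.G_carrier and c1 = D1.carriers(2) and c2 = D2.carriers(2)
  let ?D = "D2.C - D1.C"
  have "D1.C = R2 * (X * (inv_mat D1.J * R1\<^sup>T))"
    using assoc_mult_mat[OF D2.R X D1.product_carriers(3)] by (simp only: gls_core_def[of R1] RX[symmetric])
  then have C21: "D2.C * (G * D1.C) = D1.C"
    using D2.core_absorb[OF mult_carrier_mat[OF X D1.product_carriers(3)]] by (simp only:)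
  have C12: "D1.C * (G * D2.C) = D1.C"
  proof -
    have "(D2.C * (G * D1.C))\<^sup>T = (G * D1.C)\<^sup>T * D2.C\<^sup>T" by (rule transpose_mult[OF c2 mult_carrier_mat[OF G c1]])
    also have "(G * D1.C)\<^sup>T = D1.C * G" using transpose_mult[OF G c1] D1.G_sym D1.core_sym by simp
    also have "D1.C * G * D2.C\<^sup>T = D1.C * (G * D2.C)" unfolding D2.core_sym by (rule assoc_mult_mat[OF c1 G c2])
    finally show ?thesis using C21 D1.core_sym by simp
  qed
  have D: "?D \<in> carrier_mat n n" using c1 c2 by auto
  have Dsym: "?D\<^sup>T = ?D" using transpose_minus[OF c2 c1] D1.core_sym D2.core_sym by simp
  have DGD: "?D * (G * ?D) = ?D"
  proof -
    have "G * ?D = G * D2.C - G * D1.C" by (rule mult_minus_distrib_mat[OF G c2 c1])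
    then have "?D * (G * ?D) = ?D * (G * D2.C) - ?D * (G * D1.C)"
      using mult_minus_distrib_mat[OF D mult_carrier_mat[OF G c2] mult_carrier_mat[OF G c1]] by simp
    also have "?D * (G * D2.C) = D2.C - D1.C"
      using minus_mult_distrib_mat[OF c2 c1 mult_carrier_mat[OF G c2]] D2.core_idem C12 by simp
    also have "?D * (G * D1.C) = D1.C - D1.C"
      using minus_mult_distrib_mat[OF c2 c1 mult_carrier_mat[OF G c1]] D1.core_idem C21 by simp
    finally show ?thesis using c1 c2 by (intro eq_matI) auto
  qed
  show ?thesis
    unfolding psd_mat_def
  proof (intro conjI ballI)
    show "square_mat ?D" using c1 c2 by auto
    show "?D\<^sup>T = ?D" by (rule Dsym)
    fix v :: "real vec" assume "v \<in> carrier_vec (dim_row ?D)"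
    then have v: "v \<in> carrier_vec n" using c1 by simp
    have Dv: "?D *\<^sub>v v \<in> carrier_vec n" using D v by auto
    have "?D *\<^sub>v v = ?D *\<^sub>v (G *\<^sub>v (?D *\<^sub>v v))"
      by (subst DGD[symmetric], subst assoc_mult_mat_vec[OF D mult_carrier_mat[OF G D] v], subst assoc_mult_mat_vec[OF G D v]) simp
    then have "v \<bullet> (?D *\<^sub>v v) = v \<bullet> (?D *\<^sub>v (G *\<^sub>v (?D *\<^sub>v v)))" by simp
    also have "\<dots> = (?D *\<^sub>v v) \<bullet> (G *\<^sub>v (?D *\<^sub>v v))"
      using transpose_vec_mult_scalar[OF D, of "G *\<^sub>v (?D *\<^sub>v v)" v] G Dv v Dsym by simp
    also have "\<dots> \<ge> 0" by (rule pd_mat_nonneg[OF D1.G Dv])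
    finally show "0 \<le> v \<bullet> (?D *\<^sub>v v)" .
  qed
qed

text \<open>The deterministic part of the response is mapped to the normal matrix times
  \<open>\<gamma>\<close>, which the inverse cancels. As \<open>\<gamma>\<close> is any coefficient
  vector for the restrictions \<open>B\<close>, true and enlarged restrictions are treated
  alike.\<close>

lemma gls_beta_expansion:
  assumes X: "X \<in> carrier_mat p T" and S: "S \<in> carrier_mat N N" "det S \<noteq> 0"
    and B: "B \<in> carrier_mat N p" and \<gamma>: "\<gamma> \<in> carrier_vec (nonzeros B)" and u: "u \<in> carrier_vec (N * T)"
    and d: "det ((restr_mat B)\<^sup>T * ((X * X\<^sup>T) \<otimes>\<^sub>m inv_mat S) * restr_mat B) \<noteq> 0"
  shows "gls_beta S B X ((X\<^sup>T \<otimes>\<^sub>m 1\<^sub>m N) *\<^sub>v (restr_mat B *\<^sub>v \<gamma>) + u) =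
    restr_mat B *\<^sub>v \<gamma> + gls_core (restr_mat B) ((X * X\<^sup>T) \<otimes>\<^sub>m inv_mat S) *\<^sub>v ((X \<otimes>\<^sub>m inv_mat S) *\<^sub>v u)"
proof -
  let ?R = "restr_mat B" and ?m = "nonzeros B" and ?n = "p * N"
  let ?G = "(X * X\<^sup>T) \<otimes>\<^sub>m inv_mat S" and ?K = "X \<otimes>\<^sub>m inv_mat S"
  have R: "?R \<in> carrier_mat ?n ?m" using restr_mat_carrier[OF B] by (simp add: mult.commute)
  have RT: "?R\<^sup>T \<in> carrier_mat ?m ?n" using R by simp
  have Si: "inv_mat S \<in> carrier_mat N N" using S by simp
  have XX: "X * X\<^sup>T \<in> carrier_mat p p" using X by simp
  have G: "?G \<in> carrier_mat ?n ?n" by (rule kron_carrier[OF XX Si])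
  have K: "?K \<in> carrier_mat ?n (T * N)" by (rule kron_carrier[OF X Si])
  have I: "X\<^sup>T \<otimes>\<^sub>m 1\<^sub>m N \<in> carrier_mat (T * N) ?n" using X by (intro kron_carrier) auto
  have u': "u \<in> carrier_vec (T * N)" using u by (simp add: mult.commute)
  let ?J = "?R\<^sup>T * ?G * ?R"
  have J: "?J \<in> carrier_mat ?m ?m" using R G by auto
  note Ji = inv_mat_carrier[OF J]
  have b: "?R *\<^sub>v \<gamma> \<in> carrier_vec ?n" using R \<gamma> by auto
  have "?K *\<^sub>v ((X\<^sup>T \<otimes>\<^sub>m 1\<^sub>m N) *\<^sub>v (?R *\<^sub>v \<gamma>) + u) = ?K *\<^sub>v ((X\<^sup>T \<otimes>\<^sub>m 1\<^sub>m N) *\<^sub>v (?R *\<^sub>v \<gamma>)) + ?K *\<^sub>v u"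
    using K I b u' by (intro mult_add_distrib_mat_vec) auto
  also have "?K *\<^sub>v ((X\<^sup>T \<otimes>\<^sub>m 1\<^sub>m N) *\<^sub>v (?R *\<^sub>v \<gamma>)) = (?K * (X\<^sup>T \<otimes>\<^sub>m 1\<^sub>m N)) *\<^sub>v (?R *\<^sub>v \<gamma>)"
    by (rule assoc_mult_mat_vec[OF K I b, symmetric])
  also have "?K * (X\<^sup>T \<otimes>\<^sub>m 1\<^sub>m N) = ?G"
    using kron_mult[OF X Si, of "X\<^sup>T" p "1\<^sub>m N" N] X Si by simp
  finally have Ky: "?K *\<^sub>v ((X\<^sup>T \<otimes>\<^sub>m 1\<^sub>m N) *\<^sub>v (?R *\<^sub>v \<gamma>) + u) = ?G *\<^sub>v (?R *\<^sub>v \<gamma>) + ?K *\<^sub>v u" .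
  have Gb: "?G *\<^sub>v (?R *\<^sub>v \<gamma>) \<in> carrier_vec ?n" and Ku: "?K *\<^sub>v u \<in> carrier_vec ?n" using G K b u' by auto
  have "?R\<^sup>T *\<^sub>v (?G *\<^sub>v (?R *\<^sub>v \<gamma>)) = ?J *\<^sub>v \<gamma>"
    using assoc_mult_mat_vec[OF mult_carrier_mat[OF RT G] R \<gamma>] assoc_mult_mat_vec[OF RT G b] by simp
  then have "?R\<^sup>T *\<^sub>v (?G *\<^sub>v (?R *\<^sub>v \<gamma>) + ?K *\<^sub>v u) = ?J *\<^sub>v \<gamma> + ?R\<^sup>T *\<^sub>v (?K *\<^sub>v u)"
    using mult_add_distrib_mat_vec[OF RT Gb Ku] by simp
  then have "inv_mat ?J *\<^sub>v (?R\<^sup>T *\<^sub>v (?G *\<^sub>v (?R *\<^sub>v \<gamma>) + ?K *\<^sub>v u)) = inv_mat ?J *\<^sub>v (?J *\<^sub>v \<gamma>) + inv_mat ?J *\<^sub>v (?R\<^sup>T *\<^sub>v (?K *\<^sub>v u))"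
    using mult_add_distrib_mat_vec[OF Ji, of "?J *\<^sub>v \<gamma>" "?R\<^sup>T *\<^sub>v (?K *\<^sub>v u)"] J \<gamma> RT Ku by auto
  also have "inv_mat ?J *\<^sub>v (?J *\<^sub>v \<gamma>) = \<gamma>"
    using assoc_mult_mat_vec[OF Ji J \<gamma>] inv_mat_mult(2)[OF J d] \<gamma> by simp
  finally have g: "gls_gamma S B X ((X\<^sup>T \<otimes>\<^sub>m 1\<^sub>m N) *\<^sub>v (?R *\<^sub>v \<gamma>) + u) = \<gamma> + inv_mat ?J *\<^sub>v (?R\<^sup>T *\<^sub>v (?K *\<^sub>v u))"
    unfolding gls_gamma_def Ky .
  have "?R *\<^sub>v (\<gamma> + inv_mat ?J *\<^sub>v (?R\<^sup>T *\<^sub>v (?K *\<^sub>v u))) = ?R *\<^sub>v \<gamma> + ?R *\<^sub>v (inv_mat ?J *\<^sub>v (?R\<^sup>T *\<^sub>v (?K *\<^sub>v u)))"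
    using R \<gamma> Ji RT Ku by (intro mult_add_distrib_mat_vec) auto
  also have "?R *\<^sub>v (inv_mat ?J *\<^sub>v (?R\<^sup>T *\<^sub>v (?K *\<^sub>v u))) = gls_core ?R ?G *\<^sub>v (?K *\<^sub>v u)"
    unfolding gls_core_def
    using assoc_mult_mat_vec[OF R mult_carrier_mat[OF Ji RT] Ku] assoc_mult_mat_vec[OF Ji RT Ku] by simp
  finally show ?thesis unfolding gls_beta_def g .
qed

text \<open>The Gram matrix of the data is the sample size times the sample covariance; this moves
  the sample size out of the inverse.\<close>

lemma gls_core_smult:
  assumes R: "R \<in> carrier_mat n m" and G: "G \<in> carrier_mat n n" and a: "a \<noteq> 0" and d: "det (R\<^sup>T * G * R) \<noteq> 0"
  shows "gls_core R (a \<cdot>\<^sub>m G) = (1 / a) \<cdot>\<^sub>m gls_core R G" "det (R\<^sup>T * (a \<cdot>\<^sub>m G) * R) \<noteq> 0"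
proof -
  let ?J = "R\<^sup>T * G * R"
  have RT: "R\<^sup>T \<in> carrier_mat m n" using R by simp
  have J: "?J \<in> carrier_mat m m" using R G by auto
  note Ji = inv_mat_carrier[OF J]
  have "R\<^sup>T * (a \<cdot>\<^sub>m G) * R = (a \<cdot>\<^sub>m (R\<^sup>T * G)) * R" using mult_smult_distrib[OF RT G] by simp
  also have "\<dots> = a \<cdot>\<^sub>m ?J" by (rule mult_smult_assoc_mat[OF mult_carrier_mat[OF RT G] R])
  finally have aJ: "R\<^sup>T * (a \<cdot>\<^sub>m G) * R = a \<cdot>\<^sub>m ?J" .
  show "det (R\<^sup>T * (a \<cdot>\<^sub>m G) * R) \<noteq> 0" unfolding aJ using d a by simp
  have "inv_mat (a \<cdot>\<^sub>m ?J) = (1 / a) \<cdot>\<^sub>m inv_mat ?J"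
  proof (rule inv_mat_eqI)
    have "(a \<cdot>\<^sub>m ?J) * ((1 / a) \<cdot>\<^sub>m inv_mat ?J) = a \<cdot>\<^sub>m (?J * ((1 / a) \<cdot>\<^sub>m inv_mat ?J))"
      by (rule mult_smult_assoc_mat[OF J smult_carrier_mat[OF Ji]])
    also have "?J * ((1 / a) \<cdot>\<^sub>m inv_mat ?J) = (1 / a) \<cdot>\<^sub>m 1\<^sub>m m"
      using mult_smult_distrib[OF J Ji] inv_mat_mult(1)[OF J d] by simp
    finally show "(a \<cdot>\<^sub>m ?J) * ((1 / a) \<cdot>\<^sub>m inv_mat ?J) = 1\<^sub>m m" using a by (auto intro!: eq_matI)
  qed (use J Ji in auto)
  then have "gls_core R (a \<cdot>\<^sub>m G) = R * (((1 / a) \<cdot>\<^sub>m inv_mat ?J) * R\<^sup>T)" by (simp add: gls_core_def aJ)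
  also have "((1 / a) \<cdot>\<^sub>m inv_mat ?J) * R\<^sup>T = (1 / a) \<cdot>\<^sub>m (inv_mat ?J * R\<^sup>T)" by (rule mult_smult_assoc_mat[OF Ji RT])
  also have "R * \<dots> = (1 / a) \<cdot>\<^sub>m (R * (inv_mat ?J * R\<^sup>T))" by (rule mult_smult_distrib[OF R mult_carrier_mat[OF Ji RT]])
  finally show "gls_core R (a \<cdot>\<^sub>m G) = (1 / a) \<cdot>\<^sub>m gls_core R G" by (simp add: gls_core_def)
qed

subsection \<open>Identification of the asymptotic variance\<close>

context prob_space
begin

text \<open>If \<open>\<bar>z\<bar>\<close> exceeds \<open>K + 1\<close>, then either
  \<open>\<bar>y\<bar>\<close> exceeds \<open>K\<close>, which Markov's inequality bounds, or
  \<open>z\<close> and \<open>y\<close> differ by more than \<open>1\<close>. Tightness thus passes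
  from a variable bounded in L1 to a close one without moments.\<close>

lemma prob_greater_le:
  assumes [measurable]: "z \<in> borel_measurable M" and y: "integrable M y" and K: "K > 0"
  shows "prob {\<omega>\<in>space M. \<bar>z \<omega>\<bar> > K + 1} \<le> expectation (\<lambda>\<omega>. min 1 \<bar>z \<omega> - y \<omega>\<bar>) + expectation (\<lambda>\<omega>. \<bar>y \<omega>\<bar>) / K"
proof -
  have [measurable]: "y \<in> borel_measurable M" using y by auto
  let ?A = "{\<omega>\<in>space M. \<bar>z \<omega>\<bar> > K + 1}"
  have i: "integrable M (\<lambda>\<omega>. min 1 \<bar>z \<omega> - y \<omega>\<bar>)" by (rule integrable_const_bound[of _ 1]) auto
  have "prob ?A = expectation (indicator ?A)" by simp
  also have "\<dots> \<le> expectation (\<lambda>\<omega>. min 1 \<bar>z \<omega> - y \<omega>\<bar> + \<bar>y \<omega>\<bar> / K)"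
  proof (rule integral_mono)
    fix \<omega>
    show "indicator ?A \<omega> \<le> min 1 \<bar>z \<omega> - y \<omega>\<bar> + \<bar>y \<omega>\<bar> / K"
    proof (cases "\<bar>z \<omega>\<bar> > K + 1")
      case True
      show ?thesis
      proof (cases "\<bar>y \<omega>\<bar> \<le> K")
        case True
        with \<open>\<bar>z \<omega>\<bar> > K + 1\<close> have "min 1 \<bar>z \<omega> - y \<omega>\<bar> = 1" by (simp add: min_def)
        then show ?thesis using K by (simp add: indicator_def)
      next
        case False
        then have "1 \<le> \<bar>y \<omega>\<bar> / K" using K by simp
        moreover have "0 \<le> min 1 \<bar>z \<omega> - y \<omega>\<bar>" by simp
        moreover have "indicator ?A \<omega> \<le> (1 :: real)" by (simp add: indicator_def)
        ultimately show ?thesis by linarith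
      qed
    next
      case False
      then show ?thesis using K by (simp add: indicator_def)
    qed
  qed (use i y in \<open>auto intro!: integrable_real_indicator simp: less_top[symmetric]\<close>)
  also have "\<dots> = expectation (\<lambda>\<omega>. min 1 \<bar>z \<omega> - y \<omega>\<bar>) + expectation (\<lambda>\<omega>. \<bar>y \<omega>\<bar>) / K"
    using i y by simp
  finally show ?thesis .
qed

text \<open>The weight \<open>2\<close> pays for the case in which some coordinate differs by more
  than \<open>1\<close>, and \<open>\<bar>u l\<bar>\<close> is the Lipschitz constant in the other
  case.\<close>

lemma cis_sum_difference_le:
  fixes d :: nat
  assumes z: "\<And>l. l < d \<Longrightarrow> z l \<in> borel_measurable M" and y: "\<And>l. l < d \<Longrightarrow> y l \<in> borel_measurable M"
  shows "cmod (expectation (\<lambda>\<omega>. cis (\<Sum>l<d. u l * z l \<omega>)) - expectation (\<lambda>\<omega>. cis (\<Sum>l<d. u l * y l \<omega>))) \<le>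
    (\<Sum>l<d. (2 + \<bar>u l\<bar>) * expectation (\<lambda>\<omega>. min 1 \<bar>z l \<omega> - y l \<omega>\<bar>))"
proof -
  have m: "(\<lambda>\<omega>. cis (\<Sum>l<d. u l * f l \<omega>)) \<in> borel_measurable M" if "\<And>l. l < d \<Longrightarrow> f l \<in> borel_measurable M" for f
  proof -
    have "(\<lambda>\<omega>. \<Sum>l<d. u l * f l \<omega>) \<in> borel_measurable M" using that by (intro borel_measurable_sum borel_measurable_times) auto
    then show ?thesis by (rule measurable_compose[OF _ cis_measurable])
  qed
  have ci: "integrable M (\<lambda>\<omega>. cis (\<Sum>l<d. u l * f l \<omega>))" if "\<And>l. l < d \<Longrightarrow> f l \<in> borel_measurable M" for f
    by (rule integrable_const_bound[of _ 1]) (auto simp: m[OF that])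
  have mi: "integrable M (\<lambda>\<omega>. min 1 \<bar>z l \<omega> - y l \<omega>\<bar>)" if "l < d" for l
    using z[OF that] y[OF that] by (intro integrable_const_bound[of _ 1]) auto
  have one: "cmod (cis a - cis b) \<le> \<bar>a - b\<bar>" for a b
  proof -
    have "cis a - cis b = cis b * (cis (a - b) - 1)" by (simp add: cis_mult right_diff_distrib)
    then have "cmod (cis a - cis b) = cmod (cis (a - b) - 1)" by (simp add: norm_mult)
    also have "\<dots> \<le> \<bar>a - b\<bar>" using iexp_approx1[of "a - b" 0] by (simp add: cis_conv_exp)
    finally show ?thesis .
  qed
  have le: "cmod (cis (\<Sum>l<d. u l * z l \<omega>) - cis (\<Sum>l<d. u l * y l \<omega>)) \<le> (\<Sum>l<d. (2 + \<bar>u l\<bar>) * min 1 \<bar>z l \<omega> - y l \<omega>\<bar>)" for \<omega>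
  proof (cases "\<exists>l<d. \<bar>z l \<omega> - y l \<omega>\<bar> > 1")
    case True
    then obtain l where l: "l < d" "\<bar>z l \<omega> - y l \<omega>\<bar> > 1" by blast
    have "cmod (cis (\<Sum>l<d. u l * z l \<omega>) - cis (\<Sum>l<d. u l * y l \<omega>)) \<le> 2"
      using norm_triangle_ineq4[of "cis (\<Sum>l<d. u l * z l \<omega>)" "cis (\<Sum>l<d. u l * y l \<omega>)"] by simp
    also have "2 \<le> (2 + \<bar>u l\<bar>) * min 1 \<bar>z l \<omega> - y l \<omega>\<bar>" using l by simp
    also have "\<dots> \<le> (\<Sum>l<d. (2 + \<bar>u l\<bar>) * min 1 \<bar>z l \<omega> - y l \<omega>\<bar>)"
      using l by (intro member_le_sum[of l "{..<d}" "\<lambda>l. (2 + \<bar>u l\<bar>) * min 1 \<bar>z l \<omega> - y l \<omega>\<bar>"]) auto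
    finally show ?thesis .
  next
    case False
    have "cmod (cis (\<Sum>l<d. u l * z l \<omega>) - cis (\<Sum>l<d. u l * y l \<omega>)) \<le> \<bar>(\<Sum>l<d. u l * z l \<omega>) - (\<Sum>l<d. u l * y l \<omega>)\<bar>" by (rule one)
    also have "\<dots> = \<bar>\<Sum>l<d. u l * (z l \<omega> - y l \<omega>)\<bar>" by (simp add: right_diff_distrib sum_subtractf)
    also have "\<dots> \<le> (\<Sum>l<d. (2 + \<bar>u l\<bar>) * min 1 \<bar>z l \<omega> - y l \<omega>\<bar>)"
    proof (rule order_trans[OF sum_abs], rule sum_mono)
      fix l assume "l \<in> {..<d}"
      then have "\<bar>z l \<omega> - y l \<omega>\<bar> \<le> 1" using False by (metis lessThan_iff not_less)
      then have "min 1 \<bar>z l \<omega> - y l \<omega>\<bar> = \<bar>z l \<omega> - y l \<omega>\<bar>" by simp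
      then show "\<bar>u l * (z l \<omega> - y l \<omega>)\<bar> \<le> (2 + \<bar>u l\<bar>) * min 1 \<bar>z l \<omega> - y l \<omega>\<bar>"
        unfolding abs_mult by (simp add: mult_right_mono)
    qed
    finally show ?thesis .
  qed
  have "expectation (\<lambda>\<omega>. cis (\<Sum>l<d. u l * z l \<omega>)) - expectation (\<lambda>\<omega>. cis (\<Sum>l<d. u l * y l \<omega>)) =
      expectation (\<lambda>\<omega>. cis (\<Sum>l<d. u l * z l \<omega>) - cis (\<Sum>l<d. u l * y l \<omega>))"
    using ci[OF z] ci[OF y] by simp
  also have "cmod \<dots> \<le> expectation (\<lambda>\<omega>. \<Sum>l<d. (2 + \<bar>u l\<bar>) * min 1 \<bar>z l \<omega> - y l \<omega>\<bar>)"
    using ci[OF z] ci[OF y] mi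
    by (intro norm_integral_le_integral le Bochner_Integration.integrable_diff Bochner_Integration.integrable_sum integrable_mult_right) auto
  also have "\<dots> = (\<Sum>l<d. expectation (\<lambda>\<omega>. (2 + \<bar>u l\<bar>) * min 1 \<bar>z l \<omega> - y l \<omega>\<bar>))"
    using mi by (intro Bochner_Integration.integral_sum integrable_mult_right) auto
  also have "\<dots> = (\<Sum>l<d. (2 + \<bar>u l\<bar>) * expectation (\<lambda>\<omega>. min 1 \<bar>z l \<omega> - y l \<omega>\<bar>))" by simp
  finally show ?thesis .
qed

text \<open>A Slutsky argument. No moments of \<open>Z\<close> are available, so it is compared with
  integrable variables \<open>Y\<close> in a distance that metrises convergence in probability;
  limit and tightness are established for \<open>Y\<close> and transferred.\<close>

lemma has_asymptotic_varianceI: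
  fixes Z :: "nat \<Rightarrow> 'a \<Rightarrow> real vec" and Y :: "nat \<Rightarrow> nat \<Rightarrow> 'a \<Rightarrow> real"
  assumes rv: "\<And>T. random_vec M d (Z T)"
    and Y: "\<And>T l. l < d \<Longrightarrow> integrable M (Y T l)" "\<And>T l. l < d \<Longrightarrow> expectation (\<lambda>\<omega>. \<bar>Y T l \<omega>\<bar>) \<le> C"
    and approx: "\<And>l. l < d \<Longrightarrow> (\<lambda>T. expectation (\<lambda>\<omega>. min 1 \<bar>Z T \<omega> $ l - Y T l \<omega>\<bar>)) \<longlonglongrightarrow> 0"
    and psd: "psd_form d V"
    and ch: "\<And>u. (\<lambda>T. expectation (\<lambda>\<omega>. cis (\<Sum>l<d. u l * Y T l \<omega>))) \<longlonglongrightarrow>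
        of_real (exp (- (\<Sum>i<d. \<Sum>j<d. u i * u j * V i j) / 2))"
  shows "has_asymptotic_variance M d Z (mat d d (\<lambda>(i, j). V i j))"
proof -
  obtain L where L: "prob_space L" "sets L = sets (borel_vec d)"
    "\<And>u. (\<integral>x. cis (\<Sum>j<d. u j * x j) \<partial>L) = of_real (exp (- (\<Sum>i<d. \<Sum>j<d. u i * u j * V i j) / 2))"
    "\<And>i. i < d \<Longrightarrow> integrable L (\<lambda>x. (x i)\<^sup>2)" "\<And>i. i < d \<Longrightarrow> (\<integral>x. x i \<partial>L) = 0"
    "\<And>i j. i < d \<Longrightarrow> j < d \<Longrightarrow> (\<integral>x. x i * x j \<partial>L) = V i j"
    using gaussian_exists[OF psd] by blast
  interpret L: prob_space L by fact
  have cm: "(\<lambda>\<omega>. coords d (Z T \<omega>)) \<in> measurable M (borel_vec d)" for T using rv by (simp add: random_vec_def)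
  define \<mu> where "\<mu> T = distr M (borel_vec d) (\<lambda>\<omega>. coords d (Z T \<omega>))" for T
  have \<mu>: "prob_space (\<mu> T)" "sets (\<mu> T) = sets (borel_vec d)" for T
    unfolding \<mu>_def by (rule prob_space_distr[OF cm]) simp
  have zM: "(\<lambda>\<omega>. Z T \<omega> $ l) \<in> borel_measurable M" if "l < d" for T l
  proof -
    have "(\<lambda>\<omega>. coords d (Z T \<omega>) l) \<in> borel_measurable M"
      by (rule measurable_compose[OF cm]) (use that in simp)
    then show ?thesis using that by (simp add: coords_def)
  qed
  have yM: "Y T l \<in> borel_measurable M" if "l < d" for T l using Y(1)[OF that] by auto
  have big: "prob {\<omega>\<in>space M. \<exists>l<d. \<bar>z l \<omega>\<bar> > K} \<le> (\<Sum>l<d. prob {\<omega>\<in>space M. \<bar>z l \<omega>\<bar> > K})"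
    if "\<And>l. l < d \<Longrightarrow> z l \<in> borel_measurable M" for z :: "nat \<Rightarrow> 'a \<Rightarrow> real" and K
  proof -
    have "{\<omega>\<in>space M. \<exists>l<d. \<bar>z l \<omega>\<bar> > K} = (\<Union>l\<in>{..<d}. {\<omega>\<in>space M. \<bar>z l \<omega>\<bar> > K})" by auto
    also have "prob \<dots> \<le> (\<Sum>l<d. prob {\<omega>\<in>space M. \<bar>z l \<omega>\<bar> > K})"
    proof (rule finite_measure_subadditive_finite)
      show "(\<lambda>l. {\<omega>\<in>space M. \<bar>z l \<omega>\<bar> > K}) ` {..<d} \<subseteq> sets M"
      proof safe
        fix l assume "l < d"
        then have [measurable]: "z l \<in> borel_measurable M" by (rule that)
        show "{\<omega>\<in>space M. \<bar>z l \<omega>\<bar> > K} \<in> sets M" by measurable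
      qed
    qed simp
    finally show ?thesis .
  qed
  have C0: "real d * C \<ge> 0"
  proof (cases "d = 0")
    case False
    have "0 \<le> expectation (\<lambda>\<omega>. \<bar>Y 0 0 \<omega>\<bar>)" by simp
    then have "0 \<le> C" using Y(2)[of 0 0] False by linarith
    then show ?thesis by simp
  qed simp
  have conv: "(\<lambda>T. \<integral>x. f x \<partial>\<mu> T) \<longlonglongrightarrow> (\<integral>x. f x \<partial>L)"
    if f: "continuous_map (powertop_real {..<d}) euclideanreal f" "bounded (f ` ({..<d} \<rightarrow>\<^sub>E UNIV))" for f
  proof (rule weak_convergence_of_char[OF \<mu> L(1,2) _ _ _ f])
    fix u :: "nat \<Rightarrow> real"
    have m: "(\<lambda>x. cis (\<Sum>j<d. u j * x j)) \<in> borel_measurable (borel_vec d)"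
    proof -
      have "(\<lambda>x. \<Sum>j<d. u j * x j) \<in> borel_measurable (borel_vec d)"
        by (intro borel_measurable_sum borel_measurable_times) auto
      then show ?thesis by (rule measurable_compose[OF _ cis_measurable])
    qed
    have e: "(\<integral>x. cis (\<Sum>j<d. u j * x j) \<partial>\<mu> T) = expectation (\<lambda>\<omega>. cis (\<Sum>l<d. u l * Z T \<omega> $ l))" for T
      unfolding \<mu>_def integral_distr[OF cm m] by (simp add: coords_def)
    have "(\<lambda>T. expectation (\<lambda>\<omega>. cis (\<Sum>l<d. u l * Z T \<omega> $ l)) - expectation (\<lambda>\<omega>. cis (\<Sum>l<d. u l * Y T l \<omega>))) \<longlonglongrightarrow> 0"
    proof (rule tendsto_norm_zero_cancel, rule tendsto_zero_sandwich)
      have "(\<lambda>T. \<Sum>l<d. (2 + \<bar>u l\<bar>) * expectation (\<lambda>\<omega>. min 1 \<bar>Z T \<omega> $ l - Y T l \<omega>\<bar>)) \<longlonglongrightarrow> (\<Sum>l<d. (2 + \<bar>u l\<bar>) * 0)"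
        by (intro tendsto_sum tendsto_mult tendsto_const approx) auto
      then show "(\<lambda>T. \<Sum>l<d. (2 + \<bar>u l\<bar>) * expectation (\<lambda>\<omega>. min 1 \<bar>Z T \<omega> $ l - Y T l \<omega>\<bar>)) \<longlonglongrightarrow> 0" by simp
      show "norm (expectation (\<lambda>\<omega>. cis (\<Sum>l<d. u l * Z T \<omega> $ l)) - expectation (\<lambda>\<omega>. cis (\<Sum>l<d. u l * Y T l \<omega>))) \<le>
          (\<Sum>l<d. (2 + \<bar>u l\<bar>) * expectation (\<lambda>\<omega>. min 1 \<bar>Z T \<omega> $ l - Y T l \<omega>\<bar>))" for T
        by (rule cis_sum_difference_le[OF zM yM])
    qed simp
    from tendsto_add[OF this ch[of u]]
    show "(\<lambda>T. \<integral>x. cis (\<Sum>j<d. u j * x j) \<partial>\<mu> T) \<longlonglongrightarrow> (\<integral>x. cis (\<Sum>j<d. u j * x j) \<partial>L)"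
      unfolding e L(3) by simp
  next
    fix e :: real assume e: "e > 0"
    \<comment> \<open>Chosen so that the Markov terms of all \<open>d\<close> coordinates together
      contribute at most \<open>e / 2\<close>.\<close>
    define K where "K = (2 * (real d * C) + 1) / e"
    have K: "K > 0" using e C0 by (simp add: K_def)
    have KC: "real d * C / K \<le> e / 2"
    proof -
      have "real d * C * 2 \<le> e * K" using e by (simp add: K_def)
      then show ?thesis using K by (simp add: field_simps)
    qed
    have "(\<lambda>T. \<Sum>l<d. expectation (\<lambda>\<omega>. min 1 \<bar>Z T \<omega> $ l - Y T l \<omega>\<bar>)) \<longlonglongrightarrow> (\<Sum>l<d. 0)"
      by (intro tendsto_sum approx) auto
    then have "\<forall>\<^sub>F T in sequentially. (\<Sum>l<d. expectation (\<lambda>\<omega>. min 1 \<bar>Z T \<omega> $ l - Y T l \<omega>\<bar>)) < e / 2"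
      using e by (intro order_tendstoD(2)[of _ 0]) auto
    then have "\<forall>\<^sub>F T in sequentially. measure (\<mu> T) {x\<in>space (\<mu> T). \<exists>i<d. \<bar>x i\<bar> > K + 1} \<le> e"
    proof eventually_elim
      case (elim T)
      have xM: "(\<lambda>x. x i) \<in> borel_measurable (borel_vec d)" if "i < d" for i using that by simp
      have S: "{x\<in>space (borel_vec d). \<exists>i<d. \<bar>x i\<bar> > K + 1} \<in> sets (borel_vec d)"
      proof -
        have "{x\<in>space (borel_vec d). \<exists>i<d. \<bar>x i\<bar> > K + 1} = (\<Union>i\<in>{..<d}. {x\<in>space (borel_vec d). \<bar>x i\<bar> > K + 1})" by auto
        also have "\<dots> \<in> sets (borel_vec d)"
        proof (intro sets.finite_UN)
          fix i assume "i \<in> {..<d}"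
          then have [measurable]: "(\<lambda>x. x i) \<in> borel_measurable (borel_vec d)" using xM by simp
          show "{x\<in>space (borel_vec d). \<bar>x i\<bar> > K + 1} \<in> sets (borel_vec d)" by measurable
        qed simp
        finally show ?thesis .
      qed
      have "measure (\<mu> T) {x\<in>space (\<mu> T). \<exists>i<d. \<bar>x i\<bar> > K + 1} =
          prob ((\<lambda>\<omega>. coords d (Z T \<omega>)) -` {x\<in>space (borel_vec d). \<exists>i<d. \<bar>x i\<bar> > K + 1} \<inter> space M)"
        unfolding \<mu>_def space_distr by (rule measure_distr[OF cm S])
      also have "(\<lambda>\<omega>. coords d (Z T \<omega>)) -` {x\<in>space (borel_vec d). \<exists>i<d. \<bar>x i\<bar> > K + 1} \<inter> space M =
          {\<omega>\<in>space M. \<exists>l<d. \<bar>Z T \<omega> $ l\<bar> > K + 1}"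
        using measurable_space[OF cm] by (auto simp: coords_def)
      also have "prob \<dots> \<le> (\<Sum>l<d. prob {\<omega>\<in>space M. \<bar>Z T \<omega> $ l\<bar> > K + 1})" by (rule big[OF zM])
      also have "\<dots> \<le> (\<Sum>l<d. expectation (\<lambda>\<omega>. min 1 \<bar>Z T \<omega> $ l - Y T l \<omega>\<bar>) + C / K)"
      proof (rule sum_mono)
        fix l assume "l \<in> {..<d}"
        then have l: "l < d" by simp
        have "expectation (\<lambda>\<omega>. \<bar>Y T l \<omega>\<bar>) / K \<le> C / K" using Y(2)[OF l] K by (intro divide_right_mono) auto
        then show "prob {\<omega>\<in>space M. \<bar>Z T \<omega> $ l\<bar> > K + 1} \<le> expectation (\<lambda>\<omega>. min 1 \<bar>Z T \<omega> $ l - Y T l \<omega>\<bar>) + C / K"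
          using prob_greater_le[OF zM[OF l] Y(1)[OF l] K, of T T] by linarith
      qed
      also have "\<dots> = (\<Sum>l<d. expectation (\<lambda>\<omega>. min 1 \<bar>Z T \<omega> $ l - Y T l \<omega>\<bar>)) + real d * C / K"
        by (simp add: sum.distrib)
      finally show ?case using elim KC by linarith
    qed
    then show "\<exists>K. \<forall>\<^sub>F T in sequentially. measure (\<mu> T) {x\<in>space (\<mu> T). \<exists>i<d. \<bar>x i\<bar> > K} \<le> e" by blast
    have xL: "(\<lambda>x. x i) \<in> borel_measurable L" if "i < d" for i
      using measurable_cong_sets[OF L(2) refl] that by (simp add: measurable_cong_sets[OF L(2) refl])
    define c where "c = (\<Sum>l<d. V l l)"
    \<comment> \<open>As \<open>K' \<ge> 1\<close>, a coordinate above \<open>K'\<close> has a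
      square above \<open>K'\<close>, so the second moments bound the tail of the limit by
      \<open>c / K'\<close>, which is at most \<open>e\<close>.\<close>
    define K' where "K' = (c + 1) / e + 1"
    have V0: "V l l \<ge> 0" if "l < d" for l
    proof -
      have "0 \<le> (\<integral>x. x l * x l \<partial>L)" by simp
      then show ?thesis using L(6)[OF that that] by simp
    qed
    have c: "c \<ge> 0" unfolding c_def using V0 by (intro sum_nonneg) auto
    have K': "K' \<ge> 1" "c / K' \<le> e"
    proof -
      show k1: "K' \<ge> 1" using c e by (simp add: K'_def)
      have "e * K' = c + 1 + e" using e by (simp add: K'_def field_simps)
      then have "c \<le> e * K'" using e by linarith
      then show "c / K' \<le> e" using k1 by (simp add: divide_le_eq)
    qed
    have "measure L {x\<in>space L. \<exists>i<d. \<bar>x i\<bar> > K'} \<le> L.expectation (\<lambda>x. (\<Sum>i<d. (x i)\<^sup>2) / K')"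
    proof -
      have S: "{x\<in>space L. \<exists>i<d. \<bar>x i\<bar> > K'} \<in> sets L"
      proof -
        have "{x\<in>space L. \<exists>i<d. \<bar>x i\<bar> > K'} = (\<Union>i\<in>{..<d}. {x\<in>space L. \<bar>x i\<bar> > K'})" by auto
        also have "\<dots> \<in> sets L"
        proof (intro sets.finite_UN)
          fix i assume "i \<in> {..<d}"
          then have [measurable]: "(\<lambda>x. x i) \<in> borel_measurable L" using xL by simp
          show "{x\<in>space L. \<bar>x i\<bar> > K'} \<in> sets L" by measurable
        qed simp
        finally show ?thesis .
      qed
      have ind: "measure L A = L.expectation (indicator A)" if "A \<in> sets L" for A using that by simp
      have "measure L {x\<in>space L. \<exists>i<d. \<bar>x i\<bar> > K'} = L.expectation (indicator {x\<in>space L. \<exists>i<d. \<bar>x i\<bar> > K'})"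
        by (rule ind[OF S])
      also have "\<dots> \<le> L.expectation (\<lambda>x. (\<Sum>i<d. (x i)\<^sup>2) / K')"
      proof (rule integral_mono)
        show "integrable L (indicator {x\<in>space L. \<exists>i<d. \<bar>x i\<bar> > K'} :: _ \<Rightarrow> real)"
          by (intro integrable_real_indicator S) (simp add: less_top[symmetric])
        show "integrable L (\<lambda>x. (\<Sum>i<d. (x i)\<^sup>2) / K')"
          using L(4) by (intro integrable_divide_zero Bochner_Integration.integrable_sum) auto
        fix x
        show "indicator {x\<in>space L. \<exists>i<d. \<bar>x i\<bar> > K'} x \<le> (\<Sum>i<d. (x i)\<^sup>2) / K'"
        proof (cases "\<exists>i<d. \<bar>x i\<bar> > K'")
          case True
          then obtain i where i: "i < d" "\<bar>x i\<bar> > K'" by blast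
          have "K' * 1 \<le> \<bar>x i\<bar> * \<bar>x i\<bar>" using i K' by (intro mult_mono) auto
          also have "\<dots> = (x i)\<^sup>2" by (simp add: power2_eq_square)
          also have "\<dots> \<le> (\<Sum>i<d. (x i)\<^sup>2)" using i by (intro member_le_sum[of i "{..<d}" "\<lambda>i. (x i)\<^sup>2"]) auto
          finally have "1 \<le> (\<Sum>i<d. (x i)\<^sup>2) / K'" using K' by (simp add: le_divide_eq)
          then show ?thesis by (simp add: indicator_def)
        next
          case False
          then show ?thesis using K' by (auto simp: indicator_def intro!: divide_nonneg_nonneg sum_nonneg)
        qed
      qed
      finally show ?thesis .
    qed
    also have "\<dots> = c / K'"
    proof -
      have "L.expectation (\<lambda>x. (\<Sum>i<d. (x i)\<^sup>2)) = (\<Sum>i<d. L.expectation (\<lambda>x. (x i)\<^sup>2))"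
        using L(4) by (intro Bochner_Integration.integral_sum) auto
      also have "\<dots> = c" unfolding c_def using L(6) by (intro sum.cong) (auto simp: power2_eq_square)
      finally show ?thesis by simp
    qed
    finally show "\<exists>K. measure L {x\<in>space L. \<exists>i<d. \<bar>x i\<bar> > K} \<le> e" using K'(2) order_trans by blast
  qed
  have "converges_in_distribution M d Z L"
    unfolding converges_in_distribution_def
  proof (intro conjI allI impI)
    fix f assume f: "continuous_map (powertop_real {..<d}) euclideanreal f \<and> bounded (f ` ({..<d} \<rightarrow>\<^sub>E UNIV))"
    have "(\<integral>x. f x \<partial>\<mu> T) = (\<integral>\<omega>. f (coords d (Z T \<omega>)) \<partial>M)" for T
      unfolding \<mu>_def using f by (intro integral_distr[OF cm] continuous_map_measurable_borel_vec) auto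
    then show "(\<lambda>T. \<integral>\<omega>. f (coords d (Z T \<omega>)) \<partial>M) \<longlonglongrightarrow> (\<integral>x. f x \<partial>L)"
      using conv[OF conjunct1[OF f] conjunct2[OF f]] by simp
  qed (use rv L in auto)
  moreover have "mat d d (\<lambda>(i, j). V i j) = cov_mat d L"
    using L(5,6) by (intro eq_matI) (auto simp: cov_mat_def)
  ultimately show ?thesis unfolding has_asymptotic_variance_def using L(4) by blast
qed

end

section \<open>Definiteness of the stationary covariance\<close>

context var_process
begin

lemma Gam_psd: "psd_form n Gam"
  by (rule covariance_psd_form[where f = "x 0"]) (auto intro: x_M x_square x_cov)

text \<open>By the Lyapunov equation the form of \<open>Gam\<close> at \<open>u\<close> is its form
  at the image of \<open>u\<close> under the transpose of \<open>P\<close>, plus the form of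
  \<open>Om\<close> at \<open>u\<close>. Both are nonnegative, so both vanish.\<close>

lemma Gam_zero:
  assumes Om: "\<And>u. (\<Sum>i<n. \<Sum>j<n. u i * u j * Om i j) = 0 \<Longrightarrow> \<forall>i<n. u i = 0"
    and z: "(\<Sum>i<n. \<Sum>j<n. u i * u j * Gam i j) = 0"
  shows "\<forall>i<n. u i = 0"
proof (rule Om)
  define w where "w k = (\<Sum>i<n. u i * P i k)" for k
  have "(\<Sum>i<n. \<Sum>j<n. u i * u j * Gam i j) = (\<Sum>i<n. \<Sum>j<n. u i * u j * ((\<Sum>k<n. \<Sum>l<n. P i k * P j l * Gam k l) + Om i j))"
  proof (intro sum.cong refl)
    fix i j assume "i \<in> {..<n}" "j \<in> {..<n}"
    then have "Gam i j = (\<Sum>k<n. \<Sum>l<n. P i k * P j l * Gam k l) + Om i j" by (intro Gam_eq) auto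
    then show "u i * u j * Gam i j = u i * u j * ((\<Sum>k<n. \<Sum>l<n. P i k * P j l * Gam k l) + Om i j)"
      by (rule arg_cong)
  qed
  also have "\<dots> = (\<Sum>i<n. \<Sum>j<n. \<Sum>k<n. \<Sum>l<n. (u i * P i k) * (u j * P j l) * Gam k l) + (\<Sum>i<n. \<Sum>j<n. u i * u j * Om i j)"
    by (simp add: distrib_left sum.distrib sum_distrib_left mult_ac)
  also have "(\<Sum>i<n. \<Sum>j<n. \<Sum>k<n. \<Sum>l<n. (u i * P i k) * (u j * P j l) * Gam k l) = (\<Sum>k<n. \<Sum>l<n. w k * w l * Gam k l)"
  proof -
    have "(\<Sum>i<n. \<Sum>j<n. \<Sum>k<n. \<Sum>l<n. (u i * P i k) * (u j * P j l) * Gam k l) =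
        (\<Sum>i<n. \<Sum>k<n. \<Sum>j<n. \<Sum>l<n. (u i * P i k) * (u j * P j l) * Gam k l)"
      by (intro sum.cong refl sum.swap)
    also have "\<dots> = (\<Sum>k<n. \<Sum>i<n. \<Sum>j<n. \<Sum>l<n. (u i * P i k) * (u j * P j l) * Gam k l)" by (rule sum.swap)
    also have "\<dots> = (\<Sum>k<n. \<Sum>i<n. \<Sum>l<n. \<Sum>j<n. (u i * P i k) * (u j * P j l) * Gam k l)"
      by (intro sum.cong refl sum.swap)
    also have "\<dots> = (\<Sum>k<n. \<Sum>l<n. \<Sum>i<n. \<Sum>j<n. (u i * P i k) * (u j * P j l) * Gam k l)"
      by (intro sum.cong refl sum.swap)
    also have "\<dots> = (\<Sum>k<n. \<Sum>l<n. w k * w l * Gam k l)"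
      unfolding w_def sum_product unfolding sum_distrib_right by (rule refl)
    finally show ?thesis .
  qed
  finally have "(\<Sum>k<n. \<Sum>l<n. w k * w l * Gam k l) + (\<Sum>i<n. \<Sum>j<n. u i * u j * Om i j) = 0" using z by simp
  moreover have "0 \<le> (\<Sum>k<n. \<Sum>l<n. w k * w l * Gam k l)" using Gam_psd by (simp add: psd_form_def)
  ultimately show "(\<Sum>i<n. \<Sum>j<n. u i * u j * Om i j) = 0" using Om_nonneg[of u] by linarith
qed

end

subsection \<open>The NIRVAR model as a stable autoregression\<close>

context nirvar
begin

definition noise :: "nat \<Rightarrow> nat \<Rightarrow> 'w \<Rightarrow> real" where
  "noise t a \<omega> = eps (a div N) (int t) \<omega> $ (a mod N)"

definition state :: "nat \<Rightarrow> nat \<Rightarrow> 'w \<Rightarrow> real" where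
  "state t a \<omega> = X (a div N) (int t) \<omega> $ (a mod N)"

text \<open>Block diagonal because the noises of different features are independent and
  centred.\<close>

definition noise_cov :: "nat \<Rightarrow> nat \<Rightarrow> real" where
  "noise_cov a b = (if a div N = b div N then Sigma (a div N) $$ (a mod N, b mod N) else 0)"

definition state_cov :: "nat \<Rightarrow> nat \<Rightarrow> real" where
  "state_cov a b = expectation (\<lambda>\<omega>. state 0 a \<omega> * state 0 b \<omega>)"

text \<open>Generated by the joint restriction of the family to \<open>I\<close>, since independence
  of disjoint groups is available for exactly these restriction maps.\<close>

definition generated :: "(nat \<times> int) set \<Rightarrow> 'w measure" where
  "generated I = vimage_algebra (space M) (\<lambda>\<omega>. restrict (\<lambda>i. (\<lambda>(p, t) \<omega>. coords N (eps p t \<omega>)) i \<omega>) I) (Pi\<^sub>M I (\<lambda>_. borel_vec N))"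

lemma index_less: "a < N * Q \<Longrightarrow> a div N < Q" "a < N * Q \<Longrightarrow> a mod N < N"
  using divmod_less[of a N Q] by auto

lemma coords_eps_measurable: "p < Q \<Longrightarrow> (\<lambda>\<omega>. coords N (eps p t \<omega>)) \<in> measurable M (borel_vec N)"
  using random_eps by (simp add: random_vec_def)

lemma restrict_measurable:
  assumes "I \<subseteq> {..<Q} \<times> UNIV"
  shows "(\<lambda>\<omega>. restrict (\<lambda>i. (\<lambda>(p, t) \<omega>. coords N (eps p t \<omega>)) i \<omega>) I) \<in> measurable M (Pi\<^sub>M I (\<lambda>_. borel_vec N))"
  using assms by (intro measurable_restrict) (auto intro: coords_eps_measurable)

lemma generated_subalgebra:
  assumes "I \<subseteq> {..<Q} \<times> UNIV"
  shows "subalgebra M (generated I)"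
  unfolding subalgebra_def generated_def
  using sets_image_in_sets[OF refl restrict_measurable[OF assms]] by simp

lemma generated_component:
  assumes I: "I \<subseteq> {..<Q} \<times> UNIV" and pt: "(p, t) \<in> I"
  shows "(\<lambda>\<omega>. coords N (eps p t \<omega>)) \<in> measurable (generated I) (borel_vec N)"
proof -
  have "(\<lambda>\<omega>. restrict (\<lambda>i. (\<lambda>(p, t) \<omega>. coords N (eps p t \<omega>)) i \<omega>) I) \<in> measurable (generated I) (Pi\<^sub>M I (\<lambda>_. borel_vec N))"
    unfolding generated_def
    by (rule measurable_vimage_algebra1) (use measurable_space[OF restrict_measurable[OF I]] in auto)
  from measurable_compose[OF this measurable_component_singleton[OF pt]]
  show ?thesis using pt by simp
qed

lemma generated_mono:
  assumes "I \<subseteq> J" "J \<subseteq> {..<Q} \<times> UNIV"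
  shows "sets (generated I) \<subseteq> sets (generated J)"
  unfolding generated_def[of I]
proof (rule sets_image_in_sets)
  show "space (generated J) = space M" by (simp add: generated_def)
  show "(\<lambda>\<omega>. restrict (\<lambda>i. (\<lambda>(p, t) \<omega>. coords N (eps p t \<omega>)) i \<omega>) I) \<in> measurable (generated J) (Pi\<^sub>M I (\<lambda>_. borel_vec N))"
    using assms by (intro measurable_restrict) (auto intro!: generated_component)
qed

lemma generated_indep:
  assumes "I \<subseteq> {..<Q} \<times> UNIV" "J \<subseteq> {..<Q} \<times> UNIV" "I \<inter> J = {}"
  shows "indep_set (sets (generated I)) (sets (generated J))"
proof -
  let ?f = "\<lambda>I \<omega>. restrict (\<lambda>i. (\<lambda>(p, t) \<omega>. coords N (eps p t \<omega>)) i \<omega>) I"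
  have s: "sets (generated I) \<subseteq> sigma_sets (space M) {?f I -` A \<inter> space M | A. A \<in> sets (Pi\<^sub>M I (\<lambda>_. borel_vec N))}"
    if "I \<subseteq> {..<Q} \<times> UNIV" for I
    unfolding generated_def
    using measurable_space[OF restrict_measurable[OF that]]
    by (subst sets_vimage_algebra2) (auto intro: sigma_sets.Basic)
  have "indep_var (Pi\<^sub>M I (\<lambda>_. borel_vec N)) (?f I) (Pi\<^sub>M J (\<lambda>_. borel_vec N)) (?f J)"
    by (rule indep_var_restrict[OF eps_indep assms(3,1,2)])
  then show ?thesis unfolding indep_var_eq
    using s[OF assms(1)] s[OF assms(2)] unfolding indep_sets2_eq by (meson order_trans subsetD)
qed

lemma noise_generated:
  assumes "I \<subseteq> {..<Q} \<times> UNIV" "a < N * Q" "(a div N, int t) \<in> I"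
  shows "noise t a \<in> borel_measurable (generated I)"
proof -
  have "(\<lambda>\<omega>. coords N (eps (a div N) (int t) \<omega>) (a mod N)) \<in> borel_measurable (generated I)"
    by (rule measurable_compose[OF generated_component[OF assms(1,3)]]) (use index_less[OF assms(2)] in simp)
  then show ?thesis using index_less[OF assms(2)] by (simp add: noise_def[abs_def] coords_def)
qed

lemma noise_fourth: "a < N * Q \<Longrightarrow> integrable M (\<lambda>\<omega>. noise t a \<omega> ^ 4)"
  using eps_fourth_moments index_less[of a] unfolding noise_def power4_eq_xxxx by blast

lemma noise_M: "a < N * Q \<Longrightarrow> noise t a \<in> borel_measurable M"
  using measurable_from_subalg[OF generated_subalgebra noise_generated, of "{(a div N, int t)}"] index_less[of a] by simp

lemma noise_mean: "a < N * Q \<Longrightarrow> expectation (noise t a) = 0"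
  using eps_mean index_less[of a] by (simp add: noise_def[abs_def])

lemma noise_covariance:
  assumes "a < N * Q" "b < N * Q"
  shows "expectation (\<lambda>\<omega>. noise t a \<omega> * noise t b \<omega>) = noise_cov a b"
proof (cases "a div N = b div N")
  case True
  then show ?thesis using eps_covariance index_less assms by (simp add: noise_def noise_cov_def)
next
  case False
  let ?I = "\<lambda>a. {(a div N, int t)}"
  have I: "?I a \<subseteq> {..<Q} \<times> UNIV" if "a < N * Q" for a using index_less(1)[OF that] by simp
  have "indep_var borel (noise t a) borel (noise t b)"
    by (rule indep_var_subalgebra[OF generated_subalgebra[OF I[OF assms(1)]] generated_subalgebra[OF I[OF assms(2)]] generated_indep[OF I[OF assms(1)] I[OF assms(2)]]])
       (use False assms in \<open>auto intro!: noise_generated I dest: index_less\<close>)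
  from indep_var_lebesgue_integral[OF this]
    integrable_fourth_power_imp(1)[OF finite_measure_axioms noise_M noise_fourth]
  show ?thesis using assms False by (simp add: noise_mean noise_cov_def)
qed

lemma var_mat_carrier: "var_mat N Q A W \<in> carrier_mat (N * Q) (N * Q)"
  by (simp add: var_mat_def)

lemma state_M: "a < N * Q \<Longrightarrow> state t a \<in> borel_measurable M"
proof -
  assume a: "a < N * Q"
  have "(\<lambda>\<omega>. coords N (X (a div N) (int t) \<omega>)) \<in> measurable M (borel_vec N)"
    using random_X index_less[OF a] by (simp add: random_vec_def)
  then have "(\<lambda>\<omega>. coords N (X (a div N) (int t) \<omega>) (a mod N)) \<in> borel_measurable M"
    by (rule measurable_compose) (use index_less[OF a] in simp)
  then show ?thesis using index_less[OF a] by (simp add: state_def[abs_def] coords_def)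
qed

lemma state_equation:
  assumes a: "a < N * Q"
  shows "AE \<omega> in M. state (Suc t) a \<omega> = (\<Sum>b<N * Q. var_mat N Q A W $$ (a, b) * state t b \<omega>) + noise (Suc t) a \<omega>"
proof -
  define p i where "p = a div N" and "i = a mod N"
  have p: "p < Q" "i < N" using index_less[OF a] by (simp_all add: p_def i_def)
  have "int (Suc t) - 1 = int t" by simp
  then have "AE \<omega> in M. \<forall>i<N. X p (int (Suc t)) \<omega> $ i = (\<Sum>r<Q. ((A p r \<odot>\<^sub>m W p r) *\<^sub>v X r (int t) \<omega>) $ i) + eps p (int (Suc t)) \<omega> $ i"
    using equation[OF p(1), of "int (Suc t)"] by (simp only:)
  then show ?thesis
  proof (rule AE_mp, intro AE_I2 impI)
    fix \<omega> assume \<omega>: "\<omega> \<in> space M"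
      and eq: "\<forall>i<N. X p (int (Suc t)) \<omega> $ i = (\<Sum>r<Q. ((A p r \<odot>\<^sub>m W p r) *\<^sub>v X r (int t) \<omega>) $ i) + eps p (int (Suc t)) \<omega> $ i"
    have "(\<Sum>b<N * Q. var_mat N Q A W $$ (a, b) * state t b \<omega>) =
        (\<Sum>b<N * Q. (A p (b div N) \<odot>\<^sub>m W p (b div N)) $$ (i, b mod N) * X (b div N) (int t) \<omega> $ (b mod N))"
      using a p by (intro sum.cong refl) (simp add: var_mat_def coef_mat_def hconcat_mat_def state_def p_def i_def)
    also have "\<dots> = (\<Sum>r<Q. \<Sum>j<N. (A p r \<odot>\<^sub>m W p r) $$ (i, j) * X r (int t) \<omega> $ j)"
      by (rule sum_divmod[of "\<lambda>j r. (A p r \<odot>\<^sub>m W p r) $$ (i, j) * X r (int t) \<omega> $ j"])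
    also have "\<dots> = (\<Sum>r<Q. ((A p r \<odot>\<^sub>m W p r) *\<^sub>v X r (int t) \<omega>) $ i)"
    proof (rule sum.cong[OF refl])
      fix r assume "r \<in> {..<Q}"
      then have "A p r \<in> carrier_mat N N" "X r (int t) \<omega> \<in> carrier_vec N"
        using adjacency[OF p(1)] random_X \<omega> by (auto simp: binary_mat_def random_vec_def)
      then show "(\<Sum>j<N. (A p r \<odot>\<^sub>m W p r) $$ (i, j) * X r (int t) \<omega> $ j) = ((A p r \<odot>\<^sub>m W p r) *\<^sub>v X r (int t) \<omega>) $ i"
        using p by (simp add: scalar_prod_def hadamard_mat_def atLeast0LessThan)
    qed
    finally show "state (Suc t) a \<omega> = (\<Sum>b<N * Q. var_mat N Q A W $$ (a, b) * state t b \<omega>) + noise (Suc t) a \<omega>"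
      using eq p by (simp add: state_def noise_def p_def[symmetric] i_def[symmetric])
  qed
qed

text \<open>The past at time \<open>t\<close> contains the noise at times \<open>1\<close> to
  \<open>t\<close> only, because the path starts at time \<open>0\<close>; it is trivial at
  \<open>t = 0\<close> and never overlaps the group at \<open>Suc t\<close>.\<close>

lemma stacked_var_process:
  "\<exists>c r C4. var_process M (N * Q) (\<lambda>a b. var_mat N Q A W $$ (a, b)) noise_cov noise
     (\<lambda>t. generated ({..<Q} \<times> {1..int t})) (\<lambda>t. generated ({..<Q} \<times> {int t})) c r C4 state state_cov"
proof -
  obtain c r where cr: "geometric_decay {..<N * Q} (\<lambda>a b. var_mat N Q A W $$ (a, b)) c r"
    using spectral_radius_less_1_imp_geometric_decay[OF var_mat_carrier _ stable] dims by auto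
  obtain C4 where C4: "\<And>p t i. p < Q \<Longrightarrow> i < N \<Longrightarrow>
      expectation (\<lambda>\<omega>. \<bar>eps p t \<omega> $ i * eps p t \<omega> $ i * eps p t \<omega> $ i * eps p t \<omega> $ i\<bar>) \<le> C4"
    using eps_fourth_moments by blast
  have "var_process M (N * Q) (\<lambda>a b. var_mat N Q A W $$ (a, b)) noise_cov noise
     (\<lambda>t. generated ({..<Q} \<times> {1..int t})) (\<lambda>t. generated ({..<Q} \<times> {int t})) c r C4 state state_cov"
  proof unfold_locales
    show "geometric_decay {..<N * Q} (\<lambda>a b. var_mat N Q A W $$ (a, b)) c r" by (rule cr)
    show "subalgebra M (generated ({..<Q} \<times> {1..int t}))" "subalgebra M (generated ({..<Q} \<times> {int t}))" for t
      by (rule generated_subalgebra; auto)+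
    show "sets (generated ({..<Q} \<times> {1..int s})) \<subseteq> sets (generated ({..<Q} \<times> {1..int t}))" if "s \<le> t" for s t
      using that by (intro generated_mono) auto
    show "indep_set (sets (generated ({..<Q} \<times> {1..int t}))) (sets (generated ({..<Q} \<times> {int (Suc t)})))" for t
      by (rule generated_indep) auto
    fix a t assume a: "a < N * Q"
    show "noise (Suc t) a \<in> borel_measurable (generated ({..<Q} \<times> {1..int (Suc t)}))"
      "noise (Suc t) a \<in> borel_measurable (generated ({..<Q} \<times> {int (Suc t)}))"
      using a by (auto intro!: noise_generated dest: index_less)
    show "expectation (noise (Suc t) a) = 0" by (rule noise_mean[OF a])
    show "integrable M (\<lambda>\<omega>. noise (Suc t) a \<omega> ^ 4)" by (rule noise_fourth[OF a])
    show "expectation (\<lambda>\<omega>. noise (Suc t) a \<omega> ^ 4) \<le> C4"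
    proof -
      have "expectation (\<lambda>\<omega>. noise (Suc t) a \<omega> ^ 4) = expectation (\<lambda>\<omega>. \<bar>noise (Suc t) a \<omega> ^ 4\<bar>)" by simp
      also have "\<dots> \<le> C4" using C4 index_less[OF a] unfolding power4_eq_xxxx noise_def by blast
      finally show ?thesis .
    qed
    show "state t a \<in> borel_measurable M" by (rule state_M[OF a])
    show "integrable M (\<lambda>\<omega>. (state t a \<omega>)\<^sup>2)" using X_square_integrable index_less[OF a] by (simp add: state_def)
    show "AE \<omega> in M. state (Suc t) a \<omega> = (\<Sum>b<N * Q. var_mat N Q A W $$ (a, b) * state t b \<omega>) + noise (Suc t) a \<omega>"
      by (rule state_equation[OF a])
    fix b assume b: "b < N * Q"
    show "expectation (\<lambda>\<omega>. noise (Suc t) a \<omega> * noise (Suc t) b \<omega>) = noise_cov a b" by (rule noise_covariance[OF a b])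
    show "expectation (\<lambda>\<omega>. state t a \<omega> * state t b \<omega>) = state_cov a b"
      using X_autocovariance[of "a div N" "b div N" "a mod N" "b mod N" "int t" 0 0] index_less[OF a] index_less[OF b]
      by (simp add: state_def state_cov_def)
  qed
  then show ?thesis by blast
qed

lemma noise_index:
  assumes "q < Q" "i < N"
  shows "N * q + i < N * Q" "(N * q + i) div N = q" "(N * q + i) mod N = i"
proof -
  have "N * q + i < N * Suc q" using assms by simp
  also have "\<dots> \<le> N * Q" using assms by (intro mult_le_mono) auto
  finally show "N * q + i < N * Q" .
qed (use assms in auto)

lemma Sigma_pd:
  assumes p: "p < Q"
  shows "pd_mat N (Sigma p)"
proof (rule psd_invertible_imp_pd[OF Sigma(1)[OF p] _ Sigma(2)[OF p]])
  note a = noise_index[OF p]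
  show "psd_form N (\<lambda>i j. Sigma p $$ (i, j))"
  proof (rule covariance_psd_form[where f = "\<lambda>i. noise 0 (N * p + i)"])
    fix i assume i: "i < N"
    show "noise 0 (N * p + i) \<in> borel_measurable M" by (rule noise_M[OF a(1)[OF i]])
    then show "integrable M (\<lambda>\<omega>. (noise 0 (N * p + i) \<omega>)\<^sup>2)"
      by (rule integrable_fourth_power_imp(2)[OF finite_measure_axioms _ noise_fourth[OF a(1)[OF i]]])
    fix j assume j: "j < N"
    show "expectation (\<lambda>\<omega>. noise 0 (N * p + i) \<omega> * noise 0 (N * p + j) \<omega>) = Sigma p $$ (i, j)"
      using noise_covariance[OF a(1)[OF i] a(1)[OF j], of 0] i j by (simp add: noise_cov_def a)
  qed
qed

text \<open>The form splits into the forms of the matrices \<open>Sigma p\<close>, one per feature.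
  These are nonnegative and definite, so a zero sum annihilates every block of
  \<open>u\<close>.\<close>

lemma noise_cov_zero:
  assumes z: "(\<Sum>a<N * Q. \<Sum>b<N * Q. u a * u b * noise_cov a b) = 0"
  shows "\<forall>a<N * Q. u a = 0"
proof -
  let ?q = "\<lambda>p. \<Sum>i<N. \<Sum>j<N. u (i + N * p) * u (j + N * p) * Sigma p $$ (i, j)"
  have "(\<Sum>a<N * Q. \<Sum>b<N * Q. u a * u b * noise_cov a b) = (\<Sum>p<Q. ?q p)"
  proof -
    let ?U = "\<lambda>i p. u (i + N * p)"
    have uU: "u a = ?U (a mod N) (a div N)" for a by simp
    have "(\<Sum>a<N * Q. \<Sum>b<N * Q. u a * u b * noise_cov a b) =
        (\<Sum>a<N * Q. \<Sum>b<N * Q. ?U (a mod N) (a div N) * ?U (b mod N) (b div N) * (if a div N = b div N then Sigma (a div N) $$ (a mod N, b mod N) else 0))"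
      by (simp add: noise_cov_def)
    also have "\<dots> = (\<Sum>a<N * Q. \<Sum>r<Q. \<Sum>j<N. ?U (a mod N) (a div N) * ?U j r * (if a div N = r then Sigma (a div N) $$ (a mod N, j) else 0))"
      by (intro sum.cong refl sum_divmod[of "\<lambda>j r. ?U (_ mod N) (_ div N) * ?U j r * (if _ div N = r then Sigma (_ div N) $$ (_ mod N, j) else 0)"])
    also have "\<dots> = (\<Sum>p<Q. \<Sum>i<N. \<Sum>r<Q. \<Sum>j<N. ?U i p * ?U j r * (if p = r then Sigma p $$ (i, j) else 0))"
      by (rule sum_divmod[of "\<lambda>i p. \<Sum>r<Q. \<Sum>j<N. ?U i p * ?U j r * (if p = r then Sigma p $$ (i, j) else 0)"])
    also have "\<dots> = (\<Sum>p<Q. ?q p)"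
    proof (rule sum.cong[OF refl], rule sum.cong[OF refl])
      fix p i assume p: "p \<in> {..<Q}"
      have "(\<Sum>r<Q. \<Sum>j<N. ?U i p * ?U j r * (if p = r then Sigma p $$ (i, j) else 0)) =
          (\<Sum>r<Q. if p = r then (\<Sum>j<N. ?U i p * ?U j r * Sigma p $$ (i, j)) else 0)"
        by (intro sum.cong refl) simp
      also have "\<dots> = (\<Sum>j<N. ?U i p * ?U j p * Sigma p $$ (i, j))" using p by simp
      finally show "(\<Sum>r<Q. \<Sum>j<N. ?U i p * ?U j r * (if p = r then Sigma p $$ (i, j) else 0)) = (\<Sum>j<N. ?U i p * ?U j p * Sigma p $$ (i, j))" .
    qed
    finally show ?thesis .
  qed
  moreover have q0: "?q p \<ge> 0" if "p < Q" for p
    using pd_mat_psd_form[OF Sigma_pd[OF that]] by (simp add: psd_form_def)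
  ultimately have "\<forall>p\<in>{..<Q}. ?q p = 0" using z sum_nonneg_eq_0_iff[of "{..<Q}" ?q] by auto
  then have "u (i + N * p) = 0" if "p < Q" "i < N" for p i
    using pd_mat_zero[OF Sigma_pd[OF that(1)], of "\<lambda>i. u (i + N * p)" i] that by simp
  then have "u (a mod N + N * (a div N)) = 0" if "a < N * Q" for a using index_less[OF that] by blast
  then show ?thesis by simp
qed

definition state_cov_mat :: "real mat" where
  "state_cov_mat = mat (N * Q) (N * Q) (\<lambda>(a, b). state_cov a b)"

lemma state_cov_mat_pd: "pd_mat (N * Q) state_cov_mat"
proof -
  obtain c r C4 where "var_process M (N * Q) (\<lambda>a b. var_mat N Q A W $$ (a, b)) noise_cov noise
     (\<lambda>t. generated ({..<Q} \<times> {1..int t})) (\<lambda>t. generated ({..<Q} \<times> {int t})) c r C4 state state_cov"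
    using stacked_var_process by blast
  then interpret V: var_process M "N * Q" "\<lambda>a b. var_mat N Q A W $$ (a, b)" noise_cov noise
     "\<lambda>t. generated ({..<Q} \<times> {1..int t})" "\<lambda>t. generated ({..<Q} \<times> {int t})" c r C4 state state_cov .
  have e: "(\<Sum>a<N * Q. \<Sum>b<N * Q. u a * u b * state_cov_mat $$ (a, b)) = (\<Sum>a<N * Q. \<Sum>b<N * Q. u a * u b * state_cov a b)" for u
    by (intro sum.cong refl) (simp add: state_cov_mat_def)
  show ?thesis
  proof (rule pd_matI)
    show "state_cov_mat \<in> carrier_mat (N * Q) (N * Q)" by (simp add: state_cov_mat_def)
    show "psd_form (N * Q) (\<lambda>a b. state_cov_mat $$ (a, b))"
      using V.Gam_psd unfolding psd_form_def e by (simp add: state_cov_mat_def)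
    fix u assume "(\<Sum>a<N * Q. \<Sum>b<N * Q. u a * u b * state_cov_mat $$ (a, b)) = 0"
    then have "(\<Sum>a<N * Q. \<Sum>b<N * Q. u a * u b * state_cov a b) = 0"
      unfolding e .
    from V.Gam_zero[OF noise_cov_zero this] show "\<forall>a<N * Q. u a = 0" .
  qed
qed

end

subsection \<open>Asymptotic normality of the estimators\<close>

lemma vec_mat_index: "k < n * m \<Longrightarrow> A \<in> carrier_mat n m \<Longrightarrow> vec_mat A $ k = A $$ (k mod n, k div n)"
  by (simp add: vec_mat_def)

lemma vec_mat_carrier: "A \<in> carrier_mat n m \<Longrightarrow> vec_mat A \<in> carrier_vec (n * m)"
  by (simp add: vec_mat_def)

lemma mult_mat_vec_index:
  fixes A :: "real mat"
  assumes "A \<in> carrier_mat n m" "v \<in> carrier_vec m" "i < n"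
  shows "(A *\<^sub>v v) $ i = (\<Sum>j<m. A $$ (i, j) * v $ j)"
  using assms by (simp add: scalar_prod_def atLeast0LessThan)

lemma kron_mult_vec_mat:
  assumes X: "X \<in> carrier_mat p T" and S: "S \<in> carrier_mat N N" and U: "U \<in> carrier_mat N T" and k: "k < p * N"
  shows "((X \<otimes>\<^sub>m S) *\<^sub>v vec_mat U) $ k = (\<Sum>t<T. X $$ (k div N, t) * (\<Sum>i<N. S $$ (k mod N, i) * U $$ (i, t)))"
proof -
  have K: "X \<otimes>\<^sub>m S \<in> carrier_mat (p * N) (T * N)" by (rule kron_carrier[OF X S])
  have d: "dim_vec (vec_mat U) = T * N" using U by (simp add: vec_mat_def mult.commute)
  have "((X \<otimes>\<^sub>m S) *\<^sub>v vec_mat U) $ k = (\<Sum>l<T * N. (X \<otimes>\<^sub>m S) $$ (k, l) * vec_mat U $ l)"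
    using K d k by (simp add: scalar_prod_def atLeast0LessThan)
  also have "\<dots> = (\<Sum>l<T * N. X $$ (k div N, l div N) * S $$ (k mod N, l mod N) * U $$ (l mod N, l div N))"
    using U by (intro sum.cong refl) (simp add: kron_index[OF X S k] vec_mat_index mult.commute)
  also have "\<dots> = (\<Sum>t<T. \<Sum>i<N. X $$ (k div N, t) * S $$ (k mod N, i) * U $$ (i, t))"
    by (rule sum_divmod'[of "\<lambda>t i. X $$ (k div N, t) * S $$ (k mod N, i) * U $$ (i, t)"])
  finally show ?thesis by (simp add: sum_distrib_left mult.assoc)
qed

text \<open>Entrywise form of the fact that noise with covariance \<open>S\<close>, multiplied by
  the inverse of \<open>S\<close>, has covariance \<open>inv_mat S\<close>.\<close>

lemma inv_mat_sandwich:
  assumes S: "S \<in> carrier_mat N N" "det S \<noteq> 0" "S\<^sup>T = S" and ij: "s < N" "s' < N"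
  shows "(\<Sum>i<N. \<Sum>j<N. inv_mat S $$ (s, i) * inv_mat S $$ (s', j) * S $$ (i, j)) = inv_mat S $$ (s, s')"
proof -
  let ?I = "inv_mat S"
  have I: "?I \<in> carrier_mat N N" using S by simp
  have sym: "?I $$ (s', j) = ?I $$ (j, s')" if "j < N" for j
    using transpose_inv_mat[OF S] I ij that by (metis carrier_matD index_transpose_mat(1))
  have "(\<Sum>i<N. \<Sum>j<N. ?I $$ (s, i) * ?I $$ (s', j) * S $$ (i, j)) = (\<Sum>i<N. ?I $$ (s, i) * (\<Sum>j<N. S $$ (i, j) * ?I $$ (j, s')))"
    unfolding sum_distrib_left by (intro sum.cong refl) (simp add: sym)
  also have "\<dots> = (\<Sum>i<N. ?I $$ (s, i) * (S * ?I) $$ (i, s'))"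
    using S(1) ij by (intro sum.cong refl) (simp add: scalar_prod_def atLeast0LessThan carrier_matD[OF I])
  also have "\<dots> = (\<Sum>i<N. ?I $$ (s, i) * (if i = s' then 1 else 0))"
    unfolding inv_mat_mult(1)[OF S(1,2)] using ij by (intro sum.cong refl) simp
  also have "\<dots> = ?I $$ (s, s')" using ij by (simp add: if_distrib cong: if_cong)
  finally show ?thesis .
qed

text \<open>\<open>b\<close>, \<open>f\<close> and \<open>C\<close> may depend on
  \<open>\<epsilon>\<close>, but the bound \<open>c\<close> on the expectation of \<open>b\<close>
  may not. A small \<open>\<epsilon>\<close> handles the first summand for all times at once, and a
  late time handles the second.\<close>

lemma (in prob_space) min_tendsto_zeroI:
  assumes z: "\<And>T. z T \<in> borel_measurable M"
    and bound: "\<And>\<epsilon>. \<epsilon> > 0 \<Longrightarrow> \<exists>b f C. L1_null f \<and> C \<ge> 0 \<and> (\<forall>T. integrable M (b T) \<and> expectation (b T) \<le> c) \<and>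
      (\<forall>T>0. AE \<omega> in M. min 1 \<bar>z T \<omega>\<bar> \<le> \<epsilon> * b T \<omega> + C * f T \<omega>)"
    and c: "c \<ge> 0"
  shows "(\<lambda>T. expectation (\<lambda>\<omega>. min 1 \<bar>z T \<omega>\<bar>)) \<longlonglongrightarrow> 0"
proof (rule LIMSEQ_I)
  fix e :: real assume e: "e > 0"
  define \<epsilon> where "\<epsilon> = e / (2 * (c + 1))"
  have \<epsilon>: "\<epsilon> > 0" "\<epsilon> * c \<le> e / 2" using e c by (auto simp: \<epsilon>_def field_simps)
  obtain b f C where f: "L1_null f" and C: "C \<ge> 0" and b: "\<And>T. integrable M (b T)" "\<And>T. expectation (b T) \<le> c"
    and le: "\<And>T. T > 0 \<Longrightarrow> AE \<omega> in M. min 1 \<bar>z T \<omega>\<bar> \<le> \<epsilon> * b T \<omega> + C * f T \<omega>"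
    using bound[OF \<epsilon>(1)] by blast
  have fI: "integrable M (f T)" for T using f by (simp add: L1_null_def)
  have E: "expectation (\<lambda>\<omega>. min 1 \<bar>z T \<omega>\<bar>) \<le> e / 2 + C * expectation (\<lambda>\<omega>. \<bar>f T \<omega>\<bar>)" if "T > 0" for T
  proof -
    have "expectation (\<lambda>\<omega>. min 1 \<bar>z T \<omega>\<bar>) \<le> expectation (\<lambda>\<omega>. \<epsilon> * b T \<omega> + C * f T \<omega>)"
      by (rule integral_mono_AE[OF _ _ le[OF that]])
         (use z b fI in \<open>auto intro!: integrable_const_bound[of _ 1]\<close>)
    also have "\<dots> = \<epsilon> * expectation (b T) + C * expectation (f T)" using b fI by simp
    also have "\<dots> \<le> \<epsilon> * c + C * expectation (\<lambda>\<omega>. \<bar>f T \<omega>\<bar>)"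
      using b \<epsilon> C fI by (intro add_mono mult_left_mono integral_mono) auto
    finally show ?thesis using \<epsilon> by simp
  qed
  have "(\<lambda>T. C * expectation (\<lambda>\<omega>. \<bar>f T \<omega>\<bar>)) \<longlonglongrightarrow> C * 0"
    using f by (intro tendsto_mult tendsto_const) (simp add: L1_null_def)
  then have "\<forall>\<^sub>F T in sequentially. C * expectation (\<lambda>\<omega>. \<bar>f T \<omega>\<bar>) < e / 2"
    using e by (intro order_tendstoD(2)[of _ 0]) auto
  with eventually_gt_at_top[of 0] have "\<forall>\<^sub>F T in sequentially. norm (expectation (\<lambda>\<omega>. min 1 \<bar>z T \<omega>\<bar>) - 0) < e"
  proof eventually_elim
    case (elim T)
    have "0 \<le> expectation (\<lambda>\<omega>. min 1 \<bar>z T \<omega>\<bar>)" by simp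
    then show ?case using E[OF elim(1)] elim(2) by simp
  qed
  then show "\<exists>no. \<forall>T\<ge>no. norm (expectation (\<lambda>\<omega>. min 1 \<bar>z T \<omega>\<bar>) - 0) < e" by (simp add: eventually_sequentially)
qed

section \<open>Score, Gram matrix and measurability of the estimator\<close>

context nirvar
begin

lemma design_mat_carrier: "design_mat N Q X T \<omega> \<in> carrier_mat (N * Q) T"
  by (simp add: design_mat_def)

lemma response_mat_carrier: "response_mat N Y q T \<omega> \<in> carrier_mat N T"
  by (simp add: response_mat_def)

lemma design_mat_index: "a < N * Q \<Longrightarrow> t < T \<Longrightarrow> design_mat N Q X T \<omega> $$ (a, t) = state t a \<omega>"
  by (simp add: design_mat_def stack_vec_def state_def)

lemma response_noise_index:
  "q < Q \<Longrightarrow> i < N \<Longrightarrow> t < T \<Longrightarrow> response_mat N eps q T \<omega> $$ (i, t) = noise (Suc t) (N * q + i) \<omega>"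
  using noise_index[of q i] by (simp add: response_mat_def noise_def add.commute)

lemma score_index:
  assumes q: "q < Q" and S: "S \<in> carrier_mat N N" and k: "k < N * Q * N"
  shows "((design_mat N Q X T \<omega> \<otimes>\<^sub>m S) *\<^sub>v vec_mat (response_mat N eps q T \<omega>)) $ k =
    (\<Sum>i<N. S $$ (k mod N, i) * (\<Sum>t<T. state t (k div N) \<omega> * noise (Suc t) (N * q + i) \<omega>))"
proof -
  note kd = divmod_less'[OF k]
  have "((design_mat N Q X T \<omega> \<otimes>\<^sub>m S) *\<^sub>v vec_mat (response_mat N eps q T \<omega>)) $ k =
      (\<Sum>t<T. state t (k div N) \<omega> * (\<Sum>i<N. S $$ (k mod N, i) * noise (Suc t) (N * q + i) \<omega>))"
    unfolding kron_mult_vec_mat[OF design_mat_carrier S response_mat_carrier k]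
    using kd q by (intro sum.cong refl) (simp add: design_mat_index response_noise_index)
  also have "\<dots> = (\<Sum>t<T. \<Sum>i<N. S $$ (k mod N, i) * (state t (k div N) \<omega> * noise (Suc t) (N * q + i) \<omega>))"
    by (simp add: sum_distrib_left mult_ac)
  also have "\<dots> = (\<Sum>i<N. \<Sum>t<T. S $$ (k mod N, i) * (state t (k div N) \<omega> * noise (Suc t) (N * q + i) \<omega>))"
    by (rule sum.swap)
  finally show ?thesis by (simp add: sum_distrib_left)
qed

lemma gram_index:
  assumes "a < N * Q" "b < N * Q"
  shows "(design_mat N Q X T \<omega> * (design_mat N Q X T \<omega>)\<^sup>T) $$ (a, b) = (\<Sum>t<T. state t a \<omega> * state t b \<omega>)"
proof -
  note c = design_mat_carrier[of T \<omega>]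
  have "(design_mat N Q X T \<omega> * (design_mat N Q X T \<omega>)\<^sup>T) $$ (a, b) = (\<Sum>t<T. design_mat N Q X T \<omega> $$ (a, t) * design_mat N Q X T \<omega> $$ (b, t))"
    using c assms by (simp add: scalar_prod_def atLeast0LessThan)
  also have "\<dots> = (\<Sum>t<T. state t a \<omega> * state t b \<omega>)"
    using assms by (intro sum.cong refl) (simp add: design_mat_index)
  finally show ?thesis .
qed

text \<open>Convergence in distribution asks for measurability at every sample size, including
  samples with a singular normal matrix; the adjugate formula behind
  \<open>gls_core_measurable\<close> covers these.\<close>

lemma gls_beta_random:
  assumes q: "q < Q" and B: "B \<in> carrier_mat N (N * Q)" and b: "beta \<in> carrier_vec (N * Q * N)"
  shows "random_vec M (N * Q * N) (\<lambda>\<omega>. a \<cdot>\<^sub>v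
    (gls_beta (Sigma q) B (design_mat N Q X T \<omega>) (vec_mat (response_mat N X q T \<omega>)) - beta))"
proof -
  let ?D = "design_mat N Q X T" and ?R = "restr_mat B" and ?S = "inv_mat (Sigma q)" and ?d = "N * Q * N" and ?m = "nonzeros B"
  let ?y = "\<lambda>\<omega>. vec_mat (response_mat N X q T \<omega>)"
  have R: "?R \<in> carrier_mat ?d ?m" using restr_mat_carrier[OF B] by (simp add: mult.commute mult.left_commute)
  have RT: "?R\<^sup>T \<in> carrier_mat ?m ?d" using R by simp
  have S: "?S \<in> carrier_mat N N" using Sigma(1)[OF q] by simp
  have D: "measurable_algebra.mat_in M (N * Q) T ?D"
    by (rule measurable_algebra.mat_inI[where f = "\<lambda>a t. state t a"]) (auto simp: design_mat_carrier design_mat_index state_M)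
  have DT: "measurable_algebra.mat_in M T (N * Q) (\<lambda>\<omega>. (?D \<omega>)\<^sup>T)"
    by (rule measurable_algebra.mat_inI[where f = "\<lambda>t a. state t a"])
       (use design_mat_carrier[of T] in \<open>auto simp: design_mat_index state_M carrier_matD[OF design_mat_carrier]\<close>)
  have G: "measurable_algebra.mat_in M ?d ?d (\<lambda>\<omega>. (?D \<omega> * (?D \<omega>)\<^sup>T) \<otimes>\<^sub>m ?S)"
    by (intro measurable_algebra.mat_in_kron measurable_algebra.mat_in_mult[OF D DT] measurable_algebra.mat_in_const S)
  have Gc: "(?D \<omega> * (?D \<omega>)\<^sup>T) \<otimes>\<^sub>m ?S \<in> carrier_mat ?d ?d" for \<omega> using G by (simp add: measurable_algebra.mat_in_def)
  have K: "?D \<omega> \<otimes>\<^sub>m ?S \<in> carrier_mat ?d (T * N)" for \<omega> by (rule kron_carrier[OF design_mat_carrier S])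
  have y: "?y \<omega> \<in> carrier_vec (T * N)" for \<omega>
    using vec_mat_carrier[OF response_mat_carrier] by (simp only: mult.commute[of T N])
  have Ky: "(?D \<omega> \<otimes>\<^sub>m ?S) *\<^sub>v ?y \<omega> \<in> carrier_vec ?d" for \<omega> by (rule mult_mat_vec_carrier[OF K y])
  note J = gls_core_carrier(2)[OF R Gc] and C = gls_core_carrier(1)[OF R Gc]
  have beta: "gls_beta (Sigma q) B (?D \<omega>) (?y \<omega>) = gls_core ?R ((?D \<omega> * (?D \<omega>)\<^sup>T) \<otimes>\<^sub>m ?S) *\<^sub>v ((?D \<omega> \<otimes>\<^sub>m ?S) *\<^sub>v ?y \<omega>)" for \<omega>
    unfolding gls_beta_def gls_gamma_def gls_core_def
    using assoc_mult_mat_vec[OF R mult_carrier_mat[OF inv_mat_carrier[OF J] RT] Ky]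
      assoc_mult_mat_vec[OF inv_mat_carrier[OF J] RT Ky] by simp
  have bc: "gls_beta (Sigma q) B (?D \<omega>) (?y \<omega>) \<in> carrier_vec ?d" for \<omega>
    unfolding beta by (rule mult_mat_vec_carrier[OF C Ky])
  have Xm: "(\<lambda>\<omega>. X q t \<omega> $ i) \<in> borel_measurable M" if "i < N" for i t
  proof -
    have "(\<lambda>\<omega>. coords N (X q t \<omega>) i) \<in> borel_measurable M"
      by (rule measurable_compose[of _ _ "borel_vec N"]) (use random_X[OF q] that in \<open>auto simp: random_vec_def\<close>)
    then show ?thesis using that by (simp add: coords_def)
  qed
  have Kym: "(\<lambda>\<omega>. ((?D \<omega> \<otimes>\<^sub>m ?S) *\<^sub>v ?y \<omega>) $ k) \<in> borel_measurable M" if k: "k < ?d" for k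
  proof -
    have "((?D \<omega> \<otimes>\<^sub>m ?S) *\<^sub>v ?y \<omega>) $ k = (\<Sum>t<T. state t (k div N) \<omega> * (\<Sum>i<N. ?S $$ (k mod N, i) * X q (int t + 1) \<omega> $ i))" for \<omega>
      unfolding kron_mult_vec_mat[OF design_mat_carrier S response_mat_carrier k]
      using divmod_less'[OF k] by (intro sum.cong refl) (simp add: design_mat_index response_mat_def)
    moreover have "(\<lambda>\<omega>. \<Sum>t<T. state t (k div N) \<omega> * (\<Sum>i<N. ?S $$ (k mod N, i) * X q (int t + 1) \<omega> $ i)) \<in> borel_measurable M"
      using divmod_less'[OF k] by (intro borel_measurable_sum borel_measurable_times borel_measurable_const state_M Xm) auto
    ultimately show ?thesis by simp
  qed
  have bm: "(\<lambda>\<omega>. gls_beta (Sigma q) B (?D \<omega>) (?y \<omega>) $ l) \<in> borel_measurable M" if l: "l < ?d" for l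
  proof -
    have "gls_beta (Sigma q) B (?D \<omega>) (?y \<omega>) $ l =
        (\<Sum>k<?d. gls_core ?R ((?D \<omega> * (?D \<omega>)\<^sup>T) \<otimes>\<^sub>m ?S) $$ (l, k) * ((?D \<omega> \<otimes>\<^sub>m ?S) *\<^sub>v ?y \<omega>) $ k)" for \<omega>
      unfolding beta by (rule mult_mat_vec_index[OF C Ky l])
    moreover have "(\<lambda>\<omega>. \<Sum>k<?d. gls_core ?R ((?D \<omega> * (?D \<omega>)\<^sup>T) \<otimes>\<^sub>m ?S) $$ (l, k) * ((?D \<omega> \<otimes>\<^sub>m ?S) *\<^sub>v ?y \<omega>) $ k) \<in> borel_measurable M"
      by (intro borel_measurable_sum borel_measurable_times gls_core_measurable[OF R G l] Kym) auto
    ultimately show ?thesis by simp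
  qed
  show ?thesis
    unfolding random_vec_def
  proof (intro conjI ballI)
    show "a \<cdot>\<^sub>v (gls_beta (Sigma q) B (?D \<omega>) (?y \<omega>) - beta) \<in> carrier_vec ?d" for \<omega>
      using bc[of \<omega>] b by simp
    have "(\<lambda>\<omega>. a * (gls_beta (Sigma q) B (?D \<omega>) (?y \<omega>) $ l - beta $ l)) \<in> borel_measurable M" if "l < ?d" for l
      using bm[OF that] by measurable
    then show "(\<lambda>\<omega>. coords ?d (a \<cdot>\<^sub>v (gls_beta (Sigma q) B (?D \<omega>) (?y \<omega>) - beta))) \<in> measurable M (borel_vec ?d)"
      unfolding coords_def using bc b
      by (intro measurable_restrict) (auto simp: carrier_vecD[OF bc] carrier_vecD[OF b])
  qed
qed

end

lemma sum_block:
  fixes f :: "nat \<Rightarrow> real"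
  assumes "q < Q" "\<And>b. b < N * Q \<Longrightarrow> b div N \<noteq> q \<Longrightarrow> f b = 0"
  shows "(\<Sum>b<N * Q. f b) = (\<Sum>i<N. f (N * q + i))"
proof (cases "N = 0")
  case False
  let ?g = "\<lambda>i p. if p = q then f (N * q + i) else 0"
  have "(\<Sum>b<N * Q. f b) = (\<Sum>b<N * Q. ?g (b mod N) (b div N))"
    using assms(2) by (intro sum.cong refl) auto
  also have "\<dots> = (\<Sum>p<Q. \<Sum>i<N. ?g i p)" by (rule sum_divmod)
  also have "\<dots> = (\<Sum>p<Q. if p = q then (\<Sum>i<N. f (N * q + i)) else 0)" by (intro sum.cong refl) simp
  finally show ?thesis using assms(1) by simp
qed simp

lemma sum_rotate3:
  "(\<Sum>t\<in>A. \<Sum>j\<in>B. \<Sum>s\<in>C. \<Sum>i\<in>D. f t j s i) = (\<Sum>j\<in>B. \<Sum>s\<in>C. \<Sum>i\<in>D. \<Sum>t\<in>A. f t j s i)"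
  by (subst sum.swap, rule sum.cong[OF refl], subst sum.swap, rule sum.cong[OF refl], rule sum.swap)

lemma sum_rotate4:
  "(\<Sum>t\<in>A. \<Sum>j\<in>B. \<Sum>s\<in>C. \<Sum>i\<in>D. \<Sum>k\<in>E. f t j s i k) = (\<Sum>j\<in>B. \<Sum>s\<in>C. \<Sum>i\<in>D. \<Sum>k\<in>E. \<Sum>t\<in>A. f t j s i k)"
  by (subst sum_rotate3, rule sum.cong[OF refl], rule sum.cong[OF refl], rule sum.cong[OF refl], rule sum.swap)

context gls_design
begin

text \<open>By symmetry \<open>h\<close> is \<open>C u\<close>, so the left-hand side is
  \<open>u' C G C u\<close>, and \<open>C G C = C\<close>. With \<open>G\<close> the limiting
  covariance of the score, this is the limiting variance of the functional \<open>u\<close> of the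
  estimator.\<close>

lemma core_quadratic_form:
  fixes u :: "nat \<Rightarrow> real"
  defines "h \<equiv> \<lambda>k. \<Sum>l<n. u l * C $$ (l, k)"
  shows "(\<Sum>k<n. \<Sum>k'<n. h k * h k' * G $$ (k, k')) = (\<Sum>i<n. \<Sum>j<n. u i * u j * C $$ (i, j))"
proof -
  let ?u = "vec n u"
  have u: "?u \<in> carrier_vec n" by simp
  define w where "w = C *\<^sub>v ?u"
  have w: "w \<in> carrier_vec n" unfolding w_def by (rule mult_mat_vec_carrier[OF carriers(2) u])
  have sym: "C $$ (k, l) = C $$ (l, k)" if "k < n" "l < n" for k l
    using core_sym carriers(2) that by (metis carrier_matD index_transpose_mat(1))
  have wh: "w $ k = h k" if "k < n" for k
    unfolding w_def mult_mat_vec_index[OF carriers(2) u that] h_def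
    using that by (intro sum.cong refl) (simp add: sym mult.commute)
  have "(\<Sum>k<n. \<Sum>k'<n. h k * h k' * G $$ (k, k')) = (\<Sum>k<n. \<Sum>k'<n. w $ k * w $ k' * G $$ (k, k'))"
    by (intro sum.cong refl) (simp add: wh)
  also have "\<dots> = w \<bullet> (G *\<^sub>v w)" by (rule quadratic_form_mat[OF G_carrier w, symmetric])
  also have "\<dots> = (G *\<^sub>v w) \<bullet> w" by (rule comm_scalar_prod[OF w mult_mat_vec_carrier[OF G_carrier w]])
  also have "\<dots> = (C\<^sup>T *\<^sub>v (G *\<^sub>v w)) \<bullet> ?u"
    using transpose_vec_mult_scalar[OF carriers(2) u mult_mat_vec_carrier[OF G_carrier w]] by (simp only: w_def[symmetric])
  also have "C\<^sup>T *\<^sub>v (G *\<^sub>v w) = (C * (G * C)) *\<^sub>v ?u"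
    unfolding core_sym w_def assoc_mult_mat_vec[OF carriers(2) mult_carrier_mat[OF G_carrier carriers(2)] u]
      assoc_mult_mat_vec[OF G_carrier carriers(2) u] ..
  also have "(C * (G * C)) *\<^sub>v ?u = C *\<^sub>v ?u" unfolding core_idem ..
  also have "(C *\<^sub>v ?u) \<bullet> ?u = ?u \<bullet> (C *\<^sub>v ?u)"
    by (rule comm_scalar_prod[OF mult_mat_vec_carrier[OF carriers(2) u] u])
  also have "\<dots> = (\<Sum>i<n. \<Sum>j<n. ?u $ i * ?u $ j * C $$ (i, j))" by (rule quadratic_form_mat[OF carriers(2) u])
  also have "\<dots> = (\<Sum>i<n. \<Sum>j<n. u i * u j * C $$ (i, j))" by (intro sum.cong refl) simp
  finally show ?thesis .
qed

lemma core_psd_form: "psd_form n (\<lambda>i j. C $$ (i, j))"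
  unfolding psd_form_def
proof (intro conjI allI impI)
  show "C $$ (k, l) = C $$ (l, k)" if "k < n" "l < n" for k l
    using core_sym carriers(2) that by (metis carrier_matD index_transpose_mat(1))
  show "0 \<le> (\<Sum>i<n. \<Sum>j<n. u i * u j * C $$ (i, j))" for u
    unfolding core_quadratic_form[symmetric] using pd_mat_psd_form[OF G] by (simp add: psd_form_def)
qed

end

lemma smult_kron:
  assumes "A \<in> carrier_mat n m" "B \<in> carrier_mat k l"
  shows "(a \<cdot>\<^sub>m A) \<otimes>\<^sub>m B = a \<cdot>\<^sub>m (A \<otimes>\<^sub>m B)"
proof (rule eq_matI)
  have aA: "a \<cdot>\<^sub>m A \<in> carrier_mat n m" using assms by simp
  note c = kron_carrier[OF assms] and c' = kron_carrier[OF aA assms(2)]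
  show "dim_row ((a \<cdot>\<^sub>m A) \<otimes>\<^sub>m B) = dim_row (a \<cdot>\<^sub>m (A \<otimes>\<^sub>m B))" "dim_col ((a \<cdot>\<^sub>m A) \<otimes>\<^sub>m B) = dim_col (a \<cdot>\<^sub>m (A \<otimes>\<^sub>m B))"
    using c c' by simp_all
  fix i j assume "i < dim_row (a \<cdot>\<^sub>m (A \<otimes>\<^sub>m B))" "j < dim_col (a \<cdot>\<^sub>m (A \<otimes>\<^sub>m B))"
  then have ij: "i < n * k" "j < m * l" using c by simp_all
  show "((a \<cdot>\<^sub>m A) \<otimes>\<^sub>m B) $$ (i, j) = (a \<cdot>\<^sub>m (A \<otimes>\<^sub>m B)) $$ (i, j)"
    using ij c assms divmod_less'[OF ij(1)] divmod_less'[OF ij(2)]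
    by (simp add: kron_index[OF aA assms(2) ij] kron_index[OF assms ij])
qed

context nirvar
begin

text \<open>\<open>a\<close> collects the coefficients with which the products of state and noise
  enter the functional \<open>h\<close> of the weighted score; only the noise of feature
  \<open>q\<close> occurs. Multiplying its covariance by the inverse on both sides leaves the
  Kronecker weight.\<close>

lemma score_variance:
  fixes h :: "nat \<Rightarrow> real"
  assumes q: "q < Q"
  defines "S \<equiv> inv_mat (Sigma q)"
  defines "a \<equiv> \<lambda>j b. if b div N = q then \<Sum>s<N. h (j * N + s) * S $$ (s, b mod N) else 0"
  shows "(\<Sum>b<N * Q. \<Sum>b'<N * Q. \<Sum>j<N * Q. \<Sum>l<N * Q. a j b * a l b' * noise_cov b b' * state_cov j l) =
    (\<Sum>k<N * Q * N. \<Sum>k'<N * Q * N. h k * h k' * (state_cov_mat \<otimes>\<^sub>m S) $$ (k, k'))"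
proof -
  have pd: "pd_mat N (Sigma q)" by (rule Sigma_pd[OF q])
  have Sc: "S \<in> carrier_mat N N" unfolding S_def using Sigma(1)[OF q] by simp
  let ?n = "N * Q"
  let ?H = "\<lambda>j i. \<Sum>s<N. h (j * N + s) * S $$ (s, i)"
  have a_eq: "a j (N * q + i) = ?H j i" if "i < N" for i j
    using noise_index[OF q that] by (simp add: a_def)
  have a0: "a j b = 0" if "b div N \<noteq> q" for j b using that by (simp add: a_def)
  have "(\<Sum>b<?n. \<Sum>b'<?n. \<Sum>j<?n. \<Sum>l<?n. a j b * a l b' * noise_cov b b' * state_cov j l) =
      (\<Sum>i<N. \<Sum>b'<?n. \<Sum>j<?n. \<Sum>l<?n. a j (N * q + i) * a l b' * noise_cov (N * q + i) b' * state_cov j l)"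
    by (rule sum_block[OF q]) (simp add: a0)
  also have "\<dots> = (\<Sum>i<N. \<Sum>i'<N. \<Sum>j<?n. \<Sum>l<?n. a j (N * q + i) * a l (N * q + i') * noise_cov (N * q + i) (N * q + i') * state_cov j l)"
    by (intro sum.cong refl sum_block[OF q]) (simp add: a0)
  also have "\<dots> = (\<Sum>i<N. \<Sum>i'<N. \<Sum>j<?n. \<Sum>l<?n. \<Sum>s<N. \<Sum>s'<N.
      h (j * N + s) * h (l * N + s') * state_cov j l * (S $$ (s, i) * S $$ (s', i') * Sigma q $$ (i, i')))"
  proof (intro sum.cong refl)
    fix i i' j l assume "i \<in> {..<N}" "i' \<in> {..<N}"
    then have i: "i < N" "i' < N" by auto
    have "a j (N * q + i) * a l (N * q + i') * noise_cov (N * q + i) (N * q + i') * state_cov j l =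
        (?H j i * ?H l i') * (Sigma q $$ (i, i') * state_cov j l)"
      using noise_index[OF q i(1)] noise_index[OF q i(2)] by (simp add: a_eq i noise_cov_def)
    also have "?H j i * ?H l i' = (\<Sum>s<N. \<Sum>s'<N. (h (j * N + s) * S $$ (s, i)) * (h (l * N + s') * S $$ (s', i')))"
      by (rule sum_product)
    also have "\<dots> * (Sigma q $$ (i, i') * state_cov j l) = (\<Sum>s<N. \<Sum>s'<N.
      h (j * N + s) * h (l * N + s') * state_cov j l * (S $$ (s, i) * S $$ (s', i') * Sigma q $$ (i, i')))"
      unfolding sum_distrib_right by (intro sum.cong refl) (simp only: mult_ac)
    finally show "a j (N * q + i) * a l (N * q + i') * noise_cov (N * q + i) (N * q + i') * state_cov j l = (\<Sum>s<N. \<Sum>s'<N.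
      h (j * N + s) * h (l * N + s') * state_cov j l * (S $$ (s, i) * S $$ (s', i') * Sigma q $$ (i, i')))" .
  qed
  also have "\<dots> = (\<Sum>j<?n. \<Sum>l<?n. \<Sum>s<N. \<Sum>s'<N. \<Sum>i<N. \<Sum>i'<N.
      h (j * N + s) * h (l * N + s') * state_cov j l * (S $$ (s, i) * S $$ (s', i') * Sigma q $$ (i, i')))"
    by (subst sum_rotate4, rule sum_rotate4)
  also have "\<dots> = (\<Sum>j<?n. \<Sum>l<?n. \<Sum>s<N. \<Sum>s'<N. h (j * N + s) * h (l * N + s') * (state_cov j l * S $$ (s, s')))"
  proof (intro sum.cong refl)
    fix j l s s' assume "s \<in> {..<N}" "s' \<in> {..<N}"
    then have "(\<Sum>i<N. \<Sum>i'<N. S $$ (s, i) * S $$ (s', i') * Sigma q $$ (i, i')) = S $$ (s, s')"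
      unfolding S_def using pd pd_mat_det[OF pd] by (intro inv_mat_sandwich) (auto simp: pd_mat_def)
    then show "(\<Sum>i<N. \<Sum>i'<N. h (j * N + s) * h (l * N + s') * state_cov j l * (S $$ (s, i) * S $$ (s', i') * Sigma q $$ (i, i'))) =
        h (j * N + s) * h (l * N + s') * (state_cov j l * S $$ (s, s'))"
      by (simp add: sum_distrib_left[symmetric] mult.assoc)
  qed
  also have "\<dots> = (\<Sum>j<?n. \<Sum>s<N. \<Sum>l<?n. \<Sum>s'<N. h (j * N + s) * h (l * N + s') * (state_cov j l * S $$ (s, s')))"
    by (intro sum.cong refl sum.swap)
  also have "\<dots> = (\<Sum>k<?n * N. \<Sum>l<?n. \<Sum>s'<N. h (k div N * N + k mod N) * h (l * N + s') * (state_cov (k div N) l * S $$ (k mod N, s')))"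
    by (rule sum_divmod'[of "\<lambda>j s. \<Sum>l<?n. \<Sum>s'<N. h (j * N + s) * h (l * N + s') * (state_cov j l * S $$ (s, s'))", symmetric])
  also have "\<dots> = (\<Sum>k<?n * N. \<Sum>k'<?n * N. h k * h k' * (state_cov_mat \<otimes>\<^sub>m S) $$ (k, k'))"
  proof (rule sum.cong[OF refl])
    fix k assume "k \<in> {..<?n * N}"
    then have k: "k < ?n * N" by simp
    have "(\<Sum>l<?n. \<Sum>s'<N. h (k div N * N + k mod N) * h (l * N + s') * (state_cov (k div N) l * S $$ (k mod N, s'))) =
        (\<Sum>k'<?n * N. h (k div N * N + k mod N) * h (k' div N * N + k' mod N) * (state_cov (k div N) (k' div N) * S $$ (k mod N, k' mod N)))"
      by (rule sum_divmod'[of "\<lambda>l s'. h (k div N * N + k mod N) * h (l * N + s') * (state_cov (k div N) l * S $$ (k mod N, s'))", symmetric])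
    also have "\<dots> = (\<Sum>k'<?n * N. h k * h k' * (state_cov_mat \<otimes>\<^sub>m S) $$ (k, k'))"
    proof (rule sum.cong[OF refl])
      fix k' assume "k' \<in> {..<?n * N}"
      then have k': "k' < ?n * N" by simp
      have c: "state_cov_mat \<in> carrier_mat ?n ?n" by (simp add: state_cov_mat_def)
      show "h (k div N * N + k mod N) * h (k' div N * N + k' mod N) * (state_cov (k div N) (k' div N) * S $$ (k mod N, k' mod N)) =
          h k * h k' * (state_cov_mat \<otimes>\<^sub>m S) $$ (k, k')"
        unfolding kron_index[OF c Sc k k'] using divmod_less'[OF k] divmod_less'[OF k'] by (simp add: state_cov_mat_def)
    qed
    finally show "(\<Sum>l<?n. \<Sum>s'<N. h (k div N * N + k mod N) * h (l * N + s') * (state_cov (k div N) l * S $$ (k mod N, s'))) =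
        (\<Sum>k'<?n * N. h k * h k' * (state_cov_mat \<otimes>\<^sub>m S) $$ (k, k'))" .
  qed
  finally show ?thesis .
qed

text \<open>Brings a functional of the weighted score into the shape required by
  \<open>central_limit_char\<close>, with the same \<open>a\<close> as in
  \<open>score_variance\<close>.\<close>

lemma score_combination:
  fixes h :: "nat \<Rightarrow> real" and w e :: "nat \<Rightarrow> nat \<Rightarrow> real" and S :: "real mat"
  assumes q: "q < Q"
  defines "a \<equiv> \<lambda>j b. if b div N = q then \<Sum>s<N. h (j * N + s) * S $$ (s, b mod N) else 0"
  shows "(\<Sum>k<N * Q * N. h k * (\<Sum>i<N. S $$ (k mod N, i) * ((\<Sum>t<T. w t (k div N) * e (Suc t) (N * q + i)) / x))) =
    (\<Sum>t<T. \<Sum>b<N * Q. (\<Sum>j<N * Q. a j b * w t j) * e (Suc t) b) / x"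
proof -
  let ?n = "N * Q"
  let ?f = "\<lambda>t j s i. h (j * N + s) * S $$ (s, i) * w t j * e (Suc t) (N * q + i) / x"
  have a_eq: "a j (N * q + i) = (\<Sum>s<N. h (j * N + s) * S $$ (s, i))" if "i < N" for i j
    using noise_index[OF q that] by (simp add: a_def)
  have "(\<Sum>k<?n * N. h k * (\<Sum>i<N. S $$ (k mod N, i) * ((\<Sum>t<T. w t (k div N) * e (Suc t) (N * q + i)) / x))) =
      (\<Sum>k<?n * N. \<Sum>i<N. \<Sum>t<T. ?f t (k div N) (k mod N) i)"
    by (intro sum.cong refl) (simp add: sum_distrib_left sum_divide_distrib mult_ac)
  also have "\<dots> = (\<Sum>j<?n. \<Sum>s<N. \<Sum>i<N. \<Sum>t<T. ?f t j s i)"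
    by (rule sum_divmod'[of "\<lambda>j s. \<Sum>i<N. \<Sum>t<T. ?f t j s i"])
  also have "\<dots> = (\<Sum>t<T. \<Sum>j<?n. \<Sum>s<N. \<Sum>i<N. ?f t j s i)" by (rule sum_rotate3[symmetric])
  also have "\<dots> = (\<Sum>t<T. (\<Sum>b<?n. (\<Sum>j<?n. a j b * w t j) * e (Suc t) b) / x)"
  proof (rule sum.cong[OF refl])
    fix t
    have "(\<Sum>b<?n. (\<Sum>j<?n. a j b * w t j) * e (Suc t) b) = (\<Sum>i<N. (\<Sum>j<?n. a j (N * q + i) * w t j) * e (Suc t) (N * q + i))"
      by (rule sum_block[OF q]) (simp add: a_def)
    also have "\<dots> = (\<Sum>i<N. \<Sum>j<?n. \<Sum>s<N. h (j * N + s) * S $$ (s, i) * w t j * e (Suc t) (N * q + i))"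
      by (intro sum.cong refl) (simp add: a_eq sum_distrib_right)
    also have "\<dots> = (\<Sum>j<?n. \<Sum>i<N. \<Sum>s<N. h (j * N + s) * S $$ (s, i) * w t j * e (Suc t) (N * q + i))"
      by (rule sum.swap)
    also have "\<dots> = (\<Sum>j<?n. \<Sum>s<N. \<Sum>i<N. h (j * N + s) * S $$ (s, i) * w t j * e (Suc t) (N * q + i))"
      by (intro sum.cong refl sum.swap)
    finally show "(\<Sum>j<?n. \<Sum>s<N. \<Sum>i<N. ?f t j s i) = (\<Sum>b<?n. (\<Sum>j<?n. a j b * w t j) * e (Suc t) b) / x"
      by (simp add: sum_divide_distrib)
  qed
  finally show ?thesis by (simp add: sum_divide_distrib)
qed

section \<open>Linearisation of the estimator and its limit\<close>

definition sample_cov_mat :: "nat \<Rightarrow> 'w \<Rightarrow> real mat" where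
  "sample_cov_mat T \<omega> = mat (N * Q) (N * Q) (\<lambda>(a, b). (\<Sum>t<T. state t a \<omega> * state t b \<omega>) / real T)"

text \<open>The process \<open>w\<close> is a parameter because the estimator produces the score of
  the stationary process, while the limit theorem treats that of the path. Position \<open>k\<close>
  encodes the regressor \<open>k div N\<close> and the response entry
  \<open>k mod N\<close>.\<close>

definition weighted_score :: "nat \<Rightarrow> (nat \<Rightarrow> nat \<Rightarrow> 'w \<Rightarrow> real) \<Rightarrow> nat \<Rightarrow> nat \<Rightarrow> 'w \<Rightarrow> real" where
  "weighted_score q w T k \<omega> = (\<Sum>i<N. inv_mat (Sigma q) $$ (k mod N, i) *
     ((\<Sum>t<T. w t (k div N) \<omega> * noise (Suc t) (N * q + i) \<omega>) / sqrt (real T)))"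

text \<open>The inverse of the Gram matrix contributes \<open>1 / T\<close>, which combines with the
  factor \<open>sqrt T\<close> to the normalisation \<open>1 / sqrt T\<close> of the score.\<close>

lemma gls_error_expansion:
  fixes B :: "real mat"
  assumes q: "q < Q" and B: "B \<in> carrier_mat N (N * Q)" and \<gamma>: "\<gamma> \<in> carrier_vec (nonzeros B)"
    and coef: "vec_mat (coef_mat N Q A W q) = restr_mat B *\<^sub>v \<gamma>" and T: "T > 0"
    and reg: "vec_mat (response_mat N X q T \<omega>) =
      ((design_mat N Q X T \<omega>)\<^sup>T \<otimes>\<^sub>m 1\<^sub>m N) *\<^sub>v vec_mat (coef_mat N Q A W q) + vec_mat (response_mat N eps q T \<omega>)"
    and d: "det ((restr_mat B)\<^sup>T * (sample_cov_mat T \<omega> \<otimes>\<^sub>m inv_mat (Sigma q)) * restr_mat B) \<noteq> 0"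
    and l: "l < N * Q * N"
  shows "(sqrt (real T) \<cdot>\<^sub>v (gls_beta (Sigma q) B (design_mat N Q X T \<omega>) (vec_mat (response_mat N X q T \<omega>)) -
      vec_mat (coef_mat N Q A W q))) $ l =
    (\<Sum>k<N * Q * N. gls_core (restr_mat B) (sample_cov_mat T \<omega> \<otimes>\<^sub>m inv_mat (Sigma q)) $$ (l, k) * weighted_score q state T k \<omega>)"
proof -
  let ?D = "design_mat N Q X T \<omega>" and ?R = "restr_mat B" and ?S = "inv_mat (Sigma q)" and ?d = "N * Q * N" and ?m = "nonzeros B"
  let ?\<Gamma> = "sample_cov_mat T \<omega>"
  let ?U = "vec_mat (response_mat N eps q T \<omega>)"
  note D = design_mat_carrier[of T \<omega>]
  have R: "?R \<in> carrier_mat ?d ?m" using restr_mat_carrier[OF B] by (simp add: mult.commute mult.left_commute)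
  have S: "?S \<in> carrier_mat N N" using Sigma(1)[OF q] by simp
  have \<Gamma>: "?\<Gamma> \<in> carrier_mat (N * Q) (N * Q)" by (simp add: sample_cov_mat_def)
  have \<Gamma>S: "?\<Gamma> \<otimes>\<^sub>m ?S \<in> carrier_mat ?d ?d" by (rule kron_carrier[OF \<Gamma> S])
  have DD: "?D * ?D\<^sup>T = real T \<cdot>\<^sub>m ?\<Gamma>"
  proof (rule eq_matI)
    fix a b assume "a < dim_row (real T \<cdot>\<^sub>m ?\<Gamma>)" "b < dim_col (real T \<cdot>\<^sub>m ?\<Gamma>)"
    then have "a < N * Q" "b < N * Q" by (simp_all add: sample_cov_mat_def)
    then show "(?D * ?D\<^sup>T) $$ (a, b) = (real T \<cdot>\<^sub>m ?\<Gamma>) $$ (a, b)"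
      using T gram_index[of a b T \<omega>] by (simp add: sample_cov_mat_def del: index_mult_mat)
  qed (use D in \<open>auto simp: sample_cov_mat_def\<close>)
  have T': "real T \<noteq> 0" using T by simp
  have DDS: "(?D * ?D\<^sup>T) \<otimes>\<^sub>m ?S = real T \<cdot>\<^sub>m (?\<Gamma> \<otimes>\<^sub>m ?S)" unfolding DD by (rule smult_kron[OF \<Gamma> S])
  note sm = gls_core_smult[OF R \<Gamma>S T' d]
  let ?C = "gls_core ?R (?\<Gamma> \<otimes>\<^sub>m ?S)"
  have C: "?C \<in> carrier_mat ?d ?d" by (rule gls_core_carrier(1)[OF R \<Gamma>S])
  have U: "?U \<in> carrier_vec (N * T)" by (rule vec_mat_carrier[OF response_mat_carrier])
  have K: "?D \<otimes>\<^sub>m ?S \<in> carrier_mat ?d (T * N)" by (rule kron_carrier[OF D S])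
  have KU: "(?D \<otimes>\<^sub>m ?S) *\<^sub>v ?U \<in> carrier_vec ?d"
    by (rule mult_mat_vec_carrier[OF K]) (use U in \<open>simp only: mult.commute[of T N]\<close>)
  let ?b = "vec_mat (coef_mat N Q A W q)"
  have b: "?b \<in> carrier_vec ?d" unfolding coef by (rule mult_mat_vec_carrier[OF R \<gamma>])
  have E: "gls_beta (Sigma q) B ?D (vec_mat (response_mat N X q T \<omega>)) = ?b + ((1 / real T) \<cdot>\<^sub>m ?C) *\<^sub>v ((?D \<otimes>\<^sub>m ?S) *\<^sub>v ?U)"
    unfolding reg coef
    using gls_beta_expansion[OF D Sigma(1)[OF q] pd_mat_det[OF Sigma_pd[OF q]] B \<gamma> U] sm unfolding DDS by simp
  have C': "(1 / real T) \<cdot>\<^sub>m ?C \<in> carrier_mat ?d ?d" using C by simp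
  note CU = mult_mat_vec_carrier[OF C' KU]
  have "(sqrt (real T) \<cdot>\<^sub>v (gls_beta (Sigma q) B ?D (vec_mat (response_mat N X q T \<omega>)) - ?b)) $ l =
      sqrt (real T) * (((1 / real T) \<cdot>\<^sub>m ?C) *\<^sub>v ((?D \<otimes>\<^sub>m ?S) *\<^sub>v ?U)) $ l"
    unfolding E using l carrier_vecD[OF b] carrier_vecD[OF CU] by (simp del: index_mult_mat_vec dim_mult_mat_vec)
  also have "\<dots> = sqrt (real T) * (\<Sum>k<?d. (1 / real T) * ?C $$ (l, k) * ((?D \<otimes>\<^sub>m ?S) *\<^sub>v ?U) $ k)"
    unfolding mult_mat_vec_index[OF C' KU l] using C l by (simp del: index_mult_mat_vec)
  also have "\<dots> = (\<Sum>k<?d. ?C $$ (l, k) * weighted_score q state T k \<omega>)"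
    unfolding sum_distrib_left
  proof (rule sum.cong[OF refl])
    fix k assume "k \<in> {..<?d}"
    then have k: "k < ?d" by simp
    have sT: "sqrt (real T) * (1 / real T) = 1 / sqrt (real T)"
      using real_div_sqrt[of "real T"] T by (simp add: field_simps)
    have "((?D \<otimes>\<^sub>m ?S) *\<^sub>v ?U) $ k / sqrt (real T) = weighted_score q state T k \<omega>"
      unfolding score_index[OF q S k] weighted_score_def by (subst sum_divide_distrib) simp
    then have w: "weighted_score q state T k \<omega> = (1 / sqrt (real T)) * ((?D \<otimes>\<^sub>m ?S) *\<^sub>v ?U) $ k" by simp
    show "sqrt (real T) * ((1 / real T) * ?C $$ (l, k) * ((?D \<otimes>\<^sub>m ?S) *\<^sub>v ?U) $ k) = ?C $$ (l, k) * weighted_score q state T k \<omega>"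
      unfolding w sT[symmetric] by (simp only: mult_ac)
  qed
  finally show ?thesis .
qed

text \<open>The restrictions \<open>B\<close> only have to represent the true coefficients by some
  \<open>\<gamma>\<close>, so that the true and the enlarged restrictions are both
  instances.\<close>

lemma gls_asymptotic:
  fixes B :: "real mat"
  assumes q: "q < Q" and B: "binary_mat N (N * Q) B" and \<gamma>: "\<gamma> \<in> carrier_vec (nonzeros B)"
    and coef: "vec_mat (coef_mat N Q A W q) = restr_mat B *\<^sub>v \<gamma>"
  shows "gls_design (N * Q * N) (nonzeros B) (restr_mat B) (state_cov_mat \<otimes>\<^sub>m inv_mat (Sigma q))"
    and "has_asymptotic_variance M (N * Q * N) (\<lambda>T \<omega>. sqrt (real T) \<cdot>\<^sub>v
      (gls_beta (Sigma q) B (design_mat N Q X T \<omega>) (vec_mat (response_mat N X q T \<omega>)) - vec_mat (coef_mat N Q A W q)))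
      (gls_core (restr_mat B) (state_cov_mat \<otimes>\<^sub>m inv_mat (Sigma q)))"
proof -
  let ?R = "restr_mat B" and ?S = "inv_mat (Sigma q)" and ?d = "N * Q * N" and ?m = "nonzeros B" and ?n = "N * Q"
  let ?G = "state_cov_mat \<otimes>\<^sub>m ?S"
  let ?b = "vec_mat (coef_mat N Q A W q)"
  let ?Z = "\<lambda>T \<omega>. sqrt (real T) \<cdot>\<^sub>v
      (gls_beta (Sigma q) B (design_mat N Q X T \<omega>) (vec_mat (response_mat N X q T \<omega>)) - ?b)"
  have Bc: "B \<in> carrier_mat N ?n" using B by (simp add: binary_mat_def)
  have R: "?R \<in> carrier_mat ?d ?m" using restr_mat_carrier[OF Bc] by (simp add: mult.commute mult.left_commute)
  have S: "?S \<in> carrier_mat N N" using Sigma(1)[OF q] by simp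
  show design: "gls_design ?d ?m ?R ?G"
  proof
    show "?R \<in> carrier_mat ?d ?m" by (rule R)
    show "pd_mat ?d ?G" by (rule pd_mat_kron[OF state_cov_mat_pd pd_mat_inverse[OF Sigma_pd[OF q]]])
    show "v = 0\<^sub>v ?m" if "v \<in> carrier_vec ?m" "?R *\<^sub>v v = 0\<^sub>v ?d" for v
      by (rule restr_mat_inj[OF B that(1)]) (use that(2) in \<open>simp only: mult.commute[of N]\<close>)
  qed
  interpret D: gls_design ?d ?m ?R ?G by (rule design)
  obtain c r C4 where "var_process M ?n (\<lambda>a b. var_mat N Q A W $$ (a, b)) noise_cov noise
     (\<lambda>t. generated ({..<Q} \<times> {1..int t})) (\<lambda>t. generated ({..<Q} \<times> {int t})) c r C4 state state_cov"
    using stacked_var_process by blast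
  then interpret V: var_process M ?n "\<lambda>a b. var_mat N Q A W $$ (a, b)" noise_cov noise
     "\<lambda>t. generated ({..<Q} \<times> {1..int t})" "\<lambda>t. generated ({..<Q} \<times> {int t})" c r C4 state state_cov .
  let ?sX = "weighted_score q state" and ?sW = "weighted_score q V.W"
  \<comment> \<open>Obtained from \<open>\<bar>x\<bar> \<le> 1 + x\<^sup>2\<close> and the bound on
    the second moments of the score in \<open>V.score_square\<close>.\<close>
  define K where "K = 1 + (1 + V.K4) * (1 + C4)"
  have score: "integrable M (\<lambda>\<omega>. (\<Sum>t<T. V.W t a \<omega> * noise (Suc t) b \<omega>) / sqrt (real T))"
    "expectation (\<lambda>\<omega>. \<bar>(\<Sum>t<T. V.W t a \<omega> * noise (Suc t) b \<omega>) / sqrt (real T)\<bar>) \<le> K" if "a < ?n" "b < ?n" for T a b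
  proof -
    let ?f = "\<lambda>\<omega>. (\<Sum>t<T. V.W t a \<omega> * noise (Suc t) b \<omega>) / sqrt (real T)"
    note sq = V.score_square[OF that, of T]
    have f: "?f \<in> borel_measurable M" using V.W_M that noise_M by measurable
    have le: "\<bar>x\<bar> \<le> 1 + x\<^sup>2" for x :: real
    proof -
      have "0 \<le> (\<bar>x\<bar> - 1)\<^sup>2 + \<bar>x\<bar>\<^sup>2 + 1" by (intro add_nonneg_nonneg) auto
      then show ?thesis by (simp add: power2_eq_square algebra_simps)
    qed
    show i: "integrable M ?f"
    proof (rule Bochner_Integration.integrable_bound[of M "\<lambda>\<omega>. 1 + (?f \<omega>)\<^sup>2"])
      have "norm (?f \<omega>) \<le> norm (1 + (?f \<omega>)\<^sup>2)" for \<omega>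
        using le[of "?f \<omega>"] unfolding real_norm_def by linarith
      then show "AE \<omega> in M. norm (?f \<omega>) \<le> norm (1 + (?f \<omega>)\<^sup>2)" by (rule AE_I2)
    qed (use sq f in auto)
    have "expectation (\<lambda>\<omega>. \<bar>?f \<omega>\<bar>) \<le> expectation (\<lambda>\<omega>. 1 + (?f \<omega>)\<^sup>2)"
      by (rule integral_mono[OF integrable_abs[OF i] Bochner_Integration.integrable_add[OF integrable_const sq(1)] le])
    also have "\<dots> = 1 + expectation (\<lambda>\<omega>. (?f \<omega>)\<^sup>2)" using sq by (simp add: prob_space)
    finally show "expectation (\<lambda>\<omega>. \<bar>?f \<omega>\<bar>) \<le> K" using sq by (simp add: K_def)
  qed
  have K: "K \<ge> 0"
  proof -
    have "0 < ?n" using dims by simp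
    have "0 \<le> expectation (\<lambda>\<omega>. \<bar>(\<Sum>t<0. V.W t 0 \<omega> * noise (Suc t) 0 \<omega>) / sqrt (real 0)\<bar>)" by simp
    also have "\<dots> \<le> K" by (rule score(2)) (use dims in simp_all)
    finally show ?thesis .
  qed
  define K' where "K' = (\<Sum>k<?d. \<Sum>i<N. \<bar>?S $$ (k mod N, i)\<bar> * K)"
  have sW: "integrable M (?sW T k)" if k: "k < ?d" for T k
    unfolding weighted_score_def
    using divmod_less'[OF k] noise_index[OF q] by (intro Bochner_Integration.integrable_sum integrable_mult_right score(1)) auto
  have sW_le: "expectation (\<lambda>\<omega>. \<Sum>k<?d. \<bar>?sW T k \<omega>\<bar>) \<le> K'" for T
  proof -
    have "expectation (\<lambda>\<omega>. \<bar>?sW T k \<omega>\<bar>) \<le> (\<Sum>i<N. \<bar>?S $$ (k mod N, i)\<bar> * K)" if k: "k < ?d" for k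
    proof -
      let ?f = "\<lambda>i \<omega>. (\<Sum>t<T. V.W t (k div N) \<omega> * noise (Suc t) (N * q + i) \<omega>) / sqrt (real T)"
      have f: "integrable M (?f i)" "expectation (\<lambda>\<omega>. \<bar>?f i \<omega>\<bar>) \<le> K" if "i < N" for i
        using score[of "k div N" "N * q + i" T] divmod_less'[OF k] noise_index[OF q that] by auto
      have "expectation (\<lambda>\<omega>. \<bar>?sW T k \<omega>\<bar>) \<le> expectation (\<lambda>\<omega>. \<Sum>i<N. \<bar>?S $$ (k mod N, i)\<bar> * \<bar>?f i \<omega>\<bar>)"
      proof (rule integral_mono)
        show "integrable M (\<lambda>\<omega>. \<Sum>i<N. \<bar>?S $$ (k mod N, i)\<bar> * \<bar>?f i \<omega>\<bar>)"
          by (intro Bochner_Integration.integrable_sum integrable_mult_right integrable_abs f) auto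
        show "\<bar>?sW T k \<omega>\<bar> \<le> (\<Sum>i<N. \<bar>?S $$ (k mod N, i)\<bar> * \<bar>?f i \<omega>\<bar>)" for \<omega>
          unfolding weighted_score_def abs_mult[symmetric] by (rule sum_abs)
      qed (use sW[OF k] in simp)
      also have "\<dots> = (\<Sum>i<N. \<bar>?S $$ (k mod N, i)\<bar> * expectation (\<lambda>\<omega>. \<bar>?f i \<omega>\<bar>))"
      proof (subst Bochner_Integration.integral_sum)
        show "integrable M (\<lambda>\<omega>. \<bar>?S $$ (k mod N, i)\<bar> * \<bar>?f i \<omega>\<bar>)" if "i \<in> {..<N}" for i
          by (rule integrable_mult_right[OF integrable_abs[OF f(1)]]) (use that in simp)
      qed (simp only: integral_mult_right_zero)
      also have "\<dots> \<le> (\<Sum>i<N. \<bar>?S $$ (k mod N, i)\<bar> * K)" using f by (intro sum_mono mult_left_mono) auto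
      finally show ?thesis .
    qed
    then have "(\<Sum>k<?d. expectation (\<lambda>\<omega>. \<bar>?sW T k \<omega>\<bar>)) \<le> K'" unfolding K'_def by (intro sum_mono) auto
    then show ?thesis using sW by (subst Bochner_Integration.integral_sum) auto
  qed
  have K': "K' \<ge> 0" unfolding K'_def using K by (intro sum_nonneg mult_nonneg_nonneg) auto
  have diff: "L1_null (\<lambda>T \<omega>. ?sX T k \<omega> - ?sW T k \<omega>)" if k: "k < ?d" for k
  proof -
    have "L1_null (\<lambda>T \<omega>. \<Sum>i<N. ?S $$ (k mod N, i) *
        ((\<Sum>t<T. state t (k div N) \<omega> * noise (Suc t) (N * q + i) \<omega>) / sqrt (real T) -
         (\<Sum>t<T. V.W t (k div N) \<omega> * noise (Suc t) (N * q + i) \<omega>) / sqrt (real T)))"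
      using divmod_less'[OF k] noise_index[OF q] by (intro L1_null_sum L1_null_mult V.score_difference) auto
    then show ?thesis unfolding weighted_score_def by (simp add: sum_subtractf right_diff_distrib)
  qed
  define cov_err where "cov_err T \<omega> = (\<Sum>a<?n. \<Sum>b<?n. \<bar>sample_cov_mat T \<omega> $$ (a, b) - state_cov_mat $$ (a, b)\<bar>)" for T \<omega>
  have cov_null: "L1_null cov_err"
  proof -
    have "L1_null (\<lambda>T \<omega>. sample_cov_mat T \<omega> $$ (a, b) - state_cov_mat $$ (a, b))" if "a < ?n" "b < ?n" for a b
      using V.sample_covariance[OF that] that by (simp add: sample_cov_mat_def state_cov_mat_def)
    then show ?thesis unfolding cov_err_def[abs_def] by (intro L1_null_sum L1_null_abs) auto
  qed
  define score_err where "score_err T \<omega> = (\<Sum>k<?d. \<bar>?sX T k \<omega> - ?sW T k \<omega>\<bar>)" for T \<omega>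
  have score_null: "L1_null score_err"
    unfolding score_err_def[abs_def] using diff by (intro L1_null_sum L1_null_abs) auto
  \<comment> \<open>The integrable proxy: the sample covariance is replaced by its limit, and the
    stationary process in the score by the path.\<close>
  define Y where "Y T l \<omega> = (\<Sum>k<?d. D.C $$ (l, k) * ?sW T k \<omega>)" for T l \<omega>
  have YI: "integrable M (Y T l)" for T l
    unfolding Y_def by (intro Bochner_Integration.integrable_sum integrable_mult_right sW) auto
  define CC where "CC = (\<Sum>l<?d. \<Sum>k<?d. \<bar>D.C $$ (l, k)\<bar>)"
  have CC: "\<bar>D.C $$ (l, k)\<bar> \<le> CC" if "l < ?d" "k < ?d" for l k
  proof -
    have "\<bar>D.C $$ (l, k)\<bar> \<le> (\<Sum>k<?d. \<bar>D.C $$ (l, k)\<bar>)" using that by (intro member_le_sum) auto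
    also have "\<dots> \<le> CC" unfolding CC_def
      by (rule member_le_sum[where f = "\<lambda>l. \<Sum>k<?d. \<bar>D.C $$ (l, k)\<bar>"]) (use that in \<open>auto intro: sum_nonneg\<close>)
    finally show ?thesis .
  qed
  have CC0: "CC \<ge> 0" unfolding CC_def by (intro sum_nonneg) auto
  have reg: "AE \<omega> in M. vec_mat (response_mat N X q T \<omega>) =
      ((design_mat N Q X T \<omega>)\<^sup>T \<otimes>\<^sub>m 1\<^sub>m N) *\<^sub>v ?b + vec_mat (response_mat N eps q T \<omega>)" for T
    using regression_form[OF q, of T] unfolding coef_restricted[OF q] .
  have b: "?b \<in> carrier_vec ?d" unfolding coef by (rule mult_mat_vec_carrier[OF R \<gamma>])
  have rv: "random_vec M ?d (?Z T)" for T by (rule gls_beta_random[OF q Bc b])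
  have Zm: "(\<lambda>\<omega>. ?Z T \<omega> $ l) \<in> borel_measurable M" if "l < ?d" for T l
  proof -
    have "(\<lambda>\<omega>. coords ?d (?Z T \<omega>) l) \<in> borel_measurable M"
      by (rule measurable_compose[of _ _ "borel_vec ?d"]) (use rv[of T] that in \<open>auto simp: random_vec_def\<close>)
    then show ?thesis using that by (simp add: coords_def)
  qed
  have approx: "(\<lambda>T. expectation (\<lambda>\<omega>. min 1 \<bar>?Z T \<omega> $ l - Y T l \<omega>\<bar>)) \<longlonglongrightarrow> 0" if l: "l < ?d" for l
  proof (rule min_tendsto_zeroI[OF _ _ K'])
    show "(\<lambda>\<omega>. ?Z T \<omega> $ l - Y T l \<omega>) \<in> borel_measurable M" for T using Zm[OF l] YI[of T l] by simp
    fix \<epsilon> :: real assume \<epsilon>: "\<epsilon> > 0"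
    have sc: "state_cov_mat \<in> carrier_mat ?n ?n" by (simp add: state_cov_mat_def)
    obtain \<delta> where \<delta>: "\<delta> > 0" and close: "\<And>\<Gamma>'. \<Gamma>' \<in> carrier_mat ?n ?n \<Longrightarrow>
        (\<forall>i<?n. \<forall>j<?n. \<bar>\<Gamma>' $$ (i, j) - state_cov_mat $$ (i, j)\<bar> < \<delta>) \<Longrightarrow>
        det (?R\<^sup>T * (\<Gamma>' \<otimes>\<^sub>m ?S) * ?R) \<noteq> 0 \<and>
        (\<forall>i<?d. \<forall>j<?d. \<bar>gls_core ?R (\<Gamma>' \<otimes>\<^sub>m ?S) $$ (i, j) - D.C $$ (i, j)\<bar> \<le> \<epsilon>)"
      using gls_core_continuous[OF R S sc D.det_J \<epsilon>] by blast
    \<comment> \<open>The part \<open>\<epsilon> + CC\<close> bounds the sample coefficients that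
      multiply the score error; \<open>1 / \<delta>\<close> charges a sample covariance that is far
      from its limit.\<close>
    define C where "C = \<epsilon> + CC + 1 / \<delta>"
    have C0: "C \<ge> 0" unfolding C_def using \<epsilon> CC0 \<delta> by simp
    define f where "f T \<omega> = score_err T \<omega> + cov_err T \<omega>" for T \<omega>
    have f: "L1_null f" unfolding f_def[abs_def] by (rule L1_null_add[OF score_null cov_null])
    define g where "g T \<omega> = (\<Sum>k<?d. \<bar>?sW T k \<omega>\<bar>)" for T \<omega>
    have g: "integrable M (g T)" "expectation (g T) \<le> K'" "g T \<omega> \<ge> 0" for T \<omega>
      using sW_le[of T] sW unfolding g_def by (auto intro!: Bochner_Integration.integrable_sum sum_nonneg)
    have err0: "score_err T \<omega> \<ge> 0" "cov_err T \<omega> \<ge> 0" for T \<omega>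
      by (auto simp: score_err_def cov_err_def intro!: sum_nonneg)
    have "AE \<omega> in M. min 1 \<bar>?Z T \<omega> $ l - Y T l \<omega>\<bar> \<le> \<epsilon> * g T \<omega> + C * f T \<omega>" if T: "T > 0" for T
      using reg[of T]
    proof eventually_elim
      fix \<omega> assume reg: "vec_mat (response_mat N X q T \<omega>) =
        ((design_mat N Q X T \<omega>)\<^sup>T \<otimes>\<^sub>m 1\<^sub>m N) *\<^sub>v ?b + vec_mat (response_mat N eps q T \<omega>)"
      let ?\<Gamma> = "sample_cov_mat T \<omega>"
      have \<Gamma>: "?\<Gamma> \<in> carrier_mat ?n ?n" by (simp add: sample_cov_mat_def)
      show "min 1 \<bar>?Z T \<omega> $ l - Y T l \<omega>\<bar> \<le> \<epsilon> * g T \<omega> + C * f T \<omega>"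
      \<comment> \<open>Within \<open>\<delta>\<close> of the limit the normal matrix is invertible
        and the expansion holds with coefficients within \<open>\<epsilon>\<close> of those of
        \<open>D.C\<close>. Otherwise the covariance error is at least \<open>\<delta>\<close>, so
        \<open>C * f T\<close> exceeds the truncation level \<open>1\<close>.\<close>
      proof (cases "\<forall>i<?n. \<forall>j<?n. \<bar>?\<Gamma> $$ (i, j) - state_cov_mat $$ (i, j)\<bar> < \<delta>")
        case True
        note cl = close[OF \<Gamma> True]
        let ?C = "gls_core ?R (?\<Gamma> \<otimes>\<^sub>m ?S)"
        have "?Z T \<omega> $ l = (\<Sum>k<?d. ?C $$ (l, k) * ?sX T k \<omega>)"
          by (rule gls_error_expansion[OF q Bc \<gamma> coef T reg conjunct1[OF cl] l])
        then have Zl: "?Z T \<omega> $ l - Y T l \<omega> = (\<Sum>k<?d. ?C $$ (l, k) * (?sX T k \<omega> - ?sW T k \<omega>) + (?C $$ (l, k) - D.C $$ (l, k)) * ?sW T k \<omega>)"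
          unfolding Y_def by (simp add: sum_subtractf[symmetric] algebra_simps)
        have "\<bar>?Z T \<omega> $ l - Y T l \<omega>\<bar> \<le> (\<Sum>k<?d. (\<epsilon> + CC) * \<bar>?sX T k \<omega> - ?sW T k \<omega>\<bar> + \<epsilon> * \<bar>?sW T k \<omega>\<bar>)"
          unfolding Zl
        proof (rule order_trans[OF sum_abs sum_mono])
          fix k assume "k \<in> {..<?d}"
          then have k: "k < ?d" by simp
          have e: "\<bar>?C $$ (l, k) - D.C $$ (l, k)\<bar> \<le> \<epsilon>" using cl l k by blast
          then have "\<bar>?C $$ (l, k)\<bar> \<le> \<epsilon> + CC" using CC[OF l k] by linarith
          then show "\<bar>?C $$ (l, k) * (?sX T k \<omega> - ?sW T k \<omega>) + (?C $$ (l, k) - D.C $$ (l, k)) * ?sW T k \<omega>\<bar> \<le>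
              (\<epsilon> + CC) * \<bar>?sX T k \<omega> - ?sW T k \<omega>\<bar> + \<epsilon> * \<bar>?sW T k \<omega>\<bar>"
            using e by (intro order_trans[OF abs_triangle_ineq] add_mono) (auto simp: abs_mult intro!: mult_right_mono)
        qed
        also have "\<dots> = (\<epsilon> + CC) * score_err T \<omega> + \<epsilon> * g T \<omega>"
          by (simp add: score_err_def g_def sum.distrib sum_distrib_left)
        finally have "\<bar>?Z T \<omega> $ l - Y T l \<omega>\<bar> \<le> (\<epsilon> + CC) * score_err T \<omega> + \<epsilon> * g T \<omega>" .
        moreover have "(\<epsilon> + CC) * score_err T \<omega> \<le> C * f T \<omega>"
          using err0[of T \<omega>] \<epsilon> \<delta> CC0 C0 by (intro mult_mono) (auto simp: C_def f_def)
        ultimately show ?thesis by (intro min.coboundedI2) linarith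
      next
        case False
        then obtain i j where ij: "i < ?n" "j < ?n" "\<delta> \<le> \<bar>?\<Gamma> $$ (i, j) - state_cov_mat $$ (i, j)\<bar>" by force
        have "\<bar>?\<Gamma> $$ (i, j) - state_cov_mat $$ (i, j)\<bar> \<le> (\<Sum>j<?n. \<bar>?\<Gamma> $$ (i, j) - state_cov_mat $$ (i, j)\<bar>)"
          using ij by (intro member_le_sum) auto
        also have "\<dots> \<le> cov_err T \<omega>" unfolding cov_err_def
          by (rule member_le_sum[where f = "\<lambda>i. \<Sum>j<?n. \<bar>?\<Gamma> $$ (i, j) - state_cov_mat $$ (i, j)\<bar>"]) (use ij in \<open>auto intro: sum_nonneg\<close>)
        finally have "\<delta> \<le> f T \<omega>" using ij err0[of T \<omega>] by (simp add: f_def)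
        then have "1 \<le> (1 / \<delta>) * f T \<omega>" using \<delta> by (simp add: field_simps)
        also have "\<dots> \<le> C * f T \<omega>" using \<epsilon> CC0 err0[of T \<omega>] by (intro mult_right_mono) (auto simp: C_def f_def)
        finally have "1 \<le> C * f T \<omega>" .
        moreover have "0 \<le> \<epsilon> * g T \<omega>" using g(3)[of T \<omega>] \<epsilon> by simp
        ultimately show ?thesis by (intro min.coboundedI1) linarith
      qed
    qed
    then show "\<exists>b f C. L1_null f \<and> C \<ge> 0 \<and> (\<forall>T. integrable M (b T) \<and> expectation (b T) \<le> K') \<and>
      (\<forall>T>0. AE \<omega> in M. min 1 \<bar>?Z T \<omega> $ l - Y T l \<omega>\<bar> \<le> \<epsilon> * b T \<omega> + C * f T \<omega>)"
      using f C0 g by (intro exI[of _ g] exI[of _ f] exI[of _ C]) auto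
  qed
  have Y_le: "expectation (\<lambda>\<omega>. \<bar>Y T l \<omega>\<bar>) \<le> CC * K'" if l: "l < ?d" for T l
  proof -
    have "expectation (\<lambda>\<omega>. \<bar>Y T l \<omega>\<bar>) \<le> expectation (\<lambda>\<omega>. CC * (\<Sum>k<?d. \<bar>?sW T k \<omega>\<bar>))"
    proof (rule integral_mono)
      show "\<bar>Y T l \<omega>\<bar> \<le> CC * (\<Sum>k<?d. \<bar>?sW T k \<omega>\<bar>)" for \<omega>
        unfolding Y_def sum_distrib_left
        by (rule order_trans[OF sum_abs sum_mono]) (use CC[OF l] in \<open>auto simp: abs_mult intro!: mult_right_mono\<close>)
    qed (use YI sW in auto)
    also have "\<dots> \<le> CC * K'" using sW_le[of T] CC0 by (simp add: mult_left_mono)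
    finally show ?thesis .
  qed
  have "has_asymptotic_variance M ?d ?Z (mat ?d ?d (\<lambda>(i, j). D.C $$ (i, j)))"
  proof (rule has_asymptotic_varianceI[OF rv YI Y_le approx D.core_psd_form])
    fix u :: "nat \<Rightarrow> real"
    \<comment> \<open>The functional \<open>u\<close> of \<open>Y\<close> is the functional
      \<open>h\<close> of the score, and \<open>a\<close> turns that into coefficients of products
      of path and noise.\<close>
    define h where "h k = (\<Sum>l<?d. u l * D.C $$ (l, k))" for k
    define a where "a j b = (if b div N = q then \<Sum>s<N. h (j * N + s) * ?S $$ (s, b mod N) else 0)" for j b
    have "(\<Sum>l<?d. u l * Y T l \<omega>) = (\<Sum>t<T. \<Sum>b<?n. (\<Sum>j<?n. a j b * V.W t j \<omega>) * noise (Suc t) b \<omega>) / sqrt (real T)" for T \<omega>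
    proof -
      have "(\<Sum>l<?d. u l * Y T l \<omega>) = (\<Sum>l<?d. \<Sum>k<?d. u l * D.C $$ (l, k) * ?sW T k \<omega>)"
        by (simp add: Y_def sum_distrib_left mult.assoc)
      also have "\<dots> = (\<Sum>k<?d. \<Sum>l<?d. u l * D.C $$ (l, k) * ?sW T k \<omega>)" by (rule sum.swap)
      also have "\<dots> = (\<Sum>k<?d. h k * ?sW T k \<omega>)" by (simp add: h_def sum_distrib_right)
      also have "\<dots> = (\<Sum>t<T. \<Sum>b<?n. (\<Sum>j<?n. a j b * V.W t j \<omega>) * noise (Suc t) b \<omega>) / sqrt (real T)"
        unfolding weighted_score_def a_def
        by (rule score_combination[OF q, where w = "\<lambda>t j. V.W t j \<omega>" and e = "\<lambda>t b. noise t b \<omega>"])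
      finally show ?thesis .
    qed
    moreover have "(\<Sum>b<?n. \<Sum>b'<?n. \<Sum>j<?n. \<Sum>l<?n. a j b * a l b' * noise_cov b b' * state_cov j l) =
        (\<Sum>i<?d. \<Sum>j<?d. u i * u j * D.C $$ (i, j))"
      unfolding a_def score_variance[OF q, of h] unfolding h_def by (rule D.core_quadratic_form)
    ultimately show "(\<lambda>T. expectation (\<lambda>\<omega>. cis (\<Sum>l<?d. u l * Y T l \<omega>))) \<longlonglongrightarrow>
        of_real (exp (- (\<Sum>i<?d. \<Sum>j<?d. u i * u j * D.C $$ (i, j)) / 2))"
      using V.central_limit_char[of a] by simp
  qed
  moreover have "mat ?d ?d (\<lambda>(i, j). D.C $$ (i, j)) = D.C" using D.carriers(2) by (intro eq_matI) auto
  ultimately show "has_asymptotic_variance M ?d ?Z D.C" by simp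
qed

end

text \<open>Each column of \<open>R1\<close> is the image of a unit vector, hence lies in the column
  space of \<open>R2\<close>; chosen preimages under \<open>R2\<close> form the columns of
  \<open>X\<close>.\<close>

lemma col_space_subset_factor:
  fixes R1 R2 :: "real mat"
  assumes R1: "R1 \<in> carrier_mat d m1" and R2: "R2 \<in> carrier_mat d m2"
    and sub: "vec_space.col_space d R1 \<subseteq> vec_space.col_space d R2"
  obtains X where "X \<in> carrier_mat m2 m1" "R1 = R2 * X"
proof -
  have ex: "\<exists>x\<in>carrier_vec m2. R2 *\<^sub>v x = R1 *\<^sub>v v" if v: "v \<in> carrier_vec m1" for v
  proof -
    have "R1 *\<^sub>v v \<in> vec_space.col_space d R1"
      unfolding vec_space.col_space_eq[OF R1] using v R1 by auto
    then show ?thesis using sub unfolding vec_space.col_space_eq[OF R2] using R2 by auto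
  qed
  then obtain x where x: "\<And>v. v \<in> carrier_vec m1 \<Longrightarrow> x v \<in> carrier_vec m2" "\<And>v. v \<in> carrier_vec m1 \<Longrightarrow> R2 *\<^sub>v x v = R1 *\<^sub>v v"
    by metis
  define X where "X = mat_of_cols m2 (map (\<lambda>j. x (unit_vec m1 j)) [0..<m1])"
  have X: "X \<in> carrier_mat m2 m1" unfolding X_def using mat_of_cols_carrier(1)[of m2 "map (\<lambda>j. x (unit_vec m1 j)) [0..<m1]"] by simp
  have "col R1 j = col (R2 * X) j" if j: "j < m1" for j
  proof -
    have "col X j = x (unit_vec m1 j)" unfolding X_def using j x(1) by (subst col_mat_of_cols) auto
    then have "col (R2 * X) j = R2 *\<^sub>v x (unit_vec m1 j)" using col_mult2[OF R2 X j] by simp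
    also have "\<dots> = col R1 j" using x(2)[of "unit_vec m1 j"] col_mult2[OF R1 one_carrier_mat j] R1 j by simp
    finally show ?thesis by simp
  qed
  then have "R1 = R2 * X" using R1 R2 X by (intro mat_col_eqI) auto
  with X show thesis by (rule that)
qed

theorem proposition5p3:
  fixes M :: "'w measure" and N Q q :: nat
    and A W :: "nat \<Rightarrow> nat \<Rightarrow> real mat"
    and X eps :: "nat \<Rightarrow> int \<Rightarrow> 'w \<Rightarrow> real vec"
    and Sigma :: "nat \<Rightarrow> real mat"
    and Aq Ahat :: "real mat" and beta :: "real vec"
  assumes model: "nirvar M N Q A W X eps Sigma"
    and q: "q < Q"
    and Aq: "Aq = hconcat_mat N Q (A q)"
    and beta: "beta = vec_mat (coef_mat N Q A W q)"
    and Ahat: "binary_mat N (N * Q) Ahat"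
    and colsp: "vec_space.col_space (N\<^sup>2 * Q) (restr_mat Aq) \<subseteq>
                vec_space.col_space (N\<^sup>2 * Q) (restr_mat Ahat)"
  shows "\<exists>Vhat V.
    has_asymptotic_variance M (N\<^sup>2 * Q) (\<lambda>T \<omega>. sqrt (real T) \<cdot>\<^sub>v
      (gls_beta (Sigma q) Ahat (design_mat N Q X T \<omega>) (vec_mat (response_mat N X q T \<omega>)) - beta)) Vhat \<and>
    has_asymptotic_variance M (N\<^sup>2 * Q) (\<lambda>T \<omega>. sqrt (real T) \<cdot>\<^sub>v
      (gls_beta (Sigma q) Aq (design_mat N Q X T \<omega>) (vec_mat (response_mat N X q T \<omega>)) - beta)) V \<and>
    psd_mat (Vhat - V)"
proof -
  interpret nirvar M N Q A W X eps Sigma by (rule model)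
  have d: "N\<^sup>2 * Q = N * Q * N" by (simp add: power2_eq_square mult_ac)
  have Aqb: "binary_mat N (N * Q) Aq" unfolding Aq by (rule binary_hconcat[OF q])
  define \<gamma> where "\<gamma> = restr_vec Aq beta"
  have carr: "restr_mat Aq \<in> carrier_mat (N * Q * N) (nonzeros Aq)" "restr_mat Ahat \<in> carrier_mat (N * Q * N) (nonzeros Ahat)"
    using restr_mat_carrier[of Aq N "N * Q"] restr_mat_carrier[of Ahat N "N * Q"] Aqb Ahat
    by (simp_all add: binary_mat_def mult.commute mult.left_commute)
  have beta_A: "restr_mat Aq *\<^sub>v \<gamma> = beta"
    unfolding \<gamma>_def Aq beta by (rule coef_restricted[OF q])
  obtain X' where X': "X' \<in> carrier_mat (nonzeros Ahat) (nonzeros Aq)" "restr_mat Aq = restr_mat Ahat * X'"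
    using col_space_subset_factor[OF carr] colsp unfolding d by blast
  have \<gamma>: "\<gamma> \<in> carrier_vec (nonzeros Aq)"
  proof -
    have "beta \<in> carrier_vec (N * (N * Q))" unfolding beta
      by (rule vec_mat_carrier) (simp add: coef_mat_def hconcat_mat_def)
    then show ?thesis unfolding \<gamma>_def carrier_vec_def restr_vec_def
      using nonzeros_eq_length[of Aq N "N * Q"] Aqb by (simp add: binary_mat_def)
  qed
  \<comment> \<open>The column-space inclusion is also what makes the larger model correctly
    specified: the true coefficients are representable under \<open>Ahat\<close>, so the normalised
    error has no bias term.\<close>
  have beta_hat: "beta = restr_mat Ahat *\<^sub>v (X' *\<^sub>v \<gamma>)"
    using assoc_mult_mat_vec[OF carr(2) X'(1) \<gamma>] beta_A X'(2) by simp
  note A = gls_asymptotic[OF q Aqb \<gamma>, folded beta, OF beta_A[symmetric]]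
  note H = gls_asymptotic[OF q Ahat mult_mat_vec_carrier[OF X'(1) \<gamma>], folded beta, OF beta_hat]
  have "psd_mat (gls_core (restr_mat Ahat) (state_cov_mat \<otimes>\<^sub>m inv_mat (Sigma q)) -
      gls_core (restr_mat Aq) (state_cov_mat \<otimes>\<^sub>m inv_mat (Sigma q)))"
    by (rule psd_gls_core_difference[OF A(1) H(1) X'])
  with A(2) H(2) show ?thesis unfolding d by blast
qed

end
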